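(* Let $\mathcal{H}\in C^2(\mathbb{R}^{2d},\mathbb{R})$ and let $x$ be a bounded orbit of $\dot x=J\mathcal{H}'(x)$. If the $\omega$-limit set of $x$ satisfies $\Lambda_\omega(x)=\Lambda(\tilde x)$ for some quasi-periodic orbit $\tilde x$ of the same system, then $$\mathcal{I}(x)=\mathcal{I}(\Lambda_\omega(x))=\mathcal{I}(\Lambda(\tilde x)).$$ Likewise, if the $\alpha$-limit set of $x$ satisfies $\Lambda_\alpha(x)=\Lambda(\tilde x)$ for some quasi-periodic orbit $\tilde x$, then $$\mathcal{I}^-(x)=\mathcal{I}^-(\Lambda_\alpha(x))=\mathcal{I}^-(\Lambda(\tilde x)).$$
   Context: Let $d\ge 1$, $I$ the identity matrix, $J=\begin{pmatrix}0&-I\\ I&0\end{pmatrix}$ the standard $2d\times 2d$ symplectic matrix, $\mathrm{Sp}(2d)=\{M\in GL(\mathbb{R}^{2d}): M^TJM=J\}$, $\mathbb{U}$ the unit circle in $\mathbb{C}$, and $\mathrm{Sym}(2d,\mathbb{R})$ the real symmetric $2d\times 2d$ matrices. For bounded $B\in C^0(\mathbb{R},\mathrm{Sym}(2d,\mathbb{R}))$, $\gamma=\gamma_B$ is the fundamental solution: $\dot\gamma(t)=JB(t)\gamma(t)$, $\gamma(0)=I$. Maslov-type index: for $\omega\in\mathbb{U}$ let $\mathrm{Sp}(2d)^0_\omega=\{M\in\mathrm{Sp}(2d):\det(M-\omega I)=0\}$, a codimension-one hypersurface co-oriented at $M$ by the direction $\frac{d}{dt}Me^{tJ}|_{t=0}$.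 For a continuous path $\gamma:[a,b]\to\mathrm{Sp}(2d)$ and $M\in\mathrm{Sp}(2d)$, $\iota(\omega M,\gamma,[a,b])\in\mathbb{Z}$ is the intersection number of the path $t\mapsto e^{-\epsilon J}\gamma(t)M^{-1}$, $t\in[a,b]$, with the co-oriented hypersurface $\mathrm{Sp}(2d)^0_\omega$, for $\epsilon>0$ sufficiently small. For a path on $[0,T]$ with $\gamma(0)=I$, $i_\omega(\gamma,[0,T])=\iota(\omega I,\gamma,[0,T])-\frac12\dim_{\mathbb{C}}\ker(I-\omega I)$; thus $i_1(\gamma,[0,T])=\iota(I,\gamma,[0,T])-d$. Mean indices: $\mathcal{I}_U(B)=\limsup_{l\to+\infty}\frac{i_1(\gamma,[0,l])}{l}$, $\mathcal{I}_L(B)=\liminf_{l\to+\infty}\frac{i_1(\gamma,[0,l])}{l}$, $\mathcal{I}^-_U(B)=\limsup_{l\to+\infty}\frac{i_1(\gamma,[0,-l])}{-l}$, $\mathcal{I}^-_L(B)=\liminf_{l\to+\infty}\frac{i_1(\gamma,[0,-l])}{-l}$, where $i_1(\gamma,[0,-l])$ is the index $i_1$ of the path $t\mapsto\gamma(-t)$, $t\in[0,l]$. Set $\mathcal{I}(B)=[\mathcal{I}_L(B),\mathcal{I}_U(B)]$ and $\mathcal{I}^-(B)=[\mathcal{I}^-_L(B),\mathcal{I}^-_U(B)]$. For an orbit $x$ of $\dot x=J\mathcal{H}'(x)$ ($\mathcal{H}'$ gradient, $\mathcal{H}''$ Hessian), $\mathcal{I}(x)=\mathcal{I}(B)$ and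 $\mathcal{I}^-(x)=\mathcal{I}^-(B)$ with $B(t)=\mathcal{H}''(x(t))$; for $\xi\in\mathbb{R}^{2d}$, $\mathcal{I}(\xi)=\mathcal{I}(x)$, $\mathcal{I}^-(\xi)=\mathcal{I}^-(x)$, where $x(0)=\xi$. For a set $\Lambda$ invariant under the Hamiltonian flow, $\mathcal{I}(\Lambda)=\bigcup_{\xi\in\Lambda}\mathcal{I}(\xi)$, $\mathcal{I}^-(\Lambda)=\bigcup_{\xi\in\Lambda}\mathcal{I}^-(\xi)$. Let $\Lambda(x)=\overline{\{x(t):t\in\mathbb{R}\}}$. The orbit $x$ is quasi-periodic if there are a torus $\mathbb{T}^m$, a homeomorphism $D:\mathbb{T}^m\to\Lambda(x)$ and $\omega=(\omega_1,\dots,\omega_m)\in\mathbb{R}^m$ with $\omega_1,\dots,\omega_m$ linearly independent over $\mathbb{Q}$ such that $x(t)=D(D^{-1}(x(0))+\omega t)$ for all $t$. For a bounded orbit $x:\mathbb{R}\to\mathbb{R}^{2d}$, $\Lambda_\omega(x)$ and $\Lambda_\alpha(x)$ denote its $\omega$-limit set ($t\to+\infty$) and $\alpha$-limit set ($t\to-\infty$). *)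

theory Defs
  imports "HOL-Analysis.Analysis"
begin

section \<open>The symplectic group\<close>

text \<open>
  The space of dimension \<open>2d\<close> is \<open>real ^ ('n + 'n)\<close> with \<open>d = CARD('n)\<close>; the \<open>Inl\<close> coordinates are
  the first \<open>d\<close> coordinates and the \<open>Inr\<close> coordinates the last \<open>d\<close>.
\<close>

type_synonym 'n phase = "real ^ ('n + 'n)"
type_synonym 'n phase_matrix = "real ^ ('n + 'n) ^ ('n + 'n)"

definition symp_J :: "'n::finite phase_matrix" where
  "symp_J = (\<chi> i j. case (i, j) of
       (Inl k, Inr l) \<Rightarrow> if k = l then - 1 else 0
     | (Inr k, Inl l) \<Rightarrow> if k = l then 1 else 0
     | _ \<Rightarrow> 0)"

definition symp_group :: "'n::finite phase_matrix set" where
  "symp_group = {M. invertible M \<and> transpose M ** symp_J ** M = symp_J}"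

definition matrix_exp :: "real ^ 'k ^ 'k \<Rightarrow> real ^ 'k::finite ^ 'k" where
  "matrix_exp A = (\<Sum>m. (1 / fact m) *\<^sub>R (((**) A ^^ m) (mat 1)))"

definition fundamental_solution :: "(real \<Rightarrow> 'n::finite phase_matrix) \<Rightarrow> real \<Rightarrow> 'n phase_matrix" where
  "fundamental_solution B = (THE \<gamma>. \<gamma> 0 = mat 1 \<and>
     (\<forall>t. (\<gamma> has_vector_derivative (symp_J ** B t ** \<gamma> t)) (at t)))"


section \<open>Intersection numbers with the singular hypersurface\<close>

definition char_det :: "complex \<Rightarrow> 'n::finite phase_matrix \<Rightarrow> complex" where
  "char_det \<omega> M = det (map_matrix complex_of_real M - mat \<omega>)"

definition symp_sing :: "complex \<Rightarrow> 'n::finite phase_matrix set" where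
  "symp_sing \<omega> = {M \<in> symp_group. char_det \<omega> M = 0}"

text \<open>
  For \<open>\<bar>\<omega>\<bar> = 1\<close> the function \<open>cnj \<omega> ^ d * char_det \<omega>\<close> is real-valued on the symplectic group, and at
  a point \<open>M\<close> of the hypersurface its differential is nonzero, with nonzero value in the direction of
  \<open>M e\<^sup>s\<^sup>J\<close>, precisely when the kernel of \<open>M - \<omega> I\<close> is one-dimensional, i.e. when \<open>M\<close> is a regular
  point.  So it is a local equation of the hypersurface near regular points, and a nonzero
  derivative along a path says that the path crosses transversally at a regular point.  The constant
  factor \<open>cnj \<omega> ^ d\<close> matters neither for this nor for the (real) quotient of the two derivatives in
  \<open>crossing_sign\<close>, which is positive iff the path crosses in the co-orienting direction.
\<close>

definition transverse_path ::
    "complex \<Rightarrow> (real \<Rightarrow> 'n::finite phase_matrix) \<Rightarrow> real \<Rightarrow> real \<Rightarrow> bool" where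
  "transverse_path \<omega> \<xi> a b \<longleftrightarrow>
     continuous_on {a..b} \<xi> \<and> \<xi> ` {a..b} \<subseteq> symp_group \<and>
     \<xi> a \<notin> symp_sing \<omega> \<and> \<xi> b \<notin> symp_sing \<omega> \<and>
     (\<forall>t\<in>{a<..<b}. \<xi> t \<in> symp_sing \<omega> \<longrightarrow>
        \<xi> differentiable (at t) \<and> vector_derivative (\<lambda>s. char_det \<omega> (\<xi> s)) (at t) \<noteq> 0)"

definition crossing_sign :: "complex \<Rightarrow> (real \<Rightarrow> 'n::finite phase_matrix) \<Rightarrow> real \<Rightarrow> int" where
  "crossing_sign \<omega> \<xi> t =
     (if Re (vector_derivative (\<lambda>s. char_det \<omega> (\<xi> s)) (at t) /
             vector_derivative (\<lambda>s. char_det \<omega> (\<xi> t ** matrix_exp (s *\<^sub>R symp_J))) (at 0)) > 0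
      then 1 else - 1)"

definition crossing_count :: "complex \<Rightarrow> (real \<Rightarrow> 'n::finite phase_matrix) \<Rightarrow> real \<Rightarrow> real \<Rightarrow> int" where
  "crossing_count \<omega> \<xi> a b = (\<Sum>t | t \<in> {a<..<b} \<and> \<xi> t \<in> symp_sing \<omega>. crossing_sign \<omega> \<xi> t)"

text \<open>
  The intersection number of a continuous path with end points off the hypersurface is the signed
  count of crossings of any transverse path homotopic to it in the symplectic group relative to the
  end points.  It is well defined because the non-regular points have codimension at least two in
  the hypersurface.
\<close>

definition intersection_number ::
    "complex \<Rightarrow> (real \<Rightarrow> 'n::finite phase_matrix) \<Rightarrow> real \<Rightarrow> real \<Rightarrow> int" where
  "intersection_number \<omega> \<eta> a b = (THE n. \<exists>\<xi>.
     homotopic_with_canon (\<lambda>h. h a = \<eta> a \<and> h b = \<eta> b) {a..b} symp_group \<eta> \<xi> \<and>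
     transverse_path \<omega> \<xi> a b \<and> n = crossing_count \<omega> \<xi> a b)"


section \<open>The Maslov-type index and mean indices\<close>

definition maslov_index ::
    "complex \<Rightarrow> 'n::finite phase_matrix \<Rightarrow> (real \<Rightarrow> 'n phase_matrix) \<Rightarrow> real \<Rightarrow> real \<Rightarrow> int" where
  "maslov_index \<omega> M \<gamma> a b = (THE n. \<forall>\<^sub>F \<epsilon> in at_right 0.
     intersection_number \<omega> (\<lambda>t. matrix_exp (- \<epsilon> *\<^sub>R symp_J) ** \<gamma> t ** matrix_inv M) a b = n)"

definition omega_index :: "complex \<Rightarrow> (real \<Rightarrow> 'n::finite phase_matrix) \<Rightarrow> real \<Rightarrow> real" where
  "omega_index \<omega> \<gamma> T = real_of_int (maslov_index \<omega> (mat 1) \<gamma> 0 T)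
     - 1 / 2 * real (vec.dim {v :: complex ^ ('n + 'n). (mat 1 - mat \<omega>) *v v = 0})"

definition mean_index_upper :: "(real \<Rightarrow> 'n::finite phase_matrix) \<Rightarrow> ereal" where
  "mean_index_upper B =
     Limsup at_top (\<lambda>l. ereal (omega_index 1 (fundamental_solution B) l / l))"

definition mean_index_lower :: "(real \<Rightarrow> 'n::finite phase_matrix) \<Rightarrow> ereal" where
  "mean_index_lower B =
     Liminf at_top (\<lambda>l. ereal (omega_index 1 (fundamental_solution B) l / l))"

definition mean_index_upper_neg :: "(real \<Rightarrow> 'n::finite phase_matrix) \<Rightarrow> ereal" where
  "mean_index_upper_neg B =
     Limsup at_top (\<lambda>l. ereal (omega_index 1 (\<lambda>t. fundamental_solution B (- t)) l / (- l)))"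

definition mean_index_lower_neg :: "(real \<Rightarrow> 'n::finite phase_matrix) \<Rightarrow> ereal" where
  "mean_index_lower_neg B =
     Liminf at_top (\<lambda>l. ereal (omega_index 1 (\<lambda>t. fundamental_solution B (- t)) l / (- l)))"

definition mean_index_interval :: "(real \<Rightarrow> 'n::finite phase_matrix) \<Rightarrow> ereal set" where
  "mean_index_interval B = {mean_index_lower B .. mean_index_upper B}"

definition mean_index_interval_neg :: "(real \<Rightarrow> 'n::finite phase_matrix) \<Rightarrow> ereal set" where
  "mean_index_interval_neg B = {mean_index_lower_neg B .. mean_index_upper_neg B}"


section \<open>Hamiltonian systems\<close>

definition grad :: "('n::finite phase \<Rightarrow> real) \<Rightarrow> 'n phase \<Rightarrow> 'n phase" where
  "grad H z = (THE g. GDERIV H z :> g)"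

definition hessian :: "('n::finite phase \<Rightarrow> real) \<Rightarrow> 'n phase \<Rightarrow> 'n phase_matrix" where
  "hessian H z = matrix (frechet_derivative (grad H) (at z))"

definition C2_function :: "('n::finite phase \<Rightarrow> real) \<Rightarrow> bool" where
  "C2_function H \<longleftrightarrow> (\<forall>z. H differentiable (at z)) \<and> (\<forall>z. grad H differentiable (at z)) \<and>
     continuous_on UNIV (hessian H)"

definition hamiltonian_orbit :: "('n::finite phase \<Rightarrow> real) \<Rightarrow> (real \<Rightarrow> 'n phase) \<Rightarrow> bool" where
  "hamiltonian_orbit H x \<longleftrightarrow> (\<forall>t. (x has_vector_derivative (symp_J *v grad H (x t))) (at t))"

definition orbit_index :: "('n::finite phase \<Rightarrow> real) \<Rightarrow> (real \<Rightarrow> 'n phase) \<Rightarrow> ereal set" where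
  "orbit_index H x = mean_index_interval (\<lambda>t. hessian H (x t))"

definition orbit_index_neg :: "('n::finite phase \<Rightarrow> real) \<Rightarrow> (real \<Rightarrow> 'n phase) \<Rightarrow> ereal set" where
  "orbit_index_neg H x = mean_index_interval_neg (\<lambda>t. hessian H (x t))"

definition orbit_from :: "('n::finite phase \<Rightarrow> real) \<Rightarrow> 'n phase \<Rightarrow> real \<Rightarrow> 'n phase" where
  "orbit_from H \<xi> = (THE x. hamiltonian_orbit H x \<and> x 0 = \<xi>)"

definition set_index :: "('n::finite phase \<Rightarrow> real) \<Rightarrow> 'n phase set \<Rightarrow> ereal set" where
  "set_index H \<Lambda> = (\<Union>\<xi>\<in>\<Lambda>. orbit_index H (orbit_from H \<xi>))"

definition set_index_neg :: "('n::finite phase \<Rightarrow> real) \<Rightarrow> 'n phase set \<Rightarrow> ereal set" where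
  "set_index_neg H \<Lambda> = (\<Union>\<xi>\<in>\<Lambda>. orbit_index_neg H (orbit_from H \<xi>))"

definition orbit_closure :: "(real \<Rightarrow> 'n::finite phase) \<Rightarrow> 'n phase set" where
  "orbit_closure x = closure (range x)"

definition omega_limit_set :: "(real \<Rightarrow> 'n::finite phase) \<Rightarrow> 'n phase set" where
  "omega_limit_set x = {y. \<exists>s. filterlim s at_top sequentially \<and> (\<lambda>k. x (s k)) \<longlonglongrightarrow> y}"

definition alpha_limit_set :: "(real \<Rightarrow> 'n::finite phase) \<Rightarrow> 'n phase set" where
  "alpha_limit_set x = {y. \<exists>s. filterlim s at_bot sequentially \<and> (\<lambda>k. x (s k)) \<longlonglongrightarrow> y}"


section \<open>Quasi-periodic orbits\<close>

text \<open>
  The torus \<open>\<real>\<^sup>m / \<int>\<^sup>m\<close> is realised as the \<open>m\<close>-fold product of the unit circle in the complex plane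
  via \<open>\<theta> \<mapsto> e\<^sup>2\<^sup>\<pi>\<^sup>i\<^sup>\<theta>\<close>, so that adding \<open>v\<close> to a point of the torus becomes multiplication by
  \<open>cis (2 \<pi> v\<^sub>k)\<close> in the \<open>k\<close>-th coordinate.  Here \<open>m = 0\<close> (an equilibrium) is allowed.
\<close>

definition torus :: "nat \<Rightarrow> (nat \<Rightarrow> complex) topology" where
  "torus m = product_topology (\<lambda>_. top_of_set (sphere 0 1)) {..<m}"

definition torus_add :: "nat \<Rightarrow> (nat \<Rightarrow> complex) \<Rightarrow> (nat \<Rightarrow> real) \<Rightarrow> nat \<Rightarrow> complex" where
  "torus_add m \<theta> v = (\<lambda>k\<in>{..<m}. \<theta> k * cis (2 * pi * v k))"

definition rationally_independent :: "nat \<Rightarrow> (nat \<Rightarrow> real) \<Rightarrow> bool" where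
  "rationally_independent m w \<longleftrightarrow>
     (\<forall>q :: nat \<Rightarrow> rat. (\<Sum>k<m. of_rat (q k) * w k) = 0 \<longrightarrow> (\<forall>k<m. q k = 0))"

definition quasi_periodic :: "(real \<Rightarrow> 'n::finite phase) \<Rightarrow> bool" where
  "quasi_periodic x \<longleftrightarrow> (\<exists>m D w.
     homeomorphic_map (torus m) (top_of_set (orbit_closure x)) D \<and>
     rationally_independent m w \<and>
     (\<forall>t. x t = D (torus_add m (inv_into (topspace (torus m)) D (x 0)) (\<lambda>k. w k * t))))"

end

theory Submission
  imports Defs "HOL-Computational_Algebra.Fundamental_Theorem_Algebra"
begin

text \<open>
  For a symplectic \<open>M\<close> the function \<open>r \<mapsto> det ((M - I) - \<i> r J (M + I))\<close> has no zeros for \<open>r > 0\<close>,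
  and at \<open>r = 0\<close> it vanishes exactly on the hypersurface.  Following its logarithm around the
  crossings of a transverse path expresses the signed number of crossings by the change of
  argument at \<open>r = 1\<close>, which is a homotopy invariant.  Hence the intersection number is well defined, and
  \<open>i\<^sub>1\<close> differs by a bounded amount from \<open>1 / \<pi>\<close> times this change of argument, the rotation.

  The rotation is additive up to a bounded error under concatenation of paths and stable on compact
  time intervals.  A quasi-periodic orbit is almost periodic, so that over a long time \<open>T\<close> all its
  translates, and hence all orbit pieces of length \<open>T\<close> that stay close to it, have nearly the same
  rotation.  Cutting an orbit asymptotic to it into pieces of length \<open>T\<close> shows that all such orbits have
  the same mean rotation, as a limit; so all the intervals in question are one and the same point.
\<close>

section \<open>Change of argument along a path\<close>

text \<open>Two features of the definitions shape the argument. The intersection number is a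
  definite description over all transverse paths homotopic to the given one, so it calls for
  invariance and for existence: a path with regular end points has to be deformed into a transverse
  one. Transvections are used for this because \<open>det (M - I)\<close> is affine along them.
  Moreover only limits of the index divided by \<open>l\<close> matter, so bounded errors vanish,
  and an error bounded per block of length \<open>T\<close> becomes small for large
  \<open>T\<close>.

  The determinant comes from \<open>(M - I) - r J (M + I) = (I - r J) M - (I + r J)\<close>. For
  real \<open>r = tan (s / 2)\<close> this is singular exactly when \<open>e^(-sJ) M\<close> has
  eigenvalue 1, so real \<open>r\<close> performs the shift in the definition of the index, while
  the imaginary parameter \<open>\<i> r\<close> with \<open>r > 0\<close> never meets a zero. The
  value \<open>r = 1\<close> is distinguished: \<open>I - \<i> J\<close> and
  \<open>I + \<i> J\<close> are then twice complementary projections, and the determinant is a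
  constant times the complex determinant of the part of \<open>M\<close> that commutes with
  \<open>J\<close>. This is where the additivity of the rotation up to a bounded error comes
  from.\<close>

lemma log_diff_constant:
  fixes l m :: "'a::topological_space \<Rightarrow> complex"
  assumes "connected S" "continuous_on S l" "continuous_on S m"
    and "\<And>x. x \<in> S \<Longrightarrow> exp (l x) = exp (m x)"
  obtains k where "\<And>x. x \<in> S \<Longrightarrow> l x = m x + k"
proof -
  have "(\<lambda>x. l x - m x) constant_on S"
  proof (rule continuous_discrete_range_constant[OF assms(1)])
    show "continuous_on S (\<lambda>x. l x - m x)" by (intro continuous_intros assms)
    fix x assume x: "x \<in> S"
    \<comment> \<open>Both are logarithms of the same number, so the difference takes values in
      \<open>2 pi \<i> Z\<close>, and distinct values are at least \<open>2 pi\<close>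
      apart.\<close>
    have "2 * pi \<le> norm ((l y - m y) - (l x - m x))" if y: "y \<in> S" "l y - m y \<noteq> l x - m x" for y
    proof -
      obtain n where n: "l y = m y + complex_of_real (of_int (2 * n) * pi) * \<i>"
        using assms(4)[OF y(1)] unfolding exp_eq by (auto simp: mult_ac)
      obtain k where k: "l x = m x + complex_of_real (of_int (2 * k) * pi) * \<i>"
        using assms(4)[OF x] unfolding exp_eq by (auto simp: mult_ac)
      define j where "j = n - k"
      have e: "(l y - m y) - (l x - m x) = complex_of_real (of_int (2 * j) * pi) * \<i>"
        unfolding n k j_def by (simp add: algebra_simps)
      with y(2) have "j \<noteq> 0" by auto
      hence "1 \<le> \<bar>real_of_int j\<bar>" by linarith
      moreover have "norm ((l y - m y) - (l x - m x)) = 2 * \<bar>real_of_int j\<bar> * pi"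
        unfolding e by (simp add: norm_mult abs_mult)
      ultimately show ?thesis by simp
    qed
    thus "\<exists>e>0. \<forall>y. y \<in> S \<and> l y - m y \<noteq> l x - m x \<longrightarrow> e \<le> norm (l y - m y - (l x - m x))"
      by (intro exI[of _ "2 * pi"]) auto
  qed
  then obtain k where "\<And>x. x \<in> S \<Longrightarrow> l x - m x = k"
    unfolding constant_on_def by blast
  thus ?thesis by (intro that[of k]) (simp add: algebra_simps)
qed

text \<open>The winding angle, in radians, of a path avoiding 0. A continuous logarithm is used
  rather than the principal argument, so that no branch cut has to be followed.\<close>

definition arg_change :: "(real \<Rightarrow> complex) \<Rightarrow> real \<Rightarrow> real \<Rightarrow> real" where
  "arg_change c a b = (THE r. \<exists>l. continuous_on {a..b} l \<and> (\<forall>t\<in>{a..b}. c t = exp (l t)) \<and>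
     r = Im (l b) - Im (l a))"

lemma arg_change_eq:
  assumes "a \<le> b" "continuous_on {a..b} l" "\<And>t. t \<in> {a..b} \<Longrightarrow> c t = exp (l t)"
  shows "arg_change c a b = Im (l b) - Im (l a)"
  unfolding arg_change_def
proof (rule the_equality)
  show "\<exists>m. continuous_on {a..b} m \<and> (\<forall>t\<in>{a..b}. c t = exp (m t)) \<and>
      Im (l b) - Im (l a) = Im (m b) - Im (m a)"
    using assms by blast
  fix r assume "\<exists>m. continuous_on {a..b} m \<and> (\<forall>t\<in>{a..b}. c t = exp (m t)) \<and> r = Im (m b) - Im (m a)"
  then obtain m where m: "continuous_on {a..b} m" "\<And>t. t \<in> {a..b} \<Longrightarrow> c t = exp (m t)"
      "r = Im (m b) - Im (m a)" by blast
  obtain k where "\<And>t. t \<in> {a..b} \<Longrightarrow> m t = l t + k"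
    by (rule log_diff_constant[of "{a..b}" m l]) (use m assms in auto)
  with m(3) assms(1) show "r = Im (l b) - Im (l a)" by simp
qed

lemma arg_change_log:
  assumes "a \<le> b" "continuous_on {a..b} c" "\<And>t. t \<in> {a..b} \<Longrightarrow> c t \<noteq> 0"
  obtains l where "continuous_on {a..b} l" "\<And>t. t \<in> {a..b} \<Longrightarrow> c t = exp (l t)"
    "arg_change c a b = Im (l b) - Im (l a)"
proof -
  obtain l where l: "continuous_on {a..b} l" "\<And>t. t \<in> {a..b} \<Longrightarrow> c t = exp (l t)"
    using continuous_logarithm_on_contractible[OF assms(2) convex_imp_contractible] assms(3)
    by (metis convex_real_interval(5))
  with arg_change_eq[OF assms(1) l] that show ?thesis by blast
qed

lemma arg_change_cong:
  assumes "\<And>t. t \<in> {a..b} \<Longrightarrow> c t = d t"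
  shows "arg_change c a b = arg_change d a b"
  unfolding arg_change_def using assms by (intro arg_cong[where f = The] ext) auto

lemma arg_change_mult:
  assumes "a \<le> b" "continuous_on {a..b} c" "\<And>t. t \<in> {a..b} \<Longrightarrow> c t \<noteq> 0"
    "continuous_on {a..b} d" "\<And>t. t \<in> {a..b} \<Longrightarrow> d t \<noteq> 0"
  shows "arg_change (\<lambda>t. c t * d t) a b = arg_change c a b + arg_change d a b"
proof -
  obtain l where l: "continuous_on {a..b} l" "\<And>t. t \<in> {a..b} \<Longrightarrow> c t = exp (l t)"
    "arg_change c a b = Im (l b) - Im (l a)" using arg_change_log[OF assms(1-3)] by blast
  obtain m where m: "continuous_on {a..b} m" "\<And>t. t \<in> {a..b} \<Longrightarrow> d t = exp (m t)"
    "arg_change d a b = Im (m b) - Im (m a)" using arg_change_log[OF assms(1,4,5)] by blast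
  have "arg_change (\<lambda>t. c t * d t) a b = Im (l b + m b) - Im (l a + m a)"
    by (rule arg_change_eq[OF assms(1)]) (auto intro!: continuous_intros l m simp: exp_add l(2) m(2))
  thus ?thesis using l m by simp
qed

lemma arg_change_const: "a \<le> b \<Longrightarrow> k \<noteq> 0 \<Longrightarrow> arg_change (\<lambda>_. k) a b = 0"
  by (subst arg_change_eq[where l = "\<lambda>_. Ln k"]) auto

lemma arg_change_cmult:
  assumes "a \<le> b" "continuous_on {a..b} c" "\<And>t. t \<in> {a..b} \<Longrightarrow> c t \<noteq> 0" "k \<noteq> 0"
  shows "arg_change (\<lambda>t. k * c t) a b = arg_change c a b"
  using arg_change_mult[of a b "\<lambda>_. k" c] assms arg_change_const[of a b k] by simp

lemma arg_change_split:
  assumes "a \<le> m" "m \<le> b" "continuous_on {a..b} c" "\<And>t. t \<in> {a..b} \<Longrightarrow> c t \<noteq> 0"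
  shows "arg_change c a b = arg_change c a m + arg_change c m b"
proof -
  obtain l where l: "continuous_on {a..b} l" "\<And>t. t \<in> {a..b} \<Longrightarrow> c t = exp (l t)"
    "arg_change c a b = Im (l b) - Im (l a)"
    using arg_change_log[of a b c] assms order.trans[OF assms(1,2)] by blast
  have "arg_change c a m = Im (l m) - Im (l a)"
    by (rule arg_change_eq[OF assms(1) continuous_on_subset[OF l(1)]]) (use assms(1,2) l(2) in auto)
  moreover have "arg_change c m b = Im (l b) - Im (l m)"
    by (rule arg_change_eq[OF assms(2) continuous_on_subset[OF l(1)]]) (use assms(1,2) l(2) in auto)
  ultimately show ?thesis using l by simp
qed

lemma arg_change_shift:
  assumes "a \<le> b" "continuous_on {a+s..b+s} c" "\<And>t. t \<in> {a+s..b+s} \<Longrightarrow> c t \<noteq> 0"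
  shows "arg_change (\<lambda>t. c (s + t)) a b = arg_change c (a + s) (b + s)"
proof -
  obtain l where l: "continuous_on {a+s..b+s} l" "\<And>t. t \<in> {a+s..b+s} \<Longrightarrow> c t = exp (l t)"
    "arg_change c (a + s) (b + s) = Im (l (b + s)) - Im (l (a + s))"
    using arg_change_log[of "a+s" "b+s" c] assms by auto
  have "arg_change (\<lambda>t. c (s + t)) a b = Im (l (s + b)) - Im (l (s + a))"
    by (rule arg_change_eq[OF assms(1)])
       (auto intro!: continuous_on_compose2[OF l(1)] continuous_intros l(2))
  thus ?thesis using l by (simp add: add.commute)
qed

text \<open>A rectangle is contractible, so one logarithm serves all four edges. This is homotopy
  invariance in the form used below, with the side terms kept because the end points may
  move.\<close>

lemma arg_change_rectangle:
  assumes "a \<le> b" "c \<le> d" "continuous_on ({a..b} \<times> {c..d}) F"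
    "\<And>t s. t \<in> {a..b} \<Longrightarrow> s \<in> {c..d} \<Longrightarrow> F (t, s) \<noteq> 0"
  shows "arg_change (\<lambda>t. F (t, c)) a b + arg_change (\<lambda>s. F (b, s)) c d =
         arg_change (\<lambda>s. F (a, s)) c d + arg_change (\<lambda>t. F (t, d)) a b"
proof -
  obtain l where l: "continuous_on ({a..b} \<times> {c..d}) l"
      "\<And>x. x \<in> {a..b} \<times> {c..d} \<Longrightarrow> F x = exp (l x)"
    by (rule continuous_logarithm_on_contractible[OF assms(3)])
       (use assms(4) in \<open>auto intro!: convex_imp_contractible convex_Times\<close>)
  have h: "arg_change (\<lambda>t. F (t, s)) a b = Im (l (b, s)) - Im (l (a, s))" if "s \<in> {c..d}" for s
    by (rule arg_change_eq[OF assms(1)])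
       (use that in \<open>auto intro!: continuous_on_compose2[OF l(1)] continuous_intros l(2)\<close>)
  have v: "arg_change (\<lambda>s. F (t, s)) c d = Im (l (t, d)) - Im (l (t, c))" if "t \<in> {a..b}" for t
    by (rule arg_change_eq[OF assms(2)])
       (use that in \<open>auto intro!: continuous_on_compose2[OF l(1)] continuous_intros l(2)\<close>)
  show ?thesis using h[of c] h[of d] v[of a] v[of b] assms by simp
qed

text \<open>After multiplication by \<open>w\<close> the path stays in the right half-plane, where
  \<open>Ln\<close> is continuous and its imaginary part lies between \<open>- pi / 2\<close> and
  \<open>pi / 2\<close>.\<close>

lemma arg_change_half_plane:
  assumes "a \<le> b" "continuous_on {a..b} c" "\<And>t. t \<in> {a..b} \<Longrightarrow> Re (w * c t) > 0"
  shows "\<bar>arg_change c a b\<bar> \<le> pi"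
proof -
  have w: "w \<noteq> 0" using assms(1) assms(3)[of a] by auto
  have nz: "w * c t \<noteq> 0" if "t \<in> {a..b}" for t using assms(3)[OF that] by auto
  have "arg_change (\<lambda>t. w * c t) a b = Im (Ln (w * c b)) - Im (Ln (w * c a))"
  proof (rule arg_change_eq[OF assms(1)])
    show "continuous_on {a..b} (\<lambda>t. Ln (w * c t))"
      by (intro continuous_intros assms)
         (use assms(3) in \<open>force simp: complex_nonpos_Reals_iff\<close>)
  qed (use nz in auto)
  moreover have "arg_change (\<lambda>t. w * c t) a b = arg_change c a b"
    by (rule arg_change_cmult) (use assms w nz in auto)
  moreover have "\<bar>Im (Ln (w * c t))\<bar> < pi / 2" if "t \<in> {a..b}" for t
    using Re_Ln_pos_lt[OF nz[OF that]] assms(3)[OF that] by simp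
  from this[of a] this[of b] have "\<bar>Im (Ln (w * c b)) - Im (Ln (w * c a))\<bar> \<le> pi"
    using assms(1) by (simp add: abs_if split: if_splits)
  ultimately show ?thesis by simp
qed

text \<open>Seen from a point \<open>z\<close> off the segment \<open>[0, 1]\<close>, the segment
  lies in an open half-plane: on one side of \<open>z\<close> if \<open>z\<close> is real, strictly
  above or below it otherwise.\<close>

lemma arg_change_linear_factor:
  assumes "\<And>t. t \<in> {0..1} \<Longrightarrow> complex_of_real t - z \<noteq> 0"
  shows "\<bar>arg_change (\<lambda>t. complex_of_real t - z) 0 1\<bar> \<le> pi"
proof -
  have cont: "continuous_on {0..1} (\<lambda>t. complex_of_real t - z)" by (intro continuous_intros)
  show ?thesis
  proof (cases "Im z = 0")
    case True
    have "Re z < 0 \<or> Re z > 1"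
    proof (rule ccontr)
      assume "\<not> ?thesis"
      with assms[of "Re z"] True show False by (simp add: complex_eq_iff)
    qed
    thus ?thesis
    proof
      assume "Re z < 0" thus ?thesis
        by (intro arg_change_half_plane[where w = 1] cont) auto
    next
      assume "Re z > 1" thus ?thesis
        by (intro arg_change_half_plane[where w = "-1"] cont) auto
    qed
  next
    case False
    thus ?thesis
      by (intro arg_change_half_plane[where w = "of_real (Im z) * \<i>"] cont)
         (auto simp: zero_less_mult_iff)
  qed
qed

text \<open>Factor over the roots; each linear factor contributes at most \<open>pi\<close>. The
  bound depends on the degree alone, which makes it uniform over the non-compact symplectic
  group.\<close>

lemma arg_change_poly:
  fixes p :: "complex poly"
  assumes "\<And>t. t \<in> {0..1} \<Longrightarrow> poly p (complex_of_real t) \<noteq> 0"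
  shows "\<bar>arg_change (\<lambda>t. poly p (complex_of_real t)) 0 1\<bar> \<le> pi * degree p"
proof -
  have prod: "\<bar>arg_change (\<lambda>t. poly (\<Prod>x\<in>#A. [:- x, 1:]) (complex_of_real t)) 0 1\<bar> \<le> pi * size A"
    if "\<And>t. t \<in> {0..1} \<Longrightarrow> poly (\<Prod>x\<in>#A. [:- x, 1:]) (complex_of_real t) \<noteq> 0" for A
    using that
  proof (induction A)
    case empty
    show ?case by (simp add: arg_change_const)
  next
    case (add z A)
    have nz: "complex_of_real t - z \<noteq> 0" "poly (\<Prod>x\<in>#A. [:- x, 1:]) (complex_of_real t) \<noteq> 0"
      if "t \<in> {0..1}" for t
      using add.prems[OF that] by auto
    have "arg_change (\<lambda>t. poly (\<Prod>x\<in>#add_mset z A. [:- x, 1:]) (complex_of_real t)) 0 1 =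
          arg_change (\<lambda>t. (complex_of_real t - z) * poly (\<Prod>x\<in>#A. [:- x, 1:]) (complex_of_real t)) 0 1"
      by (rule arg_change_cong) (simp add: algebra_simps)
    also have "\<dots> = arg_change (\<lambda>t. complex_of_real t - z) 0 1 +
        arg_change (\<lambda>t. poly (\<Prod>x\<in>#A. [:- x, 1:]) (complex_of_real t)) 0 1"
      by (rule arg_change_mult) (use nz in \<open>auto intro!: continuous_intros\<close>)
    finally show ?case
      using add.IH[OF nz(2)] arg_change_linear_factor[OF nz(1)] by (simp add: algebra_simps)
  qed
  have p0: "p \<noteq> 0" using assms[of 0] by auto
  obtain A where A: "size A = degree p" "p = smult (lead_coeff p) (\<Prod>x\<in>#A. [:- x, 1:])"
    using alg_closed_imp_factorization[OF p0] by blast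
  have e: "poly p z = lead_coeff p * poly (\<Prod>x\<in>#A. [:- x, 1:]) z" for z
    using A(2) by (metis poly_smult)
  have nz: "poly (\<Prod>x\<in>#A. [:- x, 1:]) (complex_of_real t) \<noteq> 0" if "t \<in> {0..1}" for t
    using assms[OF that] e by auto
  have "arg_change (\<lambda>t. poly p (complex_of_real t)) 0 1 =
      arg_change (\<lambda>t. lead_coeff p * poly (\<Prod>x\<in>#A. [:- x, 1:]) (complex_of_real t)) 0 1"
    by (rule arg_change_cong) (rule e)
  also have "\<dots> = arg_change (\<lambda>t. poly (\<Prod>x\<in>#A. [:- x, 1:]) (complex_of_real t)) 0 1"
    by (rule arg_change_cmult) (use nz p0 in \<open>auto intro!: continuous_intros\<close>)
  finally show ?thesis using prod[OF nz] A(1) by simp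
qed

text \<open>The entries are read as polynomials of degree at most one, and a product in the Leibniz
  formula has one factor from each row.\<close>

lemma det_affine_poly:
  fixes A X :: "'a::{comm_ring_1,ring_no_zero_divisors} ^ 'k ^ 'k::finite"
  obtains p where "degree p \<le> CARD('k)" "\<And>r. poly p r = det (\<chi> i j. A $ i $ j + r * X $ i $ j)"
proof -
  define Z :: "'a poly ^ 'k ^ 'k" where "Z = (\<chi> i j. [:A $ i $ j, X $ i $ j:])"
  have "degree (\<Prod>i\<in>UNIV. Z $ i $ p i) \<le> CARD('k)" for p
  proof -
    have "degree (\<Prod>i\<in>UNIV. Z $ i $ p i) \<le> (\<Sum>i\<in>UNIV. degree (Z $ i $ p i))"
      using degree_prod_sum_le[of UNIV "\<lambda>i. Z $ i $ p i"] by (simp add: o_def)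
    also have "\<dots> \<le> (\<Sum>i\<in>(UNIV::'k set). 1)" by (intro sum_mono) (simp add: Z_def)
    finally show ?thesis by simp
  qed
  hence "degree (det Z) \<le> CARD('k)"
    unfolding det_def
    by (intro degree_sum_le) (auto simp: sign_def)
  moreover have "poly (det Z) r = det (\<chi> i j. A $ i $ j + r * X $ i $ j)" for r
    unfolding det_def Z_def
    by (auto simp: poly_sum poly_prod sign_def intro!: sum.cong)
  ultimately show ?thesis using that by blast
qed

text \<open>The source of the error constants that are multiples of
  \<open>pi * CARD('n + 'n)\<close>: the interpolations between matrices used below are affine in
  their parameter.\<close>

lemma arg_change_det_affine:
  fixes A X :: "complex ^ 'k ^ 'k::finite"
  assumes "\<And>t. t \<in> {0..1} \<Longrightarrow> det (\<chi> i j. A $ i $ j + complex_of_real t * X $ i $ j) \<noteq> 0"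
  shows "\<bar>arg_change (\<lambda>t. det (\<chi> i j. A $ i $ j + complex_of_real t * X $ i $ j)) 0 1\<bar> \<le> pi * CARD('k)"
proof -
  obtain p where p: "degree p \<le> CARD('k)" "\<And>r. poly p r = det (\<chi> i j. A $ i $ j + r * X $ i $ j)"
    using det_affine_poly[of A X] by blast
  have "\<bar>arg_change (\<lambda>t. poly p (complex_of_real t)) 0 1\<bar> \<le> pi * degree p"
    by (rule arg_change_poly) (use assms p in auto)
  also have "\<dots> \<le> pi * CARD('k)" using p(1) by simp
  finally show ?thesis unfolding p(2) .
qed

section \<open>Symplectic linear algebra\<close>

lemma matrix_mult_add_rdistrib: "((A::'a::semiring_1^'k^'m) + B) ** C = A ** C + B ** (C::'a^'l^'k::finite)"
  by (simp add: matrix_matrix_mult_def vec_eq_iff distrib_right sum.distrib)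

lemma matrix_mult_diff_ldistrib: "(A::'a::ring_1^'k^'m) ** (B - C) = A ** B - A ** (C::'a^'l^'k::finite)"
  by (simp add: matrix_matrix_mult_def vec_eq_iff right_diff_distrib sum_subtractf)

lemma matrix_mult_diff_rdistrib: "((A::'a::ring_1^'k^'m) - B) ** C = A ** C - B ** (C::'a^'l^'k::finite)"
  by (simp add: matrix_matrix_mult_def vec_eq_iff left_diff_distrib sum_subtractf)

lemma matrix_mult_minus_left: "(- (A::'a::ring_1^'k^'m)) ** C = - (A ** (C::'a^'l^'k::finite))"
  by (simp add: matrix_matrix_mult_def vec_eq_iff sum_negf)

lemma matrix_mult_minus_right: "(A::'a::ring_1^'k^'m) ** (- C) = - (A ** (C::'a^'l^'k::finite))"
  by (simp add: matrix_matrix_mult_def vec_eq_iff sum_negf)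

lemma matrix_mult_scaleR_left: "(c *\<^sub>R (A::'a::real_algebra_1^'k^'m)) ** C = c *\<^sub>R (A ** (C::'a^'l^'k::finite))"
  by (simp add: matrix_matrix_mult_def vec_eq_iff scaleR_sum_right)

lemma matrix_mult_scaleR_right: "(A::'a::real_algebra_1^'k^'m) ** (c *\<^sub>R C) = c *\<^sub>R (A ** (C::'a^'l^'k::finite))"
  by (simp add: matrix_matrix_mult_def vec_eq_iff scaleR_sum_right)

lemma matrix_vector_mult_minus_left: "(- (A::'a::ring_1^'k::finite^'m)) *v x = - (A *v x)"
  by (simp add: matrix_vector_mult_def vec_eq_iff sum_negf)

lemma matrix_vector_mult_minus_right: "(A::'a::ring_1^'k::finite^'m) *v (- x) = - (A *v x)"
  by (simp add: matrix_vector_mult_def vec_eq_iff sum_negf)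

lemmas matrix_ring = matrix_add_ldistrib matrix_mult_add_rdistrib matrix_mult_diff_ldistrib
  matrix_mult_diff_rdistrib matrix_mult_minus_left matrix_mult_minus_right matrix_mult_scaleR_left
  matrix_mult_scaleR_right matrix_mul_assoc

lemmas matrix_vec = matrix_vector_mult_minus_left matrix_vector_mult_minus_right
  matrix_vector_mult_add_rdistrib matrix_vector_mult_diff_rdistrib matrix_vector_right_distrib
  matrix_vector_mult_diff_distrib matrix_vector_mult_scaleR scaleR_matrix_vector_assoc[symmetric]
  matrix_vector_mul_assoc[symmetric]

lemma mat_minus [simp]: "mat (- c :: 'a::ring_1) = - mat c"
  by (simp add: mat_def vec_eq_iff)

lemma mat_mult_nth: "(mat c ** A) $ i $ j = c * (A :: 'a::semiring_1^'l^'k::finite) $ i $ j"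
  by (simp add: mat_def matrix_matrix_mult_def if_distrib if_distribR cong: if_cong)

lemma mult_mat_nth: "(A ** mat c) $ i $ j = (A :: 'a::semiring_1^'l::finite^'k) $ i $ j * c"
  by (simp add: mat_def matrix_matrix_mult_def if_distrib if_distribR cong: if_cong)

lemma mat_mult_mat: "mat a ** mat b = (mat (a * b) :: 'a::semiring_1^'k^'k::finite)"
  by (simp add: vec_eq_iff mat_mult_nth) (simp add: mat_def)

lemma mat_commute: "A ** mat c = mat c ** (A :: 'a::comm_semiring_1^'k^'k::finite)"
  by (simp add: vec_eq_iff mat_mult_nth mult_mat_nth mult.commute)

lemma inner_matrix_left: "(A *v x) \<bullet> y = x \<bullet> (transpose A *v y)" for A :: "real^'k::finite^'m::finite"
  by (metis adjoint_matrix adjoint_works matrix_vector_mul_linear inner_commute)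

section \<open>The matrix \<open>J\<close> and the symplectic group\<close>

lemma symp_J_vec:
  "(symp_J *v x) $ Inl k = - x $ Inr k" "(symp_J *v x) $ Inr k = x $ Inl k"
  for x :: "'n::finite phase"
  unfolding matrix_vector_mult_def symp_J_def
  by (simp_all add: UNIV_Plus_UNIV[symmetric] sum.Plus if_distrib if_distribR cong: if_cong
      del: UNIV_Plus_UNIV)

lemma symp_J_J_vec [simp]: "symp_J *v (symp_J *v x) = - x"
proof (rule vec_eq_iff[THEN iffD2], rule allI)
  fix i show "(symp_J *v (symp_J *v x)) $ i = (- x) $ i"
    by (cases i) (simp_all add: symp_J_vec)
qed

lemma symp_J_squared [simp]: "symp_J ** symp_J = - mat 1"
  by (simp add: matrix_eq matrix_vec)

lemma transpose_symp_J [simp]: "transpose symp_J = - symp_J"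
proof (rule vec_eq_iff[THEN iffD2], rule allI, rule vec_eq_iff[THEN iffD2], rule allI)
  fix i j show "transpose symp_J $ i $ j = (- symp_J) $ i $ j"
    by (cases i; cases j) (simp_all add: transpose_def symp_J_def)
qed

lemma symp_J_assoc [simp]: "symp_J ** (symp_J ** A) = - A" "A ** symp_J ** symp_J = - A"
  by (simp_all add: matrix_ring) (metis matrix_mul_assoc symp_J_squared matrix_mult_minus_right matrix_mul_rid)

lemma inner_J_left: "(symp_J *v x) \<bullet> y = - (x \<bullet> (symp_J *v y))"
  using inner_matrix_left[of symp_J x y] by (simp add: matrix_vec del: transpose_matrix_vector)

lemma inner_J_J [simp]: "(symp_J *v x) \<bullet> (symp_J *v y) = x \<bullet> y"
  by (simp add: inner_J_left)

lemma inner_J_same [simp]: "x \<bullet> (symp_J *v x) = 0"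
  using inner_J_left[of x x] by (simp add: inner_commute)

text \<open>This formula for the inverse of a symplectic matrix is linear in \<open>M\<close>, so
  that continuity, norm bounds and derivatives follow without passing through
  \<open>matrix_inv\<close>.\<close>

definition symp_inv :: "'n::finite phase_matrix \<Rightarrow> 'n phase_matrix" where
  "symp_inv M = - (symp_J ** transpose M ** symp_J)"

lemma symp_group_iff: "M \<in> symp_group \<longleftrightarrow> transpose M ** symp_J ** M = symp_J"
proof
  assume h: "transpose M ** symp_J ** M = symp_J"
  have "symp_inv M ** M = - (symp_J ** (transpose M ** symp_J ** M))"
    by (simp add: symp_inv_def matrix_ring)
  also have "\<dots> = mat 1" unfolding h by simp
  finally have "invertible M" using invertible_left_inverse by blast
  with h show "M \<in> symp_group" by (simp add: symp_group_def)
qed (simp add: symp_group_def)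

lemma symp_inv_left: "M \<in> symp_group \<Longrightarrow> symp_inv M ** M = mat 1"
proof -
  assume "M \<in> symp_group"
  hence h: "transpose M ** symp_J ** M = symp_J" by (simp add: symp_group_iff)
  have "symp_inv M ** M = - (symp_J ** (transpose M ** symp_J ** M))"
    by (simp add: symp_inv_def matrix_ring)
  thus ?thesis unfolding h by simp
qed

lemma symp_inv_right: "M \<in> symp_group \<Longrightarrow> M ** symp_inv M = mat 1"
  using matrix_left_right_inverse symp_inv_left by blast

lemma symp_group_mult: "M \<in> symp_group \<Longrightarrow> N \<in> symp_group \<Longrightarrow> M ** N \<in> symp_group"
  unfolding symp_group_iff matrix_transpose_mul by (metis matrix_mul_assoc)

lemma symp_group_one [simp]: "mat 1 \<in> symp_group"
  by (simp add: symp_group_iff)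

lemma symp_group_inv: "M \<in> symp_group \<Longrightarrow> symp_inv M \<in> symp_group"
proof -
  assume M: "M \<in> symp_group"
  have "transpose (symp_inv M) ** symp_J ** symp_inv M
      = transpose (symp_inv M) ** (transpose M ** symp_J ** M) ** symp_inv M"
    using M by (simp add: symp_group_iff)
  also have "\<dots> = transpose (M ** symp_inv M) ** symp_J ** (M ** symp_inv M)"
    by (simp only: matrix_transpose_mul matrix_mul_assoc)
  finally show ?thesis using M by (simp add: symp_inv_right symp_group_iff)
qed

lemma symp_form: "M \<in> symp_group \<Longrightarrow> (M *v x) \<bullet> (symp_J *v (M *v y)) = x \<bullet> (symp_J *v y)"
  by (simp add: inner_matrix_left[of M] matrix_vector_mul_assoc symp_group_iff del: transpose_matrix_vector)
     (simp add: symp_group_iff matrix_mul_assoc)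

section \<open>Complexification of real matrices and vectors\<close>

abbreviation cmat :: "real^'k^'m \<Rightarrow> complex^'k^'m" where "cmat \<equiv> map_matrix complex_of_real"

lemma cmat_simps:
  "cmat (A + B) = cmat A + cmat B" "cmat (A - B) = cmat A - cmat B" "cmat (- A) = - cmat A"
  "cmat (mat r) = mat (complex_of_real r)" "cmat (r *\<^sub>R A) = r *\<^sub>R cmat A"
  for r :: real
  by (simp_all add: vec_eq_iff mat_def complex_eq_iff)

lemma cmat_mult: "cmat (A ** B) = cmat A ** cmat (B :: real^'l^'k::finite)"
  by (simp add: vec_eq_iff matrix_matrix_mult_def)

lemma det_cmat: "det (cmat A) = complex_of_real (det A)" for A :: "real^'k::finite^'k"
  by (simp add: det_def)

definition vec_Re :: "complex^'k \<Rightarrow> real^'k" where "vec_Re v = (\<chi> i. Re (v $ i))"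
definition vec_Im :: "complex^'k \<Rightarrow> real^'k" where "vec_Im v = (\<chi> i. Im (v $ i))"

lemma vec_Re_Im_zero: "vec_Re v = 0 \<Longrightarrow> vec_Im v = 0 \<Longrightarrow> v = 0"
  by (simp add: vec_Re_def vec_Im_def vec_eq_iff complex_eq_iff)

lemma vec_Re_Im_simps:
  "vec_Re (v + w) = vec_Re v + vec_Re w" "vec_Im (v + w) = vec_Im v + vec_Im w"
  "vec_Re (v - w) = vec_Re v - vec_Re w" "vec_Im (v - w) = vec_Im v - vec_Im w"
  "vec_Re 0 = 0" "vec_Im 0 = 0"
  by (simp_all add: vec_Re_def vec_Im_def vec_eq_iff)

lemma vec_Re_Im_cmat:
  "vec_Re (cmat A *v v) = A *v vec_Re v" "vec_Im (cmat A *v v) = A *v vec_Im v"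
  for A :: "real^'k::finite^'m"
  by (simp_all add: vec_Re_def vec_Im_def vec_eq_iff matrix_vector_mult_def)

lemma mat_vec_nth: "(mat c *v v) $ i = c * v $ i" for c :: "'a::semiring_1"
  by (simp add: mat_def matrix_vector_mult_def if_distrib if_distribR cong: if_cong)

lemma vec_Re_Im_mat:
  "vec_Re (mat c *v v) = Re c *\<^sub>R vec_Re v - Im c *\<^sub>R vec_Im v"
  "vec_Im (mat c *v v) = Re c *\<^sub>R vec_Im v + Im c *\<^sub>R vec_Re v"
  by (simp_all add: vec_Re_def vec_Im_def vec_eq_iff mat_vec_nth)

lemma det_zero_iff_kernel: "det A = 0 \<longleftrightarrow> (\<exists>v. v \<noteq> 0 \<and> A *v v = 0)" for A :: "'a::field^'k::finite^'k"
  by (metis invertible_det_nz invertible_left_inverse matrix_left_invertible_ker matrix_vector_mult_0_right)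

section \<open>The Cayley determinant\<close>

definition cayley_det :: "'n::finite phase_matrix \<Rightarrow> real \<Rightarrow> complex" where
  "cayley_det M r = det (cmat (M - mat 1) - mat (\<i> * complex_of_real r) ** cmat (symp_J ** (M + mat 1)))"

lemma cayley_det_0: "cayley_det M 0 = complex_of_real (det (M - mat 1))"
  for M :: "'n::finite phase_matrix"
proof -
  have "(mat (\<i> * complex_of_real 0) :: complex^('n+'n)^('n+'n)) = 0" by (simp add: mat_def vec_eq_iff)
  thus ?thesis unfolding cayley_det_def by (simp add: det_cmat)
qed

text \<open>Put \<open>A = M - I\<close> and \<open>B = J (M + I)\<close>. For symplectic
  \<open>M\<close> the form \<open>(A x) \<bullet> (B y)\<close> is symmetric. A kernel vector with
  real part \<open>a\<close> and imaginary part \<open>b\<close> satisfies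
  \<open>A a = - r B b\<close> and \<open>A b = r B a\<close>, so symmetry forces
  \<open>B a = B b = 0\<close>; then \<open>A\<close> kills \<open>a\<close> and \<open>b\<close> as
  well, and \<open>A\<close> and \<open>B\<close> have no common kernel.\<close>

lemma cayley_det_nonzero:
  assumes M: "M \<in> symp_group" and r: "r \<noteq> 0"
  shows "cayley_det M r \<noteq> 0"
proof
  let ?A = "M - mat 1" and ?B = "symp_J ** (M + mat 1)"
  assume "cayley_det M r = 0"
  then obtain v where v: "v \<noteq> 0"
    "(cmat ?A - mat (\<i> * complex_of_real r) ** cmat ?B) *v v = 0"
    unfolding cayley_det_def det_zero_iff_kernel by blast
  define a b where "a = vec_Re v" and "b = vec_Im v"
  have e: "cmat ?A *v v - mat (\<i> * complex_of_real r) *v (cmat ?B *v v) = 0"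
    using v(2) by (simp add: matrix_vec)
  from arg_cong[OF e, of vec_Re] have 1: "?A *v a = - (r *\<^sub>R (?B *v b))"
    by (simp add: vec_Re_Im_simps vec_Re_Im_cmat vec_Re_Im_mat a_def b_def)
       (simp add: algebra_simps eq_neg_iff_add_eq_0)
  from arg_cong[OF e, of vec_Im] have 2: "?A *v b = r *\<^sub>R (?B *v a)"
    by (simp add: vec_Re_Im_simps vec_Re_Im_cmat vec_Re_Im_mat a_def b_def)
  have sym: "(?A *v x) \<bullet> (?B *v y) = (?A *v y) \<bullet> (?B *v x)" for x y
    using symp_form[OF M, of x y] symp_form[OF M, of y x] inner_J_left[of x y] inner_J_left[of "M *v x" y]
      inner_J_left[of x "M *v y"]
    by (simp add: matrix_vec inner_diff_left inner_diff_right inner_add_left inner_add_right inner_commute)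
  have "- r * ((?B *v b) \<bullet> (?B *v b)) = r * ((?B *v a) \<bullet> (?B *v a))"
    using sym[of a b] unfolding 1 2 by simp
  hence "r * ((?B *v b) \<bullet> (?B *v b) + (?B *v a) \<bullet> (?B *v a)) = 0"
    by (simp only: distrib_left)
  hence "(?B *v b) \<bullet> (?B *v b) + (?B *v a) \<bullet> (?B *v a) = 0"
    using r by simp
  hence "?B *v a = 0" "?B *v b = 0"
    by (simp_all add: add_nonneg_eq_0_iff)
  hence z: "?A *v a = 0" "?A *v b = 0" "?B *v a = 0" "?B *v b = 0" using 1 2 by auto
  have "x = 0" if "?A *v x = 0" "?B *v x = 0" for x
  proof -
    have "symp_J *v (?B *v x) = 0" using that by simp
    hence "- (M *v x + x) = 0" by (simp add: matrix_vec)
    hence "M *v x + x = 0" by (simp only: neg_equal_0_iff_equal)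
    moreover have "M *v x = x" using that by (simp add: matrix_vec)
    ultimately have "2 *\<^sub>R x = 0" by (simp add: scaleR_2)
    thus "x = 0" by simp
  qed
  hence "a = 0" "b = 0" using z by auto
  with v(1) show False unfolding a_def b_def using vec_Re_Im_zero by blast
qed

section \<open>The differential of the determinant\<close>

text \<open>The Leibniz formula differentiated factor by factor, over a general field so that it
  serves both the real \<open>det (M - I)\<close> and the complex \<open>cayley_det\<close>.\<close>

definition det_deriv :: "'a::real_normed_field^'k^'k \<Rightarrow> 'a^'k^'k \<Rightarrow> 'a" where
  "det_deriv A X = (\<Sum>p | p permutes UNIV. of_int (sign p) *
     (\<Sum>i\<in>UNIV. X $ i $ p i * (\<Prod>j\<in>UNIV - {i}. A $ j $ p j)))"

lemma has_derivative_matrix_nth [derivative_intros]: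
  assumes "(f has_derivative f') F"
  shows "((\<lambda>x. f x $ i $ j) has_derivative (\<lambda>h. f' h $ i $ j)) F"
  using bounded_linear.has_derivative[OF bounded_linear_vec_nth[of j] bounded_linear.has_derivative[OF bounded_linear_vec_nth[of i] assms]] .

lemma has_derivative_det:
  fixes A :: "'a::real_normed_field^'k::finite^'k"
  shows "(det has_derivative det_deriv A) (at A within S)"
  unfolding det_def[abs_def] det_deriv_def[abs_def]
  by (intro has_derivative_sum has_derivative_mult_right has_derivative_prod has_derivative_matrix_nth
      has_derivative_ident)

lemma has_vector_derivative_det:
  fixes f :: "real \<Rightarrow> 'a::real_normed_field^'k::finite^'k"
  assumes "(f has_vector_derivative X) (at t within S)"
  shows "((\<lambda>s. det (f s)) has_vector_derivative det_deriv (f t) X) (at t within S)"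
proof -
  have lin: "linear (det_deriv (f t))" using has_derivative_det has_derivative_linear by blast
  have "((\<lambda>s. det (f s)) has_derivative (\<lambda>h. det_deriv (f t) (h *\<^sub>R X))) (at t within S)"
    using diff_chain_within[OF assms[unfolded has_vector_derivative_def] has_derivative_det]
    by (simp add: o_def)
  thus ?thesis unfolding has_vector_derivative_def by (simp add: linear_scale[OF lin])
qed

section \<open>Continuity of matrix operations\<close>

lemma continuous_on_matrix_nth [continuous_intros]:
  fixes f :: "'b::topological_space \<Rightarrow> 'a::real_normed_vector^'k::finite^'m::finite"
  assumes "continuous_on S f"
  shows "continuous_on S (\<lambda>x. f x $ i $ j)"
  using assms by (intro continuous_intros)

lemma continuous_on_det [continuous_intros]:
  fixes f :: "'b::topological_space \<Rightarrow> 'a::real_normed_field^'k::finite^'k"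
  assumes "continuous_on S f"
  shows "continuous_on S (\<lambda>x. det (f x))"
  unfolding det_def using assms by (intro continuous_intros)

lemma continuous_on_det_deriv [continuous_intros]:
  fixes f g :: "'b::topological_space \<Rightarrow> 'a::real_normed_field^'k::finite^'k"
  assumes "continuous_on S f" "continuous_on S g"
  shows "continuous_on S (\<lambda>x. det_deriv (f x) (g x))"
  unfolding det_deriv_def using assms by (intro continuous_intros)

lemma continuous_on_matrix_mult [continuous_intros]:
  fixes f :: "'b::topological_space \<Rightarrow> 'a::real_normed_field^'k::finite^'m::finite"
    and g :: "'b \<Rightarrow> 'a^'l::finite^'k"
  assumes "continuous_on S f" "continuous_on S g"
  shows "continuous_on S (\<lambda>x. f x ** g x)"
  unfolding matrix_matrix_mult_def using assms by (intro continuous_intros)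

lemma continuous_on_mat [continuous_intros]:
  fixes f :: "'b::topological_space \<Rightarrow> 'a::real_normed_field"
  assumes "continuous_on S f"
  shows "continuous_on S (\<lambda>x. mat (f x) :: 'a^'k::finite^'k)"
proof -
  have "continuous_on S (\<lambda>x. if i = j then f x else 0)" for i j :: 'k
    by (cases "i = j") (simp_all add: assms)
  thus ?thesis unfolding mat_def by (intro continuous_on_vec_lambda)
qed

lemma continuous_on_cmat [continuous_intros]:
  fixes f :: "'b::topological_space \<Rightarrow> real^'k::finite^'m::finite"
  assumes "continuous_on S f"
  shows "continuous_on S (\<lambda>x. cmat (f x))"
  unfolding map_matrix_def using assms by (intro continuous_intros)

lemma continuous_on_transpose [continuous_intros]:
  fixes f :: "'b::topological_space \<Rightarrow> 'a::real_normed_field^'k::finite^'m::finite"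
  assumes "continuous_on S f"
  shows "continuous_on S (\<lambda>x. transpose (f x))"
  unfolding transpose_def using assms by (intro continuous_intros)

section \<open>The differential of the determinant at singular matrices\<close>

lemma linear_det_deriv: "linear (det_deriv A)" for A :: "'a::real_normed_field^'k::finite^'k"
  using has_derivative_det has_derivative_linear by blast

lemma det_deriv_line_zero:
  fixes A X :: "'a::real_normed_field^'k::finite^'k"
  assumes "\<And>s::real. det (A + s *\<^sub>R X) = 0"
  shows "det_deriv A X = 0"
proof -
  have "((\<lambda>s::real. A + s *\<^sub>R X) has_vector_derivative X) (at 0)"
    by (auto intro!: derivative_eq_intros)
  from has_vector_derivative_det[OF this] have "((\<lambda>s::real. 0) has_vector_derivative det_deriv A X) (at 0)"
    by (simp add: assms)
  thus ?thesis using vector_derivative_unique_at has_vector_derivative_const by blast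
qed

definition outer :: "real^'m \<Rightarrow> real^'k \<Rightarrow> real^'k^'m" where
  "outer v u = (\<chi> i j. v $ i * u $ j)"

lemma outer_vec: "outer v u *v x = (u \<bullet> x) *\<^sub>R v" for u :: "real^'k::finite"
  by (simp add: outer_def vec_eq_iff matrix_vector_mult_def inner_vec_def sum_distrib_left mult_ac)

lemma mult_outer: "A ** outer v u = outer (A *v v) u" for v :: "real^'k::finite"
  by (simp add: outer_def vec_eq_iff matrix_vector_mult_def matrix_matrix_mult_def sum_distrib_right sum_distrib_left mult_ac)

lemma outer_linear: "linear (\<lambda>v. outer v u)"
  by (intro linearI) (simp_all add: outer_def vec_eq_iff algebra_simps)

lemma det_deriv_kernel:
  fixes A X :: "real^'k::finite^'k"
  assumes "A *v u = 0" "u \<noteq> 0" "X *v u = 0"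
  shows "det_deriv A X = 0"
proof (rule det_deriv_line_zero)
  fix s :: real
  have "(A + s *\<^sub>R X) *v u = 0" using assms by (simp add: matrix_vec)
  thus "det (A + s *\<^sub>R X) = 0" using assms(2) det_zero_iff_kernel by blast
qed

text \<open>\<open>X\<close> and the rescaled rank one matrix agree on the kernel vector
  \<open>u\<close>. Their difference therefore kills \<open>u\<close>, and along it the determinant
  stays zero.\<close>

lemma det_deriv_outer:
  fixes A X :: "real^'k::finite^'k"
  assumes "A *v u = 0" "u \<noteq> 0"
  shows "det_deriv A X = det_deriv A (outer (X *v u) u) / (u \<bullet> u)"
proof -
  have "det_deriv A (X - (1 / (u \<bullet> u)) *\<^sub>R outer (X *v u) u) = 0"
    by (rule det_deriv_kernel[OF assms]) (use assms(2) in \<open>simp add: matrix_vec outer_vec\<close>)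
  thus ?thesis
    by (simp add: linear_diff[OF linear_det_deriv] linear_scale[OF linear_det_deriv])
qed

text \<open>
  At a point where the differential of \<open>det (M - I)\<close> does not vanish, the kernel is a line spanned by
  some \<open>u\<close>, and the symplectic relation forces the differential to be a multiple of
  \<open>X \<mapsto> J u \<bullet> X u\<close>.
\<close>

lemma symp_det_deriv:
  fixes M X :: "'n::finite phase_matrix"
  assumes M: "M \<in> symp_group" and sing: "det (M - mat 1) = 0"
    and nz: "det_deriv (M - mat 1) X \<noteq> 0"
  shows "det_deriv (M - mat 1) (M ** symp_J) \<noteq> 0"
    and "det_deriv (M - mat 1) (symp_J ** (M + mat 1)) = 2 * det_deriv (M - mat 1) (M ** symp_J)"
proof -
  let ?A = "M - mat 1"
  obtain u where u: "u \<noteq> 0" "?A *v u = 0" using sing det_zero_iff_kernel by blast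
  hence Mu: "M *v u = u" by (simp add: matrix_vec)
  \<comment> \<open>A second kernel direction, made orthogonal to \<open>u\<close>, is annihilated
    by \<open>outer (X *v u) u\<close>. The determinant then vanishes along this direction too,
    contradicting \<open>nz\<close>.\<close>
  have ker: "\<exists>k. w = k *\<^sub>R u" if w: "?A *v w = 0" for w
  proof (rule ccontr)
    assume no: "\<nexists>k. w = k *\<^sub>R u"
    define w' where "w' = w - ((u \<bullet> w) / (u \<bullet> u)) *\<^sub>R u"
    have w'0: "w' \<noteq> 0" using no by (auto simp: w'_def)
    have w'A: "?A *v w' = 0" using w u by (simp add: w'_def matrix_vec)
    have "outer (X *v u) u *v w' = 0"
      using u(1) by (simp add: outer_vec w'_def inner_diff_right)
    hence "det_deriv ?A (outer (X *v u) u) = 0" using det_deriv_kernel[OF w'A w'0] by blast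
    with det_deriv_outer[OF u(2,1), of X] nz show False by simp
  qed
  define l where "l v = det_deriv ?A (outer v u) / (u \<bullet> u)" for v
  have lin: "linear l"
    unfolding l_def
    by (intro linearI)
       (simp_all add: linear_add[OF outer_linear] linear_scale[OF outer_linear]
          linear_add[OF linear_det_deriv] linear_scale[OF linear_det_deriv] add_divide_distrib)
  define c where "c = (\<chi> i. l (axis i 1))"
  have lc: "l v = c \<bullet> v" for v
  proof -
    have "v = (\<Sum>i\<in>UNIV. v $ i *\<^sub>R axis i 1)"
      using basis_expansion[of v] by (simp add: scalar_mult_eq_scaleR)
    hence "l v = l (\<Sum>i\<in>UNIV. v $ i *\<^sub>R axis i 1)" by (rule arg_cong)
    also have "\<dots> = c \<bullet> v" by (simp add: linear_sum[OF lin] linear_scale[OF lin] c_def inner_vec_def mult.commute)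
    finally show ?thesis .
  qed
  have D: "det_deriv ?A Y = c \<bullet> (Y *v u)" for Y
    using det_deriv_outer[OF u(2,1), of Y] lc[of "Y *v u"] by (simp add: l_def)
  \<comment> \<open>Multiplying the singular matrix \<open>M - I\<close> from the right keeps it
    singular, so the differential kills \<open>(M - I) ** outer v u\<close>. This says that the
    covector \<open>c\<close> is invariant under \<open>M\<close>.\<close>
  have cM: "c \<bullet> (M *v v) = c \<bullet> v" for v
  proof -
    have "det_deriv ?A (?A ** outer v u) = 0"
    proof (rule det_deriv_line_zero)
      fix s :: real
      have "?A + s *\<^sub>R (?A ** outer v u) = ?A ** (mat 1 + s *\<^sub>R outer v u)"
        by (simp add: matrix_ring)
      thus "det (?A + s *\<^sub>R (?A ** outer v u)) = 0" using sing by (simp add: det_mul)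
    qed
    thus ?thesis using u(1) by (simp add: D mult_outer outer_vec matrix_vec inner_diff_right)
  qed
  \<comment> \<open>With \<open>c = J w\<close>, invariance of the covector becomes
    \<open>M w = w\<close> through the symplectic form; as the kernel is a line, \<open>c\<close> is
    a multiple of \<open>J u\<close>.\<close>
  define w where "w = - (symp_J *v c)"
  have cw: "c = symp_J *v w" by (simp add: w_def matrix_vec)
  have "(M *v w - w) \<bullet> (symp_J *v y) = 0" for y
  proof -
    define v where "v = symp_inv M *v y"
    have y: "y = M *v v" unfolding v_def using symp_inv_right[OF M] by (simp add: matrix_vector_mul_assoc)
    show ?thesis
      using cM[of v] symp_form[OF M, of w v] unfolding cw y by (simp add: inner_diff_left inner_J_left)
  qed
  from this[of "- (symp_J *v (M *v w - w))"] have "M *v w - w = 0" by (simp add: matrix_vector_mult_minus_right)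
  then obtain k where k: "w = k *\<^sub>R u" using ker[of w] by (auto simp: matrix_vec)
  have c: "c = k *\<^sub>R (symp_J *v u)" unfolding cw k by (simp add: matrix_vec)
  have "k \<noteq> 0" using nz D[of X] c by auto
  have 1: "det_deriv ?A (M ** symp_J) = k * (u \<bullet> u)"
    by (simp add: D matrix_vector_mul_assoc[symmetric] cM) (simp add: c)
  thus "det_deriv ?A (M ** symp_J) \<noteq> 0" using \<open>k \<noteq> 0\<close> u(1) by simp
  have "det_deriv ?A (symp_J ** (M + mat 1)) = c \<bullet> (symp_J *v u) + c \<bullet> (symp_J *v u)"
    by (simp only: D matrix_vec Mu matrix_vector_mul_lid inner_add_right)
  also have "\<dots> = 2 * (k * (u \<bullet> u))" by (simp add: c)
  finally show "det_deriv ?A (symp_J ** (M + mat 1)) = 2 * det_deriv ?A (M ** symp_J)" using 1 by simp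
qed

section \<open>Counting crossings\<close>

lemma char_det_1: "char_det 1 M = complex_of_real (det (M - mat 1))"
proof -
  have "cmat M - mat 1 = cmat (M - mat 1)" by (simp add: cmat_simps)
  thus ?thesis unfolding char_det_def by (simp add: det_cmat)
qed

lemma symp_sing_1: "M \<in> symp_sing 1 \<longleftrightarrow> M \<in> symp_group \<and> det (M - mat 1) = 0"
  by (simp add: symp_sing_def char_det_1)

text \<open>Since \<open>J\<close> squares to \<open>- I\<close>, the exponential series splits into
  the cosine and the sine series.\<close>

lemma matrix_exp_J:
  "matrix_exp (s *\<^sub>R symp_J) = cos s *\<^sub>R mat 1 + sin s *\<^sub>R (symp_J :: 'n::finite phase_matrix)"
proof -
  let ?J = "symp_J :: 'n phase_matrix"
  have pow: "((**) (s *\<^sub>R ?J) ^^ m) (mat 1) =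
      fact m *\<^sub>R ((cos_coeff m * s ^ m) *\<^sub>R mat 1 + (sin_coeff m * s ^ m) *\<^sub>R ?J)" for m
  proof (induction m)
    case 0 show ?case by (simp add: cos_coeff_def sin_coeff_def)
  next
    case (Suc m)
    have c: "fact (Suc m) * cos_coeff (Suc m) = - (fact m * sin_coeff m)"
      "fact (Suc m) * sin_coeff (Suc m) = fact m * cos_coeff m"
      by (simp_all add: cos_coeff_Suc sin_coeff_Suc field_simps del: of_nat_Suc)
    have "((**) (s *\<^sub>R ?J) ^^ Suc m) (mat 1) =
        (s *\<^sub>R ?J) ** (fact m *\<^sub>R ((cos_coeff m * s ^ m) *\<^sub>R mat 1 + (sin_coeff m * s ^ m) *\<^sub>R ?J))"
      by (simp only: funpow.simps o_apply Suc)
    also have "\<dots> = - (fact m * sin_coeff m * s ^ Suc m) *\<^sub>R mat 1 + (fact m * cos_coeff m * s ^ Suc m) *\<^sub>R ?J"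
      by (simp add: matrix_ring scaleR_add_right mult_ac)
    also have "\<dots> = fact (Suc m) *\<^sub>R ((cos_coeff (Suc m) * s ^ Suc m) *\<^sub>R mat 1 + (sin_coeff (Suc m) * s ^ Suc m) *\<^sub>R ?J)"
      unfolding scaleR_add_right scaleR_scaleR mult.assoc[symmetric] c by simp
    finally show ?case .
  qed
  have "(\<lambda>m. (cos_coeff m * s ^ m) *\<^sub>R mat 1 + (sin_coeff m * s ^ m) *\<^sub>R ?J)
      sums (cos s *\<^sub>R mat 1 + sin s *\<^sub>R ?J)"
    using cos_converges[of s] sin_converges[of s]
    by (intro sums_add sums_scaleR_left) auto
  thus ?thesis unfolding matrix_exp_def pow by (simp add: sums_iff)
qed

lemma det_deriv_cmat:
  "det_deriv (cmat A) (mat k ** cmat B) = k * complex_of_real (det_deriv A B)"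
  for A B :: "real^'k::finite^'k"
  unfolding det_deriv_def by (simp add: mat_mult_nth sum_distrib_left mult_ac)

lemma Im_Ln_imaginary:
  assumes "y \<noteq> 0"
  shows "Im (Ln (complex_of_real y * \<i>)) = sgn y * pi / 2"
proof -
  have "Ln (complex_of_real y * \<i>) = Complex (ln \<bar>y\<bar>) (sgn y * pi / 2)"
  proof (rule Ln_unique)
    show "exp (Complex (ln \<bar>y\<bar>) (sgn y * pi / 2)) = complex_of_real y * \<i>"
      using assms by (cases "y > 0") (auto simp: exp_eq_polar cis.code sgn_if complex_eq_iff)
    show "- pi < Im (Complex (ln \<bar>y\<bar>) (sgn y * pi / 2))" "Im (Complex (ln \<bar>y\<bar>) (sgn y * pi / 2)) \<le> pi"
      by (auto simp: sgn_if)
  qed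
  thus ?thesis by simp
qed

text \<open>Subtracting the jumps accumulated so far makes \<open>f\<close> locally constant on the
  whole interval, hence constant, because the interval is connected.\<close>

lemma sum_of_jumps:
  fixes f j :: "real \<Rightarrow> real"
  assumes "a \<le> b" "finite Z" "Z \<subseteq> {a<..<b}"
    and loc: "\<And>t. t \<in> {a..b} - Z \<Longrightarrow> \<forall>\<^sub>F u in at t within {a..b}. f u = f t"
    and jump: "\<And>z. z \<in> Z \<Longrightarrow> \<exists>e>0. \<forall>s r. 0 < s \<and> s < e \<and> 0 < r \<and> r < e \<longrightarrow> f (z + s) - f (z - r) = j z"
  shows "f b - f a = (\<Sum>z\<in>Z. j z)"
proof -
  have "\<forall>z\<in>Z. \<exists>e>0. \<forall>s r. 0 < s \<and> s < e \<and> 0 < r \<and> r < e \<longrightarrow> f (z + s) - f (z - r) = j z"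
    using jump by blast
  then obtain e where e: "\<And>z. z \<in> Z \<Longrightarrow> e z > 0"
    "\<And>z s r. z \<in> Z \<Longrightarrow> 0 < s \<Longrightarrow> s < e z \<Longrightarrow> 0 < r \<Longrightarrow> r < e z \<Longrightarrow> f (z + s) - f (z - r) = j z"
    by metis
  define S where "S t = (\<Sum>z\<in>{z\<in>Z. z < t}. j z)" for t
  \<comment> \<open>The value of \<open>f\<close> at a jump point is arbitrary and is replaced by a
    value just to its left. The strict inequality in \<open>S\<close> matches this: the jump at
    \<open>t\<close> itself is not yet counted.\<close>
  define g where "g t = (if t \<in> Z then f (t - e t / 2) else f t) - S t" for t
  have isol: "\<exists>d>0. \<forall>z\<in>Z. z \<noteq> t \<longrightarrow> d \<le> dist t z" for t
    using finite_set_avoid[OF assms(2), of t] by metis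
  have "g a = g b"
  proof (rule connected_local_const[of "{a..b}" a b g])
    show "\<forall>t\<in>{a..b}. \<forall>\<^sub>F u in at t within {a..b}. g t = g u"
    proof
      fix t assume t: "t \<in> {a..b}"
      obtain d where d: "d > 0" "\<And>z. z \<in> Z \<Longrightarrow> z \<noteq> t \<Longrightarrow> d \<le> dist t z" using isol[of t] by metis
      show "\<forall>\<^sub>F u in at t within {a..b}. g t = g u"
      proof (cases "t \<in> Z")
        case False
        have "\<forall>\<^sub>F u in at t within {a..b}. dist u t < d" using d(1) eventually_at by blast
        with loc[of t] show ?thesis
        proof (rule eventually_elim2)
          show "t \<in> {a..b} - Z" using t False by simp
          fix u assume u: "f u = f t" "dist u t < d"
          have "u \<notin> Z" using d(2)[of u] False u(2) by (auto simp: dist_commute)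
          have "S u = S t" unfolding S_def
            by (rule arg_cong[where f = "sum j"]) (use d(2) u(2) False in \<open>force simp: dist_real_def\<close>)
          with u(1) False \<open>u \<notin> Z\<close> show "g t = g u" by (simp add: g_def)
        qed
      next
        case True
        have "\<forall>\<^sub>F u in at t within {a..b}. u \<noteq> t \<and> dist u t < min d (e t)"
          using d(1) e(1)[OF True] unfolding eventually_at by (intro exI[of _ "min d (e t)"]) auto
        thus ?thesis
        proof (rule eventually_mono)
          fix u assume u: "u \<noteq> t \<and> dist u t < min d (e t)"
          have uZ: "u \<notin> Z" using d(2)[of u] u by (auto simp: dist_commute)
          have m: "f (t + e t / 2) - f (t - e t / 2) = j t"
            using e(2)[OF True, of "e t / 2" "e t / 2"] e(1)[OF True] by simp
          show "g t = g u"
          proof (cases "u < t")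
            case True
            have "S u = S t" unfolding S_def
              by (rule arg_cong[where f = "sum j"]) (use d(2) u True in \<open>force simp: dist_real_def\<close>)
            moreover have "f (t + e t / 2) - f (t - (t - u)) = j t"
              by (rule e(2)) (use \<open>t \<in> Z\<close> e(1)[OF \<open>t \<in> Z\<close>] u True in \<open>auto simp: dist_real_def\<close>)
            ultimately show ?thesis using m uZ \<open>t \<in> Z\<close> by (simp add: g_def)
          next
            case False
            have "{z \<in> Z. z < u} = insert t {z \<in> Z. z < t}"
              using d(2) u False \<open>t \<in> Z\<close> by (force simp: dist_real_def)
            hence "S u = S t + j t" unfolding S_def using assms(2) by simp
            moreover have "f (t + (u - t)) - f (t - e t / 2) = j t"
              by (rule e(2)) (use \<open>t \<in> Z\<close> e(1)[OF \<open>t \<in> Z\<close>] u False in \<open>auto simp: dist_real_def\<close>)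
            ultimately show ?thesis using m uZ \<open>t \<in> Z\<close> by (simp add: g_def)
          qed
        qed
      qed
    qed
  qed (use assms in auto)
  moreover have "a \<notin> Z" "b \<notin> Z" using assms(3) by auto
  moreover have "S a = 0" unfolding S_def using assms(3) by (intro sum.neutral) auto
  moreover have "S b = sum j Z" unfolding S_def
    by (rule arg_cong[where f = "sum j"]) (use assms(3) in auto)
  ultimately show ?thesis by (simp add: g_def)
qed

lemma continuous_on_cayley_det [continuous_intros]:
  fixes f :: "'b::topological_space \<Rightarrow> 'n::finite phase_matrix"
  assumes "continuous_on S f" "continuous_on S g"
  shows "continuous_on S (\<lambda>x. cayley_det (f x) (g x))"
  unfolding cayley_det_def using assms by (intro continuous_intros)

text \<open>\<open>D\<close> is the speed of \<open>det (M - I)\<close> along the path and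
  \<open>k\<close> its speed in the co-orienting direction \<open>M J\<close>. The same
  \<open>k\<close>, doubled, is the speed in the direction \<open>J (M + I)\<close>, which governs
  \<open>cayley_det\<close> for small \<open>r\<close>; this links the sign of a crossing to the
  argument.\<close>

lemma crossing_derivatives:
  fixes \<xi> :: "real \<Rightarrow> 'n::finite phase_matrix"
  assumes "transverse_path 1 \<xi> a b" "z \<in> {a<..<b}" "\<xi> z \<in> symp_sing 1"
  obtains D k where "((\<lambda>t. det (\<xi> t - mat 1)) has_real_derivative D) (at z)" "D \<noteq> 0" "k \<noteq> 0"
    "det_deriv (\<xi> z - mat 1) (symp_J ** (\<xi> z + mat 1)) = 2 * k"
    "of_int (crossing_sign 1 \<xi> z) = sgn (D * k)"
proof -
  have M: "\<xi> z \<in> symp_group" "det (\<xi> z - mat 1) = 0" using assms(3) by (simp_all add: symp_sing_1)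
  have diff: "\<xi> differentiable (at z)"
    and nz: "vector_derivative (\<lambda>s. char_det 1 (\<xi> s)) (at z) \<noteq> 0"
    using assms by (auto simp: transverse_path_def)
  define X where "X = vector_derivative \<xi> (at z)"
  have "(\<xi> has_vector_derivative X) (at z)"
    using diff unfolding X_def by (simp add: vector_derivative_works)
  hence "((\<lambda>t. \<xi> t - mat 1) has_vector_derivative X) (at z)"
    by (auto intro!: derivative_eq_intros)
  from has_vector_derivative_det[OF this]
  have D: "((\<lambda>t. det (\<xi> t - mat 1)) has_vector_derivative det_deriv (\<xi> z - mat 1) X) (at z)" .
  define D where "D = det_deriv (\<xi> z - mat 1) X"
  have vD: "vector_derivative (\<lambda>s. char_det 1 (\<xi> s)) (at z) = complex_of_real D"
    unfolding char_det_1 D_def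
    by (rule vector_derivative_at) (rule has_vector_derivative_of_real[OF D[folded has_real_derivative_iff_has_vector_derivative]])
  have D0: "D \<noteq> 0" using nz vD by auto
  define k where "k = det_deriv (\<xi> z - mat 1) (\<xi> z ** symp_J)"
  have k: "k \<noteq> 0" "det_deriv (\<xi> z - mat 1) (symp_J ** (\<xi> z + mat 1)) = 2 * k"
    using symp_det_deriv[OF M D0[unfolded D_def]] by (simp_all add: k_def)
  have "((\<lambda>s. \<xi> z ** matrix_exp (s *\<^sub>R symp_J) - mat 1) has_vector_derivative \<xi> z ** symp_J) (at 0)"
    unfolding matrix_exp_J matrix_ring matrix_mul_rid
    by (auto intro!: derivative_eq_intros)
  from has_vector_derivative_det[OF this]
  have "((\<lambda>s. det (\<xi> z ** matrix_exp (s *\<^sub>R symp_J) - mat 1)) has_vector_derivative k) (at 0)"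
    using matrix_exp_J[of 0, where 'n = 'n] by (simp add: k_def)
  hence vk: "vector_derivative (\<lambda>s. char_det 1 (\<xi> z ** matrix_exp (s *\<^sub>R symp_J))) (at 0) = complex_of_real k"
    unfolding char_det_1
    by (intro vector_derivative_at has_vector_derivative_of_real)
       (simp add: has_real_derivative_iff_has_vector_derivative)
  have "of_int (crossing_sign 1 \<xi> z) = sgn (D * k)"
    unfolding crossing_sign_def vD vk using D0 k(1)
    by (auto simp: sgn_if zero_less_mult_iff zero_less_divide_iff simp flip: of_real_divide)
  with D0 k D show ?thesis
    by (intro that[of D k]) (auto simp: D_def has_real_derivative_iff_has_vector_derivative)
qed

lemma simple_zero_sign:
  fixes f :: "real \<Rightarrow> real"
  assumes "(f has_real_derivative D) (at z)" "D \<noteq> 0" "f z = 0"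
  obtains e where "e > 0" "\<And>s. 0 < s \<Longrightarrow> s < e \<Longrightarrow> sgn (f (z + s)) = sgn D \<and> sgn (f (z - s)) = - sgn D"
proof (cases "D > 0")
  case True
  obtain d where "d > 0" "\<And>h. h > 0 \<Longrightarrow> h < d \<Longrightarrow> f z < f (z + h)"
    using DERIV_pos_inc_right[OF assms(1) True] by blast
  moreover obtain d' where "d' > 0" "\<And>h. h > 0 \<Longrightarrow> h < d' \<Longrightarrow> f (z - h) < f z"
    using DERIV_pos_inc_left[OF assms(1) True] by blast
  ultimately show ?thesis using True assms(3) by (intro that[of "min d d'"]) auto
next
  case False
  hence D: "D < 0" using assms(2) by simp
  obtain d where "d > 0" "\<And>h. h > 0 \<Longrightarrow> h < d \<Longrightarrow> f z > f (z + h)"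
    using DERIV_neg_dec_right[OF assms(1) D] by blast
  moreover obtain d' where "d' > 0" "\<And>h. h > 0 \<Longrightarrow> h < d' \<Longrightarrow> f (z - h) > f z"
    using DERIV_neg_dec_left[OF assms(1) D] by blast
  ultimately show ?thesis using D assms(3) by (intro that[of "min d d'"]) auto
qed

text \<open>
  Near a crossing at \<open>t = z\<close> the sign of the imaginary part of \<open>cayley_det\<close> for small \<open>r > 0\<close> is
  constant, so that a branch of its logarithm can be followed around the puncture \<open>(z, 0)\<close>.
\<close>

lemma cayley_det_Im_sign:
  fixes \<xi> :: "real \<Rightarrow> 'n::finite phase_matrix"
  assumes "continuous_on {a..b} \<xi>" "z \<in> {a<..<b}"
    and k: "det_deriv (\<xi> z - mat 1) (symp_J ** (\<xi> z + mat 1)) = 2 * k" "k \<noteq> 0"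
  obtains e where "e > 0" "\<And>t r. \<bar>t - z\<bar> < e \<Longrightarrow> 0 < r \<Longrightarrow> r < e \<Longrightarrow> sgn k * Im (cayley_det (\<xi> t) r) < 0"
proof -
  define A where "A t r = cmat (\<xi> t - mat 1) - mat (\<i> * complex_of_real r) ** cmat (symp_J ** (\<xi> t + mat 1))" for t r
  define B where "B t = mat (- \<i>) ** cmat (symp_J ** (\<xi> t + mat 1))" for t
  define g where "g x = sgn k * Im (det_deriv (A (fst x) (snd x)) (B (fst x)))" for x :: "real \<times> real"
  have A_eq: "A t r = cmat (\<xi> t - mat 1) + r *\<^sub>R B t" for t r
    unfolding A_def B_def vec_eq_iff
    by (auto simp: mat_mult_nth complex_eq_iff simp del: mat_minus nth_map_matrix)
  \<comment> \<open>At the crossing the derivative of \<open>cayley_det\<close> in \<open>r\<close>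
    is \<open>- 2 \<i> k\<close>; the factor \<open>sgn k\<close> makes the sign of its imaginary
    part independent of the sign of \<open>k\<close>.\<close>
  have "g (z, 0) = - 2 * \<bar>k\<bar>"
  proof -
    have "A z 0 = cmat (\<xi> z - mat 1)" by (simp add: A_eq)
    hence "det_deriv (A z 0) (B z) = - \<i> * complex_of_real (2 * k)"
      unfolding B_def k(1)[symmetric] by (simp only: det_deriv_cmat)
    thus ?thesis by (simp add: g_def abs_sgn mult_ac)
  qed
  hence neg: "g (z, 0) < 0" using k(2) by simp
  have "continuous_on ({a<..<b} \<times> UNIV) g"
    unfolding g_def A_def B_def
    by (intro continuous_intros continuous_on_compose2[OF assms(1)]) auto
  hence "isCont g (z, 0)"
    using assms(2) by (simp add: continuous_on_eq_continuous_at open_Times)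
  hence "eventually (\<lambda>x. g x < 0) (at (z, 0))"
    using neg unfolding isCont_def by (metis order_tendstoD(2))
  then obtain e where e: "e > 0" "\<And>x. x \<noteq> (z, 0) \<Longrightarrow> dist x (z, 0) < e \<Longrightarrow> g x < 0"
    unfolding eventually_at by auto
  have der: "((\<lambda>r. Im (cayley_det (\<xi> t) r)) has_real_derivative Im (det_deriv (A t r) (B t))) (at r)" for t r
  proof -
    have "((\<lambda>r. A t r) has_vector_derivative B t) (at r)"
      unfolding A_eq by (auto intro!: derivative_eq_intros)
    from has_vector_derivative_det[OF this]
    have "((\<lambda>r. cayley_det (\<xi> t) r) has_vector_derivative det_deriv (A t r) (B t)) (at r)"
      by (simp add: cayley_det_def A_def)
    thus ?thesis
      using bounded_linear.has_vector_derivative[OF bounded_linear_Im]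
      by (simp add: has_real_derivative_iff_has_vector_derivative)
  qed
  show ?thesis
  proof (rule that[of "e / 2"])
    fix t r assume tr: "\<bar>t - z\<bar> < e / 2" "0 < r" "r < e / 2"
    \<comment> \<open>\<open>cayley_det\<close> is real at \<open>r = 0\<close>, so its imaginary
      part at \<open>r\<close> is \<open>r\<close> times a derivative at an intermediate
      point.\<close>
    obtain s where s: "0 < s" "s < r" "Im (cayley_det (\<xi> t) r) - Im (cayley_det (\<xi> t) 0) =
        (r - 0) * Im (det_deriv (A t s) (B t))"
      using MVT2[of 0 r "\<lambda>r. Im (cayley_det (\<xi> t) r)" "\<lambda>r. Im (det_deriv (A t r) (B t))"] tr(2) der
      by blast
    have "dist (t, s) (z, 0) \<le> \<bar>t - z\<bar> + \<bar>s\<bar>"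
      using norm_Pair_le[of "t - z" s] by (simp add: dist_norm)
    hence "g (t, s) < 0" using tr s by (intro e(2)) auto
    hence "r * g (t, s) < 0" using tr(2) by (simp add: mult_less_0_iff)
    thus "sgn k * Im (cayley_det (\<xi> t) r) < 0"
      using s(3) by (simp add: g_def cayley_det_0 mult_ac)
  qed (use e in simp)
qed

text \<open>For \<open>c = \<i> sgn k\<close> the values \<open>c * cayley_det\<close> have positive
  real part for small \<open>r > 0\<close>; on the lower edge they are purely imaginary and change
  sides at \<open>z\<close>. So \<open>Ln (c * cayley_det)\<close> is a branch around the puncture,
  and its imaginary part jumps between \<open>- pi / 2\<close> and \<open>pi / 2\<close>. Any other
  branch differs from it by a constant.\<close>

lemma cayley_log_jump:
  fixes \<xi> :: "real \<Rightarrow> 'n::finite phase_matrix" and l :: "real \<times> real \<Rightarrow> complex"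
  assumes tr: "transverse_path 1 \<xi> a b" and z: "z \<in> {a<..<b}" "\<xi> z \<in> symp_sing 1"
    and l: "continuous_on {x \<in> {a..b} \<times> {0..1}. cayley_det (\<xi> (fst x)) (snd x) \<noteq> 0} l"
      "\<And>t r. t \<in> {a..b} \<Longrightarrow> r \<in> {0..1} \<Longrightarrow> cayley_det (\<xi> t) r \<noteq> 0 \<Longrightarrow> cayley_det (\<xi> t) r = exp (l (t, r))"
  obtains e where "e > 0" "\<And>s r. 0 < s \<Longrightarrow> s < e \<Longrightarrow> 0 < r \<Longrightarrow> r < e \<Longrightarrow>
    Im (l (z + s, 0)) - Im (l (z - r, 0)) = pi * of_int (crossing_sign 1 \<xi> z)"
proof -
  have cont: "continuous_on {a..b} \<xi>" and grp: "\<And>t. t \<in> {a..b} \<Longrightarrow> \<xi> t \<in> symp_group"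
    using tr by (auto simp: transverse_path_def)
  obtain D k where D: "((\<lambda>t. det (\<xi> t - mat 1)) has_real_derivative D) (at z)" "D \<noteq> 0" "k \<noteq> 0"
    "det_deriv (\<xi> z - mat 1) (symp_J ** (\<xi> z + mat 1)) = 2 * k"
    "of_int (crossing_sign 1 \<xi> z) = sgn (D * k)"
    using crossing_derivatives[OF tr z] by metis
  obtain e1 where e1: "e1 > 0"
    "\<And>s. 0 < s \<Longrightarrow> s < e1 \<Longrightarrow> sgn (det (\<xi> (z + s) - mat 1)) = sgn D \<and> sgn (det (\<xi> (z - s) - mat 1)) = - sgn D"
    using simple_zero_sign[OF D(1,2)] z(2) by (auto simp: symp_sing_1)
  obtain e2 where e2: "e2 > 0"
    "\<And>t r. \<bar>t - z\<bar> < e2 \<Longrightarrow> 0 < r \<Longrightarrow> r < e2 \<Longrightarrow> sgn k * Im (cayley_det (\<xi> t) r) < 0"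
    using cayley_det_Im_sign[OF cont z(1) D(4,3)] by metis
  define e where "e = Min {e1, e2, 1, b - z, z - a}"
  have e: "e > 0" "e \<le> e1" "e \<le> e2" "e \<le> 1" "e \<le> b - z" "e \<le> z - a"
    using e1(1) e2(1) z(1) by (auto simp: e_def)
  define h where "h = e / 2"
  define c where "c = complex_of_real (sgn k) * \<i>"
  define R where "R = {x. \<bar>fst x - z\<bar> < e \<and> 0 \<le> snd x \<and> snd x \<le> h \<and> x \<noteq> (z, 0 :: real)}"
  define q where "q x = cayley_det (\<xi> (fst x)) (snd x)" for x
  have Im_neg: "sgn k * Im (q x) < 0" if "x \<in> R" "snd x \<noteq> 0" for x
    using that e e2(2)[of "fst x" "snd x"] by (auto simp: R_def q_def h_def)
  have det_sgn: "sgn (det (\<xi> t - mat 1)) = sgn D * sgn (t - z)" if "t \<noteq> z" "\<bar>t - z\<bar> < e" for t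
    using e1(2)[of "\<bar>t - z\<bar>"] that e(2) by (cases "t > z") (auto simp: abs_if split: if_splits)
  have q0: "q (t, 0) = complex_of_real (det (\<xi> t - mat 1))" for t by (simp add: q_def cayley_det_0)
  have off: "c * q x \<notin> \<real>\<^sub>\<le>\<^sub>0 \<and> q x \<noteq> 0" if x: "x \<in> R" for x
  proof (cases "snd x = 0")
    case False
    with Im_neg[OF x] show ?thesis by (auto simp: c_def complex_nonpos_Reals_iff)
  next
    case True
    then obtain t where t: "x = (t, 0)" by (metis prod.collapse)
    have "det (\<xi> t - mat 1) \<noteq> 0" using det_sgn[of t] x D(2) unfolding t R_def by (auto simp: sgn_if split: if_splits)
    thus ?thesis unfolding t q0 using D(3) by (simp add: c_def complex_nonpos_Reals_iff sgn_if)
  qed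
  have sub: "R \<subseteq> {x \<in> {a..b} \<times> {0..1}. cayley_det (\<xi> (fst x)) (snd x) \<noteq> 0}"
    using off e by (auto simp: R_def q_def h_def)
  \<comment> \<open>The centre \<open>(z, h)\<close> lies directly above the puncture, and a segment
    from it to a point of \<open>R\<close> does not meet \<open>(z, 0)\<close>.\<close>
  have conn: "connected R"
  proof (rule starlike_imp_connected)
    have "closed_segment (z, h) x \<subseteq> R" if x: "x \<in> R" for x
    proof
      fix y assume "y \<in> closed_segment (z, h) x"
      then obtain u where u: "0 \<le> u" "u \<le> 1" "y = (1 - u) *\<^sub>R (z, h) + u *\<^sub>R x"
        by (auto simp: closed_segment_def)
      have y: "fst y - z = u * (fst x - z)" "snd y = (1 - u) * h + u * snd x"
        unfolding u(3) by (simp_all add: algebra_simps)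
      have h: "h > 0" using e by (simp add: h_def)
      have "\<bar>u * (fst x - z)\<bar> \<le> \<bar>fst x - z\<bar>" using u by (simp add: abs_mult mult_left_le_one_le)
      hence "\<bar>fst y - z\<bar> < e" using x unfolding y by (auto simp: R_def)
      moreover have "0 \<le> snd y" unfolding y using u h x by (auto simp: R_def)
      moreover have "snd y \<le> h"
      proof -
        have "u * snd x \<le> u * h" using u x by (intro mult_left_mono) (auto simp: R_def)
        thus ?thesis unfolding y by (simp add: algebra_simps)
      qed
      moreover have "y \<noteq> (z, 0)"
      proof
        assume "y = (z, 0)"
        hence "(1 - u) * h + u * snd x = 0" "u * (fst x - z) = 0" using y by auto
        moreover have "(1 - u) * h \<ge> 0" "u * snd x \<ge> 0" using u h x by (auto simp: R_def)
        ultimately have "(1 - u) * h = 0" "u * snd x = 0" "u * (fst x - z) = 0" by linarith+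
        hence "u = 1" "snd x = 0" "fst x = z" using h by auto
        thus False using x by (cases x) (auto simp: R_def)
      qed
      ultimately show "y \<in> R" by (simp add: R_def)
    qed
    moreover have "(z, h) \<in> R" using e by (simp add: R_def h_def)
    ultimately show "starlike R" unfolding starlike_def by blast
  qed
  have c0: "c \<noteq> 0" using D(3) by (simp add: c_def sgn_if)
  have "continuous_on R (\<lambda>x. cayley_det (\<xi> (fst x)) (snd x))"
    by (intro continuous_intros continuous_on_compose2[OF cont]) (use sub in auto)
  hence contq: "continuous_on R (\<lambda>x. Ln (c * q x))"
    using off unfolding q_def[symmetric] by (intro continuous_intros) auto
  obtain K where K: "\<And>x. x \<in> R \<Longrightarrow> l x + Ln c = Ln (c * q x) + K"
  proof (rule log_diff_constant[OF conn _ contq, of "\<lambda>x. l x + Ln c"])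
    show "continuous_on R (\<lambda>x. l x + Ln c)"
      by (intro continuous_intros continuous_on_subset[OF l(1) sub])
    fix x assume x: "x \<in> R"
    hence "x \<in> {x \<in> {a..b} \<times> {0..1}. cayley_det (\<xi> (fst x)) (snd x) \<noteq> 0}" using sub by blast
    hence "exp (l x) = q x" using l(2)[of "fst x" "snd x"] by (auto simp: q_def)
    thus "exp (l x + Ln c) = exp (Ln (c * q x))" using c0 off[OF x] by (simp add: exp_add)
  qed (use that in blast)
  have val: "Im (Ln (c * q (t, 0))) = sgn k * sgn D * sgn (t - z) * pi / 2" if "t \<noteq> z" "\<bar>t - z\<bar> < e" for t
  proof -
    have a1: "c * q (t, 0) = complex_of_real (sgn k * det (\<xi> t - mat 1)) * \<i>"
      by (simp add: c_def q0)
    have a2: "sgn (sgn k * det (\<xi> t - mat 1)) = sgn k * (sgn D * sgn (t - z))"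
      by (simp add: sgn_mult det_sgn[OF that])
    have "sgn k * det (\<xi> t - mat 1) \<noteq> 0"
      using a2 D that by (auto simp: sgn_if split: if_splits)
    from Im_Ln_imaginary[OF this] show ?thesis unfolding a1 a2 by (simp only: mult.assoc)
  qed
  show ?thesis
  proof (rule that[OF e(1)])
    fix s r assume sr: "0 < s" "s < e" "0 < r" "r < e"
    have "(z + s, 0) \<in> R" "(z - r, 0) \<in> R" using sr e by (auto simp: R_def h_def)
    from this[THEN K] have "l (z + s, 0) - l (z - r, 0) = Ln (c * q (z + s, 0)) - Ln (c * q (z - r, 0))"
      by (metis (no_types) add_diff_cancel_right)
    hence "Im (l (z + s, 0)) - Im (l (z - r, 0)) = Im (Ln (c * q (z + s, 0))) - Im (Ln (c * q (z - r, 0)))"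
      by (metis minus_complex.simps(2))
    also have "\<dots> = pi * (sgn k * sgn D)"
      using val[of "z + s"] val[of "z - r"] sr by (simp add: field_simps)
    finally show "Im (l (z + s, 0)) - Im (l (z - r, 0)) = pi * of_int (crossing_sign 1 \<xi> z)"
      by (simp add: D(5) sgn_mult)
  qed
qed

text \<open>Meaningful for symplectic \<open>M\<close> off the hypersurface, where
  \<open>cayley_det M\<close> has no zero on \<open>[0, 1]\<close>. It is the correction at an end
  point between the rotation at \<open>r = 1\<close> and the crossings counted at
  \<open>r = 0\<close>.\<close>

definition boundary_angle :: "'n::finite phase_matrix \<Rightarrow> real" where
  "boundary_angle M = arg_change (cayley_det M) 0 1"

lemma boundary_angle_bound:
  fixes M :: "'n::finite phase_matrix"
  assumes "M \<in> symp_group" "M \<notin> symp_sing 1"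
  shows "\<bar>boundary_angle M\<bar> \<le> pi * CARD('n + 'n)"
proof -
  define X where "X = - (mat \<i> ** cmat (symp_J ** (M + mat 1)))"
  have e: "cayley_det M r = det (\<chi> i j. cmat (M - mat 1) $ i $ j + complex_of_real r * X $ i $ j)" for r
    unfolding cayley_det_def X_def
    by (rule arg_cong[where f = det]) (simp add: vec_eq_iff mat_mult_nth)
  have nz: "cayley_det M r \<noteq> 0" for r
    using assms cayley_det_nonzero[of M r] by (cases "r = 0") (auto simp: cayley_det_0 symp_sing_1)
  have "boundary_angle M =
      arg_change (\<lambda>r. det (\<chi> i j. cmat (M - mat 1) $ i $ j + complex_of_real r * X $ i $ j)) 0 1"
    unfolding boundary_angle_def by (rule arg_change_cong) (rule e)
  moreover have "det (\<chi> i j. cmat (M - mat 1) $ i $ j + complex_of_real r * X $ i $ j) \<noteq> 0" for r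
    using nz[of r] unfolding e .
  ultimately show ?thesis
    using arg_change_det_affine[of "cmat (M - mat 1)" X] by simp
qed

text \<open>A crossing is a simple zero of \<open>det (M - I)\<close> along the path, hence
  isolated, and the interval is compact. This makes \<open>crossing_count\<close> a genuine sum, a
  sum over an infinite set being 0 by convention.\<close>

lemma finite_crossings:
  fixes \<xi> :: "real \<Rightarrow> 'n::finite phase_matrix"
  assumes "transverse_path 1 \<xi> a b"
  shows "finite {t \<in> {a<..<b}. \<xi> t \<in> symp_sing 1}"
proof -
  let ?Z = "{t \<in> {a<..<b}. \<xi> t \<in> symp_sing 1}"
  have cont: "continuous_on {a..b} \<xi>" and grp: "\<And>t. t \<in> {a..b} \<Longrightarrow> \<xi> t \<in> symp_group"
    and ends: "\<xi> a \<notin> symp_sing 1" "\<xi> b \<notin> symp_sing 1"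
    using assms by (auto simp: transverse_path_def)
  have contf: "continuous_on {a..b} (\<lambda>t. det (\<xi> t - mat 1))" by (intro continuous_intros cont)
  have "finite ({a..b} \<inter> ?Z)"
  proof (rule finite_not_islimpt_in_compact)
    fix t assume t: "t \<in> {a..b}"
    show "\<not> t islimpt ?Z"
    proof (cases "\<xi> t \<in> symp_sing 1")
      case True
      hence t': "t \<in> {a<..<b}" using t ends by (metis atLeastAtMost_iff greaterThanLessThan_iff order_le_less)
      obtain D k where D: "((\<lambda>t. det (\<xi> t - mat 1)) has_real_derivative D) (at t)" "D \<noteq> 0"
        using crossing_derivatives[OF assms t' True] by metis
      obtain e where e: "e > 0" "\<And>s. 0 < s \<Longrightarrow> s < e \<Longrightarrow>
          sgn (det (\<xi> (t + s) - mat 1)) = sgn D \<and> sgn (det (\<xi> (t - s) - mat 1)) = - sgn D"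
        using simple_zero_sign[OF D] True by (auto simp: symp_sing_1)
      have "u \<notin> ?Z" if "u \<noteq> t" "dist u t < e" for u
        using e(2)[of "\<bar>u - t\<bar>"] that D(2)
        by (cases "u > t") (auto simp: symp_sing_1 dist_real_def sgn_if split: if_splits)
      thus ?thesis using e(1) by (auto simp: islimpt_approachable)
    next
      case False
      hence "det (\<xi> t - mat 1) \<noteq> 0" using grp[OF t] by (simp add: symp_sing_1)
      then obtain d where d: "d > 0" "\<And>u. u \<in> {a..b} \<Longrightarrow> dist u t < d \<Longrightarrow> det (\<xi> u - mat 1) \<noteq> 0"
        using contf t continuous_on_avoid[of "{a..b}" "\<lambda>t. det (\<xi> t - mat 1)" t 0]
        by (metis dist_commute)
      have "u \<notin> ?Z" if "dist u t < d" for u using d(2)[of u] that by (auto simp: symp_sing_1)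
      thus ?thesis using d(1) by (auto simp: islimpt_approachable)
    qed
  qed simp
  moreover have "{a..b} \<inter> ?Z = ?Z" by auto
  ultimately show ?thesis by simp
qed

text \<open>
  Follow a branch \<open>l\<close> of \<open>ln (cayley_det (\<xi> t) r)\<close> on the rectangle \<open>{a..b} \<times> {0..1}\<close>, which is
  punctured only at the crossings on its lower edge.  On this edge \<open>cayley_det\<close> is real, so that
  \<open>Im l\<close> changes there only by jumps of \<open>\<plusminus> \<pi>\<close> at the crossings.
\<close>

lemma crossing_count_formula:
  fixes \<xi> :: "real \<Rightarrow> 'n::finite phase_matrix"
  assumes ab: "a < b" and tr: "transverse_path 1 \<xi> a b"
  shows "pi * of_int (crossing_count 1 \<xi> a b) =
    arg_change (\<lambda>t. cayley_det (\<xi> t) 1) a b - (boundary_angle (\<xi> b) - boundary_angle (\<xi> a))"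
proof -
  have cont: "continuous_on {a..b} \<xi>" and grp: "\<And>t. t \<in> {a..b} \<Longrightarrow> \<xi> t \<in> symp_group"
    and ends: "\<xi> a \<notin> symp_sing 1" "\<xi> b \<notin> symp_sing 1"
    using tr by (auto simp: transverse_path_def)
  let ?q = "\<lambda>x. cayley_det (\<xi> (fst x)) (snd x)"
  define Z where "Z = {t \<in> {a<..<b}. \<xi> t \<in> symp_sing 1}"
  define S where "S = {x \<in> {a..b} \<times> {0..1}. ?q x \<noteq> 0}"
  have finZ: "finite Z" using finite_crossings[OF tr] by (simp add: Z_def)
  have inS: "(t, r) \<in> S" if "t \<in> {a..b}" "0 < r" "r \<le> 1" for t r
    using that cayley_det_nonzero[OF grp] by (auto simp: S_def)
  have inS0: "(t, 0) \<in> S" if "t \<in> {a..b}" "t \<notin> Z" for t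
  proof -
    have "\<xi> t \<notin> symp_sing 1"
      using that ends unfolding Z_def by (metis (mono_tags, lifting) atLeastAtMost_iff greaterThanLessThan_iff mem_Collect_eq order_le_less)
    thus ?thesis using that grp by (auto simp: S_def symp_sing_1 cayley_det_0)
  qed
  \<comment> \<open>The punctures lie on the lower edge only, so a segment from the upper corner
    \<open>(a, 1)\<close> can meet one at most in its end point. Hence \<open>S\<close> is
    contractible and carries a single logarithm.\<close>
  have star: "starlike S"
  proof -
    have "closed_segment (a, 1) x \<subseteq> S" if x: "x \<in> S" for x
    proof
      fix y assume y: "y \<in> closed_segment (a, 1) x"
      have conv: "convex ({a..b} \<times> {0..1::real})" by (intro convex_Times) auto
      have yR: "y \<in> {a..b} \<times> {0..1}"
        using closed_segment_subset[OF _ _ conv, of "(a, 1)" x] y x ab by (auto simp: S_def)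
      obtain u where u: "0 \<le> u" "u \<le> 1" "y = (1 - u) *\<^sub>R (a, 1) + u *\<^sub>R x"
        using y by (auto simp: closed_segment_def)
      have sy: "snd y = (1 - u) + u * snd x" unfolding u(3) by simp
      show "y \<in> S"
      proof (cases "u = 1")
        case True
        hence "y = x" unfolding u(3) by (simp add: prod_eq_iff)
        thus ?thesis using x by simp
      next
        case False
        moreover have "0 \<le> u * snd x" using u x by (auto simp: S_def)
        ultimately have "0 < snd y" using u sy by linarith
        thus ?thesis using inS[of "fst y" "snd y"] yR by auto
      qed
    qed
    thus ?thesis using inS[of a 1] ab unfolding starlike_def by force
  qed
  have contq: "continuous_on S ?q"
    by (intro continuous_intros continuous_on_compose2[OF cont]) (auto simp: S_def)
  obtain l where l: "continuous_on S l" "\<And>x. x \<in> S \<Longrightarrow> ?q x = exp (l x)"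
  proof (rule continuous_logarithm_on_contractible[OF contq starlike_imp_contractible[OF star]])
    fix x assume "x \<in> S" thus "?q x \<noteq> 0" by (simp add: S_def)
  qed (use that in blast)
  have jump: "\<exists>e>0. \<forall>s r. 0 < s \<and> s < e \<and> 0 < r \<and> r < e \<longrightarrow>
      Im (l (z + s, 0)) - Im (l (z - r, 0)) = pi * of_int (crossing_sign 1 \<xi> z)" if z: "z \<in> Z" for z
  proof -
    have l': "cayley_det (\<xi> t) r = exp (l (t, r))"
      if "t \<in> {a..b}" "r \<in> {0..1}" "cayley_det (\<xi> t) r \<noteq> 0" for t r
      using l(2)[of "(t, r)"] that by (simp add: S_def)
    show ?thesis
      using cayley_log_jump[OF tr _ _ l(1)[unfolded S_def] l', of z] z unfolding Z_def by (metis (mono_tags, lifting) mem_Collect_eq)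
  qed
  have edge: "continuous_on ({a..b} - Z) (\<lambda>t. Im (l (t, 0)))"
    by (intro continuous_intros continuous_on_compose2[OF l(1)]) (use inS0 in auto)
  have locc: "\<forall>\<^sub>F u in at t within {a..b}. Im (l (u, 0)) = Im (l (t, 0))" if t: "t \<in> {a..b} - Z" for t
  proof -
    have sin0: "sin (Im (l (u, 0))) = 0" if u: "u \<in> {a..b} - Z" for u
    proof -
      have "exp (l (u, 0)) = complex_of_real (det (\<xi> u - mat 1))"
        using l(2)[OF inS0[of u]] u by (simp add: cayley_det_0)
      hence "Im (exp (l (u, 0))) = 0" by simp
      thus ?thesis by (simp add: Im_exp)
    qed
    obtain d where d: "d > 0" "\<And>u. u \<in> {a..b} - Z \<Longrightarrow> dist u t < d \<Longrightarrow> dist (Im (l (u, 0))) (Im (l (t, 0))) < pi"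
      using edge t pi_gt_zero unfolding continuous_on_iff by metis
    obtain d' where d': "d' > 0" "\<And>z. z \<in> Z \<Longrightarrow> z \<noteq> t \<Longrightarrow> d' \<le> dist t z"
      using finite_set_avoid[OF finZ, of t] by metis
    have "Im (l (u, 0)) = Im (l (t, 0))" if u: "u \<in> {a..b}" "u \<noteq> t" "dist u t < min d d'" for u
    proof -
      have uZ: "u \<in> {a..b} - Z" using u d'(2)[of u] by (auto simp: dist_commute)
      obtain m n :: int where "Im (l (u, 0)) = m * pi" "Im (l (t, 0)) = n * pi"
        using sin0[OF uZ] sin0[OF t] unfolding sin_zero_iff_int2 by blast
      moreover from this have "\<bar>of_int (m - n) * pi\<bar> < pi"
        using d(2)[OF uZ] u by (simp add: dist_real_def left_diff_distrib)
      hence "\<bar>real_of_int (m - n)\<bar> < 1" by (simp add: abs_mult)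
      hence "m = n" by linarith
      ultimately show ?thesis by simp
    qed
    thus ?thesis unfolding eventually_at using d(1) d'(1) by (intro exI[of _ "min d d'"]) auto
  qed
  have "Im (l (b, 0)) - Im (l (a, 0)) = (\<Sum>z\<in>Z. pi * of_int (crossing_sign 1 \<xi> z))"
    by (rule sum_of_jumps[where f = "\<lambda>t. Im (l (t, 0))"])
       (use ab finZ jump locc in \<open>auto simp: Z_def\<close>)
  also have "\<dots> = pi * of_int (crossing_count 1 \<xi> a b)"
    unfolding crossing_count_def Z_def by (simp add: sum_distrib_left)
  finally have bottom: "Im (l (b, 0)) - Im (l (a, 0)) = pi * of_int (crossing_count 1 \<xi> a b)" .
  have side: "boundary_angle (\<xi> t) = Im (l (t, 1)) - Im (l (t, 0))" if t: "t \<in> {a..b}" "t \<notin> Z" for t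
  proof -
    have sub: "(t, r) \<in> S" if "r \<in> {0..1}" for r
      using inS[OF t(1), of r] inS0[OF t] that by (cases "r = 0") auto
    have "arg_change (\<lambda>r. cayley_det (\<xi> t) r) 0 1 = Im (l (t, 1)) - Im (l (t, 0))"
      by (rule arg_change_eq[where l = "\<lambda>r. l (t, r)"])
         (use sub in \<open>auto intro!: continuous_on_compose2[OF l(1)] continuous_intros l(2)[of "(t, _)", simplified]\<close>)
    thus ?thesis by (simp add: boundary_angle_def)
  qed
  have top: "arg_change (\<lambda>t. cayley_det (\<xi> t) 1) a b = Im (l (b, 1)) - Im (l (a, 1))"
    by (rule arg_change_eq[where l = "\<lambda>t. l (t, 1)"])
       (use ab inS l(2)[of "(_, 1)"] in \<open>auto intro!: continuous_on_compose2[OF l(1)] continuous_intros\<close>)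
  show ?thesis using bottom side[of a] side[of b] top ab by (simp add: Z_def)
qed

text \<open>At \<open>r = 1\<close> the determinant vanishes nowhere on the symplectic group, so the
  homotopy is free to cross the hypersurface. The end points are fixed and contribute
  nothing.\<close>

lemma arg_change_homotopic:
  fixes \<eta> \<xi> :: "real \<Rightarrow> 'n::finite phase_matrix"
  assumes ab: "a \<le> b"
    and hom: "homotopic_with_canon (\<lambda>h. h a = \<eta> a \<and> h b = \<eta> b) {a..b} symp_group \<eta> \<xi>"
  shows "arg_change (\<lambda>t. cayley_det (\<eta> t) 1) a b = arg_change (\<lambda>t. cayley_det (\<xi> t) 1) a b"
proof -
  obtain h :: "real \<times> real \<Rightarrow> 'n phase_matrix"
    where hc: "continuous_on ({0..1} \<times> {a..b}) h" "h ` ({0..1} \<times> {a..b}) \<subseteq> symp_group"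
      and h: "\<And>t. h (0, t) = \<eta> t" "\<And>t. h (1, t) = \<xi> t"
        "\<And>s. s \<in> {0..1} \<Longrightarrow> h (s, a) = \<eta> a \<and> h (s, b) = \<eta> b"
    using hom unfolding homotopic_with_def by (auto simp flip: image_subset_iff_funcset)
  have const: "arg_change (\<lambda>s. cayley_det (h (s, t)) 1) 0 1 = 0" if t: "t = a \<or> t = b" for t
  proof -
    have "arg_change (\<lambda>s. cayley_det (h (s, t)) 1) 0 1 = arg_change (\<lambda>s. cayley_det (h (0, t)) 1) 0 1"
      by (rule arg_change_cong) (use h(3)[of 0] h(3) t in auto)
    also have "\<dots> = 0"
      by (rule arg_change_const) (use hc(2) t ab cayley_det_nonzero in force)+
    finally show ?thesis .
  qed
  have "arg_change (\<lambda>s. cayley_det (h (s, a)) 1) 0 1 + arg_change (\<lambda>t. cayley_det (h (1, t)) 1) a b =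
        arg_change (\<lambda>t. cayley_det (h (0, t)) 1) a b + arg_change (\<lambda>s. cayley_det (h (s, b)) 1) 0 1"
    by (rule arg_change_rectangle[where F = "\<lambda>x. cayley_det (h x) 1"])
       (use ab hc(2) cayley_det_nonzero in \<open>force intro!: continuous_intros hc(1)\<close>)+
  thus ?thesis using const[of a] const[of b] h(1,2) by simp
qed

section \<open>Transvections\<close>

lemma norm_vector_matrix_mult: "norm (x v* B) \<le> norm x * norm B" for B :: "real^'l::finite^'k::finite"
proof -
  have "x v* B = (\<Sum>i\<in>UNIV. x $ i *\<^sub>R B $ i)"
    by (simp add: vec_eq_iff vector_matrix_mult_def mult.commute)
  also have "norm \<dots> \<le> (\<Sum>i\<in>UNIV. \<bar>x $ i\<bar> * norm (B $ i))"
    by (rule sum_norm_le) simp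
  also have "\<dots> = (\<Sum>i\<in>UNIV. \<bar>x $ i\<bar> * \<bar>norm (B $ i)\<bar>)" by simp
  also have "\<dots> \<le> L2_set (\<lambda>i. x $ i) UNIV * L2_set (\<lambda>i. norm (B $ i)) UNIV"
    by (rule L2_set_mult_ineq)
  also have "L2_set (\<lambda>i. x $ i) UNIV = norm x" by (simp add: norm_vec_def L2_set_def)
  finally show ?thesis by (simp add: norm_vec_def)
qed

lemma norm_matrix_mult: "norm (A ** B) \<le> norm A * norm B"
  for A :: "real^'k::finite^'m::finite" and B :: "real^'l::finite^'k"
proof -
  have row: "(A ** B) $ i = A $ i v* B" for i
    by (simp add: vec_eq_iff matrix_matrix_mult_def vector_matrix_mult_def mult.commute)
  have "norm (A ** B) = L2_set (\<lambda>i. norm (A $ i v* B)) UNIV"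
    by (simp only: norm_vec_def[of "A ** B"] row)
  also have "\<dots> \<le> L2_set (\<lambda>i. norm (A $ i) * norm B) UNIV"
    by (rule L2_set_mono) (simp_all add: norm_vector_matrix_mult)
  also have "\<dots> = norm A * norm B"
    by (simp add: norm_vec_def L2_set_left_distrib)
  finally show ?thesis .
qed

lemma norm_transpose: "norm (transpose A) = norm A" for A :: "real^'k::finite^'m::finite"
proof -
  have "(\<Sum>i\<in>UNIV. \<Sum>j\<in>UNIV. (A $ j $ i)\<^sup>2) = (\<Sum>i\<in>UNIV. \<Sum>j\<in>UNIV. (A $ i $ j)\<^sup>2)"
    by (rule sum.swap)
  thus ?thesis
    by (simp add: norm_vec_def L2_set_def transpose_def real_sqrt_pow2 sum_nonneg)
qed

lemma norm_matrix_vector_mult: "norm (A *v x) \<le> norm A * norm x" for A :: "real^'k::finite^'m::finite"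
  using norm_vector_matrix_mult[of x "transpose A"] by (simp add: norm_transpose mult.commute)

text \<open>The norm is the Euclidean norm of the entries, under which the identity has norm greater
  than 1 in higher dimensions; this is why \<open>norm (mat 1)\<close> appears as a factor in the
  estimates.\<close>

lemma norm_mat_1_ge: "norm (mat 1 :: real^'k::finite^'k) \<ge> 1"
proof -
  have "norm ((mat 1 :: real^'k^'k) $ undefined $ undefined) \<le> norm (mat 1 :: real^'k^'k)"
    by (metis Finite_Cartesian_Product.norm_nth_le order.trans)
  thus ?thesis by (simp add: mat_def)
qed

section \<open>Symplectic transvections\<close>

lemma symp_groupI:
  fixes M :: "'n::finite phase_matrix"
  assumes "\<And>x y. (M *v x) \<bullet> (symp_J *v (M *v y)) = x \<bullet> (symp_J *v y)"
  shows "M \<in> symp_group"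
proof -
  have "x \<bullet> ((transpose M ** symp_J ** M) *v y - symp_J *v y) = 0" for x y
    using assms[of x y] by (simp add: inner_matrix_left[of M] inner_diff_right matrix_vector_mul_assoc matrix_mul_assoc
        del: transpose_matrix_vector)
  hence "(transpose M ** symp_J ** M) *v y - symp_J *v y = 0" for y using inner_eq_zero_iff by blast
  thus ?thesis unfolding symp_group_iff matrix_eq by simp
qed

lemma symp_inv_mult: "symp_inv (A ** B) = symp_inv B ** symp_inv A"
proof -
  have "symp_inv B ** symp_inv A = (symp_J ** transpose B) ** (symp_J ** (symp_J ** (transpose A ** symp_J)))"
    by (simp only: symp_inv_def matrix_ring minus_minus)
  also have "\<dots> = - ((symp_J ** transpose B) ** (transpose A ** symp_J))"
    by (simp only: symp_J_assoc matrix_mult_minus_right)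
  also have "\<dots> = symp_inv (A ** B)"
    by (simp only: symp_inv_def matrix_transpose_mul matrix_mul_assoc)
  finally show ?thesis by simp
qed

text \<open>The exponential of \<open>c J v v^T\<close>, a matrix whose square is zero because
  \<open>v\<close> is orthogonal to \<open>J v\<close>.\<close>

definition transvection :: "'n::finite phase \<Rightarrow> real \<Rightarrow> 'n phase_matrix" where
  "transvection v c = mat 1 + c *\<^sub>R outer (symp_J *v v) v"

lemma transvection_symp: "transvection v c \<in> symp_group"
proof (rule symp_groupI)
  fix x y
  have e: "transvection v c *v x = x + (c * (v \<bullet> x)) *\<^sub>R (symp_J *v v)" for x
    by (simp add: transvection_def matrix_vec outer_vec)
  show "(transvection v c *v x) \<bullet> (symp_J *v (transvection v c *v y)) = x \<bullet> (symp_J *v y)"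
    unfolding e
    by (simp add: matrix_vec inner_add_left inner_add_right inner_diff_right inner_J_left[of v])
       (simp add: inner_commute)
qed

text \<open>An invertible \<open>E\<close> sends \<open>v\<close> to a multiple of a coordinate
  vector. In \<open>E\<close> times the transposed matrix the perturbation then sits in a single
  row, and the determinant is linear in that row.\<close>

lemma det_rank_one_affine:
  fixes A :: "real^'k::finite^'k"
  obtains p q where "\<And>c. det (A + c *\<^sub>R outer w v) = p + c * q"
proof (cases "v = 0")
  case True
  hence "det (A + c *\<^sub>R outer w v) = det A + c * 0" for c
    by (simp add: outer_def vec_eq_iff[symmetric] zero_vec_def[symmetric])
  thus ?thesis using that by blast
next
  case False
  then obtain k where k: "v $ k \<noteq> 0" by (auto simp: vec_eq_iff)
  define E where "E = mat 1 - (1 / v $ k) *\<^sub>R outer (v - v $ k *\<^sub>R axis k 1) (axis k 1)"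
  have Ex: "E *v x = x - (x $ k / v $ k) *\<^sub>R (v - v $ k *\<^sub>R axis k 1)" for x
    by (simp add: E_def matrix_vec outer_vec inner_axis' )
  have Ev: "E *v v = v $ k *\<^sub>R axis k 1" using k by (simp add: Ex)
  have detE: "det E \<noteq> 0"
  proof
    assume "det E = 0"
    then obtain x where x: "x \<noteq> 0" "E *v x = 0" using det_zero_iff_kernel by blast
    hence eq: "x = (x $ k / v $ k) *\<^sub>R (v - v $ k *\<^sub>R axis k 1)" by (simp add: Ex)
    from arg_cong[OF eq, of "\<lambda>x. x $ k"] have "x $ k = 0" by simp
    with eq x(1) show False by simp
  qed
  define B where "B = E ** transpose A"
  have "det E * det (A + c *\<^sub>R outer w v) = det B + c * det (\<chi> i. if i = k then v $ k *\<^sub>R w else B $ i)" for c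
  proof -
    have "det E * det (A + c *\<^sub>R outer w v) = det (E ** transpose (A + c *\<^sub>R outer w v))"
      by (simp add: det_mul)
    also have "E ** transpose (A + c *\<^sub>R outer w v) = B + c *\<^sub>R outer (E *v v) w"
    proof -
      have "transpose (A + c *\<^sub>R outer w v) = transpose A + c *\<^sub>R outer v w"
        by (simp add: transpose_def outer_def vec_eq_iff mult.commute)
      thus ?thesis by (simp add: B_def matrix_ring mult_outer)
    qed
    also have "B + c *\<^sub>R outer (E *v v) w = (\<chi> i. if i = k then B $ i + c *s (v $ k *\<^sub>R w) else B $ i)"
      unfolding Ev by (auto simp: vec_eq_iff outer_def axis_def)
    also have "det \<dots> = det (\<chi> i. if i = k then B $ i else B $ i) + det (\<chi> i. if i = k then c *s (v $ k *\<^sub>R w) else B $ i)"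
      by (rule det_row_add)
    also have "(\<chi> i. if i = k then B $ i else B $ i) = B" by (simp add: vec_eq_iff)
    also have "det (\<chi> i. if i = k then c *s (v $ k *\<^sub>R w) else B $ i) = c * det (\<chi> i. if i = k then v $ k *\<^sub>R w else B $ i)"
      by (rule det_row_mul)
    finally show ?thesis .
  qed
  hence "det (A + c *\<^sub>R outer w v) = det B / det E + c * (det (\<chi> i. if i = k then v $ k *\<^sub>R w else B $ i) / det E)" for c
    using detE by (simp add: field_simps)
  thus ?thesis using that by blast
qed

lemma det_transvection_affine:
  fixes M :: "'n::finite phase_matrix"
  obtains q where "\<And>c. det (M ** transvection v c - mat 1) = det (M - mat 1) + c * q"
proof -
  obtain p q where pq: "\<And>c. det ((M - mat 1) + c *\<^sub>R outer (M *v (symp_J *v v)) v) = p + c * q"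
    using det_rank_one_affine by blast
  have e: "M ** transvection v c - mat 1 = (M - mat 1) + c *\<^sub>R outer (M *v (symp_J *v v)) v" for c
    by (simp add: transvection_def matrix_ring mult_outer)
  have "p = det (M - mat 1)" using pq[of 0] by simp
  with pq that show ?thesis unfolding e by metis
qed

section \<open>Joining transverse paths\<close>

lemma regular_crossing_cong:
  fixes f g :: "real \<Rightarrow> 'n::finite phase_matrix"
  assumes "open U" "t \<in> U" "\<And>s. s \<in> U \<Longrightarrow> f s = g s"
    and "f differentiable (at t) \<and> vector_derivative (\<lambda>s. char_det w (f s)) (at t) \<noteq> 0"
  shows "g differentiable (at t) \<and> vector_derivative (\<lambda>s. char_det w (g s)) (at t) \<noteq> 0"
proof -
  have "eventually (\<lambda>s. s \<in> U) (nhds t)" using assms(1,2) by (rule eventually_nhds_in_open)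
  hence "eventually (\<lambda>s. s \<in> UNIV \<longrightarrow> char_det w (f s) = char_det w (g s)) (nhds t)"
    by (rule eventually_mono) (simp add: assms(3))
  hence "vector_derivative (\<lambda>s. char_det w (f s)) (at t) = vector_derivative (\<lambda>s. char_det w (g s)) (at t)"
    by (intro vector_derivative_cong_eq) auto
  moreover obtain f' where "(f has_derivative f') (at t)" using assms(4) unfolding differentiable_def by blast
  hence "(g has_derivative f') (at t)"
    by (rule has_derivative_transform_within_open) (use assms(1-3) in auto)
  ultimately show ?thesis using assms(4) unfolding differentiable_def by auto
qed

text \<open>The junction lies off the hypersurface, so a corner there does no harm; elsewhere the
  joined path locally coincides with one of the two.\<close>

lemma transverse_path_join:
  fixes \<xi> \<zeta> :: "real \<Rightarrow> 'n::finite phase_matrix"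
  assumes "transverse_path w \<xi> a m" "transverse_path w \<zeta> m b" "\<xi> m = \<zeta> m" "a \<le> m" "m \<le> b"
  shows "transverse_path w (\<lambda>t. if t \<le> m then \<xi> t else \<zeta> t) a b" (is "transverse_path w ?j a b")
  unfolding transverse_path_def
proof (intro conjI ballI impI)
  have h: "continuous_on {a..m} \<xi>" "continuous_on {m..b} \<zeta>"
    "\<xi> ` {a..m} \<subseteq> symp_group" "\<zeta> ` {m..b} \<subseteq> symp_group"
    "\<xi> a \<notin> symp_sing w" "\<xi> m \<notin> symp_sing w" "\<zeta> b \<notin> symp_sing w"
    using assms(1,2) unfolding transverse_path_def by blast+
  have "continuous_on ({a..m} \<union> {m..b}) ?j"
    by (rule continuous_on_cases) (use h(1,2) assms(3) in \<open>auto simp: not_le\<close>)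
  moreover have "{a..m} \<union> {m..b} = {a..b}" using assms(4,5) by auto
  ultimately show "continuous_on {a..b} ?j" by simp
  show "?j ` {a..b} \<subseteq> symp_group" using h(3,4) by (auto simp: image_subset_iff)
  show "?j a \<notin> symp_sing w" using h(5) assms(4) by simp
  show "?j b \<notin> symp_sing w" using h(6,7) assms(3,5) by (cases "b = m") auto
  fix t assume t: "t \<in> {a<..<b}" "?j t \<in> symp_sing w"
  have "t \<noteq> m"
  proof
    assume "t = m"
    with t(2) have "\<xi> m \<in> symp_sing w" by simp
    with h(6) show False by contradiction
  qed
  then consider "t \<in> {a<..<m}" | "t \<in> {m<..<b}" using t(1) by fastforce
  hence "?j differentiable (at t) \<and> vector_derivative (\<lambda>s. char_det w (?j s)) (at t) \<noteq> 0"
  proof cases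
    case 1
    hence r: "\<xi> differentiable (at t) \<and> vector_derivative (\<lambda>s. char_det w (\<xi> s)) (at t) \<noteq> 0"
      using assms(1) t(2) by (simp add: transverse_path_def)
    show ?thesis by (rule regular_crossing_cong[of "{a<..<m}", OF _ 1 _ r]) simp_all
  next
    case 2
    hence r: "\<zeta> differentiable (at t) \<and> vector_derivative (\<lambda>s. char_det w (\<zeta> s)) (at t) \<noteq> 0"
      using assms(2) t(2) by (simp add: transverse_path_def)
    show ?thesis by (rule regular_crossing_cong[of "{m<..<b}", OF _ 2 _ r]) simp_all
  qed
  thus "?j differentiable at t" "vector_derivative (\<lambda>s. char_det w (?j s)) (at t) \<noteq> 0" by auto
qed

section \<open>Polygons of transvections\<close>

definition transvection_prod :: "'n::finite phase list \<Rightarrow> real list \<Rightarrow> 'n phase_matrix" where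
  "transvection_prod vs cs = foldr (\<lambda>(v, c) M. transvection v c ** M) (zip vs cs) (mat 1)"

lemma transvection_prod_simps [simp]:
  "transvection_prod [] cs = mat 1"
  "transvection_prod (v # vs) (c # cs) = transvection v c ** transvection_prod vs cs"
  by (simp_all add: transvection_prod_def)

lemma transvection_prod_symp: "transvection_prod vs cs \<in> symp_group"
proof (induction vs arbitrary: cs)
  case (Cons v vs)
  thus ?case
    by (cases cs) (auto intro: symp_group_mult transvection_symp, simp add: transvection_prod_def)
qed simp

lemma transvection_0 [simp]: "transvection v 0 = mat 1"
  by (simp add: transvection_def)

lemma transvection_prod_zeros: "length vs = n \<Longrightarrow> transvection_prod vs (replicate n 0) = mat 1"
  by (induction vs arbitrary: n) auto

lemma transvection_segment:
  fixes M :: "'n::finite phase_matrix"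
  assumes M: "M \<in> symp_group" "det (M - mat 1) \<noteq> 0" and ab: "a < b"
    and end_reg: "det (M ** transvection v c - mat 1) \<noteq> 0"
  shows "transverse_path 1 (\<lambda>t. M ** transvection v (c * ((t - a) / (b - a)))) a b"
proof -
  let ?x = "\<lambda>t. M ** transvection v (c * ((t - a) / (b - a)))"
  obtain q where q: "\<And>c. det (M ** transvection v c - mat 1) = det (M - mat 1) + c * q"
    using det_transvection_affine by blast
  have fx: "det (?x t - mat 1) = det (M - mat 1) + c * ((t - a) / (b - a)) * q" for t
    using q by simp
  have grp: "?x t \<in> symp_group" for t by (intro symp_group_mult M transvection_symp)
  have dx: "(?x has_vector_derivative (c / (b - a)) *\<^sub>R (M ** outer (symp_J *v v) v)) (at t)" for t
  proof -
    have "?x = (\<lambda>t. M + ((c / (b - a)) * (t - a)) *\<^sub>R (M ** outer (symp_J *v v) v))"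
      by (simp add: transvection_def matrix_ring fun_eq_iff)
    moreover have "((\<lambda>t. M + ((c / (b - a)) * (t - a)) *\<^sub>R (M ** outer (symp_J *v v) v))
        has_vector_derivative (c / (b - a)) *\<^sub>R (M ** outer (symp_J *v v) v)) (at t)"
      using ab by (auto intro!: derivative_eq_intros)
    ultimately show ?thesis by simp
  qed
  show ?thesis
    unfolding transverse_path_def
  proof (intro conjI ballI impI)
    show "continuous_on {a..b} ?x"
      using dx by (intro differentiable_imp_continuous_on) (auto simp: differentiable_on_def
        intro: differentiable_at_withinI differentiableI_vector)
    show "?x ` {a..b} \<subseteq> symp_group" using grp by auto
    show "?x a \<notin> symp_sing 1" using M by (simp add: symp_sing_1)
    show "?x b \<notin> symp_sing 1" using end_reg ab by (simp add: symp_sing_1)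
    fix t assume "?x t \<in> symp_sing 1"
    hence "det (M - mat 1) + c * ((t - a) / (b - a)) * q = 0" using fx by (simp add: symp_sing_1)
    hence cq: "c * q \<noteq> 0" using M(2) by auto
    show "?x differentiable at t" using dx differentiableI_vector by blast
    have "((\<lambda>t. det (?x t - mat 1)) has_real_derivative c * q / (b - a)) (at t)"
      unfolding fx using ab by (auto intro!: derivative_eq_intros)
    hence "vector_derivative (\<lambda>s. char_det 1 (?x s)) (at t) = complex_of_real (c * q / (b - a))"
      unfolding char_det_1 by (intro vector_derivative_at has_vector_derivative_of_real)
    thus "vector_derivative (\<lambda>s. char_det 1 (?x s)) (at t) \<noteq> 0" using cq ab by simp
  qed
qed

lemma transverse_const: "M \<in> symp_group \<Longrightarrow> M \<notin> symp_sing 1 \<Longrightarrow> transverse_path 1 (\<lambda>_. M) a b"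
  by (auto simp: transverse_path_def)

text \<open>
  Along one transvection \<open>det (M - I)\<close> is an affine function of the parameter, so that a segment
  between regular points crosses the hypersurface at most once, and transversally.  Regularity of
  the corners is achieved by moving the parameters a little.
\<close>

lemma transvection_polygon:
  fixes M :: "'n::finite phase_matrix"
  assumes "length vs = length cs" "M \<in> symp_group" "det (M - mat 1) \<noteq> 0" "a < b" "k > 0"
  shows "\<exists>\<xi> es. transverse_path 1 \<xi> a b \<and> \<xi> a = M \<and> \<xi> b = M ** transvection_prod vs es \<and>
    list_all2 (\<lambda>c e. \<bar>e - c\<bar> \<le> k) cs es \<and>
    (\<forall>t\<in>{a..b}. \<exists>ds. list_all2 (\<lambda>c d. \<bar>d\<bar> \<le> \<bar>c\<bar> + k) cs ds \<and> \<xi> t = M ** transvection_prod vs ds)"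
  using assms
proof (induction vs cs arbitrary: M a rule: list_induct2)
  case Nil
  thus ?case
    by (intro exI[of _ "\<lambda>_. M"] exI[of _ "[]"]) (auto simp: transverse_const symp_sing_1)
next
  case (Cons v vs c cs M a)
  define m where "m = (a + b) / 2"
  have m: "a < m" "m < b" using \<open>a < b\<close> by (auto simp: m_def)
  obtain q where q: "\<And>c. det (M ** transvection v c - mat 1) = det (M - mat 1) + c * q"
    using det_transvection_affine by blast
  \<comment> \<open>The determinant is affine in the parameter and nonzero at 0. If it vanishes at
    \<open>c\<close>, its slope is nonzero, so it does not vanish at \<open>c + k\<close>.\<close>
  obtain e where e: "\<bar>e - c\<bar> \<le> k" "det (M ** transvection v e - mat 1) \<noteq> 0"
  proof (cases "det (M ** transvection v c - mat 1) = 0")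
    case False thus ?thesis using that[of c] \<open>k > 0\<close> by simp
  next
    case True
    hence "q \<noteq> 0" using q[of c] Cons.prems(2) by auto
    moreover have "det (M ** transvection v (c + k) - mat 1) = k * q"
      using True q[of c] q[of "c + k"] by (simp add: distrib_right)
    ultimately have "det (M ** transvection v (c + k) - mat 1) \<noteq> 0" using \<open>k > 0\<close> by simp
    thus ?thesis using that[of "c + k"] \<open>k > 0\<close> by simp
  qed
  let ?x = "\<lambda>t. M ** transvection v (e * ((t - a) / (m - a)))"
  let ?M = "M ** transvection v e"
  have x: "transverse_path 1 ?x a m"
    by (rule transvection_segment[OF Cons.prems(1,2) m(1) e(2)])
  have M': "?M \<in> symp_group" by (intro symp_group_mult Cons.prems(1) transvection_symp)
  obtain \<xi> es where IH: "transverse_path 1 \<xi> m b" "\<xi> m = ?M" "\<xi> b = ?M ** transvection_prod vs es"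
    "list_all2 (\<lambda>c e. \<bar>e - c\<bar> \<le> k) cs es"
    "\<And>t. t \<in> {m..b} \<Longrightarrow> \<exists>ds. list_all2 (\<lambda>c d. \<bar>d\<bar> \<le> \<bar>c\<bar> + k) cs ds \<and> \<xi> t = ?M ** transvection_prod vs ds"
    using Cons.IH[OF M' e(2) m(2) \<open>k > 0\<close>] by blast
  define z where "z t = (if t \<le> m then ?x t else \<xi> t)" for t
  have "transverse_path 1 z a b"
    unfolding z_def by (rule transverse_path_join[OF x IH(1)]) (use m IH(2) in auto)
  moreover have "z a = M" using m by (simp add: z_def)
  moreover have "z b = M ** transvection_prod (v # vs) (e # es)"
    using m IH(3) by (simp add: z_def matrix_mul_assoc)
  moreover have "list_all2 (\<lambda>c e. \<bar>e - c\<bar> \<le> k) (c # cs) (e # es)" using IH(4) e(1) by simp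
  moreover have "\<exists>ds. list_all2 (\<lambda>c d. \<bar>d\<bar> \<le> \<bar>c\<bar> + k) (c # cs) ds \<and> z t = M ** transvection_prod (v # vs) ds"
    if t: "t \<in> {a..b}" for t
  proof (cases "t \<le> m")
    case True
    define d where "d = e * ((t - a) / (m - a))"
    have "0 \<le> (t - a) / (m - a)" "(t - a) / (m - a) \<le> 1" using True t m by auto
    hence "\<bar>d\<bar> \<le> \<bar>e\<bar>" by (simp only: d_def abs_mult abs_of_nonneg mult_left_le abs_ge_zero)
    hence d: "\<bar>d\<bar> \<le> \<bar>c\<bar> + k" using e(1) by linarith
    have "list_all2 (\<lambda>c d. \<bar>d\<bar> \<le> \<bar>c\<bar> + k) cs (replicate (length cs) 0)"
      using \<open>k > 0\<close> by (simp add: list_all2_conv_all_nth)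
    moreover have "z t = M ** transvection_prod (v # vs) (d # replicate (length cs) 0)"
      using True Cons.hyps by (simp add: z_def d_def transvection_prod_zeros)
    ultimately show ?thesis using d by (intro exI[of _ "d # replicate (length cs) 0"]) simp
  next
    case False
    then obtain ds where "list_all2 (\<lambda>c d. \<bar>d\<bar> \<le> \<bar>c\<bar> + k) cs ds" "\<xi> t = ?M ** transvection_prod vs ds"
      using IH(5)[of t] t by auto
    thus ?thesis using False e(1)
      by (intro exI[of _ "e # ds"]) (auto simp: z_def matrix_mul_assoc)
  qed
  ultimately show ?case by blast
qed

text \<open>Expanding the product of the factors \<open>I + A\<close>, the remainder after the terms
  of order 0, or of orders 0 and 1, is dominated by that of the scalar product of the
  \<open>1 + norm A\<close>, which is at most \<open>exp\<close> of the sum of the norms. The factor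
  \<open>n0\<close> accounts for the norm of the identity.\<close>

lemma transvection_prod_estimate:
  fixes vs :: "'n::finite phase list"
  assumes "length vs = length cs"
  defines "f \<equiv> \<lambda>(v, c). c *\<^sub>R outer (symp_J *v v) v"
  defines "n0 \<equiv> norm (mat 1 :: 'n phase_matrix)"
  shows "norm (transvection_prod vs cs - mat 1) \<le> n0 * (exp (\<Sum>p\<leftarrow>zip vs cs. norm (f p)) - 1)"
    and "norm (transvection_prod vs cs - mat 1 - (\<Sum>p\<leftarrow>zip vs cs. f p)) \<le>
      n0 * (exp (\<Sum>p\<leftarrow>zip vs cs. norm (f p)) - 1 - (\<Sum>p\<leftarrow>zip vs cs. norm (f p)))"
proof -
  have n0: "n0 \<ge> 1" unfolding n0_def by (rule norm_mat_1_ge)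
  have "norm (transvection_prod vs cs - mat 1) \<le> n0 * (exp (\<Sum>p\<leftarrow>zip vs cs. norm (f p)) - 1) \<and>
    norm (transvection_prod vs cs - mat 1 - (\<Sum>p\<leftarrow>zip vs cs. f p)) \<le>
      n0 * (exp (\<Sum>p\<leftarrow>zip vs cs. norm (f p)) - 1 - (\<Sum>p\<leftarrow>zip vs cs. norm (f p)))"
    using assms(1)
  proof (induction vs cs rule: list_induct2)
    case (Cons v vs c cs)
    define A where "A = c *\<^sub>R outer (symp_J *v v) v"
    define P where "P = transvection_prod vs cs"
    define s where "s = (\<Sum>p\<leftarrow>zip vs cs. norm (f p))"
    define S where "S = (\<Sum>p\<leftarrow>zip vs cs. f p)"
    have IH: "norm (P - mat 1) \<le> n0 * (exp s - 1)" "norm (P - mat 1 - S) \<le> n0 * (exp s - 1 - s)"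
      using Cons.IH by (simp_all add: P_def s_def S_def)
    have fA: "f (v, c) = A" by (simp add: f_def A_def)
    have s0: "s \<ge> 0" unfolding s_def by (rule sum_list_nonneg) auto
    have e: "exp s * (1 + norm A) \<le> exp (norm A + s)"
      using exp_ge_add_one_self[of "norm A"] by (simp add: exp_add mult.commute)
    have P': "transvection_prod (v # vs) (c # cs) = P + A ** P"
      by (simp add: transvection_def A_def P_def matrix_ring)
    have e1: "P + A ** P - mat 1 = (P - mat 1) + A ** (P - mat 1) + A"
      by (simp add: matrix_ring)
    have "norm (P + A ** P - mat 1) \<le> norm (P - mat 1) + norm A * norm (P - mat 1) + norm A"
      unfolding e1
      using norm_triangle_ineq[of "(P - mat 1) + A ** (P - mat 1)" A]
        norm_triangle_ineq[of "P - mat 1" "A ** (P - mat 1)"] norm_matrix_mult[of A "P - mat 1"]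
      by linarith
    also have "\<dots> \<le> n0 * (exp s - 1) + norm A * (n0 * (exp s - 1)) + n0 * norm A"
      using IH(1) n0 by (intro add_mono mult_left_mono) (auto simp: mult_le_cancel_right1)
    also have "\<dots> = n0 * (exp s * (1 + norm A) - 1)" by (simp add: algebra_simps)
    also have "\<dots> \<le> n0 * (exp (norm A + s) - 1)" using e n0 by (intro mult_left_mono) auto
    finally have 1: "norm (P + A ** P - mat 1) \<le> n0 * (exp (norm A + s) - 1)" .
    have e2: "P + A ** P - mat 1 - (A + S) = (P - mat 1 - S) + A ** (P - mat 1)"
      by (simp add: matrix_ring)
    have "norm (P + A ** P - mat 1 - (A + S)) \<le> norm (P - mat 1 - S) + norm A * norm (P - mat 1)"
      unfolding e2
      using norm_triangle_ineq[of "P - mat 1 - S" "A ** (P - mat 1)"] norm_matrix_mult[of A "P - mat 1"]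
      by linarith
    also have "\<dots> \<le> n0 * (exp s - 1 - s) + norm A * (n0 * (exp s - 1))"
      using IH by (intro add_mono mult_left_mono) auto
    also have "\<dots> = n0 * (exp s * (1 + norm A) - 1 - (norm A + s))" by (simp add: algebra_simps)
    also have "\<dots> \<le> n0 * (exp (norm A + s) - 1 - (norm A + s))" using e n0 by (intro mult_left_mono) auto
    finally have 2: "norm (P + A ** P - mat 1 - (A + S)) \<le> n0 * (exp (norm A + s) - 1 - (norm A + s))" .
    show ?case using 1 2 by (simp add: P' fA s_def[symmetric] S_def[symmetric] del: transvection_prod_simps)
  qed simp
  thus "norm (transvection_prod vs cs - mat 1) \<le> n0 * (exp (\<Sum>p\<leftarrow>zip vs cs. norm (f p)) - 1)"
    "norm (transvection_prod vs cs - mat 1 - (\<Sum>p\<leftarrow>zip vs cs. f p)) \<le>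
      n0 * (exp (\<Sum>p\<leftarrow>zip vs cs. norm (f p)) - 1 - (\<Sum>p\<leftarrow>zip vs cs. norm (f p)))"
    by blast+
qed

text \<open>Polarisation with the vectors \<open>axis i 1 + axis j 1\<close>. The list of vectors is
  the same for all \<open>Y\<close>, and the coefficients are bounded linearly in
  \<open>norm Y\<close>, so a small \<open>Y\<close> needs only small transvections.\<close>

lemma symmetric_decomposition:
  obtains vs :: "(real^'k::finite) list" and C :: real where "C \<ge> 0"
    "\<And>Y :: real^'k^'k. transpose Y = Y \<Longrightarrow> \<exists>cs. length cs = length vs \<and>
      (\<Sum>(v, c)\<leftarrow>zip vs cs. c *\<^sub>R outer v v) = Y \<and> (\<forall>c\<in>set cs. \<bar>c\<bar> \<le> C * norm Y)"
proof -
  obtain L :: "('k \<times> 'k) list" where L: "set L = UNIV" "distinct L"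
    using finite_distinct_list[OF finite, of "UNIV :: ('k \<times> 'k) set"] by blast
  define vs where "vs = map (\<lambda>(i, j). axis i 1 + axis j 1 :: real^'k) L"
  show ?thesis
  proof (rule that[of "1 / 2 + CARD('k)" vs])
    fix Y :: "real^'k^'k" assume sym: "transpose Y = Y"
    have Ysym: "Y $ i $ j = Y $ j $ i" for i j
      using arg_cong[OF sym, of "\<lambda>Z. Z $ j $ i"] by (simp add: transpose_def)
    define r where "r i = (\<Sum>j\<in>UNIV. Y $ i $ j)" for i
    \<comment> \<open>The weights \<open>Y_ij / 2\<close> over ordered pairs yield \<open>Y\<close>
      plus the row sums on the diagonal. A pair \<open>(i, i)\<close> stands for twice a coordinate
      vector, whose square has the entry 4; hence the correction \<open>r i / 4\<close>.\<close>
    define g where "g = (\<lambda>(i, j). Y $ i $ j / 2 - (if i = j then r i / 4 else 0))"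
    have row: "(\<Sum>j\<in>UNIV. g (i, j)) = r i / 4" for i
      by (simp add: g_def sum_subtractf r_def sum_divide_distrib[symmetric])
    have col: "(\<Sum>i\<in>UNIV. g (i, j)) = r j / 4" for j
    proof -
      have "(\<Sum>i\<in>UNIV. g (i, j)) = (\<Sum>i\<in>UNIV. g (j, i))"
        by (rule sum.cong) (auto simp: g_def Ysym)
      thus ?thesis using row by simp
    qed
    have "(\<Sum>(v, c)\<leftarrow>zip vs (map g L). c *\<^sub>R outer v v) =
        (\<Sum>p\<leftarrow>L. g p *\<^sub>R outer (axis (fst p) 1 + axis (snd p) 1) (axis (fst p) 1 + axis (snd p) 1))"
      unfolding vs_def by (simp add: zip_map_map o_def split_def zip_same_conv_map)
    also have "\<dots> = (\<Sum>p\<in>UNIV. g p *\<^sub>R outer (axis (fst p) 1 + axis (snd p) 1) (axis (fst p) 1 + axis (snd p) 1))"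
      by (simp add: sum_list_distinct_conv_sum_set[OF L(2)] L(1))
    also have "\<dots> = (\<Sum>i\<in>UNIV. \<Sum>j\<in>UNIV. g (i, j) *\<^sub>R outer (axis i 1 + axis j 1) (axis i 1 + axis j 1))"
      by (simp add: sum.cartesian_product split_def)
    also have "\<dots> = Y"
    proof (rule vec_eq_iff[THEN iffD2], rule allI, rule vec_eq_iff[THEN iffD2], rule allI)
      fix k l
      have "(\<Sum>i\<in>UNIV. \<Sum>j\<in>UNIV. g (i, j) *\<^sub>R outer (axis i 1 + axis j 1) (axis i 1 + axis j 1)) $ k $ l
        = (\<Sum>i\<in>UNIV. \<Sum>j\<in>UNIV. g (i, j) * ((axis i 1 $ k + axis j 1 $ k) * (axis i 1 $ l + axis j 1 $ l)))"
        by (simp add: outer_def)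
      also have "\<dots> = (\<Sum>i\<in>UNIV. \<Sum>j\<in>UNIV. (if k = i then if l = i then g (i, j) else 0 else 0)
          + (if k = i then if l = j then g (i, j) else 0 else 0)
          + (if k = j then if l = i then g (i, j) else 0 else 0)
          + (if k = j then if l = j then g (i, j) else 0 else 0))"
        by (intro sum.cong refl) (auto simp: axis_def)
      also have "\<dots> = (if k = l then \<Sum>j\<in>UNIV. g (k, j) else 0) + g (k, l) + g (l, k)
          + (if k = l then \<Sum>i\<in>UNIV. g (i, k) else 0)"
      proof -
        have s1: "(\<Sum>i\<in>UNIV. \<Sum>j\<in>UNIV. if k = i then if l = i then g (i, j) else 0 else 0) = (if k = l then \<Sum>j\<in>UNIV. g (k, j) else 0)"
          by (subst sum.swap) auto
        have s2: "(\<Sum>i\<in>UNIV. \<Sum>j\<in>UNIV. if k = i then if l = j then g (i, j) else 0 else 0) = g (k, l)"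
          by (subst sum.swap) simp
        have s3: "(\<Sum>i\<in>UNIV. \<Sum>j\<in>UNIV. if k = j then if l = i then g (i, j) else 0 else 0) = g (l, k)"
          by simp
        have s4: "(\<Sum>i\<in>UNIV. \<Sum>j\<in>UNIV. if k = j then if l = j then g (i, j) else 0 else 0) = (if k = l then \<Sum>i\<in>UNIV. g (i, k) else 0)"
          by auto
        show ?thesis by (simp only: sum.distrib s1 s2 s3 s4)
      qed
      also have "\<dots> = Y $ k $ l" unfolding row col by (simp add: g_def Ysym[of l k])
      finally show "(\<Sum>i\<in>UNIV. \<Sum>j\<in>UNIV. g (i, j) *\<^sub>R outer (axis i 1 + axis j 1) (axis i 1 + axis j 1)) $ k $ l = Y $ k $ l" .
    qed
    finally have sum: "(\<Sum>(v, c)\<leftarrow>zip vs (map g L). c *\<^sub>R outer v v) = Y" .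
    have Yij: "\<bar>Y $ i $ j\<bar> \<le> norm Y" for i j
      using order.trans[OF Finite_Cartesian_Product.norm_nth_le[of "Y $ i" j]
          Finite_Cartesian_Product.norm_nth_le[of Y i]] by simp
    have "\<bar>g (i, j)\<bar> \<le> (1 / 2 + CARD('k)) * norm Y" for i j
    proof -
      have "\<bar>r i\<bar> \<le> CARD('k) * norm Y"
        unfolding r_def using sum_norm_bound[of UNIV "\<lambda>j. Y $ i $ j" "norm Y"] Yij by simp
      moreover have "0 \<le> CARD('k) * norm Y" by simp
      moreover have "\<bar>Y $ i $ j\<bar> \<le> norm Y" by (rule Yij)
      ultimately show ?thesis by (auto simp: g_def algebra_simps abs_le_iff)
    qed
    thus "\<exists>cs. length cs = length vs \<and> (\<Sum>(v, c)\<leftarrow>zip vs cs. c *\<^sub>R outer v v) = Y \<and>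
        (\<forall>c\<in>set cs. \<bar>c\<bar> \<le> (1 / 2 + CARD('k)) * norm Y)"
      using sum by (intro exI[of _ "map g L"]) (auto simp: vs_def)
  qed simp
qed

lemma norm_symp_inv_le: "norm (symp_inv M) \<le> norm (symp_J :: 'n::finite phase_matrix) ^ 2 * norm (M :: 'n phase_matrix)"
proof -
  have "norm (symp_inv M) \<le> norm (symp_J :: 'n phase_matrix) * norm (transpose M) * norm (symp_J :: 'n phase_matrix)"
    unfolding symp_inv_def norm_minus_cancel
    by (rule order.trans[OF norm_matrix_mult]) (intro mult_right_mono norm_matrix_mult norm_ge_zero)
  thus ?thesis by (simp add: norm_transpose power2_eq_square mult_ac)
qed

lemma sum_list_outer_bound:
  fixes f :: "'v \<times> real \<Rightarrow> 'm::real_normed_vector" and B k m :: real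
  assumes "length vs = length cs" "\<And>v c. v \<in> set vs \<Longrightarrow> norm (f (v, c)) \<le> B * \<bar>c\<bar>"
    "\<And>c. c \<in> set cs \<Longrightarrow> \<bar>c\<bar> \<le> m" "B \<ge> 0"
  shows "(\<Sum>p\<leftarrow>zip vs cs. norm (f p)) \<le> length vs * B * m"
  using assms
proof (induction vs cs rule: list_induct2)
  case (Cons v vs c cs)
  have "norm (f (v, c)) \<le> B * m"
    using Cons.prems(1)[of v c] Cons.prems(2)[of c] mult_left_mono[OF _ Cons.prems(3)] by fastforce
  moreover have "(\<Sum>p\<leftarrow>zip vs cs. norm (f p)) \<le> length vs * B * m"
    using Cons by simp
  ultimately show ?case by (simp add: algebra_simps)
qed simp

lemma sum_list_outer_diff:
  fixes f :: "'v \<times> real \<Rightarrow> 'm::real_normed_vector" and B k m :: real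
  assumes "length vs = length cs" "list_all2 (\<lambda>c e. \<bar>e - c\<bar> \<le> k) cs es"
    "\<And>v c. v \<in> set vs \<Longrightarrow> norm (f (v, c)) \<le> B * \<bar>c\<bar>" "\<And>v c d. f (v, c) - f (v, d) = f (v, c - d)" "B \<ge> 0"
  shows "norm ((\<Sum>p\<leftarrow>zip vs es. f p) - (\<Sum>p\<leftarrow>zip vs cs. f p)) \<le> length vs * B * k"
  using assms
proof (induction vs cs arbitrary: es rule: list_induct2)
  case (Cons v vs c cs)
  then obtain e es' where es: "es = e # es'" "\<bar>e - c\<bar> \<le> k" "list_all2 (\<lambda>c e. \<bar>e - c\<bar> \<le> k) cs es'"
    by (auto simp: list_all2_Cons1)
  have "norm (f (v, e) - f (v, c)) \<le> B * \<bar>e - c\<bar>" unfolding Cons.prems(3) by (rule Cons.prems(2)) simp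
  also have "\<dots> \<le> B * k" using es(2) Cons.prems(4) by (rule mult_left_mono)
  finally have 1: "norm (f (v, e) - f (v, c)) \<le> B * k" .
  have 2: "norm ((\<Sum>p\<leftarrow>zip vs es'. f p) - (\<Sum>p\<leftarrow>zip vs cs. f p)) \<le> length vs * B * k"
    by (rule Cons.IH[OF es(3)]) (use Cons.prems in auto)
  have "(\<Sum>p\<leftarrow>zip (v # vs) es. f p) - (\<Sum>p\<leftarrow>zip (v # vs) (c # cs). f p) =
      (f (v, e) - f (v, c)) + ((\<Sum>p\<leftarrow>zip vs es'. f p) - (\<Sum>p\<leftarrow>zip vs cs. f p))"
    by (simp add: es(1))
  thus ?case using norm_triangle_le[OF add_mono[OF 1 2]] by (simp add: algebra_simps)
qed simp

text \<open>
  A symplectic matrix \<open>K\<close> close to \<open>I\<close> is approximated to second order by a product of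
  transvections, because the rank one matrices \<open>v v\<^sup>T\<close> span the symmetric matrices.
\<close>

lemma symp_step:
  obtains C where "C \<ge> 1"
    "\<And>e (K :: 'n::finite phase_matrix) M a b. 0 < e \<Longrightarrow> C * e \<le> 1 \<Longrightarrow> K \<in> symp_group \<Longrightarrow> norm (K - mat 1) \<le> 2 * e \<Longrightarrow>
      M \<in> symp_group \<Longrightarrow> M \<notin> symp_sing 1 \<Longrightarrow> a < b \<Longrightarrow>
      \<exists>\<xi>. transverse_path 1 \<xi> a b \<and> \<xi> a = M \<and> norm (symp_inv (\<xi> b) ** (M ** K) - mat 1) \<le> C * e\<^sup>2 \<and>
        (\<forall>t\<in>{a..b}. norm (symp_inv (\<xi> t) ** (M ** K) - mat 1) \<le> C * e)"
proof -
  let ?J = "symp_J :: 'n phase_matrix"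
  obtain vs :: "'n phase list" and C1 where C1: "C1 \<ge> 0"
    "\<And>Y :: 'n phase_matrix. transpose Y = Y \<Longrightarrow> \<exists>cs. length cs = length vs \<and>
      (\<Sum>(v, c)\<leftarrow>zip vs cs. c *\<^sub>R outer v v) = Y \<and> (\<forall>c\<in>set cs. \<bar>c\<bar> \<le> C1 * norm Y)"
    by (rule symmetric_decomposition[where 'k = "'n + 'n"], erule that, assumption)
  define j where "j = norm ?J"
  define n0 where "n0 = norm (mat 1 :: 'n phase_matrix)"
  define f where "f = (\<lambda>(v :: 'n phase, c :: real). c *\<^sub>R outer (symp_J *v v) v)"
  define B where "B = (\<Sum>v\<leftarrow>vs. norm (outer (symp_J *v v) v))"
  define W where "W = length vs * B"
  \<comment> \<open>\<open>D * e\<close> will bound the transvection parameters, \<open>F\<close>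
    the inverses of the products, \<open>E * e\<close> the distance of \<open>K\<close> from any
    product met on the way, and \<open>G * e^2\<close> its distance from the final one.\<close>
  define D where "D = 2 * C1 * j + 1"
  define E where "E = 2 + 2 * n0 * W * D"
  define F where "F = 3 * n0 * j\<^sup>2"
  define G where "G = n0 * (W * D)\<^sup>2 + W + 2 * j\<^sup>2"
  define C where "C = F * E + F * G + W * D + 1"
  have n0: "n0 \<ge> 1" unfolding n0_def by (rule norm_mat_1_ge)
  have j: "j \<ge> 0" by (simp add: j_def)
  have B: "B \<ge> 0" unfolding B_def by (rule sum_list_nonneg) auto
  have W: "W \<ge> 0" using B by (simp add: W_def)
  have D: "D \<ge> 1" using C1(1) j by (simp add: D_def)
  have E: "E \<ge> 0" using n0 W D by (simp add: E_def)
  have F: "F \<ge> 0" using n0 by (simp add: F_def)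
  have G: "G \<ge> 0" using n0 W by (simp add: G_def)
  have C: "C \<ge> 1" "F * E \<le> C" "F * G \<le> C" "W * D \<le> C" "1 \<le> C"
    using mult_nonneg_nonneg[OF F E] mult_nonneg_nonneg[OF F G] mult_nonneg_nonneg[OF W, of D] D
    by (auto simp: C_def)
  have fB: "norm (f (v, c)) \<le> B * \<bar>c\<bar>" if "v \<in> set vs" for v c
  proof -
    have "norm (outer (symp_J *v v) v) \<le> B"
      unfolding B_def using that by (intro member_le_sum_list) auto
    thus ?thesis by (simp add: f_def mult.commute[of B] mult_left_mono)
  qed
  have fd: "f (v, c) - f (v, d) = f (v, c - d)" for v c d by (simp add: f_def scaleR_diff_left)
  show ?thesis
  proof (rule that[OF C(1)])
    fix e :: real and K M :: "'n phase_matrix" and a b :: real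
    assume e: "0 < e" "C * e \<le> 1" and K: "K \<in> symp_group" "norm (K - mat 1) \<le> 2 * e"
      and M: "M \<in> symp_group" "M \<notin> symp_sing 1" and ab: "a < b"
    have ee: "W * D * e \<le> 1" "e \<le> 1"
      using mult_right_mono[OF C(4) less_imp_le[OF e(1)]] mult_right_mono[OF C(5) less_imp_le[OF e(1)]] e(2)
      by linarith+
    define X where "X = K - mat 1"
    have X: "norm X \<le> 2 * e" using K(2) by (simp add: X_def)
    \<comment> \<open>\<open>J X\<close> is symmetric up to second order, because
      \<open>I + X\<close> is symplectic. \<open>Y\<close> is the symmetric part of
      \<open>- J X\<close>, so \<open>J Y\<close> agrees with \<open>X\<close> up to second order
      and is the first order term of a product of transvections.\<close>
    define Y where "Y = - (1 / 2) *\<^sub>R (symp_J ** X + transpose (symp_J ** X))"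
    have "transpose Y = Y" by (simp add: Y_def transpose_scalar transpose_def vec_eq_iff add.commute)
    then obtain cs where cs: "length cs = length vs" "(\<Sum>(v, c)\<leftarrow>zip vs cs. c *\<^sub>R outer v v) = Y"
      "\<And>c. c \<in> set cs \<Longrightarrow> \<bar>c\<bar> \<le> C1 * norm Y" using C1(2) by blast
    have JX: "norm (symp_J ** X) \<le> j * (2 * e)"
      using order.trans[OF norm_matrix_mult mult_left_mono[OF X norm_ge_zero[of ?J]]] by (simp add: j_def)
    have "norm Y \<le> (1 / 2) * (norm (symp_J ** X) + norm (transpose (symp_J ** X)))"
      unfolding Y_def norm_scaleR using norm_triangle_ineq by fastforce
    hence Y: "norm Y \<le> j * (2 * e)" using JX by (simp add: norm_transpose)
    have Sf: "(\<Sum>p\<leftarrow>zip vs cs. f p) = symp_J ** Y"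
    proof -
      have "(\<Sum>p\<leftarrow>zip vs ds. f p) = symp_J ** (\<Sum>(v, c)\<leftarrow>zip vs ds. c *\<^sub>R outer v v)" for ds
      proof (induction vs arbitrary: ds)
        case (Cons v vs) thus ?case
          by (cases ds) (auto simp: f_def matrix_ring mult_outer)
      qed simp
      thus ?thesis using cs(2) by simp
    qed
    have JY: "norm (symp_J ** Y - X) \<le> 2 * j\<^sup>2 * e\<^sup>2"
    proof -
      have "transpose K ** symp_J ** K = symp_J" using K(1) by (simp add: symp_group_iff)
      have t: "transpose X ** symp_J + symp_J ** X + transpose X ** symp_J ** X = 0"
      proof -
        have K': "K = mat 1 + X" by (simp add: X_def)
        have "transpose K = mat 1 + transpose X" unfolding K' by (simp add: transpose_def vec_eq_iff mat_def)
        hence "transpose K ** symp_J ** K = symp_J + (transpose X ** symp_J + symp_J ** X + transpose X ** symp_J ** X)"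
          unfolding K' by (simp add: matrix_ring)
        with \<open>transpose K ** symp_J ** K = symp_J\<close> show ?thesis by simp
      qed
      have "transpose (symp_J ** X) = symp_J ** X + transpose X ** symp_J ** X"
        unfolding matrix_transpose_mul transpose_symp_J matrix_mult_minus_right
        by (rule minus_unique[OF t[unfolded add.assoc]])
      hence "Y = - (symp_J ** X) - (1 / 2) *\<^sub>R (transpose X ** symp_J ** X)"
        unfolding Y_def by (simp add: scaleR_add_right scaleR_diff_right)
      hence "symp_J ** Y - X = - ((1 / 2) *\<^sub>R (symp_J ** (transpose X ** symp_J ** X)))"
        by (simp add: matrix_mult_diff_ldistrib matrix_mult_minus_right matrix_mult_scaleR_right)
      hence "norm (symp_J ** Y - X) = norm (symp_J ** (transpose X ** symp_J ** X)) / 2" by simp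
      also have "norm (symp_J ** (transpose X ** symp_J ** X)) \<le> j * (norm X * j * norm X)"
        unfolding j_def norm_transpose[of X, symmetric]
        by (intro order.trans[OF norm_matrix_mult] mult_mono order.refl norm_ge_zero mult_nonneg_nonneg)
           (simp_all add: norm_transpose)
      also have "j * (norm X * j * norm X) = j\<^sup>2 * (norm X)\<^sup>2" by (simp add: power2_eq_square)
      also have "\<dots> \<le> j\<^sup>2 * (2 * e)\<^sup>2" using X by (intro mult_left_mono power_mono) auto
      finally show ?thesis by (simp add: power_mult_distrib mult_ac)
    qed
    have Msing: "det (M - mat 1) \<noteq> 0" using M by (simp add: symp_sing_1)
    have e2: "e\<^sup>2 > 0" using e by simp
    \<comment> \<open>The parameters may be moved by \<open>e^2\<close> to make the corners regular,
      which is of the same order as the error allowed at the end.\<close>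
    obtain \<xi> es where \<xi>: "transverse_path 1 \<xi> a b" "\<xi> a = M" "\<xi> b = M ** transvection_prod vs es"
      "list_all2 (\<lambda>c d. \<bar>d - c\<bar> \<le> e\<^sup>2) cs es"
      "\<And>t. t \<in> {a..b} \<Longrightarrow> \<exists>ds. list_all2 (\<lambda>c d. \<bar>d\<bar> \<le> \<bar>c\<bar> + e\<^sup>2) cs ds \<and> \<xi> t = M ** transvection_prod vs ds"
      using transvection_polygon[OF cs(1)[symmetric] M(1) Msing ab e2] by blast
    have est: "norm (transvection_prod vs ds - mat 1) \<le> 2 * n0 * W * D * e"
      "norm (transvection_prod vs ds - mat 1 - (\<Sum>p\<leftarrow>zip vs ds. f p)) \<le> n0 * (W * D)\<^sup>2 * e\<^sup>2"
      "norm (symp_inv (transvection_prod vs ds)) \<le> F"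
      "length ds = length vs"
      if ds: "list_all2 (\<lambda>c d. \<bar>d\<bar> \<le> \<bar>c\<bar> + e\<^sup>2) cs ds" for ds
    proof -
      show len: "length ds = length vs" using ds cs(1) by (simp add: list_all2_lengthD)
      define s where "s = (\<Sum>p\<leftarrow>zip vs ds. norm (f p))"
      have dm: "\<bar>d\<bar> \<le> D * e" if d: "d \<in> set ds" for d
      proof -
        obtain i where i: "i < length ds" "d = ds ! i" using d unfolding in_set_conv_nth by blast
        have c: "cs ! i \<in> set cs" "\<bar>d\<bar> \<le> \<bar>cs ! i\<bar> + e\<^sup>2"
          using ds i by (simp_all add: list_all2_conv_all_nth)
        have "\<bar>cs ! i\<bar> \<le> C1 * (j * (2 * e))" using cs(3)[OF c(1)] mult_left_mono[OF Y C1(1)] by linarith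
        moreover have "e\<^sup>2 \<le> e" using e(1) ee(2) by (simp add: power2_eq_square mult_left_le)
        ultimately show ?thesis using c(2) by (simp add: D_def algebra_simps)
      qed
      have s: "s \<le> W * D * e"
        unfolding s_def W_def
        using sum_list_outer_bound[OF len[symmetric] fB dm B] by (simp add: mult.assoc)
      have s0: "s \<ge> 0" unfolding s_def by (rule sum_list_nonneg) auto
      have s1: "s \<le> 1" using s ee(1) by linarith
      have ex: "exp s \<le> 1 + s + s\<^sup>2" using exp_bound[OF s0 s1] .
      have ss: "s\<^sup>2 \<le> s" using s0 s1 by (simp add: power2_eq_square mult_left_le)
      note T = transvection_prod_estimate[OF len[symmetric], folded f_def n0_def s_def]
      have "norm (transvection_prod vs ds - mat 1) \<le> n0 * (exp s - 1)" by (rule T(1))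
      also have "\<dots> \<le> n0 * (2 * (W * D * e))" using ex ss s n0 by (intro mult_left_mono) auto
      finally show 1: "norm (transvection_prod vs ds - mat 1) \<le> 2 * n0 * W * D * e" by (simp add: mult_ac)
      have "norm (transvection_prod vs ds - mat 1 - (\<Sum>p\<leftarrow>zip vs ds. f p)) \<le> n0 * (exp s - 1 - s)"
        by (rule T(2))
      also have "\<dots> \<le> n0 * (W * D * e)\<^sup>2"
        using ex power_mono[OF s s0, of 2] n0 by (intro mult_left_mono) auto
      finally show "norm (transvection_prod vs ds - mat 1 - (\<Sum>p\<leftarrow>zip vs ds. f p)) \<le> n0 * (W * D)\<^sup>2 * e\<^sup>2"
        by (simp add: power_mult_distrib mult_ac)
      have "norm (transvection_prod vs ds) \<le> n0 + 2 * n0 * (W * D * e)"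
        using norm_triangle_ineq[of "mat 1" "transvection_prod vs ds - mat 1"] 1 by (simp add: n0_def mult_ac)
      also have "\<dots> \<le> n0 + 2 * n0 * 1" using n0 ee(1) by (intro add_left_mono mult_left_mono) auto
      finally have "norm (transvection_prod vs ds) \<le> 3 * n0" by simp
      hence "j\<^sup>2 * norm (transvection_prod vs ds) \<le> j\<^sup>2 * (3 * n0)" by (rule mult_left_mono) simp
      thus "norm (symp_inv (transvection_prod vs ds)) \<le> F"
        using norm_symp_inv_le[of "transvection_prod vs ds"] by (simp add: F_def j_def mult_ac)
    qed
    \<comment> \<open>Errors are measured from the left, as the distance of
      \<open>symp_inv P ** K\<close> from the identity, so that the base point \<open>M\<close>
      drops out and the constant does not depend on it.\<close>
    have red: "symp_inv (M ** P) ** (M ** K) - mat 1 = symp_inv P ** (K - P)" if P: "P \<in> symp_group" for P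
    proof -
      have "symp_inv (M ** P) ** (M ** K) = symp_inv P ** ((symp_inv M ** M) ** K)"
        by (simp only: symp_inv_mult matrix_mul_assoc)
      also have "\<dots> = symp_inv P ** K" by (simp add: symp_inv_left[OF M(1)])
      finally show ?thesis by (simp add: matrix_mult_diff_ldistrib symp_inv_left[OF P])
    qed
    have "norm (symp_inv (\<xi> b) ** (M ** K) - mat 1) \<le> C * e\<^sup>2"
    proof -
      let ?P = "transvection_prod vs es"
      have es: "list_all2 (\<lambda>c d. \<bar>d\<bar> \<le> \<bar>c\<bar> + e\<^sup>2) cs es"
        using \<xi>(4) by (rule list_all2_mono) auto
      note T = est[OF es]
      have d: "norm ((\<Sum>p\<leftarrow>zip vs es. f p) - symp_J ** Y) \<le> W * e\<^sup>2"
        unfolding Sf[symmetric] W_def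
        by (rule sum_list_outer_diff[OF cs(1)[symmetric] \<xi>(4) fB fd B])
      have "K - ?P = - (?P - mat 1 - (\<Sum>p\<leftarrow>zip vs es. f p)) - ((\<Sum>p\<leftarrow>zip vs es. f p) - symp_J ** Y) - (symp_J ** Y - X)"
        by (simp add: X_def)
      hence "norm (K - ?P) \<le> norm (?P - mat 1 - (\<Sum>p\<leftarrow>zip vs es. f p)) + norm ((\<Sum>p\<leftarrow>zip vs es. f p) - symp_J ** Y) + norm (symp_J ** Y - X)"
        by (simp only: order.trans[OF norm_triangle_ineq4 add_right_mono[OF order.trans[OF norm_triangle_ineq4]]] norm_minus_cancel order.refl)
      also have "\<dots> \<le> n0 * (W * D)\<^sup>2 * e\<^sup>2 + W * e\<^sup>2 + 2 * j\<^sup>2 * e\<^sup>2"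
        using T(2) d JY by linarith
      also have "\<dots> = G * e\<^sup>2" by (simp add: G_def algebra_simps)
      finally have "norm (K - ?P) \<le> G * e\<^sup>2" .
      hence "norm (symp_inv ?P ** (K - ?P)) \<le> F * (G * e\<^sup>2)"
        using T(3) F by (intro order.trans[OF norm_matrix_mult] mult_mono) auto
      also have "\<dots> \<le> C * e\<^sup>2" using C(3) by (simp add: mult.assoc[symmetric] mult_right_mono)
      finally show ?thesis unfolding \<xi>(3) red[OF transvection_prod_symp] .
    qed
    moreover have "norm (symp_inv (\<xi> t) ** (M ** K) - mat 1) \<le> C * e" if t: "t \<in> {a..b}" for t
    proof -
      obtain ds where ds: "list_all2 (\<lambda>c d. \<bar>d\<bar> \<le> \<bar>c\<bar> + e\<^sup>2) cs ds" "\<xi> t = M ** transvection_prod vs ds"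
        using \<xi>(5)[OF t] by blast
      let ?P = "transvection_prod vs ds"
      note T = est[OF ds(1)]
      have "norm (K - ?P) \<le> norm (K - mat 1) + norm (?P - mat 1)"
        using norm_triangle_ineq4[of "K - mat 1" "?P - mat 1"] by simp
      also have "\<dots> \<le> E * e" using K(2) T(1) by (simp add: E_def algebra_simps)
      finally have "norm (K - ?P) \<le> E * e" .
      hence "norm (symp_inv ?P ** (K - ?P)) \<le> F * (E * e)"
        using T(3) F by (intro order.trans[OF norm_matrix_mult] mult_mono) auto
      also have "\<dots> \<le> C * e" using C(2) e(1) by (simp add: mult.assoc[symmetric] mult_right_mono)
      finally show ?thesis unfolding ds(2) red[OF transvection_prod_symp] .
    qed
    ultimately show "\<exists>\<xi>. transverse_path 1 \<xi> a b \<and> \<xi> a = M \<and> norm (symp_inv (\<xi> b) ** (M ** K) - mat 1) \<le> C * e\<^sup>2 \<and>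
        (\<forall>t\<in>{a..b}. norm (symp_inv (\<xi> t) ** (M ** K) - mat 1) \<le> C * e)"
      using \<xi>(1,2) by blast
  qed
qed

section \<open>Existence of transverse representatives\<close>

lemma near_one_mult:
  fixes A B :: "real^'k::finite^'k"
  shows "norm (A ** B - mat 1) \<le> norm (A - mat 1) * norm (B - mat 1) + norm (A - mat 1) + norm (B - mat 1)"
proof -
  have e: "A ** B - mat 1 = (A - mat 1) ** (B - mat 1) + (A - mat 1) + (B - mat 1)"
    by (simp add: matrix_ring)
  show ?thesis
    unfolding e
    using norm_triangle_ineq[of "(A - mat 1) ** (B - mat 1) + (A - mat 1)" "B - mat 1"]
      norm_triangle_ineq[of "(A - mat 1) ** (B - mat 1)" "A - mat 1"] norm_matrix_mult[of "A - mat 1" "B - mat 1"]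
    by linarith
qed

lemma near_one_inv:
  "norm (symp_inv M - mat 1) \<le> norm (symp_J :: 'n::finite phase_matrix) ^ 2 * norm (M - mat 1 :: 'n phase_matrix)"
proof -
  have "transpose (M - mat 1) = transpose M - mat 1" by (simp add: transpose_def vec_eq_iff mat_def)
  hence "symp_inv (M - mat 1) = symp_inv M - mat 1"
    by (simp add: symp_inv_def matrix_mult_diff_ldistrib matrix_mult_diff_rdistrib)
  thus ?thesis using norm_symp_inv_le[of "M - mat 1"] by simp
qed

lemma matrix_inv_right: "det A \<noteq> 0 \<Longrightarrow> A ** matrix_inv A = mat 1" for A :: "'a::field^'k::finite^'k"
  unfolding matrix_inv_def invertible_det_nz[symmetric] invertible_def by (rule someI_ex[THEN conjunct1])

text \<open>By Cramer's rule the entries of the inverse are quotients of determinants.\<close>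

lemma continuous_on_matrix_inv:
  fixes f :: "'b::topological_space \<Rightarrow> real^'k::finite^'k"
  assumes "continuous_on S f" "\<And>x. x \<in> S \<Longrightarrow> det (f x) \<noteq> 0"
  shows "continuous_on S (\<lambda>x. matrix_inv (f x))"
proof -
  have inv: "f x ** matrix_inv (f x) = mat 1" if "x \<in> S" for x
    by (rule matrix_inv_right[OF assms(2)[OF that]])
  have e: "matrix_inv (f x) $ k $ l = det (\<chi> i j. if j = k then axis l 1 $ i else f x $ i $ j) / det (f x)"
    if x: "x \<in> S" for x k l
  proof -
    have "f x *v (matrix_inv (f x) *v axis l 1) = axis l 1"
      by (simp add: matrix_vector_mul_assoc inv[OF x])
    hence "matrix_inv (f x) *v axis l 1 = (\<chi> k. det (\<chi> i j. if j = k then axis l 1 $ i else f x $ i $ j) / det (f x))"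
      using cramer[OF assms(2)[OF x]] by blast
    moreover have "(matrix_inv (f x) *v axis l 1) $ k = matrix_inv (f x) $ k $ l"
      by (simp add: matrix_vector_mult_basis column_def)
    ultimately show ?thesis by simp
  qed
  have c: "continuous_on S (\<lambda>x. det (\<chi> i j. if j = k then axis l 1 $ i else f x $ i $ j) / det (f x))" for k l
  proof -
    have "continuous_on S (\<lambda>x. if j = k then axis l 1 $ i else f x $ i $ j)" for i j
      by (cases "j = k") (auto intro!: continuous_intros assms(1))
    hence "continuous_on S (\<lambda>x. \<chi> i j. if j = k then axis l 1 $ i else f x $ i $ j)"
      by (intro continuous_on_vec_lambda)
    thus ?thesis using assms(2) by (intro continuous_on_divide continuous_on_det assms(1)) auto
  qed
  have "continuous_on S (\<lambda>x. matrix_inv (f x) $ k $ l)" for k l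
    by (rule continuous_on_eq[OF c[of k l]]) (simp add: e)
  hence "continuous_on S (\<lambda>x. \<chi> k l. matrix_inv (f x) $ k $ l)" by (intro continuous_on_vec_lambda)
  thus ?thesis by simp
qed

text \<open>
  The Cayley transform \<open>Y = (E - I) (E + I)\<^sup>-\<^sup>1\<close> of \<open>E\<close> is scaled to \<open>s Y\<close>; multiplying out leaves a
  single inverse.
\<close>

definition cayley_path :: "real \<Rightarrow> 'n::finite phase_matrix \<Rightarrow> 'n phase_matrix" where
  "cayley_path s E = ((E + mat 1) + s *\<^sub>R (E - mat 1)) ** matrix_inv ((E + mat 1) - s *\<^sub>R (E - mat 1))"

text \<open>The denominator is \<open>2 (I + Z)\<close> with \<open>norm Z \<le> 1 / 2\<close>. It
  has no kernel, and the inverse \<open>W\<close> of \<open>I + Z\<close> satisfies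
  \<open>W = I - Z W\<close>, so half of its norm can be absorbed.\<close>

lemma cayley_path_denominator:
  fixes E :: "'n::finite phase_matrix"
  assumes "norm (E - mat 1) \<le> 1" "s \<in> {0..1}"
  defines "B \<equiv> (E + mat 1) - s *\<^sub>R (E - mat 1)"
  shows "det B \<noteq> 0" "norm (matrix_inv B) \<le> norm (mat 1 :: 'n phase_matrix)"
proof -
  define Z where "Z = ((1 - s) / 2) *\<^sub>R (E - mat 1)"
  have B: "B = 2 *\<^sub>R (mat 1 + Z)"
    by (simp add: B_def Z_def vec_eq_iff field_simps)
  have "norm Z = (1 - s) / 2 * norm (E - mat 1)" using assms(2) by (simp add: Z_def)
  also have "\<dots> \<le> (1 / 2) * 1" using assms(1,2) by (intro mult_mono) auto
  finally have Z: "norm Z \<le> 1 / 2" by simp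
  show det: "det B \<noteq> 0"
  proof
    assume "det B = 0"
    then obtain v where v: "v \<noteq> 0" "B *v v = 0" using det_zero_iff_kernel by blast
    hence "v = - (Z *v v)" by (simp add: B matrix_vec eq_neg_iff_add_eq_0)
    hence "norm v = norm (Z *v v)" by (metis norm_minus_cancel)
    also have "\<dots> \<le> 1 / 2 * norm v"
      using order.trans[OF norm_matrix_vector_mult mult_right_mono[OF Z norm_ge_zero]] .
    finally show False using v(1) by simp
  qed
  define W where "W = 2 *\<^sub>R matrix_inv B"
  have "B ** matrix_inv B = mat 1" using det by (rule matrix_inv_right)
  hence "(mat 1 + Z) ** W = mat 1"
    unfolding W_def by (simp add: B matrix_mult_scaleR_left matrix_mult_scaleR_right)
  hence "W = mat 1 - Z ** W" by (simp add: matrix_mult_add_rdistrib eq_diff_eq)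
  hence "norm W \<le> norm (mat 1 :: 'n phase_matrix) + norm (Z ** W)" by (metis norm_triangle_ineq4)
  also have "norm (Z ** W) \<le> 1 / 2 * norm W"
    using order.trans[OF norm_matrix_mult mult_right_mono[OF Z norm_ge_zero]] .
  finally have "norm W \<le> 2 * norm (mat 1 :: 'n phase_matrix)" by simp
  thus "norm (matrix_inv B) \<le> norm (mat 1 :: 'n phase_matrix)" by (simp add: W_def)
qed

text \<open>With \<open>p = E + I\<close> and \<open>q = s (E - I)\<close>, symplecticity of
  \<open>E\<close> makes the cross terms of \<open>p\<close> and \<open>q\<close> cancel. So the
  numerator \<open>p + q\<close> and the denominator \<open>p - q\<close> pull \<open>J\<close> back
  to the same form.\<close>

lemma cayley_path_symp:
  fixes E :: "'n::finite phase_matrix"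
  assumes "E \<in> symp_group" "norm (E - mat 1) \<le> 1" "s \<in> {0..1}"
  shows "cayley_path s E \<in> symp_group"
proof -
  define p where "p = E + mat 1"
  define q where "q = s *\<^sub>R (E - mat 1)"
  have tp: "transpose p = transpose E + mat 1" by (simp add: p_def transpose_def vec_eq_iff mat_def)
  have tq: "transpose q = s *\<^sub>R (transpose E - mat 1)" by (auto simp: q_def transpose_def vec_eq_iff mat_def)
  have tsum: "transpose (p + q) = transpose p + transpose q" "transpose (p - q) = transpose p - transpose q"
    by (simp_all add: transpose_def vec_eq_iff)
  have E: "transpose E ** symp_J ** E = symp_J" using assms(1) by (simp add: symp_group_iff)
  have "transpose p ** symp_J ** q + transpose q ** symp_J ** p = 0"
    unfolding tp tq by (simp add: p_def q_def matrix_ring E scaleR_diff_right scaleR_add_right)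
  hence c: "transpose q ** symp_J ** p = - (transpose p ** symp_J ** q)"
    by (simp add: eq_neg_iff_add_eq_0 add.commute)
  have AB: "transpose (p + q) ** symp_J ** (p + q) = transpose (p - q) ** symp_J ** (p - q)"
    unfolding tsum by (simp add: matrix_ring c)
  define V where "V = matrix_inv (p - q)"
  have V: "(p - q) ** V = mat 1"
    unfolding V_def p_def q_def
    by (rule matrix_inv_right[OF cayley_path_denominator(1)[OF assms(2,3)]])
  have "transpose ((p + q) ** V) ** symp_J ** ((p + q) ** V) = transpose V ** (transpose (p + q) ** symp_J ** (p + q)) ** V"
    by (simp only: matrix_transpose_mul matrix_mul_assoc)
  also have "\<dots> = transpose ((p - q) ** V) ** symp_J ** ((p - q) ** V)"
    unfolding AB by (simp only: matrix_transpose_mul matrix_mul_assoc)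
  also have "\<dots> = symp_J" unfolding V by simp
  finally show ?thesis
    unfolding symp_group_iff cayley_path_def p_def[symmetric] q_def[symmetric] V_def[symmetric] .
qed

lemma cayley_path_near:
  fixes E :: "'n::finite phase_matrix"
  assumes "norm (E - mat 1) \<le> 1" "s \<in> {0..1}"
  shows "norm (cayley_path s E - mat 1) \<le> 2 * norm (mat 1 :: 'n phase_matrix) * norm (E - mat 1)"
proof -
  let ?A = "(E + mat 1) + s *\<^sub>R (E - mat 1)" and ?B = "(E + mat 1) - s *\<^sub>R (E - mat 1)"
  have inv: "?B ** matrix_inv ?B = mat 1"
    by (rule matrix_inv_right[OF cayley_path_denominator(1)[OF assms]])
  have "cayley_path s E - mat 1 = (?A - ?B) ** matrix_inv ?B"
    unfolding cayley_path_def matrix_mult_diff_rdistrib[of ?A ?B] inv by (rule refl)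
  also have "?A - ?B = (2 * s) *\<^sub>R (E - mat 1)"
    by (simp add: vec_eq_iff algebra_simps)
  finally have "norm (cayley_path s E - mat 1) \<le> norm ((2 * s) *\<^sub>R (E - mat 1)) * norm (matrix_inv ?B)"
    by (simp only: norm_matrix_mult)
  also have "\<dots> \<le> (2 * norm (E - mat 1)) * norm (mat 1 :: 'n phase_matrix)"
  proof (intro mult_mono cayley_path_denominator(2)[OF assms])
    have "s * norm (E - mat 1) \<le> 1 * norm (E - mat 1)" using assms(2) by (intro mult_right_mono) auto
    thus "norm ((2 * s) *\<^sub>R (E - mat 1)) \<le> 2 * norm (E - mat 1)" using assms(2) by (simp add: abs_mult)
  qed auto
  finally show ?thesis by (simp add: mult_ac)
qed

lemma cayley_path_0: "norm (E - mat 1) \<le> 1 \<Longrightarrow> cayley_path 0 E = mat 1"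
  using cayley_path_near[of E 0] matrix_inv_right[OF cayley_path_denominator(1)[of E 0]]
  by (simp add: cayley_path_def)

lemma matrix_inv_two: "matrix_inv (2 *\<^sub>R mat 1 :: 'n::finite phase_matrix) = (1 / 2) *\<^sub>R mat 1"
proof -
  have "det (2 *\<^sub>R mat 1 :: 'n phase_matrix) \<noteq> 0"
    using cayley_path_denominator(1)[of "mat 1 :: 'n phase_matrix" 0] by (simp add: scaleR_2)
  from matrix_inv_right[OF this] have "2 *\<^sub>R matrix_inv (2 *\<^sub>R mat 1 :: 'n phase_matrix) = mat 1"
    by (simp add: matrix_mult_scaleR_left)
  from arg_cong[OF this, of "scaleR (1 / 2)"] show ?thesis by simp
qed

lemma cayley_path_1: "cayley_path 1 E = E"
proof -
  have "(E + mat 1) + 1 *\<^sub>R (E - mat 1) = 2 *\<^sub>R E" "(E + mat 1) - 1 *\<^sub>R (E - mat 1) = 2 *\<^sub>R mat 1"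
    by (simp_all add: vec_eq_iff)
  thus ?thesis unfolding cayley_path_def by (simp add: matrix_inv_two matrix_mult_scaleR_right)
qed

lemma cayley_path_one: "cayley_path s (mat 1 :: 'n::finite phase_matrix) = mat 1"
proof -
  have h: "(mat 1 + mat 1) + s *\<^sub>R (mat 1 - mat 1) = (2 *\<^sub>R mat 1 :: 'n phase_matrix)"
    "(mat 1 + mat 1) - s *\<^sub>R (mat 1 - mat 1) = (2 *\<^sub>R mat 1 :: 'n phase_matrix)"
    by (simp_all add: scaleR_2)
  thus ?thesis
    unfolding cayley_path_def h matrix_inv_two by (simp add: matrix_mult_scaleR_right)
qed

lemma continuous_on_cayley_path:
  fixes f :: "'b::topological_space \<Rightarrow> 'n::finite phase_matrix"
  assumes "continuous_on S g" "continuous_on S f" "\<And>x. x \<in> S \<Longrightarrow> g x \<in> {0..1}" "\<And>x. x \<in> S \<Longrightarrow> norm (f x - mat 1) \<le> 1"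
  shows "continuous_on S (\<lambda>x. cayley_path (g x) (f x))"
  unfolding cayley_path_def
  by (intro continuous_intros continuous_on_matrix_inv assms(1,2) cayley_path_denominator(1) assms(3,4))

lemma continuous_on_symp_inv [continuous_intros]:
  fixes f :: "'b::topological_space \<Rightarrow> 'n::finite phase_matrix"
  assumes "continuous_on S f"
  shows "continuous_on S (\<lambda>x. symp_inv (f x))"
  unfolding symp_inv_def by (intro continuous_intros assms)

text \<open>The discrepancy \<open>symp_inv (\<xi> t) ** \<eta> t\<close> is shrunk to the identity
  along its Cayley path. At the end points it is the identity and stays so, which keeps the homotopy
  relative to the end points.\<close>

lemma homotopic_near:
  fixes \<eta> \<xi> :: "real \<Rightarrow> 'n::finite phase_matrix"
  assumes "continuous_on {a..b} \<eta>" "\<eta> ` {a..b} \<subseteq> symp_group"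
    and "continuous_on {a..b} \<xi>" "\<xi> ` {a..b} \<subseteq> symp_group"
    and "\<xi> a = \<eta> a" "\<xi> b = \<eta> b" "a \<le> b"
    and near: "\<And>t. t \<in> {a..b} \<Longrightarrow> norm (symp_inv (\<xi> t) ** \<eta> t - mat 1) \<le> 1"
  shows "homotopic_with_canon (\<lambda>h. h a = \<eta> a \<and> h b = \<eta> b) {a..b} symp_group \<eta> \<xi>"
proof -
  define E where "E t = symp_inv (\<xi> t) ** \<eta> t" for t
  have grp: "\<xi> t \<in> symp_group" "\<eta> t \<in> symp_group" if "t \<in> {a..b}" for t using assms(2,4) that by auto
  have E: "E t \<in> symp_group" if "t \<in> {a..b}" for t
    unfolding E_def by (intro symp_group_mult symp_group_inv grp that)
  have contE: "continuous_on {a..b} E"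
    unfolding E_def by (intro continuous_intros assms(1,3))
  have Eone: "E t = mat 1" if "t = a \<or> t = b" for t
    using that assms(5-7) grp(2)[of t] by (auto simp: E_def symp_inv_left)
  have XE: "\<xi> t ** E t = \<eta> t" if "t \<in> {a..b}" for t
    by (simp add: E_def matrix_mul_assoc symp_inv_right[OF grp(1)[OF that]])
  define h where "h x = \<xi> (snd x) ** cayley_path (1 - fst x) (E (snd x))" for x
  have "homotopic_with_canon (\<lambda>h. h a = \<eta> a \<and> h b = \<eta> b) {a..b} symp_group (\<lambda>t. h (0, t)) (\<lambda>t. h (1, t))"
    unfolding homotopic_with_def
  proof (intro exI[of _ h] conjI allI ballI)
    have "continuous_on ({0..1} \<times> {a..b}) h"
      unfolding h_def
      by (intro continuous_intros continuous_on_cayley_path continuous_on_compose2[OF contE]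
          continuous_on_compose2[OF assms(3)]) (auto simp: E_def intro!: near)
    moreover have "h \<in> {0..1} \<times> {a..b} \<rightarrow> symp_group"
      unfolding h_def by (auto intro!: symp_group_mult cayley_path_symp grp E simp: near[folded E_def])
    ultimately show "continuous_map (prod_topology (top_of_set {0..1}) (top_of_set {a..b})) (top_of_set symp_group) h"
      by simp
    show "h (s, a) = \<eta> a" "h (s, b) = \<eta> b" for s
      using Eone assms(5,6) by (simp_all add: h_def cayley_path_one)
  qed auto
  thus ?thesis
  proof (rule homotopic_with_eq)
    fix t assume "t \<in> topspace (top_of_set {a..b})"
    hence t: "t \<in> {a..b}" by simp
    show "\<eta> t = h (0, t)" by (simp add: h_def cayley_path_1 XE[OF t])
    show "\<xi> t = h (1, t)" using near[OF t, folded E_def] by (simp add: h_def cayley_path_0)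
  next
    fix h k assume "\<And>x. x \<in> topspace (top_of_set {a..b}) \<Longrightarrow> h x = (k x :: 'n phase_matrix)"
    thus "(h a = \<eta> a \<and> h b = \<eta> b) = (k a = \<eta> a \<and> k b = \<eta> b)" using assms(7) by simp
  qed
qed

text \<open>
  The polygon of transvections is corrected at every step: from the point reached near \<open>\<eta> (t i)\<close> one
  aims at \<open>\<eta> (t (i + 1))\<close>, and the new error is quadratic in the old one.
\<close>

lemma transverse_representative:
  fixes \<eta> :: "real \<Rightarrow> 'n::finite phase_matrix"
  assumes ab: "a < b" and cont: "continuous_on {a..b} \<eta>" and grp: "\<eta> ` {a..b} \<subseteq> symp_group"
    and ends: "\<eta> a \<notin> symp_sing 1" "\<eta> b \<notin> symp_sing 1"
  shows "\<exists>\<xi>. homotopic_with_canon (\<lambda>h. h a = \<eta> a \<and> h b = \<eta> b) {a..b} symp_group \<eta> \<xi> \<and>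
    transverse_path 1 \<xi> a b"
proof -
  have G: "\<eta> t \<in> symp_group" if "t \<in> {a..b}" for t using grp that by blast
  obtain C where C: "C \<ge> 1" and step: "\<And>e (K :: 'n phase_matrix) M a b. 0 < e \<Longrightarrow> C * e \<le> 1 \<Longrightarrow> K \<in> symp_group \<Longrightarrow>
      norm (K - mat 1) \<le> 2 * e \<Longrightarrow> M \<in> symp_group \<Longrightarrow> M \<notin> symp_sing 1 \<Longrightarrow> a < b \<Longrightarrow>
      \<exists>\<xi>. transverse_path 1 \<xi> a b \<and> \<xi> a = M \<and> norm (symp_inv (\<xi> b) ** (M ** K) - mat 1) \<le> C * e\<^sup>2 \<and>
        (\<forall>t\<in>{a..b}. norm (symp_inv (\<xi> t) ** (M ** K) - mat 1) \<le> C * e)"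
    by (rule symp_step[where 'n = 'n], erule that, assumption)
  \<comment> \<open>Within this radius of \<open>\<eta> b\<close> all matrices are regular, which
    leaves room for a crossing-free last piece.\<close>
  obtain r where r: "r > 0" "\<And>X. norm (X - mat 1) < r \<Longrightarrow> det (\<eta> b ** X - mat 1) \<noteq> 0"
  proof -
    have "det (\<eta> b ** mat 1 - mat 1) \<noteq> 0" using ends(2) G[of b] ab by (simp add: symp_sing_1)
    moreover have "continuous_on UNIV (\<lambda>X. det (\<eta> b ** X - mat 1))" by (intro continuous_intros)
    ultimately obtain r where "r > 0" "\<And>X. dist (mat 1) X < r \<Longrightarrow> det (\<eta> b ** X - mat 1) \<noteq> 0"
      using continuous_on_open_avoid[of UNIV "\<lambda>X. det (\<eta> b ** X - mat 1)" "mat 1" 0] by auto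
    thus ?thesis by (intro that[of r]) (auto simp: dist_norm norm_minus_commute)
  qed
  define j where "j = norm (symp_J :: 'n phase_matrix) ^ 2"
  define c0 where "c0 = 2 * norm (mat 1 :: 'n phase_matrix)"
  have j: "j \<ge> 0" and c0: "c0 \<ge> 0" by (simp_all add: j_def c0_def)
  \<comment> \<open>The summands are the demands of the later estimates: \<open>4 * C\<close> for a
    step of the polygon, and the two brackets, which are the coefficients in \<open>bound1\<close>
    and \<open>bound2\<close>.\<close>
  define K where "K = 4 * C + (4 * j * c0 + 2 * j + 2 * c0) + (6 * j * c0 + 2)"
  define e where "e = min 1 (r / 2) / K"
  have jc: "j * c0 \<ge> 0" using j c0 by simp
  have K: "K = 4 * C + 10 * (j * c0) + 2 * j + 2 * c0 + 2" by (simp add: K_def)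
  have K1: "K \<ge> 4" "4 * C \<le> K" using C j c0 jc unfolding K by linarith+
  have e: "e > 0" "e * K \<le> 1" "e * K < r" using r(1) K1(1) by (auto simp: e_def)
  have e4K: "4 * e \<le> 1" using mult_left_mono[OF K1(1) less_imp_le[OF e(1)]] e(2) by linarith
  have e1: "e \<le> 1" using e(1) e4K by linarith
  have ee: "e * e \<le> e" using e(1) e1 by (simp add: mult_left_le)
  have eC: "4 * (C * e) \<le> 1" "e \<le> C * e"
    using mult_left_mono[OF K1(2) less_imp_le[OF e(1)]] mult_right_mono[OF C less_imp_le[OF e(1)]] e(2)
    by (simp_all add: mult_ac)
  have bound1: "(4 * j * c0 + 2 * j + 2 * c0) * e < r"
  proof -
    have "(4 * j * c0 + 2 * j + 2 * c0) * e \<le> K * e" using e(1) C jc j c0 by (intro mult_right_mono) (auto simp: K_def)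
    thus ?thesis using e(3) by (simp add: mult.commute)
  qed
  have bound2: "(6 * j * c0 + 2) * e \<le> 1"
  proof -
    have "(6 * j * c0 + 2) * e \<le> K * e" using e(1) C jc j c0 by (intro mult_right_mono) (auto simp: K_def)
    thus ?thesis using e(2) by (simp add: mult.commute)
  qed
  define F where "F s t = symp_inv (\<eta> s) ** \<eta> t" for s t
  have contF: "continuous_on ({a..b} \<times> {a..b}) (\<lambda>x. F (fst x) (snd x))"
    unfolding F_def by (intro continuous_intros continuous_on_compose2[OF cont]) auto
  have F1: "F t t = mat 1" if "t \<in> {a..b}" for t unfolding F_def by (rule symp_inv_left[OF G[OF that]])
  have ucont: "uniformly_continuous_on ({a..b} \<times> {a..b}) (\<lambda>x. F (fst x) (snd x))"
    by (rule compact_uniformly_continuous[OF contF]) (intro compact_Times compact_Icc)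
  obtain h where h: "h > 0" "\<And>s t. s \<in> {a..b} \<Longrightarrow> t \<in> {a..b} \<Longrightarrow> \<bar>s - t\<bar> < h \<Longrightarrow> norm (F s t - mat 1) \<le> e / 2"
  proof -
    obtain h where h: "h > 0" "\<And>x y. x \<in> {a..b} \<times> {a..b} \<Longrightarrow> y \<in> {a..b} \<times> {a..b} \<Longrightarrow> dist y x < h \<Longrightarrow>
        dist (F (fst y) (snd y)) (F (fst x) (snd x)) < e / 2"
      using ucont e(1) unfolding uniformly_continuous_on_def by (metis half_gt_zero)
    have "norm (F s t - mat 1) \<le> e / 2" if st: "s \<in> {a..b}" "t \<in> {a..b}" "\<bar>s - t\<bar> < h" for s t
      using h(2)[of "(t, t)" "(s, t)"] st F1[OF st(2)] by (simp add: dist_Pair_Pair dist_real_def dist_norm)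
    with h(1) that show ?thesis by blast
  qed
  obtain n :: nat where n: "n > 0" "(b - a) / real n < h"
  proof -
    obtain n :: nat where "(b - a) / h < real n" using reals_Archimedean2 by blast
    moreover from this have "n > 0" using ab h(1) by (cases n) (auto simp: divide_less_0_iff)
    ultimately show ?thesis using h(1) by (intro that[of n]) (auto simp: field_simps)
  qed
  define w where "w = (b - a) / n"
  define t where "t i = a + real i * w" for i
  have w: "w > 0" "w < h" using n ab by (auto simp: w_def)
  have nw: "real n * w = b - a" using n(1) by (simp add: w_def)
  have tin: "t i \<in> {a..b}" if "i \<le> n" for i
  proof -
    have "real i * w \<le> real n * w" using that w by (intro mult_right_mono) auto
    thus ?thesis using w nw by (simp add: t_def)
  qed
  \<comment> \<open>Nodes are met up to \<open>e / 2\<close>. The increment of \<open>\<eta>\<close>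
    adds at most another \<open>e / 2\<close>, so the matrix aimed at is within \<open>2 * e\<close>
    of the identity, and the new error \<open>C * e^2 \<le> e / 2\<close> restores the
    invariant.\<close>
  have poly: "\<exists>\<xi>. transverse_path 1 \<xi> a (t i) \<and> \<xi> a = \<eta> a \<and> norm (symp_inv (\<xi> (t i)) ** \<eta> (t i) - mat 1) \<le> e / 2 \<and>
      (\<forall>s\<in>{a..t i}. norm (symp_inv (\<xi> s) ** \<eta> s - mat 1) \<le> 1)" if "i \<le> n" for i
    using that
  proof (induction i)
    case 0
    have a: "a \<in> {a..b}" using ab by simp
    have "norm (symp_inv (\<eta> a) ** \<eta> a - mat 1) = 0" using symp_inv_left[OF G[OF a]] by simp
    thus ?case using e(1) transverse_const[OF G[OF a] ends(1), of a a]
      by (intro exI[of _ "\<lambda>_. \<eta> a"]) (auto simp: t_def)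
  next
    case (Suc i)
    obtain \<xi> where \<xi>: "transverse_path 1 \<xi> a (t i)" "\<xi> a = \<eta> a" "norm (symp_inv (\<xi> (t i)) ** \<eta> (t i) - mat 1) \<le> e / 2"
      "\<And>s. s \<in> {a..t i} \<Longrightarrow> norm (symp_inv (\<xi> s) ** \<eta> s - mat 1) \<le> 1"
      using Suc by auto
    have ti: "t i \<in> {a..b}" "t (Suc i) \<in> {a..b}" using tin[of i] tin[of "Suc i"] Suc.prems by auto
    have lt: "t i < t (Suc i)" "t (Suc i) - t i = w" using w by (simp_all add: t_def algebra_simps)
    define M where "M = \<xi> (t i)"
    have M: "M \<in> symp_group" "M \<notin> symp_sing 1"
      using \<xi>(1) ti(1) unfolding M_def transverse_path_def by (auto simp: image_subset_iff)
    define X where "X = symp_inv M ** \<eta> (t (Suc i))"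
    have X: "X \<in> symp_group" unfolding X_def by (intro symp_group_mult symp_group_inv M(1) G ti)
    have MX: "M ** X = \<eta> (t (Suc i))" by (simp add: X_def matrix_mul_assoc symp_inv_right[OF M(1)])
    have "X = (symp_inv M ** (\<eta> (t i) ** symp_inv (\<eta> (t i)))) ** \<eta> (t (Suc i))"
      by (simp add: X_def symp_inv_right[OF G[OF ti(1)]])
    hence X': "X = (symp_inv M ** \<eta> (t i)) ** F (t i) (t (Suc i))" by (simp only: F_def matrix_mul_assoc)
    have d2: "norm (F (t i) (t (Suc i)) - mat 1) \<le> e / 2" using h(2)[OF ti] lt w by simp
    have "norm (X - mat 1) \<le> (e / 2) * (e / 2) + e / 2 + e / 2"
      unfolding X'
      by (intro order.trans[OF near_one_mult] add_mono mult_mono d2 \<xi>(3)[folded M_def]) (use e(1) in auto)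
    also have "\<dots> \<le> 2 * e" using ee e(1) by simp
    finally have Xe: "norm (X - mat 1) \<le> 2 * e" .
    obtain \<zeta> where \<zeta>: "transverse_path 1 \<zeta> (t i) (t (Suc i))" "\<zeta> (t i) = M"
      "norm (symp_inv (\<zeta> (t (Suc i))) ** \<eta> (t (Suc i)) - mat 1) \<le> C * e\<^sup>2"
      "\<And>s. s \<in> {t i..t (Suc i)} \<Longrightarrow> norm (symp_inv (\<zeta> s) ** \<eta> (t (Suc i)) - mat 1) \<le> C * e"
      using step[OF e(1) _ X Xe M lt(1)] eC(1) C e(1) unfolding MX by auto
    define z where "z s = (if s \<le> t i then \<xi> s else \<zeta> s)" for s
    have "transverse_path 1 z a (t (Suc i))"
      unfolding z_def by (rule transverse_path_join[OF \<xi>(1) \<zeta>(1)]) (use \<zeta>(2) ti lt in \<open>auto simp: M_def\<close>)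
    moreover have "z a = \<eta> a" using \<xi>(2) ti by (simp add: z_def)
    moreover have "norm (symp_inv (z (t (Suc i))) ** \<eta> (t (Suc i)) - mat 1) \<le> e / 2"
    proof -
      have "C * e\<^sup>2 \<le> e / 2" using mult_right_mono[OF eC(1), of e] e(1) by (simp add: power2_eq_square mult_ac)
      thus ?thesis using \<zeta>(3) lt by (simp add: z_def)
    qed
    moreover have "norm (symp_inv (z s) ** \<eta> s - mat 1) \<le> 1" if s: "s \<in> {a..t (Suc i)}" for s
    proof (cases "s \<le> t i")
      case True thus ?thesis using \<xi>(4) s by (simp add: z_def)
    next
      case False
      have sab: "s \<in> {a..b}" using s ti by auto
      have "symp_inv (\<zeta> s) ** \<eta> s = (symp_inv (\<zeta> s) ** (\<eta> (t (Suc i)) ** symp_inv (\<eta> (t (Suc i))))) ** \<eta> s"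
        by (simp add: symp_inv_right[OF G[OF ti(2)]])
      hence eq: "symp_inv (\<zeta> s) ** \<eta> s = (symp_inv (\<zeta> s) ** \<eta> (t (Suc i))) ** F (t (Suc i)) s"
        by (simp only: F_def matrix_mul_assoc)
      have "norm (F (t (Suc i)) s - mat 1) \<le> e / 2" using h(2)[OF ti(2) sab] False s lt w by simp
      hence "norm (symp_inv (\<zeta> s) ** \<eta> s - mat 1) \<le> (C * e) * (e / 2) + C * e + e / 2"
        unfolding eq by (intro order.trans[OF near_one_mult] add_mono mult_mono \<zeta>(4)) (use e(1) C s False in auto)
      also have "\<dots> \<le> (C * e) * 1 + C * e + C * e"
        using eC e(1) e1 C by (intro add_mono mult_left_mono) auto
      also have "\<dots> \<le> 1" using eC e(1) by linarith
      finally show ?thesis using False by (simp add: z_def)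
    qed
    ultimately show ?case by blast
  qed
  \<comment> \<open>The polygon stops one node early. It would reach \<open>\<eta> b\<close> only
    approximately, so the last interval is bridged by a Cayley path among the regular matrices near
    \<open>\<eta> b\<close>, which ends exactly there.\<close>
  define c where "c = t (n - 1)"
  have c: "c \<in> {a..b}" "c < b" "b - c = w"
  proof -
    have "real (n - 1) * w = (b - a) - w" using n(1) nw by (simp add: of_nat_diff left_diff_distrib)
    thus "b - c = w" by (simp add: c_def t_def)
    thus "c < b" using w by simp
    show "c \<in> {a..b}" unfolding c_def by (rule tin) simp
  qed
  obtain \<xi> where \<xi>: "transverse_path 1 \<xi> a c" "\<xi> a = \<eta> a" "norm (symp_inv (\<xi> c) ** \<eta> c - mat 1) \<le> e / 2"
      "\<And>s. s \<in> {a..c} \<Longrightarrow> norm (symp_inv (\<xi> s) ** \<eta> s - mat 1) \<le> 1"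
    using poly[of "n - 1"] by (auto simp: c_def)
  define M where "M = \<xi> c"
  have M: "M \<in> symp_group" "M \<notin> symp_sing 1"
    using \<xi>(1) c(1) unfolding M_def transverse_path_def by (auto simp: image_subset_iff)
  have bb: "b \<in> {a..b}" using ab by simp
  have near: "norm (symp_inv M ** \<eta> s - mat 1) \<le> 2 * e" if s: "s \<in> {c..b}" for s
  proof -
    have sab: "s \<in> {a..b}" using s c by auto
    have "symp_inv M ** \<eta> s = (symp_inv M ** (\<eta> c ** symp_inv (\<eta> c))) ** \<eta> s"
      by (simp add: symp_inv_right[OF G[OF c(1)]])
    hence eq: "symp_inv M ** \<eta> s = (symp_inv M ** \<eta> c) ** F c s" by (simp only: F_def matrix_mul_assoc)
    have "norm (F c s - mat 1) \<le> e / 2" using h(2)[OF c(1) sab] s c w by simp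
    hence "norm (symp_inv M ** \<eta> s - mat 1) \<le> (e / 2) * (e / 2) + e / 2 + e / 2"
      unfolding eq by (intro order.trans[OF near_one_mult] add_mono mult_mono \<xi>(3)[folded M_def]) (use e(1) in auto)
    also have "\<dots> \<le> 2 * e" using ee e(1) by simp
    finally show ?thesis .
  qed
  define E where "E = symp_inv M ** \<eta> b"
  have E: "E \<in> symp_group" unfolding E_def by (intro symp_group_mult symp_group_inv M(1) G bb)
  have E2: "norm (E - mat 1) \<le> 2 * e" unfolding E_def using near[of b] c by simp
  have e4: "2 * e \<le> 1" using e(1) e4K by linarith
  have E1: "norm (E - mat 1) \<le> 1" using E2 e4 by simp
  define u where "u s = (s - c) / (b - c)" for s
  have u: "u s \<in> {0..1}" if "s \<in> {c..b}" for s using that c by (auto simp: u_def)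
  define D where "D s = cayley_path (u s) E" for s
  have Dgrp: "D s \<in> symp_group" if "s \<in> {c..b}" for s unfolding D_def by (rule cayley_path_symp[OF E E1 u[OF that]])
  have Dnear: "norm (D s - mat 1) \<le> c0 * (2 * e)" if "s \<in> {c..b}" for s
    using order.trans[OF cayley_path_near[OF E1 u[OF that]] mult_left_mono[OF E2]] unfolding D_def c0_def by simp
  have ME: "M = \<eta> b ** symp_inv E"
  proof -
    have "\<eta> b ** symp_inv E = M ** (E ** symp_inv E)"
      by (simp add: E_def matrix_mul_assoc symp_inv_right[OF M(1)])
    thus ?thesis by (simp add: symp_inv_right[OF E])
  qed
  have Dreg: "M ** D s \<notin> symp_sing 1" if s: "s \<in> {c..b}" for s
  proof -
    have "norm (symp_inv E - mat 1) \<le> j * (2 * e)"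
      using order.trans[OF near_one_inv mult_left_mono[OF E2]] by (simp add: j_def)
    hence "norm (symp_inv E ** D s - mat 1) \<le> (j * (2 * e)) * (c0 * (2 * e)) + j * (2 * e) + c0 * (2 * e)"
      by (intro order.trans[OF near_one_mult] add_mono mult_mono Dnear s) (use j e(1) in auto)
    also have "\<dots> = 4 * (j * c0) * (e * e) + j * (2 * e) + c0 * (2 * e)" by simp
    also have "\<dots> \<le> 4 * (j * c0) * e + j * (2 * e) + c0 * (2 * e)"
      using mult_left_mono[OF ee, of "4 * (j * c0)"] jc by (simp add: mult_ac)
    also have "\<dots> = (4 * j * c0 + 2 * j + 2 * c0) * e" by (simp add: algebra_simps)
    finally have "norm (symp_inv E ** D s - mat 1) < r" using bound1 by linarith
    hence "det (\<eta> b ** (symp_inv E ** D s) - mat 1) \<noteq> 0" by (rule r(2))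
    moreover have "\<eta> b ** (symp_inv E ** D s) = M ** D s" by (simp add: matrix_mul_assoc ME[symmetric])
    ultimately show ?thesis by (simp add: symp_sing_1)
  qed
  have contD: "continuous_on {c..b} D"
    unfolding D_def u_def
    by (rule continuous_on_cayley_path) (use c E1 u in \<open>auto intro!: continuous_intros simp: u_def\<close>)
  have \<zeta>: "transverse_path 1 (\<lambda>s. M ** D s) c b"
    unfolding transverse_path_def
    using Dreg c(2) contD Dgrp M(1) by (auto intro!: continuous_intros symp_group_mult)
  define z where "z s = (if s \<le> c then \<xi> s else M ** D s)" for s
  have Dc: "D c = mat 1" using E1 by (simp add: D_def u_def cayley_path_0)
  have tz: "transverse_path 1 z a b"
    unfolding z_def by (rule transverse_path_join[OF \<xi>(1) \<zeta>]) (use c in \<open>auto simp: M_def[symmetric] Dc\<close>)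
  have za: "z a = \<eta> a" using \<xi>(2) c by (simp add: z_def)
  have zb: "z b = \<eta> b"
    using c by (simp add: z_def D_def u_def cayley_path_1 E_def matrix_mul_assoc symp_inv_right[OF M(1)])
  have znear: "norm (symp_inv (z s) ** \<eta> s - mat 1) \<le> 1" if s: "s \<in> {a..b}" for s
  proof (cases "s \<le> c")
    case True thus ?thesis using \<xi>(4) s by (simp add: z_def)
  next
    case False
    hence s': "s \<in> {c..b}" using s by simp
    have eq: "symp_inv (z s) ** \<eta> s = symp_inv (D s) ** (symp_inv M ** \<eta> s)"
      using False by (simp add: z_def symp_inv_mult matrix_mul_assoc)
    have "norm (symp_inv (D s) - mat 1) \<le> j * (c0 * (2 * e))"
      using order.trans[OF near_one_inv mult_left_mono[OF Dnear[OF s']]] by (simp add: j_def)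
    hence "norm (symp_inv (z s) ** \<eta> s - mat 1) \<le> (j * (c0 * (2 * e))) * (2 * e) + j * (c0 * (2 * e)) + 2 * e"
      unfolding eq by (intro order.trans[OF near_one_mult] add_mono mult_mono near s') (use j c0 e(1) in auto)
    also have "\<dots> = 4 * (j * c0) * (e * e) + 2 * (j * c0) * e + 2 * e" by simp
    also have "\<dots> \<le> 4 * (j * c0) * e + 2 * (j * c0) * e + 2 * e"
      using mult_left_mono[OF ee, of "4 * (j * c0)"] jc by (simp add: mult_ac)
    also have "\<dots> = (6 * j * c0 + 2) * e" by (simp add: algebra_simps)
    finally show ?thesis using bound2 by linarith
  qed
  have "continuous_on {a..b} z" "z ` {a..b} \<subseteq> symp_group" using tz by (auto simp: transverse_path_def)
  hence "homotopic_with_canon (\<lambda>h. h a = \<eta> a \<and> h b = \<eta> b) {a..b} symp_group \<eta> z"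
    using homotopic_near[OF cont grp _ _ za zb less_imp_le[OF ab] znear] by blast
  with tz show ?thesis by blast
qed

section \<open>The rotation of a product\<close>

text \<open>
  A real matrix splits into a part commuting with \<open>J\<close> (complex linear) and a part anticommuting
  with \<open>J\<close> (antilinear).  The projection \<open>proj_pos\<close> onto the \<open>\<i>\<close>-eigenspace of \<open>J\<close> turns the complex
  determinant of the complex linear part into an ordinary determinant.
\<close>

definition lin_part :: "'n::finite phase_matrix \<Rightarrow> 'n phase_matrix" where
  "lin_part M = (1 / 2) *\<^sub>R (M - symp_J ** M ** symp_J)"

definition antilin_part :: "'n::finite phase_matrix \<Rightarrow> 'n phase_matrix" where
  "antilin_part M = (1 / 2) *\<^sub>R (M + symp_J ** M ** symp_J)"

section \<open>The eigenprojections of \<open>J\<close> and the complex determinant\<close>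

definition i_J :: "complex^('n::finite + 'n)^('n + 'n)" where
  "i_J = mat \<i> ** cmat symp_J"

definition proj_pos :: "complex^('n::finite + 'n)^('n + 'n)" where
  "proj_pos = (1 / 2) *\<^sub>R (mat 1 - i_J)"

definition proj_neg :: "complex^('n::finite + 'n)^('n + 'n)" where
  "proj_neg = (1 / 2) *\<^sub>R (mat 1 + i_J)"

text \<open>For \<open>K\<close> commuting with \<open>J\<close> this is the determinant of
  \<open>K\<close> on the \<open>\<i>\<close>-eigenspace of \<open>J\<close>, that is, its complex
  determinant. Adding \<open>proj_neg\<close> puts the identity on the complementary eigenspace, so
  that a determinant of full size can be used.\<close>

definition lin_det :: "'n::finite phase_matrix \<Rightarrow> complex" where
  "lin_det K = det (cmat K ** proj_pos + proj_neg)"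

lemma i_J_cmat: "cmat K ** i_J = mat \<i> ** cmat (K ** symp_J)" "i_J ** cmat K = mat \<i> ** cmat (symp_J ** K)"
  for K :: "'n::finite phase_matrix"
proof -
  have "cmat K ** i_J = (cmat K ** mat \<i>) ** cmat symp_J" by (simp only: i_J_def matrix_mul_assoc)
  thus "cmat K ** i_J = mat \<i> ** cmat (K ** symp_J)"
    by (simp only: mat_commute[of "cmat K"] cmat_mult matrix_mul_assoc)
  show "i_J ** cmat K = mat \<i> ** cmat (symp_J ** K)"
    by (simp only: i_J_def cmat_mult matrix_mul_assoc)
qed

lemma i_J_conj: "i_J ** cmat K ** i_J = - cmat (symp_J ** K ** symp_J)"
  for K :: "'n::finite phase_matrix"
proof -
  have "i_J ** cmat K ** i_J = mat \<i> ** (cmat (symp_J ** K) ** i_J)"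
    by (simp only: i_J_cmat(2) matrix_mul_assoc)
  also have "\<dots> = (mat \<i> ** mat \<i>) ** cmat (symp_J ** K ** symp_J)"
    by (simp only: i_J_cmat(1) matrix_mul_assoc)
  finally show ?thesis by (simp add: mat_mult_mat matrix_mult_minus_left)
qed

lemma i_J_squared: "i_J ** i_J = mat 1" "A ** i_J ** i_J = A"
proof -
  have "i_J ** cmat (mat 1) ** i_J = mat 1" by (simp only: i_J_conj) (simp add: cmat_simps)
  thus 1: "i_J ** i_J = mat 1" by (simp add: cmat_simps)
  show "A ** i_J ** i_J = A" by (simp add: matrix_mul_assoc[symmetric] 1)
qed

lemma proj_add: "proj_pos + proj_neg = mat 1"
  by (simp add: proj_pos_def proj_neg_def scaleR_add_right[symmetric])

lemma proj_mult:
  "proj_pos ** proj_pos = proj_pos" "proj_neg ** proj_neg = proj_neg"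
  "proj_pos ** proj_neg = 0" "proj_neg ** proj_pos = 0"
proof -
  show z: "proj_pos ** proj_neg = 0" "proj_neg ** proj_pos = 0"
    by (simp_all add: proj_pos_def proj_neg_def matrix_ring i_J_squared scaleR_add_right scaleR_diff_right)
  show "proj_pos ** proj_pos = proj_pos" using proj_add z
    by (metis add.right_neutral matrix_add_ldistrib matrix_mul_rid)
  show "proj_neg ** proj_neg = proj_neg" using proj_add z
    by (metis add.left_neutral matrix_add_ldistrib matrix_mul_rid)
qed

lemma proj_mult_assoc:
  "A ** proj_pos ** proj_pos = A ** proj_pos" "A ** proj_neg ** proj_neg = A ** proj_neg"
  "A ** proj_pos ** proj_neg = 0" "A ** proj_neg ** proj_pos = 0"
  by (simp_all add: matrix_mul_assoc[symmetric] proj_mult)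

lemma proj_commute:
  fixes K :: "'n::finite phase_matrix"
  assumes "symp_J ** K = K ** symp_J"
  shows "cmat K ** proj_pos = proj_pos ** cmat K" "cmat K ** proj_neg = proj_neg ** cmat K"
  by (simp_all add: proj_pos_def proj_neg_def matrix_ring i_J_cmat assms)

lemma J_conj: "symp_J ** (symp_J ** M ** symp_J) = - (M ** symp_J)" "(symp_J ** M ** symp_J) ** symp_J = - (symp_J ** M)"
proof -
  have "symp_J ** (symp_J ** M ** symp_J) = (symp_J ** symp_J) ** (M ** symp_J)" by (simp only: matrix_mul_assoc)
  thus "symp_J ** (symp_J ** M ** symp_J) = - (M ** symp_J)" by (simp add: matrix_mult_minus_left)
  have "(symp_J ** M ** symp_J) ** symp_J = (symp_J ** M) ** (symp_J ** symp_J)" by (simp only: matrix_mul_assoc)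
  thus "(symp_J ** M ** symp_J) ** symp_J = - (symp_J ** M)" by (simp add: matrix_mult_minus_right)
qed

lemma lin_part_commute: "symp_J ** lin_part M = lin_part M ** symp_J"
  unfolding lin_part_def matrix_mult_scaleR_left matrix_mult_scaleR_right matrix_mult_diff_ldistrib
    matrix_mult_diff_rdistrib J_conj by (simp add: add.commute)

lemma antilin_part_anticommute: "symp_J ** antilin_part M = - (antilin_part M ** symp_J)"
  unfolding antilin_part_def matrix_mult_scaleR_left matrix_mult_scaleR_right matrix_add_ldistrib
    matrix_mult_add_rdistrib J_conj by (simp add: scaleR_minus_right[symmetric] del: scaleR_minus_right)

lemma antilin_part_commute: "symp_J ** (antilin_part N ** antilin_part M) = (antilin_part N ** antilin_part M) ** symp_J"
proof -
  have "symp_J ** (antilin_part N ** antilin_part M) = (symp_J ** antilin_part N) ** antilin_part M"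
    by (simp only: matrix_mul_assoc)
  also have "\<dots> = - ((antilin_part N ** symp_J) ** antilin_part M)"
    by (simp only: antilin_part_anticommute matrix_mult_minus_left)
  also have "\<dots> = - (antilin_part N ** (symp_J ** antilin_part M))"
    by (simp only: matrix_mul_assoc)
  finally show ?thesis by (simp only: antilin_part_anticommute matrix_mult_minus_right matrix_mul_assoc minus_minus)
qed

text \<open>A composition of two antilinear maps is linear, while mixed compositions are
  antilinear.\<close>

lemma lin_part_mult: "lin_part (N ** M) = lin_part N ** lin_part M + antilin_part N ** antilin_part M"
proof -
  have "(symp_J ** N ** symp_J) ** (symp_J ** M ** symp_J) = (symp_J ** N) ** (symp_J ** (symp_J ** M ** symp_J))"
    by (simp only: matrix_mul_assoc)
  hence e: "(symp_J ** N ** symp_J) ** (symp_J ** M ** symp_J) = - (symp_J ** (N ** M) ** symp_J)"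
    by (simp only: J_conj(1) matrix_mult_minus_right) (simp only: matrix_mul_assoc)
  have q: "lin_part N ** lin_part M = (1 / 4) *\<^sub>R ((N - symp_J ** N ** symp_J) ** (M - symp_J ** M ** symp_J))"
    "antilin_part N ** antilin_part M = (1 / 4) *\<^sub>R ((N + symp_J ** N ** symp_J) ** (M + symp_J ** M ** symp_J))"
    unfolding lin_part_def antilin_part_def matrix_mult_scaleR_left matrix_mult_scaleR_right scaleR_scaleR by simp_all
  have "4 *\<^sub>R (lin_part N ** lin_part M + antilin_part N ** antilin_part M) =
      (N - symp_J ** N ** symp_J) ** (M - symp_J ** M ** symp_J) + (N + symp_J ** N ** symp_J) ** (M + symp_J ** M ** symp_J)"
    unfolding q by (simp only: scaleR_add_right scaleR_scaleR) simp
  also have "\<dots> = 2 *\<^sub>R (N ** M + (symp_J ** N ** symp_J) ** (symp_J ** M ** symp_J))"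
    unfolding matrix_add_ldistrib matrix_mult_add_rdistrib matrix_mult_diff_ldistrib matrix_mult_diff_rdistrib
    by (simp add: vec_eq_iff)
  also have "\<dots> = 4 *\<^sub>R lin_part (N ** M)" unfolding e by (simp add: lin_part_def vec_eq_iff)
  finally show ?thesis by simp
qed

lemma lin_det_mult:
  fixes K L :: "'n::finite phase_matrix"
  assumes "symp_J ** K = K ** symp_J" "symp_J ** L = L ** symp_J"
  shows "lin_det (K ** L) = lin_det K * lin_det L"
proof -
  have "(cmat K ** proj_pos + proj_neg) ** (cmat L ** proj_pos + proj_neg) =
      cmat K ** (proj_pos ** cmat L) ** proj_pos + cmat K ** (proj_pos ** proj_neg) + (proj_neg ** cmat L) ** proj_pos + proj_neg ** proj_neg"
    by (simp add: matrix_add_ldistrib matrix_mult_add_rdistrib matrix_mul_assoc)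
  also have "\<dots> = cmat (K ** L) ** proj_pos + proj_neg"
    by (simp add: proj_commute[OF assms(2), symmetric] proj_mult cmat_mult matrix_mul_assoc proj_mult_assoc)
  finally show ?thesis unfolding lin_det_def by (metis det_mul)
qed

lemma lin_det_nonzero:
  fixes K :: "'n::finite phase_matrix"
  assumes comm: "symp_J ** K = K ** symp_J" and inj: "\<And>a. K *v a = 0 \<Longrightarrow> a = 0"
  shows "lin_det K \<noteq> 0"
proof
  assume "lin_det K = 0"
  then obtain v where v: "v \<noteq> 0" "(cmat K ** proj_pos + proj_neg) *v v = 0"
    unfolding lin_det_def det_zero_iff_kernel by blast
  have "proj_neg ** (cmat K ** proj_pos + proj_neg) = cmat K ** (proj_neg ** proj_pos) + proj_neg ** proj_neg"
    by (simp add: matrix_add_ldistrib matrix_mul_assoc proj_commute(2)[OF comm])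
  hence "proj_neg ** (cmat K ** proj_pos + proj_neg) = proj_neg" by (simp add: proj_mult)
  hence neg: "proj_neg *v v = 0" using v(2) by (metis matrix_vector_mul_assoc matrix_vector_mult_0_right)
  hence "cmat K *v (proj_pos *v v) = 0" using v(2) by (simp add: matrix_vec)
  moreover have "proj_pos *v v + proj_neg *v v = v"
    by (simp add: matrix_vector_mult_add_rdistrib[symmetric] proj_add)
  ultimately have "cmat K *v v = 0" using neg by simp
  hence "K *v vec_Re v = 0" "K *v vec_Im v = 0"
    using vec_Re_Im_cmat[of K v] by (simp_all add: vec_Re_Im_simps)
  hence "v = 0" using inj vec_Re_Im_zero by blast
  with v(1) show False by contradiction
qed

text \<open>The doubled matrix with blocks \<open>lin_part N\<close> and
  \<open>antilin_part N\<close> preserves an indefinite form. With \<open>a\<close> and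
  \<open>b\<close> the two images, \<open>a + b = N (c + e)\<close> and
  \<open>a - b = - J N J (c - e)\<close>, so the difference of squares
  \<open>(a + b) \<bullet> (a - b)\<close> is evaluated by the symplectic form.\<close>

lemma krein_identity:
  assumes "N \<in> symp_group"
  shows "(lin_part N *v c + antilin_part N *v e) \<bullet> (lin_part N *v c + antilin_part N *v e) -
    (antilin_part N *v c + lin_part N *v e) \<bullet> (antilin_part N *v c + lin_part N *v e) = c \<bullet> c - e \<bullet> e"
proof -
  let ?a = "lin_part N *v c + antilin_part N *v e" and ?b = "antilin_part N *v c + lin_part N *v e"
  have sum: "lin_part N + antilin_part N = N" "lin_part N - antilin_part N = - (symp_J ** N ** symp_J)"
    by (simp_all add: lin_part_def antilin_part_def vec_eq_iff field_simps)
  have "?a + ?b = (lin_part N + antilin_part N) *v (c + e)" by (simp add: matrix_vec)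
  moreover have "?a - ?b = (lin_part N - antilin_part N) *v (c - e)" by (simp add: matrix_vec)
  ultimately have "(?a + ?b) \<bullet> (?a - ?b) = - ((N *v (c + e)) \<bullet> (symp_J *v (N *v (symp_J *v (c - e)))))"
    unfolding sum by (simp only: matrix_vector_mult_minus_left matrix_vector_mul_assoc inner_minus_right matrix_mul_assoc)
  also have "\<dots> = (c + e) \<bullet> (c - e)"
    unfolding symp_form[OF assms] by (simp add: inner_diff_right)
  finally show ?thesis by (simp add: inner_add_left inner_diff_right inner_add_right inner_diff_left inner_commute)
qed

text \<open>Interpolates between the product of the linear parts at \<open>u = 0\<close>, where the
  determinant is multiplicative, and the linear part of the product at \<open>u = 1\<close>.\<close>

definition mixed_part :: "'n::finite phase_matrix \<Rightarrow> 'n phase_matrix \<Rightarrow> real \<Rightarrow> 'n phase_matrix" where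
  "mixed_part N M u = lin_part N ** lin_part M + u *\<^sub>R (antilin_part N ** antilin_part M)"

text \<open>Let \<open>c\<close> and \<open>e\<close> be the linear and antilinear images of a
  kernel vector \<open>a\<close> under \<open>M\<close>. The identity for \<open>M\<close> gives
  \<open>c \<bullet> c - e \<bullet> e = a \<bullet> a\<close>, the one for \<open>N\<close>,
  applied to \<open>c\<close> and \<open>u e\<close>, gives that \<open>c \<bullet> c\<close> is at
  most \<open>u^2\<close> times \<open>e \<bullet> e\<close>. For \<open>u \<le> 1\<close> this
  forces \<open>a = 0\<close>.\<close>

lemma mixed_part_nonzero:
  assumes N: "N \<in> symp_group" and M: "M \<in> symp_group" and u: "u \<in> {0..1}"
  shows "lin_det (mixed_part N M u) \<noteq> 0"
proof (rule lin_det_nonzero)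
  have "symp_J ** (lin_part N ** lin_part M) = (lin_part N ** lin_part M) ** symp_J"
    by (metis lin_part_commute matrix_mul_assoc)
  thus "symp_J ** mixed_part N M u = mixed_part N M u ** symp_J"
    by (simp add: mixed_part_def matrix_add_ldistrib matrix_mult_add_rdistrib matrix_mult_scaleR_left
        matrix_mult_scaleR_right antilin_part_commute)
  fix a assume a: "mixed_part N M u *v a = 0"
  define c where "c = lin_part M *v a"
  define e where "e = antilin_part M *v a"
  have "lin_part N *v c + antilin_part N *v (u *\<^sub>R e) = 0"
    using a by (simp add: mixed_part_def c_def e_def matrix_vec)
  hence "c \<bullet> c - u\<^sup>2 * (e \<bullet> e) = - ((antilin_part N *v c + lin_part N *v (u *\<^sub>R e)) \<bullet> (antilin_part N *v c + lin_part N *v (u *\<^sub>R e)))"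
    using krein_identity[OF N, of c "u *\<^sub>R e"] by (simp add: power2_eq_square mult.assoc)
  hence "c \<bullet> c - u\<^sup>2 * (e \<bullet> e) \<le> 0" by (simp only: neg_le_0_iff_le inner_ge_zero)
  moreover have "c \<bullet> c - e \<bullet> e = a \<bullet> a" using krein_identity[OF M, of a 0] by (simp add: c_def e_def)
  moreover have "u\<^sup>2 * (e \<bullet> e) \<le> 1 * (e \<bullet> e)"
    using u by (intro mult_right_mono) (auto simp: power_le_one)
  ultimately have "a \<bullet> a \<le> 0" by linarith
  hence "a \<bullet> a = 0" using inner_ge_zero[of a] by linarith
  thus "a = 0" by simp
qed

text \<open>\<open>X = proj_pos ** M ** proj_neg\<close> has square zero. Scaling one eigenspace by
  2 conjugates \<open>I - X\<close> to \<open>I - X / 2\<close>, whose square is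
  \<open>I - X\<close>; so the determinant equals its own square and is nonzero.\<close>

lemma det_square_zero:
  fixes M :: "complex^('n::finite + 'n)^('n + 'n)"
  shows "det (mat 1 - proj_pos ** M ** proj_neg) = 1"
proof -
  define X where "X = proj_pos ** M ** proj_neg"
  have XX: "X ** X = 0"
  proof -
    have "X ** X = proj_pos ** M ** (proj_neg ** proj_pos) ** M ** proj_neg"
      by (simp only: X_def matrix_mul_assoc)
    thus ?thesis by (simp add: proj_mult)
  qed
  define Y where "Y = (1 / 2) *\<^sub>R X"
  have YY: "Y ** Y = 0" "Y + Y = X" by (simp_all add: Y_def matrix_mult_scaleR_left matrix_mult_scaleR_right XX scaleR_add_left[symmetric])
  have sq: "(mat 1 - Y) ** (mat 1 - Y) = mat 1 - X"
    by (simp add: matrix_mult_diff_ldistrib matrix_mult_diff_rdistrib YY(1) YY(2)[symmetric])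
  have inv: "(mat 1 - Y) ** (mat 1 + Y) = mat 1"
    by (simp add: matrix_add_ldistrib matrix_mult_diff_rdistrib YY(1))
  hence nz: "det (mat 1 - Y) \<noteq> 0" by (metis det_I det_mul mult_zero_left zero_neq_one)
  let ?D = "proj_pos + 2 *\<^sub>R proj_neg :: complex^('n + 'n)^('n + 'n)"
  let ?E = "proj_pos + (1 / 2) *\<^sub>R proj_neg :: complex^('n + 'n)^('n + 'n)"
  have DE: "?D ** ?E = mat 1"
    by (simp add: matrix_add_ldistrib matrix_mult_add_rdistrib matrix_mult_scaleR_left matrix_mult_scaleR_right proj_mult proj_add)
  have DX: "?D ** X = X"
    by (simp add: X_def matrix_mult_add_rdistrib matrix_mult_scaleR_left matrix_mul_assoc proj_mult)
  have XE: "X ** ?E = Y"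
    by (simp add: Y_def X_def matrix_add_ldistrib matrix_mult_scaleR_right proj_mult_assoc)
  have "?D ** (mat 1 - X) ** ?E = mat 1 - Y"
    by (simp add: matrix_mult_diff_ldistrib matrix_mult_diff_rdistrib DX XE DE)
  hence "det ?D * det (mat 1 - X) * det ?E = det (mat 1 - Y)" by (metis det_mul)
  moreover have "det ?D * det ?E = 1" by (metis DE det_mul det_I)
  ultimately have "det (mat 1 - X) = det (mat 1 - Y)" by (metis mult.assoc mult.commute mult.right_neutral)
  moreover have "det (mat 1 - X) = det (mat 1 - Y) * det (mat 1 - Y)" by (metis sq det_mul)
  ultimately show ?thesis using nz by (simp add: X_def)
qed

text \<open>With \<open>P = proj_pos\<close> and \<open>N = proj_neg\<close>, the matrix at
  \<open>r = 1\<close> is \<open>2 (P M - N)\<close>. Multiplying by the reflection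
  \<open>P - N\<close> and splitting off the factor \<open>I - P M N\<close> of determinant 1 leaves
  \<open>P M P + N\<close>. The constant \<open>k\<close> is the same for all \<open>M\<close> and
  so does not affect changes of argument.\<close>

lemma cayley_det_lin_det:
  obtains k where "k \<noteq> 0" "\<And>M :: 'n::finite phase_matrix. cayley_det M 1 = k * lin_det (lin_part M)"
proof -
  let ?P = "proj_pos :: complex^('n + 'n)^('n + 'n)" and ?N = "proj_neg :: complex^('n + 'n)^('n + 'n)"
  have refl: "det (?P - ?N) * det (?P - ?N) = 1"
  proof -
    have "(?P - ?N) ** (?P - ?N) = ?P + ?N"
      by (simp add: matrix_mult_diff_ldistrib matrix_mult_diff_rdistrib proj_mult)
    from arg_cong[OF this, of det] show ?thesis by (simp only: det_mul proj_add det_I)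
  qed
  define k where "k = det (mat 2 :: complex^('n + 'n)^('n + 'n)) * det (?P - ?N)"
  have two: "det (mat 2 :: complex^('n + 'n)^('n + 'n)) \<noteq> 0"
  proof -
    have "mat 2 ** mat (1 / 2) = (mat 1 :: complex^('n + 'n)^('n + 'n))" by (simp add: mat_mult_mat)
    from arg_cong[OF this, of det] show ?thesis by (auto simp: det_mul)
  qed
  have "cayley_det M 1 = k * lin_det (lin_part M)" for M :: "'n phase_matrix"
  proof -
    let ?M = "cmat M"
    have "cmat (M - mat 1) - mat (\<i> * complex_of_real 1) ** cmat (symp_J ** (M + mat 1)) =
        cmat (M - mat 1) - i_J ** cmat (M + mat 1)"
      by (simp add: i_J_cmat)
    also have "\<dots> = 2 *\<^sub>R (?P ** ?M - ?N)"
      by (simp add: cmat_simps matrix_ring proj_pos_def proj_neg_def scaleR_diff_right scaleR_add_right)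
    also have "\<dots> = mat 2 ** (?P ** ?M - ?N)"
      by (simp add: vec_eq_iff mat_mult_nth scaleR_conv_of_real[where 'a = complex])
    finally have c: "cayley_det M 1 = det (mat 2 :: complex^('n + 'n)^('n + 'n)) * det (?P ** ?M - ?N)"
      unfolding cayley_det_def by (simp only: det_mul)
    have "cmat (lin_part M) = (1 / 2) *\<^sub>R (?M + i_J ** ?M ** i_J)"
      unfolding i_J_conj by (simp add: lin_part_def cmat_simps)
    hence CP: "cmat (lin_part M) ** ?P = ?P ** ?M ** ?P"
      by (simp add: proj_pos_def matrix_ring i_J_squared scaleR_add_right scaleR_diff_right)
    have "(?P ** ?M - ?N) ** (?P - ?N) = ?P ** ?M ** ?P - ?P ** ?M ** ?N + ?N"
      by (simp add: matrix_mult_diff_ldistrib matrix_mult_diff_rdistrib proj_mult)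
    also have "\<dots> = (mat 1 - ?P ** ?M ** ?N) ** (?P ** ?M ** ?P + ?N)"
      by (simp add: matrix_add_ldistrib matrix_mult_diff_rdistrib matrix_mul_assoc proj_mult_assoc)
    finally have E: "(?P ** ?M - ?N) ** (?P - ?N) = (mat 1 - ?P ** ?M ** ?N) ** (?P ** ?M ** ?P + ?N)" .
    have "det (?P ** ?M - ?N) * det (?P - ?N) = lin_det (lin_part M)"
      using arg_cong[OF E, of det] by (simp only: lin_det_def CP det_square_zero det_mul mult_1)
    moreover have "det (?P ** ?M - ?N) = det (?P ** ?M - ?N) * det (?P - ?N) * det (?P - ?N)"
      unfolding mult.assoc refl by simp
    ultimately have "det (?P ** ?M - ?N) = det (?P - ?N) * lin_det (lin_part M)"
      by (simp only: mult.commute)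
    thus ?thesis unfolding c k_def by simp
  qed
  moreover have "k \<noteq> 0" using two refl by (auto simp: k_def)
  ultimately show ?thesis using that by blast
qed

section \<open>The rotation of a path and of a product of paths\<close>

definition rotation :: "(real \<Rightarrow> 'n::finite phase_matrix) \<Rightarrow> real \<Rightarrow> real \<Rightarrow> real" where
  "rotation \<gamma> a b = arg_change (\<lambda>t. cayley_det (\<gamma> t) 1) a b"

lemma continuous_on_lin_det [continuous_intros]:
  fixes f :: "'b::topological_space \<Rightarrow> 'n::finite phase_matrix"
  assumes "continuous_on S f"
  shows "continuous_on S (\<lambda>x. lin_det (f x))" "continuous_on S (\<lambda>x. lin_part (f x))" "continuous_on S (\<lambda>x. antilin_part (f x))"
  unfolding lin_det_def lin_part_def antilin_part_def by (intro continuous_intros assms)+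

text \<open>At \<open>u = 0\<close> the function \<open>F\<close> is a product of determinants,
  whose arguments add exactly; at \<open>u = 1\<close> it belongs to the product of the paths. The
  interpolation is affine in \<open>u\<close> and free of zeros, so each of the two ends costs at
  most \<open>pi * CARD('n + 'n)\<close>.\<close>

lemma rotation_mult:
  fixes N M :: "real \<Rightarrow> 'n::finite phase_matrix"
  assumes ab: "a \<le> b" and N: "continuous_on {a..b} N" "N ` {a..b} \<subseteq> symp_group"
    and M: "continuous_on {a..b} M" "M ` {a..b} \<subseteq> symp_group"
  shows "\<bar>rotation (\<lambda>t. N t ** M t) a b - rotation N a b - rotation M a b\<bar> \<le> 2 * pi * CARD('n + 'n)"
proof -
  have g: "N t \<in> symp_group" "M t \<in> symp_group" if "t \<in> {a..b}" for t using N(2) M(2) that by auto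
  obtain k where k: "k \<noteq> 0" "\<And>M :: 'n phase_matrix. cayley_det M 1 = k * lin_det (lin_part M)"
    using cayley_det_lin_det by blast
  have nz: "lin_det (lin_part X) \<noteq> 0" if "X \<in> symp_group" for X :: "'n phase_matrix"
    using cayley_det_nonzero[OF that, of 1] k by auto
  have rot: "rotation X a b = arg_change (\<lambda>t. lin_det (lin_part (X t))) a b"
    if X: "continuous_on {a..b} X" "\<And>t. t \<in> {a..b} \<Longrightarrow> X t \<in> symp_group" for X :: "real \<Rightarrow> 'n phase_matrix"
    unfolding rotation_def k(2)
    by (rule arg_change_cmult[OF ab _ _ k(1)]) (auto intro!: continuous_intros X nz)
  define F where "F x = lin_det (mixed_part (N (fst x)) (M (fst x)) (snd x))" for x
  have cF: "continuous_on ({a..b} \<times> {0..1}) F"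
    unfolding F_def mixed_part_def
    by (intro continuous_intros continuous_on_compose2[OF N(1)] continuous_on_compose2[OF M(1)]) auto
  have F1: "F (t, 1) = lin_det (lin_part (N t ** M t))" for t
    by (simp add: F_def mixed_part_def lin_part_mult)
  have F0: "F (t, 0) = lin_det (lin_part (N t)) * lin_det (lin_part (M t))" for t
    by (simp add: F_def mixed_part_def lin_det_mult lin_part_commute)
  have side: "\<bar>arg_change (\<lambda>u. F (t, u)) 0 1\<bar> \<le> pi * CARD('n + 'n)" if t: "t \<in> {a..b}" for t
  proof -
    define A where "A = cmat (lin_part (N t) ** lin_part (M t)) ** proj_pos + proj_neg"
    define X where "X = cmat (antilin_part (N t) ** antilin_part (M t)) ** proj_pos"
    have e: "F (t, u) = det (\<chi> i j. A $ i $ j + complex_of_real u * X $ i $ j)" for u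
    proof -
      have "cmat (mixed_part (N t) (M t) u) ** proj_pos + proj_neg = A + u *\<^sub>R X"
        by (simp add: mixed_part_def cmat_simps A_def X_def matrix_mult_add_rdistrib matrix_mult_scaleR_left)
      also have "\<dots> = (\<chi> i j. A $ i $ j + complex_of_real u * X $ i $ j)"
        by (simp add: vec_eq_iff scaleR_conv_of_real[where 'a = complex])
      finally show ?thesis by (simp add: F_def lin_det_def)
    qed
    have "F (t, u) \<noteq> 0" if "u \<in> {0..1}" for u
      unfolding F_def using mixed_part_nonzero[OF g[OF t] that] by simp
    thus ?thesis using arg_change_det_affine[of A X] unfolding e by blast
  qed
  have "arg_change (\<lambda>t. F (t, 0)) a b + arg_change (\<lambda>u. F (b, u)) 0 1 =
      arg_change (\<lambda>u. F (a, u)) 0 1 + arg_change (\<lambda>t. F (t, 1)) a b"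
    by (rule arg_change_rectangle[OF ab _ cF]) (simp_all add: F_def mixed_part_nonzero g)
  moreover have "arg_change (\<lambda>t. F (t, 1)) a b = rotation (\<lambda>t. N t ** M t) a b"
    unfolding F1 by (rule rot[symmetric]) (auto intro!: continuous_intros N(1) M(1) symp_group_mult g)
  moreover have "arg_change (\<lambda>t. F (t, 0)) a b = rotation N a b + rotation M a b"
  proof -
    have "rotation N a b = arg_change (\<lambda>t. lin_det (lin_part (N t))) a b"
      "rotation M a b = arg_change (\<lambda>t. lin_det (lin_part (M t))) a b"
      by (rule rot[OF N(1)], rule g(1), assumption, rule rot[OF M(1)], rule g(2), assumption)
    moreover have "arg_change (\<lambda>t. lin_det (lin_part (N t)) * lin_det (lin_part (M t))) a b =
        arg_change (\<lambda>t. lin_det (lin_part (N t))) a b + arg_change (\<lambda>t. lin_det (lin_part (M t))) a b"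
      by (rule arg_change_mult[OF ab]) (simp_all add: continuous_intros N(1) M(1) nz g)
    ultimately show ?thesis unfolding F0 by simp
  qed
  ultimately show ?thesis using side[of a] side[of b] ab by (auto simp: abs_le_iff)
qed

section \<open>The Maslov-type index and the rotation\<close>

text \<open>The right-hand side depends only on the homotopy class relative to the end points, so
  all transverse representatives have the same count. As one exists, the definite description is
  resolved.\<close>

lemma intersection_number_formula:
  fixes \<eta> :: "real \<Rightarrow> 'n::finite phase_matrix"
  assumes "a < b" "continuous_on {a..b} \<eta>" "\<eta> ` {a..b} \<subseteq> symp_group"
    and "\<eta> a \<notin> symp_sing 1" "\<eta> b \<notin> symp_sing 1"
  shows "pi * of_int (intersection_number 1 \<eta> a b) = rotation \<eta> a b - (boundary_angle (\<eta> b) - boundary_angle (\<eta> a))"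
proof -
  let ?H = "\<lambda>\<xi>. homotopic_with_canon (\<lambda>h. h a = \<eta> a \<and> h b = \<eta> b) {a..b} symp_group \<eta> \<xi>"
  have val: "pi * of_int (crossing_count 1 \<xi> a b) = rotation \<eta> a b - (boundary_angle (\<eta> b) - boundary_angle (\<eta> a))"
    if "?H \<xi>" "transverse_path 1 \<xi> a b" for \<xi>
  proof -
    have "\<xi> a = \<eta> a \<and> \<xi> b = \<eta> b"
      using homotopic_with_imp_property[OF that(1)] by blast
    thus ?thesis
      using crossing_count_formula[OF assms(1) that(2)] arg_change_homotopic[OF less_imp_le[OF assms(1)] that(1)]
      by (simp add: rotation_def)
  qed
  obtain \<xi> where \<xi>: "?H \<xi>" "transverse_path 1 \<xi> a b" using transverse_representative[OF assms] by blast
  have "intersection_number 1 \<eta> a b = crossing_count 1 \<xi> a b"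
    unfolding intersection_number_def
  proof (rule the_equality)
    show "\<exists>\<zeta>. ?H \<zeta> \<and> transverse_path 1 \<zeta> a b \<and> crossing_count 1 \<xi> a b = crossing_count 1 \<zeta> a b"
      using \<xi> by blast
    fix n assume "\<exists>\<zeta>. ?H \<zeta> \<and> transverse_path 1 \<zeta> a b \<and> n = crossing_count 1 \<zeta> a b"
    then obtain \<zeta> where "?H \<zeta>" "transverse_path 1 \<zeta> a b" "n = crossing_count 1 \<zeta> a b" by blast
    hence "pi * of_int n = pi * of_int (crossing_count 1 \<xi> a b)" using val \<xi> by simp
    thus "n = crossing_count 1 \<xi> a b" by simp
  qed
  thus ?thesis using val[OF \<xi>] by simp
qed

section \<open>Shifting a path off the hypersurface\<close>

definition rot_J :: "real \<Rightarrow> 'n::finite phase_matrix" where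
  "rot_J s = cos s *\<^sub>R mat 1 + sin s *\<^sub>R symp_J"

lemma rot_J_mult: "rot_J s ** rot_J t = rot_J (s + t)"
  by (simp add: rot_J_def matrix_ring cos_add sin_add algebra_simps)

lemma rot_J_symp: "rot_J s \<in> symp_group"
proof (rule symp_groupI)
  fix x y
  have c: "cos s * cos s * r + sin s * sin s * r = r" for r :: real
    by (metis distrib_right mult_1 power2_eq_square sin_cos_squared_add2)
  show "(rot_J s *v x) \<bullet> (symp_J *v (rot_J s *v y)) = x \<bullet> (symp_J *v y)"
    using c[of "x \<bullet> (symp_J *v y)"]
    by (simp add: rot_J_def matrix_vec inner_add_left inner_add_right inner_diff_right inner_J_left algebra_simps)
qed

text \<open>
  With \<open>r = tan (s / 2)\<close> the rotation \<open>e\<^sup>s\<^sup>J\<close> is \<open>(1 + r J) (1 - r J)\<^sup>-\<^sup>1\<close>, so that \<open>det (e\<^sup>-\<^sup>s\<^sup>J M - I)\<close> vanishes only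
  where the polynomial \<open>det ((M - I) - r J (M + I))\<close> does.
\<close>

lemma rot_J_regular:
  fixes M :: "'n::finite phase_matrix"
  assumes M: "M \<in> symp_group"
  shows "\<exists>d>0. \<forall>s. 0 < s \<and> s < d \<longrightarrow> rot_J (- s) ** M \<notin> symp_sing 1"
proof -
  define X where "X = - cmat (symp_J ** (M + mat 1))"
  obtain p where p: "\<And>r. poly p r = det (\<chi> i j. cmat (M - mat 1) $ i $ j + r * X $ i $ j)"
    using det_affine_poly[of "cmat (M - mat 1)" X] by blast
  \<comment> \<open>The polynomial is nonzero because its value at \<open>\<i>\<close> is
    \<open>cayley_det M 1\<close>. It has finitely many roots, so an interval to the right of 0 is
    free of them.\<close>
  have "poly p \<i> = cayley_det M 1"
    unfolding p cayley_det_def X_def by (rule arg_cong[where f = det]) (simp add: vec_eq_iff mat_mult_nth)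
  hence "p \<noteq> 0" using cayley_det_nonzero[OF M, of 1] by auto
  hence "finite {z. poly p z = 0}" by (rule poly_roots_finite)
  hence fin: "finite {r :: real. poly p (complex_of_real r) = 0}"
    using finite_vimageI[of "{z. poly p z = 0}" complex_of_real] by (simp add: inj_of_real vimage_def)
  obtain d where d: "d > 0" "\<And>r. poly p (complex_of_real r) = 0 \<Longrightarrow> r \<noteq> 0 \<Longrightarrow> d \<le> dist 0 r"
    using finite_set_avoid[OF fin, of 0] by auto
  have pr: "poly p (complex_of_real r) = complex_of_real (det ((M - mat 1) - r *\<^sub>R (symp_J ** (M + mat 1))))" for r
    unfolding p det_cmat[symmetric] X_def by (rule arg_cong[where f = det]) (simp add: vec_eq_iff)
  have reg: "rot_J (- s) ** M \<notin> symp_sing 1" if s: "0 < s" "s < min pi (2 * arctan d)" for s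
  proof
    assume "rot_J (- s) ** M \<in> symp_sing 1"
    then obtain v where v: "v \<noteq> 0" "(rot_J (- s) ** M - mat 1) *v v = 0"
      unfolding symp_sing_1 det_zero_iff_kernel by blast
    hence "rot_J (- s) *v (M *v v) = v" by (simp add: matrix_vec)
    hence "rot_J s *v v = (rot_J s ** rot_J (- s)) *v (M *v v)" by (simp add: matrix_vector_mul_assoc[symmetric])
    hence Mv: "M *v v = cos s *\<^sub>R v + sin s *\<^sub>R (symp_J *v v)"
      unfolding rot_J_mult by (simp add: rot_J_def matrix_vec)
    define r where "r = tan (s / 2)"
    have s2: "0 < s / 2" "s / 2 < pi / 2" "s / 2 < arctan d" using s by auto
    have c: "cos (s / 2) > 0" using s2 by (intro cos_gt_zero_pi) auto
    have r: "r > 0" unfolding r_def using s2 by (intro tan_gt_zero) auto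
    have "r < d"
      unfolding r_def using tan_monotone[of "s / 2" "arctan d"] s2 arctan_ubound[of d] pi_gt_zero by (simp add: tan_arctan)
    have cs: "cos s - 1 = - (r * sin s)" "sin s = r * (cos s + 1)"
    proof -
      have "s = 2 * (s / 2)" by simp
      hence e: "cos s = 1 - 2 * (sin (s / 2))\<^sup>2" "cos s = 2 * (cos (s / 2))\<^sup>2 - 1" "sin s = 2 * sin (s / 2) * cos (s / 2)"
        by (metis cos_double_sin, metis cos_double_cos, metis sin_double)
      show "cos s - 1 = - (r * sin s)" using c unfolding e(1) e(3) by (simp add: r_def tan_def power2_eq_square)
      show "sin s = r * (cos s + 1)" using c unfolding e(2) e(3) by (simp add: r_def tan_def power2_eq_square)
    qed
    have "((M - mat 1) - r *\<^sub>R (symp_J ** (M + mat 1))) *v v =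
        (cos s - 1 + r * sin s) *\<^sub>R v + (sin s - r * (cos s + 1)) *\<^sub>R (symp_J *v v)"
      by (simp add: matrix_vec Mv algebra_simps)
    also have "\<dots> = 0" using cs by simp
    finally have "det ((M - mat 1) - r *\<^sub>R (symp_J ** (M + mat 1))) = 0" using v(1) det_zero_iff_kernel by blast
    hence "d \<le> dist 0 r" using d(2)[of r] r pr by simp
    with \<open>r < d\<close> r show False by (simp add: dist_real_def)
  qed
  have "min pi (2 * arctan d) > 0" using d(1) by (simp add: zero_less_arctan_iff)
  with reg show ?thesis by blast
qed

lemma rotation_no_crossing:
  fixes \<eta> :: "real \<Rightarrow> 'n::finite phase_matrix"
  assumes "a < b" "continuous_on {a..b} \<eta>" "\<And>t. t \<in> {a..b} \<Longrightarrow> \<eta> t \<in> symp_group \<and> \<eta> t \<notin> symp_sing 1"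
  shows "rotation \<eta> a b = boundary_angle (\<eta> b) - boundary_angle (\<eta> a)"
proof -
  have tr: "transverse_path 1 \<eta> a b" unfolding transverse_path_def using assms by auto
  have none: "{t. t \<in> {a<..<b} \<and> \<eta> t \<in> symp_sing 1} = {}" using assms(3) by auto
  have "crossing_count 1 \<eta> a b = 0" unfolding crossing_count_def none by simp
  thus ?thesis using crossing_count_formula[OF assms(1) tr] by (simp add: rotation_def)
qed

text \<open>Of the constant 4, one half comes from the two boundary angles and one half from
  splitting the constant factor \<open>rot_J (- (d / 2))\<close> off the shifted path.\<close>

lemma maslov_index_rotation:
  fixes \<gamma> :: "real \<Rightarrow> 'n::finite phase_matrix"
  assumes T: "0 < T" and cont: "continuous_on {0..T} \<gamma>" and grp: "\<gamma> ` {0..T} \<subseteq> symp_group"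
  shows "\<bar>pi * of_int (maslov_index 1 (mat 1) \<gamma> 0 T) - rotation \<gamma> 0 T\<bar> \<le> 4 * pi * CARD('n + 'n)"
proof -
  have G: "\<gamma> t \<in> symp_group" if "t \<in> {0..T}" for t using grp that by blast
  define \<eta> where "\<eta> e t = matrix_exp (- e *\<^sub>R symp_J) ** \<gamma> t ** matrix_inv (mat 1)" for e t
  have inv1: "matrix_inv (mat 1 :: 'n phase_matrix) = mat 1"
    using matrix_inv_right[of "mat 1 :: 'n phase_matrix"] by simp
  have \<eta>: "\<eta> e t = rot_J (- e) ** \<gamma> t" for e t
    by (simp add: \<eta>_def inv1) (simp add: matrix_exp_J[of "- e", simplified] rot_J_def)
  obtain d0 where d0: "d0 > 0" "\<And>s. 0 < s \<Longrightarrow> s < d0 \<Longrightarrow> rot_J (- s) ** \<gamma> 0 \<notin> symp_sing 1"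
    using rot_J_regular[OF G[of 0]] T by auto
  obtain d1 where d1: "d1 > 0" "\<And>s. 0 < s \<Longrightarrow> s < d1 \<Longrightarrow> rot_J (- s) ** \<gamma> T \<notin> symp_sing 1"
    using rot_J_regular[OF G[of T]] T by auto
  define d where "d = min d0 d1"
  have d: "d > 0" using d0(1) d1(1) by (simp add: d_def)
  have reg: "\<eta> s t \<notin> symp_sing 1" if "0 < s" "s < d" "t = 0 \<or> t = T" for s t
    using d0(2) d1(2) that by (auto simp: \<eta> d_def)
  have grp\<eta>: "\<eta> s t \<in> symp_group" if "t \<in> {0..T}" for s t
    unfolding \<eta> by (intro symp_group_mult rot_J_symp G that)
  have cont2: "continuous_on ({a..b} \<times> {0..T}) (\<lambda>x. \<eta> (fst x) (snd x))" for a b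
    unfolding \<eta> rot_J_def by (intro continuous_intros continuous_on_compose2[OF cont]) auto
  have cont\<eta>: "continuous_on {0..T} (\<eta> s)" for s
    unfolding \<eta> by (intro continuous_intros cont)
  define I where "I s = intersection_number 1 (\<eta> s) 0 T" for s
  have I: "pi * of_int (I s) = rotation (\<eta> s) 0 T - (boundary_angle (\<eta> s T) - boundary_angle (\<eta> s 0))"
    if "0 < s" "s < d" for s
    unfolding I_def
    by (rule intersection_number_formula[OF T cont\<eta>]) (use grp\<eta> reg that in auto)
  \<comment> \<open>While the shift varies in \<open>(0, d)\<close> the end points do not cross the
    hypersurface, so their rotation is exactly the change of their boundary angles, and both cancel
    in the rectangle identity.\<close>
  have const: "I s = I r" if sr: "0 < s" "s < r" "r < d" for s r
  proof -
    have side: "rotation (\<lambda>e. \<eta> e t) s r = boundary_angle (\<eta> r t) - boundary_angle (\<eta> s t)" if t: "t = 0 \<or> t = T" for t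
    proof (rule rotation_no_crossing[OF sr(2)])
      show "continuous_on {s..r} (\<lambda>e. \<eta> e t)" unfolding \<eta> rot_J_def by (intro continuous_intros)
      fix e assume "e \<in> {s..r}"
      thus "\<eta> e t \<in> symp_group \<and> \<eta> e t \<notin> symp_sing 1" using grp\<eta>[of t e] reg[of e t] t sr T by auto
    qed
    have "arg_change (\<lambda>e. cayley_det (\<eta> e 0) 1) s r + arg_change (\<lambda>t. cayley_det (\<eta> r t) 1) 0 T =
        arg_change (\<lambda>t. cayley_det (\<eta> s t) 1) 0 T + arg_change (\<lambda>e. cayley_det (\<eta> e T) 1) s r"
      by (rule arg_change_rectangle[of s r 0 T "\<lambda>x. cayley_det (\<eta> (fst x) (snd x)) 1", simplified])
         (use sr T cont2 cayley_det_nonzero[OF grp\<eta>, of _ 1] in \<open>auto intro!: continuous_intros\<close>)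
    hence "pi * of_int (I s) = pi * of_int (I r)"
      using I[of s] I[of r] side[of 0] side[of T] sr by (simp add: rotation_def)
    thus ?thesis by simp
  qed
  define n where "n = I (d / 2)"
  have In: "I s = n" if "0 < s" "s < d" for s
  proof (cases s "d / 2" rule: linorder_cases)
    case less thus ?thesis using const[of s "d / 2"] that(1) d unfolding n_def by simp
  next
    case equal thus ?thesis unfolding n_def by (rule arg_cong)
  next
    case greater thus ?thesis using const[of "d / 2" s] that(2) d unfolding n_def by simp
  qed
  have ev: "\<forall>\<^sub>F s in at_right 0. I s = n"
    unfolding eventually_at_right_field using d In by (intro exI[of _ d]) auto
  have "maslov_index 1 (mat 1) \<gamma> 0 T = n"
    unfolding maslov_index_def \<eta>_def[symmetric, abs_def] I_def[symmetric]
  proof (rule the_equality)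
    show "\<forall>\<^sub>F s in at_right 0. I s = n" by (rule ev)
    fix m assume "\<forall>\<^sub>F s in at_right 0. I s = m"
    hence "\<forall>\<^sub>F s in at_right (0 :: real). n = m" using ev by eventually_elim simp
    thus "m = n" by simp
  qed
  moreover have "pi * of_int n = rotation (\<eta> (d / 2)) 0 T - (boundary_angle (\<eta> (d / 2) T) - boundary_angle (\<eta> (d / 2) 0))"
    using I[of "d / 2"] d unfolding n_def by simp
  moreover have "\<bar>boundary_angle (\<eta> (d / 2) t)\<bar> \<le> pi * CARD('n + 'n)" if "t = 0 \<or> t = T" for t
    by (rule boundary_angle_bound) (use that grp\<eta>[of t] reg[of "d / 2" t] d T in auto)
  from this[of 0] this[of T] have "\<bar>boundary_angle (\<eta> (d / 2) T) - boundary_angle (\<eta> (d / 2) 0)\<bar> \<le> 2 * pi * CARD('n + 'n)"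
    by (simp add: abs_le_iff)
  moreover have "\<bar>rotation (\<eta> (d / 2)) 0 T - rotation \<gamma> 0 T\<bar> \<le> 2 * pi * CARD('n + 'n)"
  proof -
    have "rotation (\<lambda>t. rot_J (- (d / 2)) :: 'n phase_matrix) 0 T = 0"
      unfolding rotation_def
      by (rule arg_change_const) (use T cayley_det_nonzero[OF rot_J_symp, of 1] in auto)
    moreover have "\<bar>rotation (\<lambda>t. rot_J (- (d / 2)) ** \<gamma> t) 0 T - rotation (\<lambda>t. rot_J (- (d / 2)) :: 'n phase_matrix) 0 T
        - rotation \<gamma> 0 T\<bar> \<le> 2 * pi * CARD('n + 'n)"
      by (rule rotation_mult) (use T cont grp rot_J_symp in auto)
    ultimately show ?thesis unfolding \<eta> by simp
  qed
  ultimately show ?thesis by (simp add: abs_le_iff)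
qed

text \<open>The kernel dimension in the index depends neither on the path nor on \<open>T\<close>,
  so the constant absorbs it.\<close>

lemma omega_index_rotation:
  obtains C where "\<And>\<gamma> :: real \<Rightarrow> 'n::finite phase_matrix. \<And>T. 0 < T \<Longrightarrow> continuous_on {0..T} \<gamma> \<Longrightarrow>
    \<gamma> ` {0..T} \<subseteq> symp_group \<Longrightarrow> \<bar>omega_index 1 \<gamma> T - rotation \<gamma> 0 T / pi\<bar> \<le> C"
proof -
  define k where "k = 1 / 2 * real (vec.dim {v :: complex ^ ('n + 'n). (mat 1 - mat 1) *v v = 0})"
  show ?thesis
  proof (rule that[of "4 * CARD('n + 'n) + \<bar>k\<bar>"])
    fix \<gamma> :: "real \<Rightarrow> 'n phase_matrix" and T
    assume h: "0 < T" "continuous_on {0..T} \<gamma>" "\<gamma> ` {0..T} \<subseteq> symp_group"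
    define m where "m = real_of_int (maslov_index 1 (mat 1) \<gamma> 0 T)"
    have "\<bar>pi * m - rotation \<gamma> 0 T\<bar> / pi \<le> 4 * CARD('n + 'n)"
      using maslov_index_rotation[OF h] by (simp add: m_def field_simps)
    moreover have "\<bar>pi * m - rotation \<gamma> 0 T\<bar> / pi = \<bar>m - rotation \<gamma> 0 T / pi\<bar>"
    proof -
      have "m - rotation \<gamma> 0 T / pi = (pi * m - rotation \<gamma> 0 T) / pi" by (simp add: diff_divide_distrib)
      thus ?thesis by simp
    qed
    moreover have "omega_index 1 \<gamma> T = m - k" by (simp add: omega_index_def m_def k_def)
    ultimately show "\<bar>omega_index 1 \<gamma> T - rotation \<gamma> 0 T / pi\<bar> \<le> 4 * CARD('n + 'n) + \<bar>k\<bar>"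
      by linarith
  qed
qed

section \<open>Linear Hamiltonian systems\<close>

lemma has_vector_derivative_reflect:
  assumes "(u has_vector_derivative g) (at (- t))"
  shows "((\<lambda>t. u (- t)) has_vector_derivative - g) (at (t :: real))"
proof -
  have "((\<lambda>t :: real. - t) has_vector_derivative - 1) (at t)"
    by (auto intro!: derivative_eq_intros)
  from vector_diff_chain_at[OF this assms] show ?thesis by (simp add: o_def)
qed

text \<open>For \<open>t \<ge> 0\<close> the function
  \<open>(u \<bullet> u) * exp (- 2 * L * t)\<close> does not increase; negative times follow by
  reflection. The bound on \<open>g\<close> is assumed only up to time \<open>\<bar>t\<bar>\<close>,
  so that orbits need to stay in a ball only that long.\<close>

lemma gronwall_norm:
  fixes u :: "real \<Rightarrow> 'a::euclidean_space"
  assumes d: "\<And>t. (u has_vector_derivative g t) (at t)" and g: "\<And>s. \<bar>s\<bar> \<le> \<bar>t\<bar> \<Longrightarrow> norm (g s) \<le> L * norm (u s)"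
  shows "norm (u t) \<le> norm (u 0) * exp (L * \<bar>t\<bar>)"
proof -
  have fwd: "norm (v t) \<le> norm (v 0) * exp (L * t)"
    if v: "\<And>t. (v has_vector_derivative h t) (at t)" "\<And>s. 0 \<le> s \<Longrightarrow> s \<le> t \<Longrightarrow> norm (h s) \<le> L * norm (v s)" and t: "0 \<le> t"
    for v h :: "real \<Rightarrow> 'a" and t
  proof -
    define f where "f s = (v s \<bullet> v s) * exp (- 2 * L * s)" for s
    have "\<exists>y. (f has_real_derivative y) (at s) \<and> y \<le> 0" if s: "0 \<le> s" "s \<le> t" for s
    proof -
      have "((\<lambda>s. v s \<bullet> v s) has_derivative (\<lambda>r. v s \<bullet> (r *\<^sub>R h s) + (r *\<^sub>R h s) \<bullet> v s)) (at s)"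
        using v(1)[of s] unfolding has_vector_derivative_def by (rule has_derivative_inner) (rule v(1)[unfolded has_vector_derivative_def])
      hence "((\<lambda>s. v s \<bullet> v s) has_real_derivative 2 * (v s \<bullet> h s)) (at s)"
        unfolding has_field_derivative_def by (rule has_derivative_eq_rhs) (simp add: fun_eq_iff inner_commute)
      hence "(f has_real_derivative (2 * (v s \<bullet> h s) - 2 * L * (v s \<bullet> v s)) * exp (- 2 * L * s)) (at s)"
        unfolding f_def by (auto intro!: derivative_eq_intros simp: algebra_simps)
      moreover have "v s \<bullet> h s \<le> L * (v s \<bullet> v s)"
      proof -
        have "v s \<bullet> h s \<le> norm (v s) * norm (h s)" by (rule norm_cauchy_schwarz)
        also have "\<dots> \<le> norm (v s) * (L * norm (v s))" by (intro mult_left_mono v(2) s) simp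
        also have "\<dots> = L * (v s \<bullet> v s)" by (simp add: dot_square_norm power2_eq_square)
        finally show ?thesis .
      qed
      ultimately show ?thesis
        by (intro exI conjI) (assumption, simp add: mult_le_0_iff)
    qed
    hence "f t \<le> f 0" using DERIV_nonpos_imp_nonincreasing[OF t] by blast
    hence "(norm (v t))\<^sup>2 * exp (- 2 * L * t) \<le> (norm (v 0))\<^sup>2" by (simp add: f_def dot_square_norm)
    hence "(norm (v t))\<^sup>2 \<le> (norm (v 0) * exp (L * t))\<^sup>2"
      by (simp add: exp_minus field_simps power2_eq_square exp_add[symmetric])
    thus ?thesis by (rule power2_le_imp_le) simp
  qed
  show ?thesis
  proof (cases "t \<ge> 0")
    case True thus ?thesis using fwd[of u g t, OF d g] by simp
  next
    case False
    have "((\<lambda>t. u (- t)) has_vector_derivative - g (- t)) (at t)" for t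
      by (rule has_vector_derivative_reflect[OF d])
    from fwd[of "\<lambda>t. u (- t)" "\<lambda>t. - g (- t)" "- t", OF this] show ?thesis using False g by simp
  qed
qed

text \<open>The right-hand side is the integral of the bound on \<open>f\<close>. It vanishes at
  \<open>t = 0\<close>, which later keeps fundamental solutions near the identity for short
  times.\<close>

lemma antiderivative_exp_bound:
  fixes F :: "real \<Rightarrow> 'a::euclidean_space"
  assumes "F 0 = 0" and d: "\<And>t. (F has_vector_derivative f t) (at t)" and K: "\<And>t. norm (f t) \<le> K * exp (L * \<bar>t\<bar>)" and "L > 0"
  shows "norm (F t) \<le> K / L * (exp (L * \<bar>t\<bar>) - 1)"
proof -
  have fwd: "norm (G t) \<le> K / L * (exp (L * t) - 1)"
    if G: "G 0 = 0" "\<And>t. (G has_vector_derivative h t) (at t)" "\<And>t. norm (h t) \<le> K * exp (L * \<bar>t\<bar>)" and t: "0 < t"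
    for G h :: "real \<Rightarrow> 'a" and t
  proof -
    have "norm (G t - G 0) \<le> K / L * exp (L * t) - K / L * exp (L * 0)"
    proof (rule differentiable_bound_general[OF t, where f' = h and \<phi>' = "\<lambda>t. K * exp (L * t)"])
      show "continuous_on {0..t} G"
        by (intro continuous_at_imp_continuous_on ballI has_vector_derivative_continuous[OF G(2)])
      show "continuous_on {0..t} (\<lambda>s. K / L * exp (L * s))" by (intro continuous_intros)
      fix s assume s: "0 < s" "s < t"
      show "(G has_vector_derivative h s) (at s)" by (rule G(2))
      show "((\<lambda>s. K / L * exp (L * s)) has_vector_derivative K * exp (L * s)) (at s)"
        using \<open>L > 0\<close> by (auto intro!: derivative_eq_intros simp: has_real_derivative_iff_has_vector_derivative[symmetric])
      show "norm (h s) \<le> K * exp (L * s)" using G(3)[of s] s by simp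
    qed
    thus ?thesis using G(1) by (simp add: algebra_simps)
  qed
  consider "t = 0" | "t > 0" | "t < 0" by linarith
  thus ?thesis
  proof cases
    case 1 thus ?thesis using assms(1) by simp
  next
    case 2 thus ?thesis using fwd[of F f t, OF assms(1) d K] by simp
  next
    case 3
    have "((\<lambda>t. F (- t)) has_vector_derivative - f (- t)) (at t)" for t
      by (rule has_vector_derivative_reflect[OF d])
    moreover have "norm (- f (- t)) \<le> K * exp (L * \<bar>t\<bar>)" for t using K[of "- t"] by simp
    ultimately show ?thesis using fwd[of "\<lambda>t. F (- t)" "\<lambda>t. - f (- t)" "- t"] 3 assms(1) by simp
  qed
qed

lemma antiderivative:
  fixes f :: "real \<Rightarrow> 'a::euclidean_space"
  assumes "continuous_on UNIV f"
  shows "((\<lambda>u. LBINT s=0..u. f s) has_vector_derivative f t) (at t)"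
proof -
  have "((\<lambda>u. LBINT s=0..u. f s) has_vector_derivative f t) (at t within {- \<bar>t\<bar> - 1..\<bar>t\<bar> + 1})"
    using interval_integral_FTC2[of "- \<bar>t\<bar> - 1" 0 "\<bar>t\<bar> + 1" f t] continuous_on_subset[OF assms]
    by (simp add: zero_ereal_def)
  thus ?thesis by (subst (asm) at_within_interior) auto
qed

text \<open>Picard's operator is a contraction for the norm weighted by \<open>exp (- L \<bar>t\<bar>)\<close>.\<close>

lemma linear_ode_exists:
  fixes A :: "real \<Rightarrow> real^'k::finite^'k"
  assumes cont: "continuous_on UNIV A" and bound: "\<And>t. norm (A t) \<le> b" and b: "b > 0"
  shows "\<exists>\<gamma>. \<gamma> 0 = mat 1 \<and> (\<forall>t. (\<gamma> has_vector_derivative (A t ** \<gamma> t)) (at t))"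
proof -
  \<comment> \<open>The rate \<open>2 * b\<close> makes the contraction factor \<open>b / L\<close>
    equal to \<open>1 / 2\<close>. The unknown is the solution multiplied by
    \<open>exp (- L * \<bar>t\<bar>)\<close>, hence a bounded function on the whole line.\<close>
  define L where "L = 2 * b"
  have L: "L > 0" using b by (simp add: L_def)
  define F :: "(real \<Rightarrow> real^'k^'k) \<Rightarrow> real \<Rightarrow> real^'k^'k"
    where "F u t = (LBINT s=0..t. exp (L * \<bar>s\<bar>) *\<^sub>R (A s ** u s))" for u t
  define T :: "(real \<Rightarrow> real^'k^'k) \<Rightarrow> real \<Rightarrow> real^'k^'k"
    where "T u t = exp (- L * \<bar>t\<bar>) *\<^sub>R (mat 1 + F u t)" for u t
  have F0: "F u 0 = 0" for u by (simp add: F_def zero_ereal_def[symmetric])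
  have dF: "(F u has_vector_derivative exp (L * \<bar>t\<bar>) *\<^sub>R (A t ** u t)) (at t)" if "continuous_on UNIV u" for u t
    unfolding F_def[abs_def] by (rule antiderivative) (intro continuous_intros cont that)
  have contF: "continuous_on UNIV (F u)" if "continuous_on UNIV u" for u
    by (intro continuous_at_imp_continuous_on ballI has_vector_derivative_continuous[OF dF[OF that]])
  have contT: "continuous_on UNIV (T u)" if "continuous_on UNIV u" for u
    unfolding T_def[abs_def] by (intro continuous_intros contF[OF that])
  have est: "exp (- L * \<bar>t\<bar>) * norm (G t) \<le> D / 2"
    if "G 0 = 0" "\<And>t. (G has_vector_derivative exp (L * \<bar>t\<bar>) *\<^sub>R (A t ** w t)) (at t)" "\<And>t. norm (w t) \<le> D"
    for G w :: "real \<Rightarrow> real^'k^'k" and D t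
  proof -
    have D: "D \<ge> 0" using that(3)[of 0] norm_ge_zero order.trans by blast
    have "norm (G t) \<le> b * D / L * (exp (L * \<bar>t\<bar>) - 1)"
    proof (rule antiderivative_exp_bound[OF that(1,2) _ L])
      fix t
      have "norm (A t ** w t) \<le> b * D"
        using b by (intro order.trans[OF norm_matrix_mult] mult_mono bound that(3)) auto
      thus "norm (exp (L * \<bar>t\<bar>) *\<^sub>R (A t ** w t)) \<le> b * D * exp (L * \<bar>t\<bar>)" by simp
    qed
    hence "norm (G t) \<le> D / 2 * (exp (L * \<bar>t\<bar>) - 1)" using b by (simp add: L_def)
    also have "\<dots> \<le> D / 2 * exp (L * \<bar>t\<bar>)" using D by (intro mult_left_mono) auto
    finally show ?thesis by (simp add: exp_minus field_simps)
  qed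
  have bT: "T (apply_bcontfun u) \<in> bcontfun" for u
  proof -
    have c: "continuous_on UNIV (apply_bcontfun u)" by simp
    have "norm (T u t) \<le> norm (mat 1 :: real^'k^'k) + norm u / 2" for t
    proof -
      have "norm (T u t) \<le> exp (- L * \<bar>t\<bar>) * (norm (mat 1 :: real^'k^'k) + norm (F u t))"
        unfolding T_def by (simp add: norm_triangle_ineq)
      also have "\<dots> \<le> 1 * norm (mat 1 :: real^'k^'k) + norm u / 2"
        unfolding distrib_left
        by (intro add_mono mult_right_mono est[OF F0 dF[OF c]] norm_bounded) (use L in auto)
      finally show ?thesis by simp
    qed
    thus ?thesis by (intro bcontfun_normI contT c)
  qed
  have "\<exists>!u. Bcontfun (T (apply_bcontfun u)) = u"
  proof (rule banach_fix_type[where c = "1 / 2"])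
    show "\<forall>u v. dist (Bcontfun (T (apply_bcontfun u))) (Bcontfun (T (apply_bcontfun v))) \<le> 1 / 2 * dist u v"
    proof (intro allI dist_bound)
      fix u v :: "real \<Rightarrow>\<^sub>C (real^'k^'k)" and t
      have c: "continuous_on UNIV (apply_bcontfun u)" "continuous_on UNIV (apply_bcontfun v)" by simp_all
      have "exp (- L * \<bar>t\<bar>) * norm (F u t - F v t) \<le> dist u v / 2"
      proof (rule est[where w = "\<lambda>t. u t - v t"])
        show "F u 0 - F v 0 = 0" by (simp add: F0)
        show "((\<lambda>t. F u t - F v t) has_vector_derivative exp (L * \<bar>t\<bar>) *\<^sub>R (A t ** (u t - v t))) (at t)" for t
          using has_vector_derivative_diff[OF dF[OF c(1), of t] dF[OF c(2), of t]]
          by (simp add: matrix_mult_diff_ldistrib scaleR_diff_right)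
        show "norm (u t - v t) \<le> dist u v" for t using dist_bounded[of u t v] by (simp add: dist_norm)
      qed
      moreover have "T u t - T v t = exp (- L * \<bar>t\<bar>) *\<^sub>R (F u t - F v t)"
        by (simp add: T_def scaleR_diff_right[symmetric] del: scaleR_diff_right)
      ultimately show "dist (apply_bcontfun (Bcontfun (T u)) t) (apply_bcontfun (Bcontfun (T v)) t) \<le> 1 / 2 * dist u v"
        by (simp add: Bcontfun_inverse[OF bT] dist_norm)
    qed
  qed auto
  then obtain u where "Bcontfun (T (apply_bcontfun u)) = u" by blast
  hence fix_u: "T u t = u t" for t using Bcontfun_inverse[OF bT, of u] by simp
  define \<gamma> where "\<gamma> t = mat 1 + F u t" for t
  have u\<gamma>: "exp (L * \<bar>t\<bar>) *\<^sub>R u t = \<gamma> t" for t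
    unfolding fix_u[of t, symmetric] T_def \<gamma>_def by (simp add: exp_minus)
  have "(\<gamma> has_vector_derivative (A t ** \<gamma> t)) (at t)" for t
  proof -
    have "(\<gamma> has_vector_derivative exp (L * \<bar>t\<bar>) *\<^sub>R (A t ** u t)) (at t)"
      unfolding \<gamma>_def[abs_def] using dF[of u t] by (auto intro!: derivative_eq_intros)
    thus ?thesis by (simp add: u\<gamma>[symmetric] matrix_mult_scaleR_right)
  qed
  thus ?thesis by (intro exI[of _ \<gamma>]) (simp add: \<gamma>_def F0)
qed

section \<open>Fundamental solutions of systems with symmetric coefficients\<close>

lemma bounded_bilinear_matrix_mult:
  "bounded_bilinear ((**) :: real^'k::finite^'m::finite \<Rightarrow> real^'l::finite^'k \<Rightarrow> real^'l^'m)"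
  by (intro bounded_bilinear.intro exI[of _ 1])
     (simp_all add: matrix_ring norm_matrix_mult)

lemma bounded_linear_transpose:
  "bounded_linear (transpose :: real^'k::finite^'m::finite \<Rightarrow> real^'m^'k)"
  by (intro linear_conv_bounded_linear[THEN iffD1] linearI) (simp_all add: transpose_def vec_eq_iff)

text \<open>The bound \<open>b\<close> is a parameter because the later constants have to be uniform
  over all translates of a system and over all systems with the same bound.\<close>

definition admissible :: "real \<Rightarrow> (real \<Rightarrow> 'n::finite phase_matrix) \<Rightarrow> bool" where
  "admissible b B \<longleftrightarrow> 0 < b \<and> continuous_on UNIV B \<and> (\<forall>t. transpose (B t) = B t) \<and> (\<forall>t. norm (B t) \<le> b)"

definition solves :: "(real \<Rightarrow> 'n::finite phase_matrix) \<Rightarrow> (real \<Rightarrow> 'n phase_matrix) \<Rightarrow> bool" where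
  "solves B \<gamma> \<longleftrightarrow> \<gamma> 0 = mat 1 \<and> (\<forall>t. (\<gamma> has_vector_derivative (symp_J ** B t ** \<gamma> t)) (at t))"

text \<open>Variation of constants, in which symmetry leaves only the difference of the
  coefficients. Equal coefficients give symplecticity and uniqueness of solutions; different ones
  give the perturbation estimate for the rotation.\<close>

lemma wronskian_derivative:
  fixes \<gamma>1 \<gamma>2 :: "real \<Rightarrow> 'n::finite phase_matrix"
  assumes "(\<gamma>1 has_vector_derivative (symp_J ** B1 ** \<gamma>1 t)) (at t)" "(\<gamma>2 has_vector_derivative (symp_J ** B2 ** \<gamma>2 t)) (at t)"
    and sym: "transpose B1 = B1"
  shows "((\<lambda>t. symp_inv (\<gamma>1 t) ** \<gamma>2 t) has_vector_derivative
    - (symp_J ** (transpose (\<gamma>1 t) ** (B1 - B2) ** \<gamma>2 t))) (at t)"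
proof -
  have d1: "((\<lambda>t. transpose (\<gamma>1 t)) has_vector_derivative (transpose (symp_J ** B1 ** \<gamma>1 t))) (at t)"
    by (rule bounded_linear.has_vector_derivative[OF bounded_linear_transpose assms(1)])
  have d2: "((\<lambda>t. symp_J ** \<gamma>2 t) has_vector_derivative (symp_J ** (symp_J ** B2 ** \<gamma>2 t))) (at t)"
    by (rule bounded_linear.has_vector_derivative[OF bounded_bilinear.bounded_linear_right[OF bounded_bilinear_matrix_mult] assms(2)])
  have "((\<lambda>t. transpose (\<gamma>1 t) ** (symp_J ** \<gamma>2 t)) has_vector_derivative
      (transpose (\<gamma>1 t) ** (symp_J ** (symp_J ** B2 ** \<gamma>2 t)) + transpose (symp_J ** B1 ** \<gamma>1 t) ** (symp_J ** \<gamma>2 t))) (at t)"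
    by (rule bounded_bilinear.has_vector_derivative[OF bounded_bilinear_matrix_mult d1 d2])
  moreover have "transpose (\<gamma>1 t) ** (symp_J ** (symp_J ** B2 ** \<gamma>2 t)) = - (transpose (\<gamma>1 t) ** B2 ** \<gamma>2 t)"
    by (simp add: matrix_mul_assoc[symmetric] matrix_mult_minus_right)
  moreover have "transpose (symp_J ** B1 ** \<gamma>1 t) ** (symp_J ** \<gamma>2 t) = transpose (\<gamma>1 t) ** B1 ** \<gamma>2 t"
  proof -
    have "transpose (symp_J ** B1 ** \<gamma>1 t) ** (symp_J ** \<gamma>2 t) = - (transpose (\<gamma>1 t) ** (B1 ** (symp_J ** (symp_J ** \<gamma>2 t))))"
      by (simp only: matrix_transpose_mul sym transpose_symp_J matrix_mult_minus_right matrix_mult_minus_left matrix_mul_assoc)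
    thus ?thesis by (simp add: matrix_mult_minus_right matrix_mult_minus_left matrix_mul_assoc)
  qed
  ultimately have d: "((\<lambda>t. transpose (\<gamma>1 t) ** (symp_J ** \<gamma>2 t)) has_vector_derivative
      (transpose (\<gamma>1 t) ** (B1 - B2) ** \<gamma>2 t)) (at t)"
    by (simp add: matrix_mult_diff_ldistrib matrix_mult_diff_rdistrib)
  have "((\<lambda>t. symp_J ** (transpose (\<gamma>1 t) ** (symp_J ** \<gamma>2 t))) has_vector_derivative
      (symp_J ** (transpose (\<gamma>1 t) ** (B1 - B2) ** \<gamma>2 t))) (at t)"
    by (rule bounded_linear.has_vector_derivative[OF bounded_bilinear.bounded_linear_right[OF bounded_bilinear_matrix_mult] d])
  hence "((\<lambda>t. - (symp_J ** (transpose (\<gamma>1 t) ** (symp_J ** \<gamma>2 t)))) has_vector_derivative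
      - (symp_J ** (transpose (\<gamma>1 t) ** (B1 - B2) ** \<gamma>2 t))) (at t)"
    by (rule has_vector_derivative_minus)
  moreover have "- (symp_J ** (transpose (\<gamma>1 t) ** (symp_J ** \<gamma>2 t))) = symp_inv (\<gamma>1 t) ** \<gamma>2 t" for t
    by (simp add: symp_inv_def matrix_mult_minus_left matrix_mul_assoc)
  ultimately show ?thesis by simp
qed

lemma solves_wronskian:
  fixes \<gamma>1 \<gamma>2 :: "real \<Rightarrow> 'n::finite phase_matrix"
  assumes "solves B \<gamma>1" "solves B \<gamma>2" "\<And>t. transpose (B t) = B t"
  shows "symp_inv (\<gamma>1 t) ** \<gamma>2 t = mat 1"
proof -
  have d: "((\<lambda>t. symp_inv (\<gamma>1 t) ** \<gamma>2 t) has_vector_derivative 0) (at t)" for t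
    using wronskian_derivative[of \<gamma>1 "B t" t \<gamma>2 "B t"] assms by (simp add: solves_def)
  have "(\<lambda>t. symp_inv (\<gamma>1 t) ** \<gamma>2 t) t = (\<lambda>t. symp_inv (\<gamma>1 t) ** \<gamma>2 t) 0"
    by (rule has_derivative_zero_unique[of UNIV])
       (use d in \<open>auto simp: has_vector_derivative_def\<close>)
  also have "\<dots> = mat 1" using assms(1,2) by (simp add: solves_def symp_inv_def)
  finally show ?thesis .
qed

lemma solves_symp:
  fixes \<gamma> :: "real \<Rightarrow> 'n::finite phase_matrix"
  assumes "solves B \<gamma>" "\<And>t. transpose (B t) = B t"
  shows "\<gamma> t \<in> symp_group"
proof -
  have "symp_J ** (symp_inv (\<gamma> t) ** \<gamma> t) = symp_J" using solves_wronskian[OF assms(1,1,2)] by simp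
  moreover have "symp_J ** (symp_inv (\<gamma> t) ** \<gamma> t) = - (symp_J ** (symp_J ** (transpose (\<gamma> t) ** symp_J ** \<gamma> t)))"
    by (simp only: symp_inv_def matrix_mult_minus_left matrix_mult_minus_right matrix_mul_assoc)
  ultimately show ?thesis by (simp add: symp_group_iff)
qed

lemma solves_unique:
  fixes \<gamma>1 \<gamma>2 :: "real \<Rightarrow> 'n::finite phase_matrix"
  assumes "solves B \<gamma>1" "solves B \<gamma>2" "\<And>t. transpose (B t) = B t"
  shows "\<gamma>1 = \<gamma>2"
proof
  fix t
  have "\<gamma>2 t = (\<gamma>1 t ** symp_inv (\<gamma>1 t)) ** \<gamma>2 t"
    using symp_inv_right[OF solves_symp[OF assms(1,3)]] by simp
  also have "\<dots> = \<gamma>1 t ** (symp_inv (\<gamma>1 t) ** \<gamma>2 t)" by (simp only: matrix_mul_assoc)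
  also have "\<dots> = \<gamma>1 t" using solves_wronskian[OF assms] by simp
  finally show "\<gamma>1 t = \<gamma>2 t" by simp
qed

lemma fundamental_solution_eq:
  assumes "solves B \<gamma>" "\<And>t. transpose (B t) = B t"
  shows "fundamental_solution B = \<gamma>"
  unfolding fundamental_solution_def solves_def[symmetric]
  by (rule the_equality) (use assms solves_unique in blast)+

lemma norm_J_pos: "norm (symp_J :: 'n::finite phase_matrix) > 0"
proof -
  have "symp_J \<noteq> (0 :: 'n phase_matrix)"
  proof
    assume "symp_J = (0 :: 'n phase_matrix)"
    hence "- mat 1 = (0 :: 'n phase_matrix)" using symp_J_squared[where 'a = 'n] by simp
    thus False using norm_mat_1_ge[where 'k = "'n + 'n"] by simp
  qed
  thus ?thesis by simp
qed

lemma fundamental_solution_solves: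
  fixes B :: "real \<Rightarrow> 'n::finite phase_matrix"
  assumes "admissible b B"
  shows "solves B (fundamental_solution B)"
proof -
  have h: "0 < b" "continuous_on UNIV B" "\<And>t. transpose (B t) = B t" "\<And>t. norm (B t) \<le> b"
    using assms by (auto simp: admissible_def)
  have "\<exists>\<gamma>. \<gamma> 0 = mat 1 \<and> (\<forall>t. (\<gamma> has_vector_derivative (symp_J ** B t) ** \<gamma> t) (at t))"
  proof (rule linear_ode_exists)
    show "continuous_on UNIV (\<lambda>t. symp_J ** B t)" by (intro continuous_intros h)
    show "norm (symp_J ** B t) \<le> norm (symp_J :: 'n phase_matrix) * b" for t
      by (rule order.trans[OF norm_matrix_mult mult_left_mono[OF h(4)]]) simp
    show "norm (symp_J :: 'n phase_matrix) * b > 0" by (rule mult_pos_pos[OF norm_J_pos h(1)])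
  qed
  then obtain \<gamma> where "solves B \<gamma>" unfolding solves_def by blast
  with fundamental_solution_eq[OF this h(3)] show ?thesis by simp
qed

lemma fundamental_solution_props:
  fixes B :: "real \<Rightarrow> 'n::finite phase_matrix"
  assumes "admissible b B"
  shows "fundamental_solution B 0 = mat 1" "fundamental_solution B t \<in> symp_group"
    "(fundamental_solution B has_vector_derivative (symp_J ** B t ** fundamental_solution B t)) (at t)"
    "continuous_on S (fundamental_solution B)"
proof -
  note f = fundamental_solution_solves[OF assms]
  have sym: "transpose (B t) = B t" for t using assms by (simp add: admissible_def)
  show "fundamental_solution B 0 = mat 1" using f by (simp add: solves_def)
  show d: "(fundamental_solution B has_vector_derivative (symp_J ** B t ** fundamental_solution B t)) (at t)" for t
    using f by (simp add: solves_def)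
  show "fundamental_solution B t \<in> symp_group" by (rule solves_symp[OF f sym])
  show "continuous_on S (fundamental_solution B)"
    by (intro continuous_at_imp_continuous_on ballI has_vector_derivative_continuous[OF d])
qed

lemma admissible_shift: "admissible b B \<Longrightarrow> admissible b (\<lambda>t. B (s + t))"
  unfolding admissible_def
  by (auto intro!: continuous_on_compose2[of UNIV B] continuous_intros)

section \<open>Translation and growth of fundamental solutions\<close>

lemma fundamental_solution_shift:
  fixes B :: "real \<Rightarrow> 'n::finite phase_matrix"
  assumes "admissible b B"
  shows "fundamental_solution B (s + t) = fundamental_solution (\<lambda>t. B (s + t)) t ** fundamental_solution B s"
proof -
  let ?g = "fundamental_solution B"
  note p = fundamental_solution_props[OF assms]
  define z where "z t = ?g (s + t) ** symp_inv (?g s)" for t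
  have "(z has_vector_derivative (symp_J ** B (s + t) ** z t)) (at t)" for t
  proof -
    have sh: "((\<lambda>t. s + t) has_vector_derivative 1) (at t)" by (auto intro!: derivative_eq_intros)
    have "((\<lambda>t. ?g (s + t)) has_vector_derivative (symp_J ** B (s + t) ** ?g (s + t))) (at t)"
      using vector_diff_chain_at[OF sh p(3)[of "s + t"]] by (simp add: o_def)
    from bounded_linear.has_vector_derivative[OF bounded_bilinear.bounded_linear_left[OF bounded_bilinear_matrix_mult] this]
    have "((\<lambda>t. ?g (s + t) ** symp_inv (?g s)) has_vector_derivative (symp_J ** B (s + t) ** ?g (s + t)) ** symp_inv (?g s)) (at t)" .
    thus ?thesis by (simp add: z_def[abs_def] matrix_mul_assoc)
  qed
  moreover have "z 0 = mat 1" by (simp add: z_def symp_inv_right[OF p(2)])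
  ultimately have "solves (\<lambda>t. B (s + t)) z" by (simp add: solves_def)
  hence "fundamental_solution (\<lambda>t. B (s + t)) = z"
    by (rule fundamental_solution_eq) (use assms in \<open>simp add: admissible_def\<close>)
  moreover have "z t ** ?g s = ?g (s + t)"
    by (simp add: z_def matrix_mul_assoc[symmetric] symp_inv_left[OF p(2)])
  ultimately show ?thesis by simp
qed

lemma fundamental_solution_bound:
  fixes B :: "real \<Rightarrow> 'n::finite phase_matrix"
  assumes "admissible b B"
  defines "L \<equiv> norm (symp_J :: 'n phase_matrix) * b"
  shows "norm (fundamental_solution B t) \<le> norm (mat 1 :: 'n phase_matrix) * exp (L * \<bar>t\<bar>)"
    "norm (fundamental_solution B t - mat 1) \<le> norm (mat 1 :: 'n phase_matrix) * (exp (L * \<bar>t\<bar>) - 1)"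
proof -
  note p = fundamental_solution_props[OF assms(1)]
  have b: "b > 0" "\<And>t. norm (B t) \<le> b" using assms(1) by (auto simp: admissible_def)
  have L: "L > 0" unfolding L_def by (rule mult_pos_pos[OF norm_J_pos b(1)])
  have rhs: "norm (symp_J ** B t ** M) \<le> L * norm M" for t and M :: "'n phase_matrix"
    unfolding L_def
    by (rule order.trans[OF norm_matrix_mult]) (intro mult_right_mono order.trans[OF norm_matrix_mult] mult_left_mono b norm_ge_zero)
  show 1: "norm (fundamental_solution B t) \<le> norm (mat 1 :: 'n phase_matrix) * exp (L * \<bar>t\<bar>)" for t
    using gronwall_norm[OF p(3) rhs, of t] by (simp add: p(1))
  have "norm (fundamental_solution B t - mat 1) \<le> L * norm (mat 1 :: 'n phase_matrix) / L * (exp (L * \<bar>t\<bar>) - 1)"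
  proof (rule antiderivative_exp_bound[OF _ _ _ L])
    show "((\<lambda>t. fundamental_solution B t - mat 1) has_vector_derivative symp_J ** B t ** fundamental_solution B t) (at t)" for t
      using p(3) by (auto intro!: derivative_eq_intros)
    show "norm (symp_J ** B t ** fundamental_solution B t) \<le> L * norm (mat 1 :: 'n phase_matrix) * exp (L * \<bar>t\<bar>)" for t
      using order.trans[OF rhs mult_left_mono[OF 1]] L by (simp add: mult.assoc)
  qed (simp add: p(1))
  thus "norm (fundamental_solution B t - mat 1) \<le> norm (mat 1 :: 'n phase_matrix) * (exp (L * \<bar>t\<bar>) - 1)" using L by simp
qed

section \<open>The rotation of a linear Hamiltonian system\<close>

definition sys_rotation :: "(real \<Rightarrow> 'n::finite phase_matrix) \<Rightarrow> real \<Rightarrow> real" where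
  "sys_rotation B l = rotation (fundamental_solution B) 0 l"

text \<open>From time \<open>s\<close> on, the fundamental solution is that of the translated system
  times the constant matrix reached at \<open>s\<close>, whose rotation is zero. The whole error is
  that of a product.\<close>

lemma sys_rotation_add:
  fixes B :: "real \<Rightarrow> 'n::finite phase_matrix"
  assumes "admissible b B" "0 \<le> s" "0 \<le> t"
  shows "\<bar>sys_rotation B (s + t) - sys_rotation B s - sys_rotation (\<lambda>t. B (s + t)) t\<bar> \<le> 2 * pi * CARD('n + 'n)"
proof -
  let ?g = "fundamental_solution B" and ?h = "fundamental_solution (\<lambda>t. B (s + t))"
  note p = fundamental_solution_props[OF assms(1)]
  note q = fundamental_solution_props[OF admissible_shift[OF assms(1), of s]]
  have cont: "continuous_on S (\<lambda>t. cayley_det (?g t) 1)" for S by (intro continuous_intros p(4))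
  have nz: "cayley_det (?g t) 1 \<noteq> 0" for t by (rule cayley_det_nonzero[OF p(2)]) simp
  have "sys_rotation B (s + t) = sys_rotation B s + rotation ?g s (s + t)"
    unfolding sys_rotation_def rotation_def by (rule arg_change_split) (use assms cont nz in auto)
  moreover have "rotation ?g s (s + t) = rotation (\<lambda>r. ?g (s + r)) 0 t"
    unfolding rotation_def using arg_change_shift[of 0 t s "\<lambda>t. cayley_det (?g t) 1"] assms cont nz
    by (simp add: add.commute)
  moreover have "rotation (\<lambda>r. ?g (s + r)) 0 t = rotation (\<lambda>r. ?h r ** ?g s) 0 t"
    by (simp add: fundamental_solution_shift[OF assms(1)])
  moreover have "rotation (\<lambda>_. ?g s) 0 t = 0"
    unfolding rotation_def by (rule arg_change_const) (use assms nz in auto)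
  moreover have "\<bar>rotation (\<lambda>r. ?h r ** ?g s) 0 t - rotation ?h 0 t - rotation (\<lambda>_. ?g s) 0 t\<bar> \<le> 2 * pi * CARD('n + 'n)"
    by (rule rotation_mult) (use assms p(2) q(2,4) in auto)
  ultimately show ?thesis by (simp add: sys_rotation_def)
qed

text \<open>Near the identity \<open>cayley_det\<close> stays in the open half-plane around its
  nonzero value \<open>w\<close> there, which is selected by the factor
  \<open>cnj w\<close>.\<close>

lemma rotation_near_one:
  obtains r where "r > 0" "\<And>M a b. a \<le> b \<Longrightarrow> continuous_on {a..b} M \<Longrightarrow>
    (\<And>t. t \<in> {a..b} \<Longrightarrow> norm (M t - mat 1 :: 'n::finite phase_matrix) < r) \<Longrightarrow> \<bar>rotation M a b\<bar> \<le> pi"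
proof -
  define w where "w = cayley_det (mat 1 :: 'n phase_matrix) 1"
  have w: "w \<noteq> 0" unfolding w_def by (rule cayley_det_nonzero) simp_all
  have "continuous_on UNIV (\<lambda>M :: 'n phase_matrix. Re (cnj w * cayley_det M 1))" by (intro continuous_intros)
  hence "open {M :: 'n phase_matrix. 0 < Re (cnj w * cayley_det M 1)}"
    by (intro open_Collect_less continuous_on_const)
  moreover have "Re (cnj w * w) > 0"
    using w by (simp add: complex_neq_0 power2_eq_square[symmetric])
  ultimately obtain r where r: "r > 0" "\<And>M :: 'n phase_matrix. dist M (mat 1) < r \<Longrightarrow> 0 < Re (cnj w * cayley_det M 1)"
    unfolding open_dist w_def by (metis (no_types, lifting) mem_Collect_eq)
  show ?thesis
  proof (rule that[OF r(1)])
    fix M :: "real \<Rightarrow> 'n phase_matrix" and a b :: real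
    assume "a \<le> b" "continuous_on {a..b} M" "\<And>t. t \<in> {a..b} \<Longrightarrow> norm (M t - mat 1) < r"
    thus "\<bar>rotation M a b\<bar> \<le> pi"
      unfolding rotation_def
      by (intro arg_change_half_plane[where w = "cnj w"] continuous_intros r(2)) (auto simp: dist_norm)
  qed
qed

text \<open>The solution of the second system is that of the first times a Wronskian close to the
  identity. The bound does not depend on \<open>T\<close>; only the admissible distance
  \<open>e\<close> does.\<close>

lemma sys_rotation_perturb:
  assumes T: "0 \<le> T" and b: "0 < b"
  obtains e where "e > 0" "\<And>B B' :: real \<Rightarrow> 'n::finite phase_matrix. admissible b B \<Longrightarrow> admissible b B' \<Longrightarrow>
    (\<And>t. t \<in> {0..T} \<Longrightarrow> norm (B t - B' t) \<le> e) \<Longrightarrow>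
    \<bar>sys_rotation B' T - sys_rotation B T\<bar> \<le> 2 * pi * CARD('n + 'n) + pi"
proof -
  obtain r where r: "r > 0" "\<And>M a b. a \<le> b \<Longrightarrow> continuous_on {a..b} M \<Longrightarrow>
    (\<And>t. t \<in> {a..b} \<Longrightarrow> norm (M t - mat 1 :: 'n phase_matrix) < r) \<Longrightarrow> \<bar>rotation M a b\<bar> \<le> pi"
  proof (rule rotation_near_one[where 'n = 'n], goal_cases)
    case (1 r) show ?case by (rule that[OF 1(2,3)])
  qed
  define j where "j = norm (symp_J :: 'n phase_matrix)"
  define n where "n = norm (mat 1 :: 'n phase_matrix) * exp (j * b * T)"
  have j: "j > 0" unfolding j_def by (rule norm_J_pos)
  have n: "n > 0" unfolding n_def by (intro mult_pos_pos less_le_trans[OF zero_less_one norm_mat_1_ge] exp_gt_zero)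
  \<comment> \<open>Chosen so that the speed of the Wronskian times \<open>T + 1\<close> is exactly
    \<open>r\<close>. Using \<open>T + 1\<close> in place of \<open>T\<close> keeps the denominator
    positive at \<open>T = 0\<close> and the estimate strict.\<close>
  define e where "e = r / (j * n * n * (T + 1))"
  have e: "e > 0" using r(1) j n T by (simp add: e_def)
  show ?thesis
  proof (rule that[OF e])
    fix B B' :: "real \<Rightarrow> 'n phase_matrix"
    assume B: "admissible b B" "admissible b B'" and close: "\<And>t. t \<in> {0..T} \<Longrightarrow> norm (B t - B' t) \<le> e"
    let ?g = "fundamental_solution B" and ?h = "fundamental_solution B'"
    note p = fundamental_solution_props[OF B(1)]
    note q = fundamental_solution_props[OF B(2)]
    define W where "W t = symp_inv (?g t) ** ?h t" for t
    have sym: "transpose (B t) = B t" for t using B(1) by (simp add: admissible_def)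
    have dW: "(W has_vector_derivative - (symp_J ** (transpose (?g t) ** (B t - B' t) ** ?h t))) (at t)" for t
      unfolding W_def[abs_def] by (rule wronskian_derivative[OF p(3) q(3) sym])
    have contW: "continuous_on S W" for S
      by (intro continuous_at_imp_continuous_on ballI has_vector_derivative_continuous[OF dW])
    have W0: "W 0 = mat 1" by (simp add: W_def p(1) q(1) symp_inv_def)
    have gn: "norm (fundamental_solution C t) \<le> n" if "admissible b C" "t \<in> {0..T}" for C :: "real \<Rightarrow> 'n phase_matrix" and t
    proof -
      have "j * b * \<bar>t\<bar> \<le> j * b * T" using that(2) j b by (intro mult_left_mono) auto
      hence "norm (mat 1 :: 'n phase_matrix) * exp (j * b * \<bar>t\<bar>) \<le> n" unfolding n_def by (intro mult_left_mono) auto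
      thus ?thesis using fundamental_solution_bound(1)[OF that(1), of t] by (simp add: j_def)
    qed
    have Wn: "norm (W t - mat 1) < r" if t: "t \<in> {0..T}" for t
    proof (cases "t = 0")
      case True thus ?thesis using W0 r(1) by simp
    next
      case False
      hence t0: "0 < t" using t by simp
      have "norm (W t - W 0) \<le> (j * n * n * e) * t - (j * n * n * e) * 0"
      proof (rule differentiable_bound_general[OF t0 contW _ dW, where \<phi>' = "\<lambda>_. j * n * n * e"])
        show "continuous_on {0..t} ((*) (j * n * n * e))" by (intro continuous_intros)
        fix s assume s: "0 < s" "s < t"
        hence sT: "s \<in> {0..T}" using t by simp
        show "((*) (j * n * n * e) has_vector_derivative j * n * n * e) (at s)"
          by (auto intro!: derivative_eq_intros simp: has_real_derivative_iff_has_vector_derivative[symmetric])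
        have "norm (symp_J ** (transpose (?g s) ** (B s - B' s) ** ?h s)) \<le> j * (n * e * n)"
          unfolding j_def
          by (intro order.trans[OF norm_matrix_mult] mult_mono order.refl close[OF sT] gn[OF B(2) sT])
             (use gn[OF B(1) sT] n e in \<open>auto simp: norm_transpose\<close>)
        thus "norm (- (symp_J ** (transpose (?g s) ** (B s - B' s) ** ?h s))) \<le> j * n * n * e"
          by (simp add: mult_ac)
      qed
      also have "\<dots> \<le> (j * n * n * e) * T" using t j n e by (simp add: mult_left_mono)
      also have "\<dots> < (j * n * n * e) * (T + 1)" using j n e by (intro mult_strict_left_mono) auto
      also have "\<dots> = r" using j n T by (simp add: e_def)
      finally show ?thesis by (simp add: W0)
    qed
    have "\<bar>rotation W 0 T\<bar> \<le> pi" by (rule r(2)[OF T contW Wn])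
    moreover have "\<bar>rotation (\<lambda>t. ?g t ** W t) 0 T - rotation ?g 0 T - rotation W 0 T\<bar> \<le> 2 * pi * CARD('n + 'n)"
    proof (rule rotation_mult[OF T p(4) _ contW])
      show "?g ` {0..T} \<subseteq> symp_group" using p(2) by auto
      show "W ` {0..T} \<subseteq> symp_group" unfolding W_def using p(2) q(2) by (auto intro!: symp_group_mult symp_group_inv)
    qed
    moreover have "?g t ** W t = ?h t" for t by (simp add: W_def matrix_mul_assoc symp_inv_right[OF p(2)])
    ultimately show "\<bar>sys_rotation B' T - sys_rotation B T\<bar> \<le> 2 * pi * CARD('n + 'n) + pi"
      by (simp add: sys_rotation_def)
  qed
qed

text \<open>Over a time \<open>h\<close> depending only on \<open>b\<close> the fundamental solution
  stays near the identity and rotates by at most \<open>pi\<close>; each further step of length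
  \<open>h\<close> costs at most \<open>c\<close>.\<close>

lemma sys_rotation_linear_bound:
  assumes b: "0 < b"
  obtains K where "K > 0" "\<And>B :: real \<Rightarrow> 'n::finite phase_matrix. \<And>l. admissible b B \<Longrightarrow> 0 \<le> l \<Longrightarrow> \<bar>sys_rotation B l\<bar> \<le> K * (l + 1)"
proof -
  obtain r where r: "r > 0" "\<And>M a b. a \<le> b \<Longrightarrow> continuous_on {a..b} M \<Longrightarrow>
    (\<And>t. t \<in> {a..b} \<Longrightarrow> norm (M t - mat 1 :: 'n phase_matrix) < r) \<Longrightarrow> \<bar>rotation M a b\<bar> \<le> pi"
  proof (rule rotation_near_one[where 'n = 'n], goal_cases)
    case (1 r) show ?case by (rule that[OF 1(2,3)])
  qed
  define L where "L = norm (symp_J :: 'n phase_matrix) * b"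
  define n0 where "n0 = norm (mat 1 :: 'n phase_matrix)"
  define c where "c = 2 * pi * CARD('n + 'n) + pi"
  have L: "L > 0" unfolding L_def by (rule mult_pos_pos[OF norm_J_pos b])
  have n0: "n0 > 0" using norm_mat_1_ge[where 'k = "'n + 'n"] unfolding n0_def by linarith
  \<comment> \<open>The solution of \<open>n0 * (exp (L * h) - 1) = r / 2\<close>, by the bound on
    the distance of the fundamental solution from the identity.\<close>
  define h where "h = ln (1 + r / n0 / 2) / L"
  have "r / n0 / 2 > 0" using r(1) n0 by simp
  hence h: "h > 0" unfolding h_def by (intro divide_pos_pos L ln_gt_zero) linarith
  have c: "c > 0" "pi \<le> c" by (simp_all add: c_def add_nonneg_pos)
  have short: "\<bar>sys_rotation B l\<bar> \<le> pi" if B: "admissible b B" and l: "0 \<le> l" "l \<le> h" for B :: "real \<Rightarrow> 'n phase_matrix" and l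
    unfolding sys_rotation_def
  proof (rule r(2)[OF l(1) fundamental_solution_props(4)[OF B]])
    fix t assume t: "t \<in> {0..l}"
    have "L * \<bar>t\<bar> \<le> L * h" using t l L by (intro mult_left_mono) auto
    also have "L * h = ln (1 + r / n0 / 2)" using L by (simp add: h_def)
    finally have "exp (L * \<bar>t\<bar>) \<le> exp (ln (1 + r / n0 / 2))" by simp
    also have "\<dots> = 1 + r / n0 / 2" using r(1) n0 by (simp add: add_pos_pos)
    finally have "n0 * (exp (L * \<bar>t\<bar>) - 1) \<le> n0 * (r / n0 / 2)" using n0 by (intro mult_left_mono) auto
    also have "\<dots> < r" using n0 r(1) by simp
    finally show "norm (fundamental_solution B t - mat 1) < r"
      using fundamental_solution_bound(2)[OF B, of t] by (simp add: L_def n0_def)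
  qed
  have steps: "\<bar>sys_rotation B l\<bar> \<le> real (Suc k) * c" if "admissible b B" "0 \<le> l" "l \<le> real (Suc k) * h"
    for B :: "real \<Rightarrow> 'n phase_matrix" and k l
    using that
  proof (induction k arbitrary: B l)
    case 0 thus ?case using short[of B l] c(2) by simp
  next
    case (Suc k)
    show ?case
    proof (cases "l \<le> h")
      case True
      have "pi \<le> real (Suc (Suc k)) * c" using c by (smt (verit) mult_less_cancel_right2 of_nat_0_le_iff of_nat_Suc)
      thus ?thesis using short[OF Suc.prems(1,2) True] by linarith
    next
      case False
      have "\<bar>sys_rotation (\<lambda>t. B (h + t)) (l - h)\<bar> \<le> real (Suc k) * c"
        by (rule Suc.IH[OF admissible_shift[OF Suc.prems(1)]]) (use False Suc.prems(3) in \<open>auto simp: algebra_simps\<close>)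
      moreover have "\<bar>sys_rotation B h\<bar> \<le> pi" using short[OF Suc.prems(1), of h] h by simp
      moreover have "\<bar>sys_rotation B (h + (l - h)) - sys_rotation B h - sys_rotation (\<lambda>t. B (h + t)) (l - h)\<bar> \<le> 2 * pi * CARD('n + 'n)"
        by (rule sys_rotation_add[OF Suc.prems(1)]) (use False h in auto)
      ultimately have "\<bar>sys_rotation B l\<bar> \<le> real (Suc k) * c + c" by (simp add: c_def abs_le_iff)
      thus ?thesis by (simp add: algebra_simps)
    qed
  qed
  define K where "K = 2 * c + c / h"
  show ?thesis
  proof (rule that[of K])
    show "K > 0" using c h by (simp add: K_def add_pos_pos)
    fix B :: "real \<Rightarrow> 'n phase_matrix" and l :: real assume B: "admissible b B" and l: "0 \<le> l"
    define k where "k = nat \<lfloor>l / h\<rfloor>"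
    have k: "real k \<le> l / h" "l / h \<le> real (Suc k)"
    proof -
      have "real k = of_int \<lfloor>l / h\<rfloor>" using l h by (simp add: k_def)
      thus "real k \<le> l / h" "l / h \<le> real (Suc k)"
        using floor_correct[of "l / h"] unfolding of_nat_Suc of_int_add of_int_1 by linarith+
    qed
    hence "l \<le> real (Suc k) * h" using h by (simp add: field_simps)
    from steps[OF B l this] have "\<bar>sys_rotation B l\<bar> \<le> real (Suc k) * c" .
    also have "\<dots> \<le> (l / h + 1) * c" using k(1) c by (intro mult_right_mono) auto
    also have "\<dots> \<le> K * (l + 1)"
    proof -
      have "0 \<le> c * l" "0 \<le> c / h" using l c h by auto
      moreover have "(l / h + 1) * c = (c / h) * l + c" "K * (l + 1) = 2 * (c * l) + 2 * c + (c / h) * l + c / h"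
        by (simp_all add: K_def algebra_simps add_divide_distrib)
      ultimately show ?thesis using c by linarith
    qed
    finally show "\<bar>sys_rotation B l\<bar> \<le> K * (l + 1)" .
  qed
qed

section \<open>Hamiltonian orbits\<close>

lemma grad_eq:
  assumes "GDERIV H z :> g"
  shows "grad H z = g"
  unfolding grad_def
proof (rule the_equality)
  show "GDERIV H z :> g" by (rule assms)
  fix k assume "GDERIV H z :> k"
  hence "(\<lambda>h. h \<bullet> k) = (\<lambda>h. h \<bullet> g)"
    using has_derivative_unique[of H _ z "\<lambda>h. h \<bullet> g"] assms unfolding gderiv_def by blast
  from fun_cong[OF this, of "k - g"] have "(k - g) \<bullet> (k - g) = 0" by (simp add: inner_diff_right)
  thus "k = g" by simp
qed

lemma grad_gderiv:
  assumes "C2_function H"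
  shows "GDERIV H z :> grad H z"
proof -
  obtain f' where f': "(H has_derivative f') (at z)"
    using assms unfolding C2_function_def differentiable_def by blast
  define g where "g = (\<Sum>b\<in>Basis. f' b *\<^sub>R b)"
  have lin: "linear f'" using f' has_derivative_linear by blast
  have "f' h = h \<bullet> g" for h
  proof -
    have "f' h = f' (\<Sum>b\<in>Basis. (h \<bullet> b) *\<^sub>R b)" by (simp add: euclidean_representation)
    also have "\<dots> = h \<bullet> g"
      by (simp add: linear_sum[OF lin] linear_scale[OF lin] g_def inner_sum_right mult.commute)
    finally show ?thesis .
  qed
  hence "f' = (\<lambda>h. h \<bullet> g)" by blast
  hence g: "GDERIV H z :> g" using f' by (simp add: gderiv_def)
  thus ?thesis by (simp only: grad_eq[OF g])
qed

lemma grad_has_derivative: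
  assumes "C2_function H"
  shows "(grad H has_derivative (\<lambda>h. hessian H z *v h)) (at z)"
proof -
  have d: "(grad H has_derivative frechet_derivative (grad H) (at z)) (at z)"
    using assms frechet_derivative_works unfolding C2_function_def by blast
  have e: "(\<lambda>h. hessian H z *v h) = frechet_derivative (grad H) (at z)"
    unfolding hessian_def by (rule matrix_vector_mul(2)[OF has_derivative_linear[OF d]])
  show ?thesis unfolding e by (rule d)
qed

text \<open>The mean value theorem in the direction \<open>x\<close> reduces the second difference
  to a difference of gradients near \<open>z\<close>, which is expanded by differentiability of the
  gradient at \<open>z\<close>.\<close>

lemma second_difference:
  fixes H :: "'n::finite phase \<Rightarrow> real"
  assumes H: "C2_function H" and e: "e > 0"
  shows "\<exists>d>0. \<forall>s. 0 < s \<and> s < d \<longrightarrow>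
    \<bar>H (z + s *\<^sub>R x + s *\<^sub>R y) - H (z + s *\<^sub>R x) - H (z + s *\<^sub>R y) + H z - s\<^sup>2 * (x \<bullet> (hessian H z *v y))\<bar>
      \<le> e * (norm x * (2 * norm x + norm y)) * s\<^sup>2"
proof -
  let ?D = "hessian H z"
  define r where "r v = grad H (z + v) - grad H z - ?D *v v" for v
  obtain d0 where d0: "d0 > 0" "\<And>v. norm v < d0 \<Longrightarrow> norm (r v) \<le> e * norm v"
  proof -
    have "\<forall>e>0. \<exists>d>0. \<forall>y. norm (y - z) < d \<longrightarrow> norm (grad H y - grad H z - ?D *v (y - z)) \<le> e * norm (y - z)"
      using grad_has_derivative[OF H, of z] unfolding has_derivative_at_alt by blast
    then obtain d where d: "d > 0" "\<And>y. norm (y - z) < d \<Longrightarrow> norm (grad H y - grad H z - ?D *v (y - z)) \<le> e * norm (y - z)"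
      using e by blast
    have "norm (r v) \<le> e * norm v" if "norm v < d" for v
      using d(2)[of "z + v"] that by (simp add: r_def)
    with d(1) that show ?thesis by blast
  qed
  define d where "d = d0 / (norm x + norm y + 1)"
  have pos: "norm x + norm y + 1 > 0" by (simp add: add_nonneg_pos)
  have d: "d > 0" using d0(1) pos by (simp add: d_def)
  show ?thesis
  proof (intro exI[of _ d] conjI d allI impI)
    fix s assume s: "0 < s \<and> s < d"
    define f where "f t = H (z + t *\<^sub>R x + s *\<^sub>R y) - H (z + t *\<^sub>R x)" for t
    define f' where "f' t = x \<bullet> (grad H (z + t *\<^sub>R x + s *\<^sub>R y) - grad H (z + t *\<^sub>R x))" for t
    have line: "((\<lambda>t. H (w + t *\<^sub>R x)) has_real_derivative x \<bullet> grad H (w + t *\<^sub>R x)) (at t)" for w t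
    proof -
      have "((\<lambda>t. w + t *\<^sub>R x) has_derivative (\<lambda>h. h *\<^sub>R x)) (at t)" by (auto intro!: derivative_eq_intros)
      from diff_chain_at[OF this grad_gderiv[OF H, of "w + t *\<^sub>R x", unfolded gderiv_def]]
      show ?thesis
        unfolding has_field_derivative_def o_def by (rule has_derivative_eq_rhs) (simp add: fun_eq_iff)
    qed
    have df: "(f has_real_derivative f' t) (at t)" for t
    proof -
      have "((\<lambda>t. H ((z + s *\<^sub>R y) + t *\<^sub>R x) - H (z + t *\<^sub>R x)) has_real_derivative
        x \<bullet> grad H ((z + s *\<^sub>R y) + t *\<^sub>R x) - x \<bullet> grad H (z + t *\<^sub>R x)) (at t)"
        by (intro DERIV_diff line)
      thus ?thesis unfolding f_def[abs_def] f'_def by (simp add: add_ac inner_diff_right)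
    qed
    obtain u where u: "0 < u" "u < s" "f s - f 0 = (s - 0) * f' u"
      using MVT2[of 0 s f f'] df s by blast
    have small: "norm (t *\<^sub>R x + q *\<^sub>R y) < d0 \<and> norm (t *\<^sub>R x + q *\<^sub>R y) \<le> s * (norm x + \<bar>q / s\<bar> * norm y)"
      if t: "0 \<le> t" "t \<le> s" "0 \<le> q" "q \<le> s" for t q
    proof -
      have n: "norm (t *\<^sub>R x + q *\<^sub>R y) \<le> t * norm x + q * norm y"
        using norm_triangle_ineq[of "t *\<^sub>R x" "q *\<^sub>R y"] t by simp
      also have "\<dots> \<le> s * norm x + s * norm y" using t by (intro add_mono mult_right_mono) auto
      also have "\<dots> = s * (norm x + norm y)" by (simp add: distrib_left)
      also have "\<dots> \<le> s * (norm x + norm y + 1)" using s by simp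
      also have "\<dots> < d * (norm x + norm y + 1)" using s pos by (intro mult_strict_right_mono) auto
      also have "\<dots> = d0" using pos by (simp add: d_def)
      finally have "norm (t *\<^sub>R x + q *\<^sub>R y) < d0" .
      moreover have "t * norm x + q * norm y \<le> s * (norm x + \<bar>q / s\<bar> * norm y)"
        using t s mult_right_mono[OF t(2) norm_ge_zero[of x]] by (simp add: distrib_left)
      ultimately show ?thesis using n by linarith
    qed
    have r1: "norm (r (u *\<^sub>R x + s *\<^sub>R y)) \<le> e * (s * (norm x + norm y))"
      using order.trans[OF d0(2)[OF conjunct1[OF small[of u s]]] mult_left_mono[OF conjunct2[OF small[of u s]]]] u s e by simp
    have r2: "norm (r (u *\<^sub>R x)) \<le> e * (s * norm x)"
      using order.trans[OF d0(2)[OF conjunct1[OF small[of u 0]]] mult_left_mono[OF conjunct2[OF small[of u 0]]]] u s e by simp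
    have "f' u - s * (x \<bullet> (?D *v y)) = x \<bullet> (r (u *\<^sub>R x + s *\<^sub>R y) - r (u *\<^sub>R x))"
      by (simp add: f'_def r_def matrix_vec inner_diff_right inner_add_right add.assoc)
    also have "\<bar>\<dots>\<bar> \<le> norm x * norm (r (u *\<^sub>R x + s *\<^sub>R y) - r (u *\<^sub>R x))" by (rule Cauchy_Schwarz_ineq2)
    also have "\<dots> \<le> norm x * (e * (s * (norm x + norm y)) + e * (s * norm x))"
      using norm_triangle_ineq4[of "r (u *\<^sub>R x + s *\<^sub>R y)" "r (u *\<^sub>R x)"] r1 r2 by (intro mult_left_mono) auto
    also have "\<dots> = e * (norm x * (2 * norm x + norm y)) * s" by (simp add: algebra_simps)
    finally have b: "\<bar>f' u - s * (x \<bullet> (?D *v y))\<bar> \<le> e * (norm x * (2 * norm x + norm y)) * s" .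
    have "H (z + s *\<^sub>R x + s *\<^sub>R y) - H (z + s *\<^sub>R x) - H (z + s *\<^sub>R y) + H z - s\<^sup>2 * (x \<bullet> (?D *v y)) =
        s * (f' u - s * (x \<bullet> (?D *v y)))"
      using u(3) by (simp add: f_def power2_eq_square algebra_simps)
    hence "\<bar>H (z + s *\<^sub>R x + s *\<^sub>R y) - H (z + s *\<^sub>R x) - H (z + s *\<^sub>R y) + H z - s\<^sup>2 * (x \<bullet> (?D *v y))\<bar> =
        s * \<bar>f' u - s * (x \<bullet> (?D *v y))\<bar>" using s by (simp add: abs_mult)
    also have "\<dots> \<le> s * (e * (norm x * (2 * norm x + norm y)) * s)" using b s by (intro mult_left_mono) auto
    finally show "\<bar>H (z + s *\<^sub>R x + s *\<^sub>R y) - H (z + s *\<^sub>R x) - H (z + s *\<^sub>R y) + H z - s\<^sup>2 * (x \<bullet> (?D *v y))\<bar>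
      \<le> e * (norm x * (2 * norm x + norm y)) * s\<^sup>2" by (simp add: power2_eq_square mult_ac)
  qed
qed

text \<open>The second difference is symmetric in \<open>x\<close> and \<open>y\<close>; divided by
  \<open>s^2\<close> it approximates both mixed terms, so they coincide.\<close>

lemma hessian_symmetric:
  fixes H :: "'n::finite phase \<Rightarrow> real"
  assumes H: "C2_function H"
  shows "transpose (hessian H z) = hessian H z"
proof -
  let ?D = "hessian H z"
  have sym: "x \<bullet> (?D *v y) = y \<bullet> (?D *v x)" for x y
  proof -
    define c where "c = norm x * (2 * norm x + norm y) + norm y * (2 * norm y + norm x)"
    have c: "c \<ge> 0" by (simp add: c_def)
    have "\<bar>x \<bullet> (?D *v y) - y \<bullet> (?D *v x)\<bar> \<le> 0 + e" if e: "e > 0" for e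
    proof -
      define k where "k = e / (c + 1)"
      have k: "k > 0" using e c by (simp add: k_def)
      define Q where "Q s = H (z + s *\<^sub>R x + s *\<^sub>R y) - H (z + s *\<^sub>R x) - H (z + s *\<^sub>R y) + H z" for s
      obtain d1 where d1: "d1 > 0" "\<And>s. 0 < s \<Longrightarrow> s < d1 \<Longrightarrow> \<bar>Q s - s\<^sup>2 * (x \<bullet> (?D *v y))\<bar> \<le> k * (norm x * (2 * norm x + norm y)) * s\<^sup>2"
        using second_difference[OF H k, of z x y] unfolding Q_def by blast
      obtain d2 where d2: "d2 > 0" "\<And>s. 0 < s \<Longrightarrow> s < d2 \<Longrightarrow> \<bar>Q s - s\<^sup>2 * (y \<bullet> (?D *v x))\<bar> \<le> k * (norm y * (2 * norm y + norm x)) * s\<^sup>2"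
        using second_difference[OF H k, of z y x] unfolding Q_def
        by (auto simp: add_ac algebra_simps)
      define s where "s = min d1 d2 / 2"
      have s: "0 < s" "s < d1" "s < d2" using d1(1) d2(1) by (auto simp: s_def)
      have "s\<^sup>2 * \<bar>x \<bullet> (?D *v y) - y \<bullet> (?D *v x)\<bar> = \<bar>(Q s - s\<^sup>2 * (y \<bullet> (?D *v x))) - (Q s - s\<^sup>2 * (x \<bullet> (?D *v y)))\<bar>"
        by (simp add: abs_mult right_diff_distrib[symmetric])
      also have "\<dots> \<le> k * (norm y * (2 * norm y + norm x)) * s\<^sup>2 + k * (norm x * (2 * norm x + norm y)) * s\<^sup>2"
        using d1(2)[OF s(1,2)] d2(2)[OF s(1,3)] by linarith
      also have "\<dots> = s\<^sup>2 * (k * c)" by (simp add: c_def algebra_simps)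
      finally have "\<bar>x \<bullet> (?D *v y) - y \<bullet> (?D *v x)\<bar> \<le> k * c" using s(1) by simp
      also have "\<dots> \<le> e" using e c by (simp add: k_def field_simps)
      finally show ?thesis by simp
    qed
    hence "\<bar>x \<bullet> (?D *v y) - y \<bullet> (?D *v x)\<bar> \<le> 0" by (rule field_le_epsilon)
    thus ?thesis by simp
  qed
  have "x \<bullet> (transpose ?D *v y - ?D *v y) = 0" for x y
    using sym[of x y] inner_matrix_left[of ?D x y] by (simp add: inner_diff_right inner_commute del: transpose_matrix_vector)
  hence "transpose ?D *v y - ?D *v y = 0" for y using inner_eq_zero_iff by blast
  thus ?thesis unfolding matrix_eq by (simp del: transpose_matrix_vector)
qed

lemma hessian_bound:
  fixes H :: "'n::finite phase \<Rightarrow> real"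
  assumes H: "C2_function H"
  shows "\<exists>b>0. \<forall>z\<in>cball 0 R. norm (hessian H z) \<le> b"
proof -
  have "continuous_on (cball 0 R) (hessian H)" using H continuous_on_subset unfolding C2_function_def by blast
  hence "bounded (hessian H ` cball 0 R)" by (intro compact_imp_bounded compact_continuous_image compact_cball)
  thus ?thesis unfolding bounded_pos by blast
qed

lemma grad_lipschitz:
  fixes H :: "'n::finite phase \<Rightarrow> real"
  assumes H: "C2_function H"
  shows "\<exists>L>0. \<forall>x\<in>cball 0 R. \<forall>y\<in>cball 0 R. norm (symp_J *v grad H x - symp_J *v grad H y) \<le> L * norm (x - y)"
proof -
  obtain b where b: "b > 0" "\<And>z. z \<in> cball 0 R \<Longrightarrow> norm (hessian H z) \<le> b" using hessian_bound[OF H, of R] by blast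
  show ?thesis
  proof (intro exI[of _ "norm (symp_J :: 'n phase_matrix) * b"] conjI ballI)
    show "norm (symp_J :: 'n phase_matrix) * b > 0" by (rule mult_pos_pos[OF norm_J_pos b(1)])
    fix x y :: "'n phase" assume xy: "x \<in> cball 0 R" "y \<in> cball 0 R"
    have "norm (grad H x - grad H y) \<le> b * norm (x - y)"
    proof (rule differentiable_bound[of "cball 0 R" "grad H" "\<lambda>z h. hessian H z *v h" b])
      fix z :: "'n phase" assume z: "z \<in> cball 0 R"
      show "(grad H has_derivative (\<lambda>h. hessian H z *v h)) (at z within cball 0 R)"
        using grad_has_derivative[OF H] has_derivative_at_withinI by blast
      show "onorm (\<lambda>h. hessian H z *v h) \<le> b"
        by (rule onorm_le) (rule order.trans[OF norm_matrix_vector_mult mult_right_mono[OF b(2)[OF z] norm_ge_zero]])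
    qed (use xy in auto)
    hence "norm (symp_J :: 'n phase_matrix) * norm (grad H x - grad H y) \<le> norm (symp_J :: 'n phase_matrix) * (b * norm (x - y))"
      by (rule mult_left_mono) simp
    thus "norm (symp_J *v grad H x - symp_J *v grad H y) \<le> norm (symp_J :: 'n phase_matrix) * b * norm (x - y)"
      using norm_matrix_vector_mult[of symp_J "grad H x - grad H y"] by (simp add: matrix_vec mult.assoc)
  qed
qed

section \<open>Orbits of the nonlinear system\<close>

lemma hamiltonian_orbit_shift:
  assumes "hamiltonian_orbit H x"
  shows "hamiltonian_orbit H (\<lambda>t. x (s + t))"
  unfolding hamiltonian_orbit_def
proof
  fix t
  have sh: "((\<lambda>t. s + t) has_vector_derivative 1) (at t)" by (auto intro!: derivative_eq_intros)
  show "((\<lambda>t. x (s + t)) has_vector_derivative symp_J *v grad H (x (s + t))) (at t)"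
    using vector_diff_chain_at[OF sh assms[unfolded hamiltonian_orbit_def, rule_format, of "s + t"]]
    by (simp add: o_def)
qed

lemma hamiltonian_orbit_continuous: "hamiltonian_orbit H x \<Longrightarrow> continuous_on S x"
  unfolding hamiltonian_orbit_def
  by (intro continuous_at_imp_continuous_on ballI has_vector_derivative_continuous) blast

lemma orbit_distance:
  fixes H :: "'n::finite phase \<Rightarrow> real"
  assumes x: "hamiltonian_orbit H x" and y: "hamiltonian_orbit H y"
    and in_ball: "\<And>s. \<bar>s\<bar> \<le> \<bar>t\<bar> \<Longrightarrow> x s \<in> cball 0 R \<and> y s \<in> cball 0 R"
    and L: "\<And>x y. x \<in> cball 0 R \<Longrightarrow> y \<in> cball 0 R \<Longrightarrow> norm (symp_J *v grad H x - symp_J *v grad H y) \<le> L * norm (x - y)"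
  shows "norm (x t - y t) \<le> norm (x 0 - y 0) * exp (L * \<bar>t\<bar>)"
proof (rule gronwall_norm[where g = "\<lambda>t. symp_J *v grad H (x t) - symp_J *v grad H (y t)"])
  show "((\<lambda>t. x t - y t) has_vector_derivative symp_J *v grad H (x t) - symp_J *v grad H (y t)) (at t)" for t
    using x y unfolding hamiltonian_orbit_def by (intro has_vector_derivative_diff) auto
qed (use in_ball L in blast)

text \<open>The vector field is Lipschitz on balls, so a ball containing both orbits over the
  compact interval between \<open>- \<bar>t\<bar>\<close> and \<open>\<bar>t\<bar>\<close> is fixed
  before the distance is estimated.\<close>

lemma orbit_unique:
  fixes H :: "'n::finite phase \<Rightarrow> real"
  assumes H: "C2_function H" and x: "hamiltonian_orbit H x" and y: "hamiltonian_orbit H y" and "x 0 = y 0"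
  shows "x = y"
proof
  fix t :: real
  define S where "S = {- \<bar>t\<bar>..\<bar>t\<bar>}"
  have "compact (x ` S \<union> y ` S)" unfolding S_def
    by (intro compact_Un compact_continuous_image hamiltonian_orbit_continuous[OF x]
        hamiltonian_orbit_continuous[OF y] compact_Icc)
  hence "bounded (x ` S \<union> y ` S)" by (rule compact_imp_bounded)
  then obtain R where R: "\<forall>w \<in> x ` S \<union> y ` S. norm w \<le> R" unfolding bounded_iff by blast
  have in_ball: "x s \<in> cball 0 R \<and> y s \<in> cball 0 R" if "\<bar>s\<bar> \<le> \<bar>t\<bar>" for s
  proof -
    have "s \<in> S" using that unfolding S_def by (simp add: abs_le_iff)
    thus ?thesis using R by simp
  qed
  obtain L where "L > 0" and L: "\<And>x y. x \<in> cball 0 R \<Longrightarrow> y \<in> cball 0 R \<Longrightarrow> norm (symp_J *v grad H x - symp_J *v grad H y) \<le> L * norm (x - y)"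
    using grad_lipschitz[OF H, of R] by blast
  have "norm (x t - y t) \<le> norm (x 0 - y 0) * exp (L * \<bar>t\<bar>)"
    by (rule orbit_distance[OF x y in_ball L])
  thus "x t = y t" using assms(4) by simp
qed

lemma orbit_from_eq: "C2_function H \<Longrightarrow> hamiltonian_orbit H x \<Longrightarrow> orbit_from H (x 0) = x"
  unfolding orbit_from_def by (rule the_equality) (use orbit_unique in blast)+

text \<open>
  By Gronwall's inequality the translates \<open>y (s k + t)\<close> converge, uniformly for bounded \<open>t\<close>, when
  \<open>y (s k)\<close> converges; so no existence theorem for the nonlinear system is needed.
\<close>

lemma limit_orbit:
  fixes H :: "'n::finite phase \<Rightarrow> real"
  assumes H: "C2_function H" and y: "hamiltonian_orbit H y" and R: "range y \<subseteq> cball 0 R" and z: "z \<in> closure (range y)"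
  obtains x where "hamiltonian_orbit H x" "x 0 = z" "\<And>t. x t \<in> closure (range y)"
proof -
  obtain L where L: "L > 0" "\<And>x y. x \<in> cball 0 R \<Longrightarrow> y \<in> cball 0 R \<Longrightarrow> norm (symp_J *v grad H x - symp_J *v grad H y) \<le> L * norm (x - y)"
    using grad_lipschitz[OF H, of R] by blast
  obtain w where w: "\<And>k. w k \<in> range y" "w \<longlonglongrightarrow> z" using z unfolding closure_sequential by blast
  have "\<forall>k. \<exists>r. w k = y r" using w(1) by blast
  then obtain s where s: "\<And>k. w k = y (s k)" by (elim choice[THEN exE]) blast
  define f where "f k t = y (s k + t)" for k t
  have f: "hamiltonian_orbit H (f k)" for k unfolding f_def[abs_def] by (rule hamiltonian_orbit_shift[OF y])
  have fR: "f k t \<in> cball 0 R" for k t unfolding f_def using R by blast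
  have dist_f: "norm (f j t - f k t) \<le> norm (w j - w k) * exp (L * \<bar>t\<bar>)" for j k t
  proof -
    have "norm (f j t - f k t) \<le> norm (f j 0 - f k 0) * exp (L * \<bar>t\<bar>)"
      by (rule orbit_distance[OF f f _ L(2)]) (use fR in blast)+
    thus ?thesis by (simp add: f_def s)
  qed
  have "Cauchy (\<lambda>k. f k t)" for t
  proof (rule CauchyI)
    fix e :: real assume "e > 0"
    hence "e / exp (L * \<bar>t\<bar>) > 0" by simp
    then obtain M where M: "\<And>m n. m \<ge> M \<Longrightarrow> n \<ge> M \<Longrightarrow> norm (w m - w n) < e / exp (L * \<bar>t\<bar>)"
      using CauchyD[OF LIMSEQ_imp_Cauchy[OF w(2)]] by metis
    have "norm (f m t - f n t) < e" if "m \<ge> M" "n \<ge> M" for m n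
      using dist_f[of m t n] M[OF that] by (simp add: field_simps)
    thus "\<exists>M. \<forall>m\<ge>M. \<forall>n\<ge>M. norm (f m t - f n t) < e" by blast
  qed
  hence "\<forall>t. \<exists>l. (\<lambda>k. f k t) \<longlonglongrightarrow> l" using Cauchy_convergent convergent_def by blast
  then obtain x where x: "\<And>t. (\<lambda>k. f k t) \<longlonglongrightarrow> x t" by metis
  have x0: "x 0 = z"
    using LIMSEQ_unique[OF x[of 0]] w(2) by (simp add: f_def s[symmetric])
  have cl: "x t \<in> closure (range y)" for t
    unfolding closure_sequential using x[of t] by (intro exI[of _ "\<lambda>k. f k t"]) (auto simp: f_def)
  have xR: "x t \<in> cball 0 R" for t
    using closure_minimal[OF R closed_cball] cl by blast
  have near: "norm (f k t - x t) \<le> norm (w k - z) * exp (L * \<bar>t\<bar>)" for k t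
  proof (rule LIMSEQ_le[OF _ _ exI[of _ 0]])
    show "(\<lambda>j. norm (f k t - f j t)) \<longlonglongrightarrow> norm (f k t - x t)" by (intro tendsto_intros x)
    show "(\<lambda>j. norm (w k - w j) * exp (L * \<bar>t\<bar>)) \<longlonglongrightarrow> norm (w k - z) * exp (L * \<bar>t\<bar>)" by (intro tendsto_intros w)
  qed (use dist_f in blast)
  have "(x has_vector_derivative symp_J *v grad H (x t)) (at t)" for t
  proof -
    define T where "T = \<bar>t\<bar> + 1"
    \<comment> \<open>All translates stay in one ball, where the vector field is Lipschitz. Their
      derivatives therefore converge uniformly near \<open>t\<close>, and the limit may be
      differentiated.\<close>
    have "\<exists>g. \<forall>u\<in>ball 0 T. (\<lambda>k. f k u) \<longlonglongrightarrow> g u \<and> (g has_derivative (\<lambda>h. h *\<^sub>R (symp_J *v grad H (x u)))) (at u within ball 0 T)"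
    proof (rule has_derivative_sequence[where ?x0.0 = 0 and l = z and f' = "\<lambda>k u h. h *\<^sub>R (symp_J *v grad H (f k u))"])
      fix k and u :: real show "(f k has_derivative (\<lambda>h. h *\<^sub>R (symp_J *v grad H (f k u)))) (at u within ball 0 T)"
        using f[of k] has_derivative_at_withinI unfolding hamiltonian_orbit_def has_vector_derivative_def by blast
    next
      fix e :: real assume e: "e > 0"
      have "(\<lambda>k. L * (norm (w k - z) * exp (L * T))) \<longlonglongrightarrow> L * (norm (z - z) * exp (L * T))"
        by (intro tendsto_intros w)
      hence "\<forall>\<^sub>F k in sequentially. L * (norm (w k - z) * exp (L * T)) < e" using e by (simp add: order_tendstoD(2))
      thus "\<forall>\<^sub>F k in sequentially. \<forall>u\<in>ball 0 T. \<forall>h. norm (h *\<^sub>R (symp_J *v grad H (f k u)) - h *\<^sub>R (symp_J *v grad H (x u))) \<le> e * norm h"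
      proof (eventually_elim, intro ballI allI)
        fix k and u h :: real assume k: "L * (norm (w k - z) * exp (L * T)) < e" and u: "u \<in> ball 0 T"
        have "norm (f k u - x u) \<le> norm (w k - z) * exp (L * T)"
          by (rule order.trans[OF near]) (use u L(1) in \<open>auto intro!: mult_left_mono\<close>)
        hence "norm (symp_J *v grad H (f k u) - symp_J *v grad H (x u)) \<le> e"
          using L(2)[OF fR[of k u] xR[of u]] mult_left_mono[OF _ less_imp_le[OF L(1)], of "norm (f k u - x u)" "norm (w k - z) * exp (L * T)"] k
          by linarith
        hence "\<bar>h\<bar> * norm (symp_J *v grad H (f k u) - symp_J *v grad H (x u)) \<le> \<bar>h\<bar> * e" by (rule mult_left_mono) simp
        thus "norm (h *\<^sub>R (symp_J *v grad H (f k u)) - h *\<^sub>R (symp_J *v grad H (x u))) \<le> e * norm h"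
          by (simp add: scaleR_diff_right[symmetric] mult.commute del: scaleR_diff_right)
      qed
    qed (use x[of 0] x0 in \<open>auto simp: T_def\<close>)
    then obtain g where g: "\<And>u. u \<in> ball 0 T \<Longrightarrow> (\<lambda>k. f k u) \<longlonglongrightarrow> g u"
      "\<And>u. u \<in> ball 0 T \<Longrightarrow> (g has_derivative (\<lambda>h. h *\<^sub>R (symp_J *v grad H (x u)))) (at u within ball 0 T)" by blast
    have gx: "g u = x u" if "u \<in> ball 0 T" for u using LIMSEQ_unique[OF g(1)[OF that] x] .
    have t: "t \<in> ball 0 T" by (simp add: T_def)
    have "(g has_derivative (\<lambda>h. h *\<^sub>R (symp_J *v grad H (x t)))) (at t)"
      using g(2)[OF t] at_within_open[OF t open_ball] by simp
    hence "(x has_derivative (\<lambda>h. h *\<^sub>R (symp_J *v grad H (x t)))) (at t)"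
      by (rule has_derivative_transform_within_open[OF _ open_ball t gx])
    thus ?thesis by (simp add: has_vector_derivative_def)
  qed
  hence "hamiltonian_orbit H x" by (simp add: hamiltonian_orbit_def)
  thus ?thesis using x0 cl by (rule that)
qed

section \<open>Quasi-periodic orbits\<close>

text \<open>The torus carries a product topology, so uniform continuity is stated coordinatewise and
  proved by a Lebesgue number argument: finitely many boxes of half the admissible radius cover it,
  and the other half leaves room for a second point.\<close>

lemma torus_uniformly_continuous:
  fixes D :: "(nat \<Rightarrow> complex) \<Rightarrow> 'a::metric_space"
  assumes D: "continuous_map (torus m) euclidean D" and e: "e > 0"
  shows "\<exists>d>0. \<forall>u\<in>topspace (torus m). \<forall>v\<in>topspace (torus m).
    (\<forall>k<m. dist (u k) (v k) < d) \<longrightarrow> dist (D u) (D v) < e"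
proof -
  let ?X = "torus m"
  have ts: "topspace ?X = PiE {..<m} (\<lambda>_. sphere 0 1)" by (simp add: torus_def)
  have box: "\<exists>r>0. \<forall>v\<in>topspace ?X. (\<forall>k<m. dist (u k) (v k) < r) \<longrightarrow> dist (D u) (D v) < e / 2" if u: "u \<in> topspace ?X" for u
  proof -
    have op: "openin ?X {v \<in> topspace ?X. D v \<in> ball (D u) (e / 2)}"
      by (rule openin_continuous_map_preimage[OF D]) simp
    have "u \<in> {v \<in> topspace ?X. D v \<in> ball (D u) (e / 2)}" using u e by simp
    from bspec[OF op[unfolded torus_def openin_product_topology_alt, folded torus_def] this]
    obtain U where U0: "\<forall>i\<in>{..<m}. openin (top_of_set (sphere 0 1)) (U i)" and U: "u \<in> PiE {..<m} U"
      "PiE {..<m} U \<subseteq> {v \<in> topspace ?X. D v \<in> ball (D u) (e / 2)}"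
      by (elim exE conjE) (rule that)
    have "\<exists>r>0. ball (u i) r \<inter> sphere 0 1 \<subseteq> U i" if i: "i < m" for i
      using bspec[OF U0, of i] PiE_mem[OF U(1), of i] i unfolding openin_contains_ball by simp
    hence "\<forall>i\<in>{..<m}. \<exists>r. r > 0 \<and> ball (u i) r \<inter> sphere 0 1 \<subseteq> U i" by simp
    from bchoice[OF this] obtain r where r: "\<And>i. i < m \<Longrightarrow> r i > 0 \<and> ball (u i) (r i) \<inter> sphere 0 1 \<subseteq> U i" by auto
    define r0 where "r0 = Min (insert 1 (r ` {..<m}))"
    have r0: "r0 > 0" "\<And>i. i < m \<Longrightarrow> r0 \<le> r i" unfolding r0_def using r by (simp_all add: Min_gr_iff)
    have "dist (D u) (D v) < e / 2" if v: "v \<in> topspace ?X" "\<forall>k<m. dist (u k) (v k) < r0" for v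
    proof -
      have "v \<in> PiE {..<m} U"
      proof (rule PiE_I)
        fix k assume "k \<in> {..<m}"
        hence k: "k < m" by simp
        have "v k \<in> sphere 0 1" by (rule PiE_mem[OF v(1)[unfolded ts]]) (simp add: k)
        moreover have "v k \<in> ball (u k) (r k)" using less_le_trans[OF v(2)[rule_format, OF k] r0(2)[OF k]] by simp
        ultimately show "v k \<in> U k" using conjunct2[OF r[OF k]] by (simp add: subset_eq)
      next
        fix k assume "k \<notin> {..<m}" thus "v k = undefined" by (rule PiE_arb[OF v(1)[unfolded ts]])
      qed
      hence "D v \<in> ball (D u) (e / 2)" using U(2) by blast
      thus ?thesis by simp
    qed
    with r0(1) show ?thesis by blast
  qed
  hence "\<forall>u\<in>topspace ?X. \<exists>r. r > 0 \<and> (\<forall>v\<in>topspace ?X. (\<forall>k<m. dist (u k) (v k) < r) \<longrightarrow> dist (D u) (D v) < e / 2)"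
    by simp
  from bchoice[OF this] obtain r where
    r': "\<forall>u\<in>topspace ?X. r u > 0 \<and> (\<forall>v\<in>topspace ?X. (\<forall>k<m. dist (u k) (v k) < r u) \<longrightarrow> dist (D u) (D v) < e / 2)" ..
  have r: "\<And>u. u \<in> topspace ?X \<Longrightarrow> r u > 0"
    "\<And>u v. u \<in> topspace ?X \<Longrightarrow> v \<in> topspace ?X \<Longrightarrow> (\<And>k. k < m \<Longrightarrow> dist (u k) (v k) < r u) \<Longrightarrow> dist (D u) (D v) < e / 2"
    using r' by auto
  define W where "W u = PiE {..<m} (\<lambda>k. sphere 0 1 \<inter> ball (u k) (r u / 2))" for u
  have openW: "openin ?X (W u)" for u
    unfolding W_def torus_def by (subst openin_PiE) (auto intro!: openin_open_Int)
  have inW: "u \<in> W u" if "u \<in> topspace ?X" for u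
    using that r(1)[OF that] unfolding W_def ts by (auto simp: PiE_iff)
  have "compact_space ?X"
    unfolding torus_def by (simp add: compact_space_product_topology compact_space_subtopology)
  moreover have "\<And>V. V \<in> W ` topspace ?X \<Longrightarrow> openin ?X V" using openW by auto
  moreover have "topspace ?X \<subseteq> \<Union>(W ` topspace ?X)" using inW by auto
  ultimately obtain F0 where F0: "finite F0" "F0 \<subseteq> W ` topspace ?X" "topspace ?X \<subseteq> \<Union>F0"
    unfolding compact_space_alt by meson
  obtain F where F: "F \<subseteq> topspace ?X" "finite F" "F0 = W ` F" using finite_subset_image[OF F0(1,2)] by auto
  have cover: "topspace ?X \<subseteq> (\<Union>u\<in>F. W u)" using F0(3) F(3) by simp
  define d where "d = Min (insert 1 ((\<lambda>u. r u / 2) ` F))"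
  have d1: "d > 0" unfolding d_def using F(1,2) r(1) by (auto simp: Min_gr_iff)
  have d2: "d \<le> r u / 2" if "u \<in> F" for u unfolding d_def using F(2) that by (intro Min_le) auto
  show ?thesis
  proof (rule exI[of _ d], intro conjI d1 ballI impI)
    fix u v assume uv: "u \<in> topspace ?X" "v \<in> topspace ?X" and less: "\<forall>k<m. dist (u k) (v k) < d"
    obtain w where w: "w \<in> F" "u \<in> W w" using cover uv(1) by blast
    have wX: "w \<in> topspace ?X" using w(1) F(1) by blast
    have wu: "dist (w k) (u k) < r w / 2" if "k < m" for k using w(2) that unfolding W_def by (auto simp: PiE_iff)
    have "dist (w k) (u k) < r w" if "k < m" for k using wu[OF that] r(1)[OF wX] by linarith
    hence 1: "dist (D w) (D u) < e / 2" by (rule r(2)[OF wX uv(1)])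
    have "dist (w k) (v k) < r w" if "k < m" for k
      using wu[OF that] less[rule_format, OF that] d2[OF w(1)] dist_triangle[of "w k" "v k" "u k"] by linarith
    hence 2: "dist (D w) (D v) < e / 2" by (rule r(2)[OF wX uv(2)])
    show "dist (D u) (D v) < e" using 1 2 dist_triangle[of "D u" "D v" "D w"] by (simp add: dist_commute)
  qed
qed

text \<open>One time is chosen for each of the finitely many values, and \<open>L\<close> is the
  largest modulus among these times.\<close>

lemma finite_cells_representatives:
  fixes q :: "real \<Rightarrow> 'b"
  assumes "finite (range q)"
  shows "\<exists>L. \<forall>s. \<exists>r. \<bar>r\<bar> \<le> L \<and> q r = q s"
proof -
  define g where "g c = (SOME s. q s = c)" for c
  have g: "q (g (q s)) = q s" for s unfolding g_def by (rule someI[of _ s]) simp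
  have fin: "finite ((\<lambda>c. \<bar>g c\<bar>) ` range q)" using assms by simp
  show ?thesis
  proof (rule exI[of _ "Max ((\<lambda>c. \<bar>g c\<bar>) ` range q)"], rule allI)
    fix s
    show "\<exists>r. \<bar>r\<bar> \<le> Max ((\<lambda>c. \<bar>g c\<bar>) ` range q) \<and> q r = q s"
      by (intro exI[of _ "g (q s)"] conjI g Max_ge fin) auto
  qed
qed

text \<open>
  The translates of a quasi-periodic orbit form a totally bounded set for the supremum norm: the
  distance of the phases of two translates does not depend on time, and the phases fall into
  finitely many small cells.
\<close>

lemma quasi_periodic_almost_periodic:
  fixes y :: "real \<Rightarrow> 'n::finite phase"
  assumes y: "quasi_periodic y" and e: "e > 0"
  shows "\<exists>L. \<forall>s. \<exists>r. \<bar>r\<bar> \<le> L \<and> (\<forall>t. norm (y (s + t) - y (r + t)) < e)"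
proof -
  obtain m D w where D: "homeomorphic_map (torus m) (top_of_set (orbit_closure y)) D"
    and yt: "\<And>t. y t = D (torus_add m (inv_into (topspace (torus m)) D (y 0)) (\<lambda>k. w k * t))"
    using y unfolding quasi_periodic_def by blast
  define u0 where "u0 = inv_into (topspace (torus m)) D (y 0)"
  have ts: "topspace (torus m) = PiE {..<m} (\<lambda>_. sphere 0 1)" by (simp add: torus_def)
  have "y 0 \<in> D ` topspace (torus m)"
    using homeomorphic_imp_surjective_map[OF D] subsetD[OF closure_subset, of "y 0" "range y"]
    by (simp add: orbit_closure_def)
  hence u0: "u0 \<in> topspace (torus m)" unfolding u0_def by (rule inv_into_into)
  define p where "p t = torus_add m u0 (\<lambda>k. w k * t)" for t
  have yp: "y t = D (p t)" for t unfolding p_def u0_def by (rule yt)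
  have p: "p t \<in> topspace (torus m)" for t
    using u0 unfolding ts p_def torus_add_def by (auto simp: PiE_iff norm_mult)
  have contD: "continuous_map (torus m) euclidean D"
    using homeomorphic_imp_continuous_map[OF D] by (simp add: continuous_map_in_subtopology)
  obtain d where d: "d > 0" "\<forall>u\<in>topspace (torus m). \<forall>v\<in>topspace (torus m).
    (\<forall>k<m. dist (u k) (v k) < d) \<longrightarrow> dist (D u) (D v) < e"
    using torus_uniformly_continuous[OF contD e] by (elim exE conjE)
  define z where "z k s = cis (2 * pi * (w k * s))" for k s
  have pdist: "dist (p (s + t) k) (p (r + t) k) = dist (z k s) (z k r)" if k: "k < m" for s t r k
  proof -
    have e1: "p (s + t) k = u0 k * z k t * z k s" for s
      using k by (simp add: p_def torus_add_def z_def cis_mult distrib_left mult.assoc add.commute)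
    have "norm (u0 k) = 1" using u0 k unfolding ts by (auto simp: PiE_iff)
    hence "norm (u0 k * z k t) = 1" by (simp add: norm_mult z_def)
    thus ?thesis unfolding e1 dist_norm right_diff_distrib[symmetric] norm_mult[of "u0 k * z k t"] by simp
  qed
  \<comment> \<open>Two phases in the same cell of side \<open>1 / N\<close> are less than
    \<open>2 / N\<close> apart in each coordinate of the torus, hence less than
    \<open>d\<close>.\<close>
  obtain N :: nat where N: "2 / d < real N" using reals_Archimedean2 by blast
  have N0: "real N > 0" using N d(1) by (smt (verit) divide_pos_pos)
  define q where "q s = (\<lambda>k\<in>{..<m}. (\<lfloor>N * Re (z k s)\<rfloor>, \<lfloor>N * Im (z k s)\<rfloor>))" for s
  have bd: "\<lfloor>N * x\<rfloor> \<in> {- int N..int N}" if x: "\<bar>x\<bar> \<le> 1" for x :: real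
  proof -
    have "- real N \<le> N * x" "N * x \<le> real N" using x N0 mult_left_mono[of "-1" x "real N"] mult_left_mono[of x 1 "real N"] by (auto simp: abs_le_iff)
    thus ?thesis by (simp add: floor_le_iff le_floor_iff)
  qed
  have "q s \<in> PiE {..<m} (\<lambda>_. {- int N..int N} \<times> {- int N..int N})" for s
    unfolding q_def restrict_PiE_iff z_def
    using bd[OF abs_cos_le_one] bd[OF abs_sin_le_one] by (simp del: atLeastAtMost_iff)
  hence "range q \<subseteq> PiE {..<m} (\<lambda>_. {- int N..int N} \<times> {- int N..int N})" by (rule image_subsetI)
  hence "finite (range q)" by (rule finite_subset) (intro finite_PiE finite_cartesian_product, auto)
  from finite_cells_representatives[OF this] obtain L where L: "\<forall>s. \<exists>r. \<bar>r\<bar> \<le> L \<and> q r = q s" ..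
  show ?thesis
  proof (rule exI[of _ L], rule allI)
    fix s
    obtain r where r: "\<bar>r\<bar> \<le> L" "q r = q s" using L by blast
    have zd: "dist (z k s) (z k r) < d" if k: "k < m" for k
    proof -
      have fl: "\<bar>a - c\<bar> < 1 / N" if "\<lfloor>N * a\<rfloor> = \<lfloor>N * c\<rfloor>" for a c :: real
      proof -
        have "\<bar>N * a - N * c\<bar> < 1" using that floor_correct[of "N * a"] floor_correct[of "N * c"] by linarith
        hence "N * \<bar>a - c\<bar> < 1" using N0 by (simp add: abs_mult right_diff_distrib[symmetric] del: right_diff_distrib)
        thus ?thesis using N0 by (simp add: field_simps)
      qed
      have "\<lfloor>N * Re (z k s)\<rfloor> = \<lfloor>N * Re (z k r)\<rfloor>" "\<lfloor>N * Im (z k s)\<rfloor> = \<lfloor>N * Im (z k r)\<rfloor>"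
        using fun_cong[OF r(2), of k] k by (simp_all add: q_def)
      from this[THEN fl] have "\<bar>Re (z k s - z k r)\<bar> + \<bar>Im (z k s - z k r)\<bar> < 1 / N + 1 / N" by simp
      hence "norm (z k s - z k r) < 2 / N" using cmod_le[of "z k s - z k r"] by simp
      also have "2 / real N < d" using N N0 d(1) by (simp add: field_simps)
      finally show ?thesis by (simp add: dist_norm)
    qed
    have "norm (y (s + t) - y (r + t)) < e" for t
      using d(2)[rule_format, OF p[of "s + t"] p[of "r + t"]] pdist zd by (simp add: yp dist_norm)
    with r(1) show "\<exists>r. \<bar>r\<bar> \<le> L \<and> (\<forall>t. norm (y (s + t) - y (r + t)) < e)" by blast
  qed
qed

section \<open>Quasi-additive functionals along almost periodic curves\<close>

text \<open>This is Bohr's condition: the differences \<open>s - r\<close> are almost periods, and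
  they are relatively dense. The form with representatives from a bounded set of shifts is the one
  that is used.\<close>

definition almost_periodic :: "(real \<Rightarrow> 'v::real_normed_vector) \<Rightarrow> bool" where
  "almost_periodic y \<longleftrightarrow> (\<forall>e>0. \<exists>L. \<forall>s. \<exists>r. \<bar>r\<bar> \<le> L \<and> (\<forall>t. norm (y (s + t) - y (r + t)) < e))"

text \<open>The shift \<open>s\<close> may change with \<open>t\<close>. A curve approaching a limit
  set need not follow a single orbit with a fixed phase; on every late window it only has to look
  like some piece of \<open>y\<close>.\<close>

definition asymptotic :: "(real \<Rightarrow> 'v::real_normed_vector) \<Rightarrow> (real \<Rightarrow> 'v) \<Rightarrow> bool" where
  "asymptotic x y \<longleftrightarrow> (\<forall>T\<ge>0. \<forall>d>0. \<exists>t0\<ge>0. \<forall>t\<ge>t0. \<exists>s. \<forall>u\<in>{0..T}. norm (x (t + u) - y (s + u)) < d)"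

lemma asymptotic_refl: "asymptotic x x"
  unfolding asymptotic_def
proof (intro allI impI, rule exI[of _ 0], intro conjI allI impI order_refl)
  fix T d t :: real assume "0 < d"
  thus "\<exists>s. \<forall>u\<in>{0..T}. norm (x (t + u) - x (s + u)) < d" by (intro exI[of _ t]) simp
qed

text \<open>The properties of the rotation along orbits. The point of \<open>near\<close> is that
  \<open>C\<close> is the same for all \<open>T\<close> while \<open>d\<close> may depend on
  \<open>T\<close>, so that the error per unit of time is of order \<open>1 / T\<close>.\<close>

locale quasi_additive =
  fixes X :: "(real \<Rightarrow> 'v::real_normed_vector) set" and F :: "(real \<Rightarrow> 'v) \<Rightarrow> real \<Rightarrow> real" and c C K :: real
  assumes shift: "x \<in> X \<Longrightarrow> (\<lambda>t. x (s + t)) \<in> X"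
    and add: "x \<in> X \<Longrightarrow> 0 \<le> s \<Longrightarrow> 0 \<le> t \<Longrightarrow> \<bar>F x (s + t) - F x s - F (\<lambda>t. x (s + t)) t\<bar> \<le> c"
    and near: "0 \<le> T \<Longrightarrow> \<exists>d>0. \<forall>x\<in>X. \<forall>y\<in>X. (\<forall>t\<in>{0..T}. norm (x t - y t) < d) \<longrightarrow> \<bar>F x T - F y T\<bar> \<le> C"
    and growth: "x \<in> X \<Longrightarrow> 0 \<le> l \<Longrightarrow> \<bar>F x l\<bar> \<le> K * (l + 1)"
    and nonneg: "0 \<le> c" "0 \<le> C" "0 \<le> K"
begin

lemma sum_blocks:
  assumes z: "z \<in> X" and T: "0 \<le> T" and a: "\<And>i. \<bar>F (\<lambda>t. z (real i * T + t)) T - a i\<bar> \<le> e"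
  shows "\<bar>F z (real n * T) - (\<Sum>i<n. a i)\<bar> \<le> real n * (e + c) + K"
proof (induction n)
  case 0 thus ?case using growth[OF z, of 0] by simp
next
  case (Suc n)
  have "\<bar>F z (real n * T + T) - F z (real n * T) - F (\<lambda>t. z (real n * T + t)) T\<bar> \<le> c"
    using T by (intro add[OF z]) auto
  moreover have "real (Suc n) * T = real n * T + T" "real (Suc n) * (e + c) = real n * (e + c) + (e + c)"
    by (simp_all add: algebra_simps)
  ultimately show ?case using Suc a[of n] by simp
qed

text \<open>The incomplete last block has length at most \<open>T\<close>, so \<open>growth\<close>
  bounds it by a constant independent of \<open>l\<close>.\<close>

lemma approx_blocks:
  assumes z: "z \<in> X" and T: "0 \<le> T" and n: "real n * T \<le> l" "l \<le> real n * T + T"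
    and a: "\<And>i. \<bar>F (\<lambda>t. z (real i * T + t)) T - a i\<bar> \<le> e"
  shows "\<bar>F z l - (\<Sum>i<n. a i)\<bar> \<le> real n * (e + c) + (c + K * (T + 2))"
proof -
  have "\<bar>F z (real n * T + (l - real n * T)) - F z (real n * T) - F (\<lambda>t. z (real n * T + t)) (l - real n * T)\<bar> \<le> c"
    using T n by (intro add[OF z]) auto
  moreover have "\<bar>F (\<lambda>t. z (real n * T + t)) (l - real n * T)\<bar> \<le> K * (l - real n * T + 1)"
    using n by (intro growth[OF shift[OF z]]) auto
  moreover have "K * (l - real n * T + 1) \<le> K * (T + 1)" using n nonneg by (intro mult_left_mono) auto
  moreover have "K * (T + 2) = K * (T + 1) + K" by (simp add: algebra_simps)
  ultimately show ?thesis using sum_blocks[OF z T a, of n] by simp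
qed

lemma block_number:
  assumes "0 < T" "0 \<le> l"
  obtains n where "real n * T \<le> l" "l \<le> real n * T + T" "real n \<le> l / T"
proof (rule that[of "nat \<lfloor>l / T\<rfloor>"])
  have n: "real (nat \<lfloor>l / T\<rfloor>) = of_int \<lfloor>l / T\<rfloor>" using assms by simp
  have "of_int \<lfloor>l / T\<rfloor> \<le> l / T" "l / T < of_int \<lfloor>l / T\<rfloor> + 1" by linarith+
  moreover from this have "of_int \<lfloor>l / T\<rfloor> * T \<le> l / T * T" "l / T * T \<le> (of_int \<lfloor>l / T\<rfloor> + 1) * T"
    using assms(1) by (intro mult_right_mono; simp)+
  ultimately show "real (nat \<lfloor>l / T\<rfloor>) \<le> l / T" "real (nat \<lfloor>l / T\<rfloor>) * T \<le> l" "l \<le> real (nat \<lfloor>l / T\<rfloor>) * T + T"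
    unfolding n using assms(1) by (simp_all add: distrib_right)
qed

text \<open>Both curves are cut into blocks of length \<open>T\<close>. Each block costs
  \<open>C\<close> for the comparison and \<open>c\<close> for each of the two additivity defects,
  and there are at most \<open>l / T\<close> blocks.\<close>

lemma compare_curves:
  assumes T: "0 < T"
  shows "\<exists>d>0. \<forall>x\<in>X. \<forall>y\<in>X. (\<forall>t. norm (x t - y t) < d) \<longrightarrow>
    (\<forall>l\<ge>0. \<bar>F x l - F y l\<bar> \<le> l / T * (C + 2 * c) + 2 * (c + K * (T + 2)))"
proof -
  obtain d where d: "d > 0" "\<forall>x\<in>X. \<forall>y\<in>X. (\<forall>t\<in>{0..T}. norm (x t - y t) < d) \<longrightarrow> \<bar>F x T - F y T\<bar> \<le> C"
    using near[of T] T by auto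
  show ?thesis
  proof (rule exI[of _ d], intro conjI d(1) ballI impI allI)
    fix x y l assume x: "x \<in> X" and y: "y \<in> X" and xy: "\<forall>t. norm (x t - y t) < d" and l: "(0::real) \<le> l"
    obtain n where n: "real n * T \<le> l" "l \<le> real n * T + T" "real n \<le> l / T"
      by (rule block_number[OF T l])
    let ?a = "\<lambda>i. F (\<lambda>t. y (real i * T + t)) T"
    have "\<bar>F x l - (\<Sum>i<n. ?a i)\<bar> \<le> real n * (C + c) + (c + K * (T + 2))"
    proof (rule approx_blocks[OF x less_imp_le[OF T] n(1,2)])
      fix i show "\<bar>F (\<lambda>t. x (real i * T + t)) T - ?a i\<bar> \<le> C"
        using d(2)[rule_format, OF shift[OF x] shift[OF y], of "real i * T" "real i * T"] xy by simp
    qed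
    moreover have "\<bar>F y l - (\<Sum>i<n. ?a i)\<bar> \<le> real n * (0 + c) + (c + K * (T + 2))"
      by (rule approx_blocks[OF y less_imp_le[OF T] n(1,2)]) simp
    ultimately have "\<bar>F x l - F y l\<bar> \<le> real n * (C + 2 * c) + 2 * (c + K * (T + 2))"
      by (simp add: distrib_left)
    also have "real n * (C + 2 * c) \<le> l / T * (C + 2 * c)" using n(3) nonneg by (intro mult_right_mono) auto
    finally show "\<bar>F x l - F y l\<bar> \<le> l / T * (C + 2 * c) + 2 * (c + K * (T + 2))" by simp
  qed
qed

text \<open>The interval of length \<open>s + l\<close> is cut once at \<open>s\<close> and once at
  \<open>l\<close>; the two pieces of length \<open>s\<close> are bounded by \<open>growth\<close>,
  independently of \<open>l\<close>.\<close>

lemma compare_shift: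
  assumes x: "x \<in> X" and "0 \<le> s" "0 \<le> l"
  shows "\<bar>F (\<lambda>t. x (s + t)) l - F x l\<bar> \<le> 2 * c + 2 * K * (s + 1)"
proof -
  have "\<bar>F x (s + l) - F x s - F (\<lambda>t. x (s + t)) l\<bar> \<le> c" "\<bar>F x (l + s) - F x l - F (\<lambda>t. x (l + t)) s\<bar> \<le> c"
    using assms by (auto intro!: add)
  moreover have "\<bar>F x s\<bar> \<le> K * (s + 1)" "\<bar>F (\<lambda>t. x (l + t)) s\<bar> \<le> K * (s + 1)"
    using assms by (auto intro!: growth shift)
  ultimately show ?thesis by (simp add: add.commute)
qed

text \<open>Almost periodicity replaces an arbitrary translate by one with a bounded shift, whose
  effect goes into the constant \<open>D\<close>. What grows with \<open>l\<close> has a slope of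
  order \<open>1 / T\<close>.\<close>

lemma oscillation:
  assumes y: "y \<in> X" "almost_periodic y" and T: "0 < T"
  obtains D where "0 \<le> D" "\<And>s l. 0 \<le> l \<Longrightarrow> \<bar>F (\<lambda>t. y (s + t)) l - F y l\<bar> \<le> 2 * (l / T * (C + 2 * c)) + D"
proof -
  obtain d where d: "d > 0" "\<forall>x\<in>X. \<forall>y\<in>X. (\<forall>t. norm (x t - y t) < d) \<longrightarrow>
    (\<forall>l\<ge>0. \<bar>F x l - F y l\<bar> \<le> l / T * (C + 2 * c) + 2 * (c + K * (T + 2)))"
    using compare_curves[OF T] by (elim exE conjE)
  obtain L where L: "\<forall>s. \<exists>r. \<bar>r\<bar> \<le> L \<and> (\<forall>t. norm (y (s + t) - y (r + t)) < d)"
    using y(2)[unfolded almost_periodic_def, rule_format, OF d(1)] by (elim exE)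
  define E where "E = 2 * (c + K * (T + 2)) + (2 * c + 2 * K * (2 * L + 1))"
  have L0: "0 \<le> L" using L by (meson abs_ge_zero order.trans)
  \<comment> \<open>The reference is the translate by \<open>- L\<close>: a representative
    \<open>r\<close> lies ahead of it by \<open>r + L\<close>, which is nonnegative as
    \<open>compare_shift\<close> requires.\<close>
  have base: "\<bar>F (\<lambda>t. y (s + t)) l - F (\<lambda>t. y (- L + t)) l\<bar> \<le> l / T * (C + 2 * c) + E" if l: "0 \<le> l" for s l
  proof -
    obtain r where r: "\<bar>r\<bar> \<le> L" "\<forall>t. norm (y (s + t) - y (r + t)) < d" using L by blast
    have "\<bar>F (\<lambda>t. y (s + t)) l - F (\<lambda>t. y (r + t)) l\<bar> \<le> l / T * (C + 2 * c) + 2 * (c + K * (T + 2))"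
      using d(2)[rule_format, OF shift[OF y(1)] shift[OF y(1)], of s r] r(2) l by blast
    moreover have "\<bar>F (\<lambda>t. y (- L + (r + L + t))) l - F (\<lambda>t. y (- L + t)) l\<bar> \<le> 2 * c + 2 * K * (r + L + 1)"
      using r(1) l by (intro compare_shift shift[OF y(1)]) auto
    moreover have "2 * K * (r + L + 1) \<le> 2 * K * (2 * L + 1)" using r(1) nonneg by (intro mult_left_mono) auto
    moreover have "(\<lambda>t. y (- L + (r + L + t))) = (\<lambda>t. y (r + t))" by (simp add: algebra_simps)
    ultimately show ?thesis by (simp add: E_def)
  qed
  have "0 \<le> E" using nonneg T L0 by (simp add: E_def)
  moreover have "\<bar>F (\<lambda>t. y (s + t)) l - F y l\<bar> \<le> 2 * (l / T * (C + 2 * c)) + 2 * E" if "0 \<le> l" for s l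
    using base[OF that, of s] base[OF that, of 0] by simp
  ultimately show ?thesis using that[of "2 * E"] by simp
qed

text \<open>\<open>A\<close> is chosen from \<open>y\<close> and \<open>e\<close> alone. Every late
  block of a curve asymptotic to \<open>y\<close> is close to a translate of \<open>y\<close>, and
  all translates have nearly the value \<open>F y T\<close>, so one \<open>A\<close> serves all
  these curves.\<close>

lemma mean_approximation:
  assumes y: "y \<in> X" "almost_periodic y" and e: "0 < e"
  shows "\<exists>A. \<forall>x\<in>X. asymptotic x y \<longrightarrow> (\<forall>\<^sub>F l in at_top. \<bar>F x l / l - A\<bar> \<le> e)"
proof -
  \<comment> \<open>There are two scales. \<open>T'\<close> makes the slope of the oscillation at
    most \<open>e / 3\<close> and thereby fixes \<open>D\<close>; then \<open>T\<close> is taken so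
    long that \<open>D\<close> and the errors per block add at most \<open>e / 3\<close>. The last
    third is left for the terms independent of \<open>l\<close>.\<close>
  define T' where "T' = 6 * (C + 2 * c) / e + 1"
  have T': "0 < T'" using nonneg e by (simp add: T'_def add_nonneg_pos)
  have T'e: "2 * (C + 2 * c) / T' \<le> e / 3"
    using T' e nonneg by (simp add: pos_divide_le_eq) (simp add: T'_def field_simps)
  obtain D where D: "0 \<le> D" "\<And>s l. 0 \<le> l \<Longrightarrow> \<bar>F (\<lambda>t. y (s + t)) l - F y l\<bar> \<le> 2 * (l / T' * (C + 2 * c)) + D"
    by (rule oscillation[OF y T'], erule that, assumption)
  define T where "T = 3 * (D + C + c) / e + 1"
  have T: "0 < T" using nonneg e D(1) by (simp add: T_def add_nonneg_pos)
  have Te: "(D + C + c) / T \<le> e / 3" using T e D(1) nonneg by (simp add: pos_divide_le_eq) (simp add: T_def field_simps)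
  define a where "a = F y T"
  define h where "h = C + (2 * (T / T' * (C + 2 * c)) + D)"
  have h: "(h + c) / T \<le> 2 * e / 3"
  proof -
    have "(h + c) / T = (D + C + c) / T + 2 * (C + 2 * c) / T'" using T by (simp add: h_def field_simps)
    thus ?thesis using T'e Te by simp
  qed
  have hc: "0 \<le> h + c" using nonneg D(1) T T' by (simp add: h_def)
  obtain d where d: "d > 0" "\<forall>x\<in>X. \<forall>y\<in>X. (\<forall>t\<in>{0..T}. norm (x t - y t) < d) \<longrightarrow> \<bar>F x T - F y T\<bar> \<le> C"
    using near[of T] T by auto
  show ?thesis
  proof (rule exI[of _ "a / T"], intro ballI impI)
    fix x assume x: "x \<in> X" and xy: "asymptotic x y"
    obtain t0 where t0: "t0 \<ge> 0" "\<forall>t\<ge>t0. \<exists>s. \<forall>u\<in>{0..T}. norm (x (t + u) - y (s + u)) < d"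
      using xy[unfolded asymptotic_def, rule_format, of T d] T d(1) by auto
    define z where "z = (\<lambda>t. x (t0 + t))"
    have z: "z \<in> X" unfolding z_def by (rule shift[OF x])
    have blk: "\<bar>F (\<lambda>t. z (real i * T + t)) T - a\<bar> \<le> h" for i
    proof -
      have "t0 \<le> t0 + real i * T" using T by simp
      then obtain s where s: "\<forall>u\<in>{0..T}. norm (x (t0 + real i * T + u) - y (s + u)) < d" using t0(2) by blast
      have "\<bar>F (\<lambda>t. z (real i * T + t)) T - F (\<lambda>t. y (s + t)) T\<bar> \<le> C"
        using d(2)[rule_format, OF shift[OF z] shift[OF y(1)], of "real i * T" s] s by (simp add: z_def add.assoc)
      moreover have "\<bar>F (\<lambda>t. y (s + t)) T - a\<bar> \<le> 2 * (T / T' * (C + 2 * c)) + D"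
        unfolding a_def using T by (intro D(2)) simp
      ultimately show ?thesis by (simp add: h_def)
    qed
    define E where "E = c + K * (T + 2) + \<bar>a\<bar> + (c + K * (t0 + 1) + t0 * \<bar>a / T\<bar>)"
    have bound: "\<bar>F x l - l * (a / T)\<bar> \<le> l * (2 * e / 3) + E" if l: "t0 \<le> l" for l
    proof -
      have l0: "0 \<le> l - t0" using l by simp
      obtain n where n: "real n * T \<le> l - t0" "l - t0 \<le> real n * T + T" "real n \<le> (l - t0) / T"
        by (rule block_number[OF T l0])
      have 1: "\<bar>F z (l - t0) - real n * a\<bar> \<le> real n * (h + c) + (c + K * (T + 2))"
        using approx_blocks[OF z less_imp_le[OF T] n(1,2) blk] by simp
      have "real n * (h + c) \<le> (l - t0) / T * (h + c)" using n(3) hc by (rule mult_right_mono)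
      also have "\<dots> = (l - t0) * ((h + c) / T)" by simp
      also have "\<dots> \<le> l * (2 * e / 3)" using h hc T t0(1) l by (intro mult_mono) auto
      finally have 2: "real n * (h + c) \<le> l * (2 * e / 3)" .
      have "\<bar>(l - t0) - real n * T\<bar> * \<bar>a / T\<bar> \<le> T * \<bar>a / T\<bar>" using n(1,2) by (intro mult_right_mono) auto
      hence "\<bar>((l - t0) - real n * T) * (a / T)\<bar> \<le> T * \<bar>a / T\<bar>" by (simp only: abs_mult)
      moreover have "((l - t0) - real n * T) * (a / T) = l * (a / T) - t0 * (a / T) - real n * a" "T * \<bar>a / T\<bar> = \<bar>a\<bar>"
        using T by (simp_all add: algebra_simps)
      ultimately have 3: "\<bar>l * (a / T) - t0 * (a / T) - real n * a\<bar> \<le> \<bar>a\<bar>" by (simp only:)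
      have 4: "\<bar>t0 * (a / T)\<bar> \<le> t0 * \<bar>a / T\<bar>" using t0(1) by (simp only: abs_mult abs_of_nonneg)
      have 5: "\<bar>F x (t0 + (l - t0)) - F x t0 - F z (l - t0)\<bar> \<le> c" unfolding z_def using t0(1) l by (intro add[OF x]) auto
      have 6: "\<bar>F x t0\<bar> \<le> K * (t0 + 1)" by (rule growth[OF x t0(1)])
      have 7: "F x l - F x t0 - F z (l - t0) \<le> c" "- (F x l - F x t0 - F z (l - t0)) \<le> c"
        using 5 by (simp_all add: abs_le_iff)
      have combine: "\<bar>u - p\<bar> \<le> w + (k + m + f)"
        if "\<bar>v - q\<bar> \<le> n' + k" "n' \<le> w" "\<bar>p - r - q\<bar> \<le> m" "\<bar>r\<bar> \<le> r'" "\<bar>u - u0 - v\<bar> \<le> c" "\<bar>u0\<bar> \<le> u0'" "f = c + u0' + r'"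
        for u v p q w k m f r r' n' u0 u0' :: real
        using that by linarith
      show ?thesis unfolding E_def by (rule combine[OF 1 2 3 4 _ 6 refl]) (use 5 in simp)
    qed
    show "\<forall>\<^sub>F l in at_top. \<bar>F x l / l - a / T\<bar> \<le> e"
    proof (rule eventually_at_top_linorderI[of "max t0 (max 1 (3 * E / e))"])
      fix l assume "max t0 (max 1 (3 * E / e)) \<le> l"
      hence l: "t0 \<le> l" "0 < l" "3 * E / e \<le> l" by auto
      have "E \<le> l * (e / 3)" using l(3) e by (simp add: field_simps)
      hence "\<bar>F x l - l * (a / T)\<bar> \<le> l * e" using bound[OF l(1)] by (simp add: field_simps)
      moreover have "F x l / l - a / T = (F x l - l * (a / T)) / l" using l(2) by (simp add: field_simps)
      ultimately show "\<bar>F x l / l - a / T\<bar> \<le> e" using l(2) by (simp add: abs_divide pos_divide_le_eq mult.commute)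
    qed
  qed
qed

text \<open>The intervals of radius \<open>e\<close> around \<open>A e\<close> meet pairwise,
  because the mean of \<open>y\<close> itself eventually lies in any two of them. The supremum of
  their left ends is a common point.\<close>

lemma mean_limit:
  assumes y: "y \<in> X" "almost_periodic y"
  shows "\<exists>\<rho>. \<forall>x\<in>X. asymptotic x y \<longrightarrow> ((\<lambda>l. F x l / l) \<longlongrightarrow> \<rho>) at_top"
proof -
  have "\<forall>e. \<exists>A. 0 < e \<longrightarrow> (\<forall>x\<in>X. asymptotic x y \<longrightarrow> (\<forall>\<^sub>F l in at_top. \<bar>F x l / l - A\<bar> \<le> e))"
    using mean_approximation[OF y] by blast
  from choice[OF this] obtain A where A: "\<And>e x. 0 < e \<Longrightarrow> x \<in> X \<Longrightarrow> asymptotic x y \<Longrightarrow> \<forall>\<^sub>F l in at_top. \<bar>F x l / l - A e\<bar> \<le> e"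
    by blast
  have compat: "A e - e \<le> A e' + e'" if "0 < e" "0 < e'" for e e'
  proof -
    have "\<forall>\<^sub>F l :: real in at_top. A e - e \<le> A e' + e'"
      using A[OF that(1) y(1) asymptotic_refl] A[OF that(2) y(1) asymptotic_refl]
      by eventually_elim linarith
    thus ?thesis by simp
  qed
  define \<rho> where "\<rho> = (SUP e\<in>{0<..}. A e - e)"
  have \<rho>: "\<bar>A e - \<rho>\<bar> \<le> e" if e: "0 < e" for e
  proof -
    have "\<rho> \<le> A e + e" unfolding \<rho>_def
      using compat[OF _ e] by (intro cSUP_least) (auto intro: exI[of _ 1])
    moreover have "A e - e \<le> \<rho>" unfolding \<rho>_def
      using e compat[OF _ zero_less_one] by (intro cSUP_upper bdd_aboveI2[of _ _ "A 1 + 1"]) auto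
    ultimately show ?thesis by linarith
  qed
  show ?thesis
  proof (rule exI[of _ \<rho>], intro ballI impI tendstoI)
    fix x e assume x: "x \<in> X" "asymptotic x y" and e: "(0::real) < e"
    have e3: "0 < e / 3" using e by simp
    show "\<forall>\<^sub>F l in at_top. dist (F x l / l) \<rho> < e"
      using A[OF e3 x]
    proof eventually_elim
      case (elim l) thus ?case using \<rho>[OF e3] e unfolding dist_real_def by linarith
    qed
  qed
qed

end

section \<open>The mean index of asymptotically quasi-periodic orbits\<close>

definition orbits :: "('n::finite phase \<Rightarrow> real) \<Rightarrow> real \<Rightarrow> (real \<Rightarrow> 'n phase) set" where
  "orbits H R = {x. hamiltonian_orbit H x \<and> range x \<subseteq> cball 0 R}"

definition orbit_rotation :: "('n::finite phase \<Rightarrow> real) \<Rightarrow> (real \<Rightarrow> 'n phase) \<Rightarrow> real \<Rightarrow> real" where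
  "orbit_rotation H x = sys_rotation (\<lambda>t. hessian H (x t))"

lemma orbits_cball: "x \<in> orbits H R \<Longrightarrow> x t \<in> cball 0 R"
  unfolding orbits_def by blast

lemma admissible_hessian:
  fixes H :: "'n::finite phase \<Rightarrow> real"
  assumes H: "C2_function H" and x: "x \<in> orbits H R" and b: "0 < b" "\<forall>z\<in>cball 0 R. norm (hessian H z) \<le> b"
  shows "admissible b (\<lambda>t. hessian H (x t))"
  unfolding admissible_def
proof (intro conjI allI)
  have cx: "continuous_on UNIV x" using x by (intro hamiltonian_orbit_continuous[of H]) (simp add: orbits_def)
  have ch: "continuous_on UNIV (hessian H)" using H by (simp add: C2_function_def)
  show "continuous_on UNIV (\<lambda>t. hessian H (x t))" by (rule continuous_on_compose2[OF ch cx]) simp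
qed (use b hessian_symmetric[OF H] orbits_cball[OF x] in auto)

text \<open>Uniform continuity of the Hessian on the ball turns closeness of orbits into closeness
  of the coefficient matrices; the other properties hold for all systems with the same
  bound.\<close>

lemma quasi_additive_orbit_rotation:
  fixes H :: "'n::finite phase \<Rightarrow> real"
  assumes H: "C2_function H"
  shows "\<exists>K. quasi_additive (orbits H R) (orbit_rotation H) (2 * pi * CARD('n + 'n)) (2 * pi * CARD('n + 'n) + pi) K"
proof -
  obtain b where b: "0 < b" "\<forall>z\<in>cball 0 R. norm (hessian H z) \<le> b" using hessian_bound[OF H, of R] by blast
  note adm = admissible_hessian[OF H _ b]
  obtain K where K: "K > 0" "\<And>B :: real \<Rightarrow> 'n phase_matrix. \<And>l. admissible b B \<Longrightarrow> 0 \<le> l \<Longrightarrow> \<bar>sys_rotation B l\<bar> \<le> K * (l + 1)"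
    by (rule sys_rotation_linear_bound[OF b(1), where 'n = 'n], erule that, assumption)
  have "quasi_additive (orbits H R) (orbit_rotation H) (2 * pi * CARD('n + 'n)) (2 * pi * CARD('n + 'n) + pi) K"
  proof
    fix x s assume "x \<in> orbits H R"
    thus "(\<lambda>t. x (s + t)) \<in> orbits H R" using hamiltonian_orbit_shift[of H x s] by (auto simp: orbits_def)
  next
    fix x and s t :: real assume "x \<in> orbits H R" "0 \<le> s" "0 \<le> t"
    thus "\<bar>orbit_rotation H x (s + t) - orbit_rotation H x s - orbit_rotation H (\<lambda>t. x (s + t)) t\<bar> \<le> 2 * pi * CARD('n + 'n)"
      unfolding orbit_rotation_def by (intro sys_rotation_add[OF adm])
  next
    fix x and l :: real assume "x \<in> orbits H R" "0 \<le> l"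
    thus "\<bar>orbit_rotation H x l\<bar> \<le> K * (l + 1)" unfolding orbit_rotation_def by (intro K(2) adm)
  next
    fix T :: real assume T: "0 \<le> T"
    obtain e where e: "e > 0" "\<And>B B' :: real \<Rightarrow> 'n phase_matrix. admissible b B \<Longrightarrow> admissible b B' \<Longrightarrow>
        (\<And>t. t \<in> {0..T} \<Longrightarrow> norm (B t - B' t) \<le> e) \<Longrightarrow>
        \<bar>sys_rotation B' T - sys_rotation B T\<bar> \<le> 2 * pi * CARD('n + 'n) + pi"
    proof (rule sys_rotation_perturb[OF T b(1), where 'n = 'n], goal_cases)
      case (1 e) show ?case by (rule 1(1)[OF 1(2,3)])
    qed
    have "uniformly_continuous_on (cball 0 R) (hessian H)"
      using H by (intro compact_uniformly_continuous compact_cball) (auto simp: C2_function_def intro: continuous_on_subset)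
    then obtain d where d: "d > 0" "\<forall>z\<in>cball 0 R. \<forall>w\<in>cball 0 R. dist w z < d \<longrightarrow> dist (hessian H w) (hessian H z) < e"
      using e(1) unfolding uniformly_continuous_on_def by blast
    show "\<exists>d>0. \<forall>x\<in>orbits H R. \<forall>y\<in>orbits H R. (\<forall>t\<in>{0..T}. norm (x t - y t) < d) \<longrightarrow>
        \<bar>orbit_rotation H x T - orbit_rotation H y T\<bar> \<le> 2 * pi * CARD('n + 'n) + pi"
    proof (rule exI[of _ d], intro conjI d(1) ballI impI)
      fix x y assume x: "x \<in> orbits H R" and y: "y \<in> orbits H R" and xy: "\<forall>t\<in>{0..T}. norm (x t - y t) < d"
      show "\<bar>orbit_rotation H x T - orbit_rotation H y T\<bar> \<le> 2 * pi * CARD('n + 'n) + pi"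
        unfolding orbit_rotation_def
      proof (rule e(2)[OF adm[OF y] adm[OF x]])
        fix t assume "t \<in> {0..T}"
        hence "dist (y t) (x t) < d" using xy by (simp add: dist_norm norm_minus_commute)
        hence "dist (hessian H (y t)) (hessian H (x t)) < e"
          using d(2)[rule_format, OF orbits_cball[OF x] orbits_cball[OF y]] by blast
        thus "norm (hessian H (y t) - hessian H (x t)) \<le> e" by (simp add: dist_norm)
      qed
    qed
  qed (use K(1) in auto)
  thus ?thesis by blast
qed

text \<open>Closeness at one instant spreads over a window of length \<open>T\<close> at the price
  of a factor \<open>exp (L * T)\<close>, which is why the threshold at that instant is
  \<open>d * exp (- (L * T))\<close>.\<close>

lemma orbits_asymptotic:
  fixes H :: "'n::finite phase \<Rightarrow> real"
  assumes H: "C2_function H" and x: "x \<in> orbits H R" and y: "y \<in> orbits H R"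
    and approach: "\<And>d. d > 0 \<Longrightarrow> \<exists>t0\<ge>0. \<forall>t\<ge>t0. \<exists>s. norm (x t - y s) < d"
  shows "asymptotic x y"
  unfolding asymptotic_def
proof (intro allI impI)
  fix T d :: real assume T: "0 \<le> T" and d: "0 < d"
  obtain L where L0: "L > 0" and L: "\<And>x y. x \<in> cball 0 R \<Longrightarrow> y \<in> cball 0 R \<Longrightarrow> norm (symp_J *v grad H x - symp_J *v grad H y) \<le> L * norm (x - y)"
    using grad_lipschitz[OF H, of R] by blast
  have "d * exp (- (L * T)) > 0" using d by simp
  from approach[OF this] obtain t0 where t0: "t0 \<ge> 0" "\<forall>t\<ge>t0. \<exists>s. norm (x t - y s) < d * exp (- (L * T))" by blast
  show "\<exists>t0\<ge>0. \<forall>t\<ge>t0. \<exists>s. \<forall>u\<in>{0..T}. norm (x (t + u) - y (s + u)) < d"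
  proof (rule exI[of _ t0], intro conjI t0(1) allI impI)
    fix t assume "t0 \<le> t"
    then obtain s where s: "norm (x t - y s) < d * exp (- (L * T))" using t0(2) by blast
    have "norm (x (t + u) - y (s + u)) < d" if u: "u \<in> {0..T}" for u
    proof -
      have "norm (x (t + u) - y (s + u)) \<le> norm (x (t + 0) - y (s + 0)) * exp (L * \<bar>u\<bar>)"
      proof (rule orbit_distance[of H "\<lambda>u. x (t + u)" "\<lambda>u. y (s + u)" u R L])
        show "hamiltonian_orbit H (\<lambda>u. x (t + u))" "hamiltonian_orbit H (\<lambda>u. y (s + u))"
          using x y by (auto simp: orbits_def intro: hamiltonian_orbit_shift)
      qed (use orbits_cball[OF x] orbits_cball[OF y] in \<open>simp del: mem_cball\<close>, rule L)
      also have "\<dots> \<le> norm (x t - y s) * exp (L * T)" using u L0 by (auto intro!: mult_left_mono)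
      also have "\<dots> < d * exp (- (L * T)) * exp (L * T)" using s by (rule mult_strict_right_mono) simp
      also have "\<dots> = d" by (simp add: exp_minus)
      finally show ?thesis .
    qed
    thus "\<exists>s. \<forall>u\<in>{0..T}. norm (x (t + u) - y (s + u)) < d" by blast
  qed
qed

text \<open>Otherwise there are arbitrarily late times at which \<open>x\<close> is at distance at
  least \<open>d\<close> from \<open>y\<close>. Boundedness gives a limit point of these positions;
  it lies in the limit set and hence in the closure of \<open>y\<close>.\<close>

lemma omega_limit_approach:
  fixes x y :: "real \<Rightarrow> 'n::finite phase"
  assumes x: "bounded (range x)" and xy: "omega_limit_set x \<subseteq> closure (range y)" and d: "d > 0"
  shows "\<exists>t0\<ge>0. \<forall>t\<ge>t0. \<exists>s. norm (x t - y s) < d"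
proof (rule ccontr)
  assume n: "\<not> ?thesis"
  have "\<forall>k. \<exists>t\<ge>real k. \<forall>s. d \<le> norm (x t - y s)"
  proof
    fix k show "\<exists>t\<ge>real k. \<forall>s. d \<le> norm (x t - y s)"
      using n of_nat_0_le_iff[of k] by (meson not_le)
  qed
  from choice[OF this] obtain t where t: "\<And>k. real k \<le> t k" "\<And>k s. d \<le> norm (x (t k) - y s)" by blast
  have "bounded (range (\<lambda>k. x (t k)))" using x by (rule bounded_subset) blast
  then obtain z r where r: "strict_mono r" "((\<lambda>k. x (t k)) \<circ> r) \<longlonglongrightarrow> z"
    using bounded_imp_convergent_subsequence by blast
  have "filterlim (\<lambda>k. real (r k)) at_top sequentially"
    by (rule filterlim_compose[OF filterlim_real_sequentially filterlim_subseq[OF r(1)]])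
  hence "filterlim (\<lambda>k. t (r k)) at_top sequentially" by (rule filterlim_at_top_mono) (simp add: t(1))
  hence "z \<in> omega_limit_set x" using r(2) unfolding omega_limit_set_def o_def by blast
  hence "z \<in> closure (range y)" using xy by blast
  hence "\<forall>e>0. \<exists>w\<in>range y. dist w z < e" by (simp only: closure_approachable)
  from this[rule_format, of "d / 2"] obtain s where s: "dist (y s) z < d / 2" using d by auto
  have "\<forall>\<^sub>F k in sequentially. dist (x (t (r k))) z < d / 2" using tendstoD[OF r(2), of "d / 2"] d by simp
  then obtain k where k: "dist (x (t (r k))) z < d / 2" unfolding eventually_sequentially by blast
  have "norm (x (t (r k)) - y s) < d"
    using dist_triangle[of "x (t (r k))" "y s" z] s k by (simp add: dist_norm norm_minus_commute)
  thus False using t(2)[of "r k" s] by simp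
qed

lemma omega_limit_subset: "omega_limit_set x \<subseteq> closure (range x)"
proof
  fix z assume "z \<in> omega_limit_set x"
  then obtain s where "(\<lambda>k. x (s k)) \<longlonglongrightarrow> z" unfolding omega_limit_set_def by blast
  thus "z \<in> closure (range x)" unfolding closure_sequential by (intro exI[of _ "\<lambda>k. x (s k)"]) simp
qed

section \<open>Existence of the mean index as a limit\<close>

definition mean_index_limit :: "('n::finite phase \<Rightarrow> real) \<Rightarrow> (real \<Rightarrow> 'n phase) \<Rightarrow> real \<Rightarrow> bool" where
  "mean_index_limit H x \<rho> \<longleftrightarrow>
     ((\<lambda>l. omega_index 1 (fundamental_solution (\<lambda>t. hessian H (x t))) l / l) \<longlongrightarrow> \<rho>) at_top"

lemma omega_index_limit:
  fixes B :: "real \<Rightarrow> 'n::finite phase_matrix"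
  assumes B: "admissible b B" and lim: "((\<lambda>l. sys_rotation B l / l) \<longlongrightarrow> \<rho>) at_top"
  shows "((\<lambda>l. omega_index 1 (fundamental_solution B) l / l) \<longlongrightarrow> \<rho> / pi) at_top"
proof -
  let ?g = "fundamental_solution B"
  obtain C where C: "\<And>\<gamma> :: real \<Rightarrow> 'n phase_matrix. \<And>T. 0 < T \<Longrightarrow> continuous_on {0..T} \<gamma> \<Longrightarrow>
    \<gamma> ` {0..T} \<subseteq> symp_group \<Longrightarrow> \<bar>omega_index 1 \<gamma> T - rotation \<gamma> 0 T / pi\<bar> \<le> C"
    by (rule omega_index_rotation[where 'n = 'n], erule that)
  have "((\<lambda>l. omega_index 1 ?g l / l - sys_rotation B l / l / pi) \<longlongrightarrow> 0) at_top"
  proof (rule Lim_null_comparison)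
    show "((\<lambda>l :: real. C / l) \<longlongrightarrow> 0) at_top" by (intro tendsto_divide_0[OF tendsto_const] filterlim_at_top_imp_at_infinity filterlim_ident)
    show "\<forall>\<^sub>F l in at_top. norm (omega_index 1 ?g l / l - sys_rotation B l / l / pi) \<le> C / l"
      using eventually_gt_at_top[of 0]
    proof eventually_elim
      case (elim l)
      have "\<bar>omega_index 1 ?g l - sys_rotation B l / pi\<bar> \<le> C"
        unfolding sys_rotation_def using fundamental_solution_props[OF B] elim by (intro C) auto
      moreover have "omega_index 1 ?g l / l - sys_rotation B l / l / pi = (omega_index 1 ?g l - sys_rotation B l / pi) / l"
        by (simp add: diff_divide_distrib)
      ultimately show ?case using elim by (simp add: abs_divide divide_right_mono)
    qed
  qed
  from tendsto_add[OF this tendsto_divide[OF lim tendsto_const[of pi]]] show ?thesis by simp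
qed

text \<open>One limit, determined by \<open>y\<close>, serves all orbits in question, since each is
  asymptotic to \<open>y\<close>: \<open>x\<close> because it approaches its limit set, an orbit
  starting in the closure of \<open>y\<close> because it stays there.\<close>

lemma forward_index:
  fixes H :: "'n::finite phase \<Rightarrow> real"
  assumes H: "C2_function H" and x: "hamiltonian_orbit H x" "bounded (range x)"
    and y: "hamiltonian_orbit H y" "quasi_periodic y" and xy: "omega_limit_set x = orbit_closure y"
  shows "\<exists>\<rho>. mean_index_limit H x \<rho> \<and> (\<forall>z\<in>orbit_closure y. \<exists>u. hamiltonian_orbit H u \<and> u 0 = z \<and>
    bounded (range u) \<and> mean_index_limit H u \<rho>)"
proof -
  obtain R where R: "range x \<subseteq> cball 0 R" using x(2) unfolding bounded_iff by (auto simp: subset_eq)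
  \<comment> \<open>\<open>y\<close> lies in the ball of \<open>x\<close>, because its closure is
    the limit set of \<open>x\<close>; so both belong to the same quasi-additive family.\<close>
  have yR: "range y \<subseteq> cball 0 R"
    using omega_limit_subset[of x] closure_minimal[OF R closed_cball] closure_subset[of "range y"]
    unfolding xy orbit_closure_def by blast
  obtain b where b: "0 < b" "\<forall>z\<in>cball 0 R. norm (hessian H z) \<le> b" using hessian_bound[OF H, of R] by blast
  obtain K where K: "quasi_additive (orbits H R) (orbit_rotation H) (2 * pi * CARD('n + 'n)) (2 * pi * CARD('n + 'n) + pi) K"
    using quasi_additive_orbit_rotation[OF H] by blast
  have yo: "y \<in> orbits H R" using y(1) yR by (simp add: orbits_def)
  have "almost_periodic y" unfolding almost_periodic_def using quasi_periodic_almost_periodic[OF y(2)] by blast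
  from quasi_additive.mean_limit[OF K yo this] obtain \<rho> where
    \<rho>: "\<forall>x\<in>orbits H R. asymptotic x y \<longrightarrow> ((\<lambda>l. orbit_rotation H x l / l) \<longlongrightarrow> \<rho>) at_top" by blast
  have lim: "mean_index_limit H u (\<rho> / pi)"
    if u: "u \<in> orbits H R" and app: "\<And>d. d > 0 \<Longrightarrow> \<exists>t0\<ge>0. \<forall>t\<ge>t0. \<exists>s. norm (u t - y s) < d" for u
    using \<rho>[rule_format, OF u orbits_asymptotic[OF H u yo app]]
    unfolding mean_index_limit_def orbit_rotation_def by (rule omega_index_limit[OF admissible_hessian[OF H u b]])
  show ?thesis
  proof (rule exI[of _ "\<rho> / pi"], intro conjI ballI)
    show "mean_index_limit H x (\<rho> / pi)"
    proof (rule lim)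
      show "x \<in> orbits H R" using x(1) R by (simp add: orbits_def)
      show "\<exists>t0\<ge>0. \<forall>t\<ge>t0. \<exists>s. norm (x t - y s) < d" if "d > 0" for d
        by (rule omega_limit_approach[OF x(2) _ that]) (simp add: xy orbit_closure_def)
    qed
  next
    fix z assume "z \<in> orbit_closure y"
    hence z: "z \<in> closure (range y)" by (simp add: orbit_closure_def)
    obtain u where u: "hamiltonian_orbit H u" "u 0 = z" "\<And>t. u t \<in> closure (range y)"
      by (rule limit_orbit[OF H y(1) yR z], erule that, assumption)
    have uR: "range u \<subseteq> cball 0 R" using u(3) closure_minimal[OF yR closed_cball] by blast
    have "mean_index_limit H u (\<rho> / pi)"
    proof (rule lim)
      show "u \<in> orbits H R" using u(1) uR by (simp add: orbits_def)
      show "\<exists>t0\<ge>0. \<forall>t\<ge>t0. \<exists>s. norm (u t - y s) < d" if d: "d > 0" for d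
      proof (rule exI[of _ 0], intro conjI allI impI order_refl)
        fix t
        obtain w where "w \<in> range y" "dist w (u t) < d" using u(3)[of t] d unfolding closure_approachable by blast
        thus "\<exists>s. norm (u t - y s) < d" by (auto simp: dist_norm norm_minus_commute)
      qed
    qed
    moreover have "bounded (range u)" using bounded_cball uR by (rule bounded_subset)
    ultimately show "\<exists>u. hamiltonian_orbit H u \<and> u 0 = z \<and> bounded (range u) \<and> mean_index_limit H u (\<rho> / pi)"
      using u(1,2) by blast
  qed
qed

lemma orbit_index_limit:
  assumes "mean_index_limit H x \<rho>"
  shows "orbit_index H x = {ereal \<rho>}"
proof -
  let ?f = "\<lambda>l. ereal (omega_index 1 (fundamental_solution (\<lambda>t. hessian H (x t))) l / l)"
  have "(?f \<longlongrightarrow> ereal \<rho>) at_top" using assms unfolding mean_index_limit_def by (rule tendsto_ereal)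
  hence "Limsup at_top ?f = ereal \<rho>" "Liminf at_top ?f = ereal \<rho>"
    by (auto intro!: lim_imp_Limsup lim_imp_Liminf)
  thus ?thesis
    unfolding orbit_index_def mean_index_interval_def mean_index_lower_def mean_index_upper_def by simp
qed

lemma orbit_closure_nonempty: "orbit_closure y \<noteq> {}"
  by (simp add: orbit_closure_def)

lemma omega_part:
  fixes H :: "'n::finite phase \<Rightarrow> real"
  assumes H: "C2_function H" and x: "hamiltonian_orbit H x" "bounded (range x)"
    and y: "hamiltonian_orbit H y" "quasi_periodic y" and xy: "omega_limit_set x = orbit_closure y"
  shows "orbit_index H x = set_index H (orbit_closure y)"
proof -
  obtain \<rho> where \<rho>: "mean_index_limit H x \<rho>" "\<forall>z\<in>orbit_closure y. \<exists>u. hamiltonian_orbit H u \<and> u 0 = z \<and>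
    bounded (range u) \<and> mean_index_limit H u \<rho>"
    using forward_index[OF assms] by blast
  have "orbit_index H (orbit_from H z) = {ereal \<rho>}" if "z \<in> orbit_closure y" for z
  proof -
    obtain u where u: "hamiltonian_orbit H u" "u 0 = z" "mean_index_limit H u \<rho>" using \<rho>(2) \<open>z \<in> orbit_closure y\<close> by blast
    show ?thesis using orbit_from_eq[OF H u(1)] u(2) orbit_index_limit[OF u(3)] by simp
  qed
  hence "set_index H (orbit_closure y) = (\<Union>z\<in>orbit_closure y. {ereal \<rho>})" unfolding set_index_def by simp
  \<comment> \<open>A union of equal singletons is that singleton, the index set being
    nonempty.\<close>
  thus ?thesis using orbit_index_limit[OF \<rho>(1)] orbit_closure_nonempty[of y] by simp
qed

text \<open>
  The part on \<open>\<alpha>\<close>-limit sets is the part on \<open>\<omega>\<close>-limit sets for the time-reversed orbits, which are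
  orbits of \<open>- H\<close>.
\<close>

lemma grad_uminus:
  assumes "C2_function H"
  shows "grad (\<lambda>z. - H z) = (\<lambda>z. - grad H z)"
proof
  fix z
  have "((\<lambda>z. - H z) has_derivative (\<lambda>h. - (h \<bullet> grad H z))) (at z)"
    using grad_gderiv[OF assms, of z] unfolding gderiv_def by (rule has_derivative_minus)
  hence "GDERIV (\<lambda>z. - H z) z :> - grad H z" by (simp add: gderiv_def)
  thus "grad (\<lambda>z. - H z) z = - grad H z" by (rule grad_eq)
qed

lemma hessian_uminus:
  fixes H :: "'n::finite phase \<Rightarrow> real"
  assumes H: "C2_function H"
  shows "hessian (\<lambda>z. - H z) z = - hessian H z"
proof -
  have "((\<lambda>z. - grad H z) has_derivative (\<lambda>h. - (hessian H z *v h))) (at z)"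
    by (rule has_derivative_minus[OF grad_has_derivative[OF H]])
  hence "frechet_derivative (\<lambda>z. - grad H z) (at z) = (\<lambda>h. - (hessian H z *v h))"
    by (rule frechet_derivative_at[symmetric])
  moreover have "(\<lambda>h. - (hessian H z *v h)) = (*v) (- hessian H z)"
    by (simp add: fun_eq_iff matrix_vector_mult_def vec_eq_iff sum_negf)
  ultimately show ?thesis unfolding hessian_def[of "\<lambda>z. - H z"] grad_uminus[OF H]
    by (simp only: matrix_of_matrix_vector_mul)
qed

lemma C2_function_uminus:
  fixes H :: "'n::finite phase \<Rightarrow> real"
  assumes H: "C2_function H"
  shows "C2_function (\<lambda>z. - H z)"
proof -
  have "hessian (\<lambda>z. - H z) = (\<lambda>z. - hessian H z)" by (rule ext) (rule hessian_uminus[OF H])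
  thus ?thesis using H unfolding C2_function_def grad_uminus[OF H]
    by (auto intro: continuous_on_minus)
qed

lemma hamiltonian_orbit_reverse:
  assumes "C2_function H" "hamiltonian_orbit H x"
  shows "hamiltonian_orbit (\<lambda>z. - H z) (\<lambda>t. x (- t))"
  unfolding hamiltonian_orbit_def grad_uminus[OF assms(1)]
proof
  fix t
  have "((\<lambda>t. x (- t)) has_vector_derivative - (symp_J *v grad H (x (- t)))) (at t)"
    using assms(2) unfolding hamiltonian_orbit_def by (intro has_vector_derivative_reflect) blast
  thus "((\<lambda>t. x (- t)) has_vector_derivative symp_J *v - grad H (x (- t))) (at t)"
    by (simp add: linear_neg[OF matrix_vector_mul_linear])
qed

lemma range_reverse: "range (\<lambda>t :: real. x (- t)) = range x"
proof
  show "range x \<subseteq> range (\<lambda>t. x (- t))"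
  proof
    fix z assume "z \<in> range x"
    then obtain t where "z = x (- (- t))" by auto
    thus "z \<in> range (\<lambda>t. x (- t))" by blast
  qed
qed auto

lemma orbit_closure_reverse: "orbit_closure (\<lambda>t. x (- t)) = orbit_closure x"
  unfolding orbit_closure_def range_reverse ..

lemma omega_limit_set_reverse: "omega_limit_set (\<lambda>t. x (- t)) = alpha_limit_set x"
  unfolding omega_limit_set_def alpha_limit_set_def
proof (intro set_eqI iffI CollectI; elim CollectE exE conjE)
  fix z s assume "filterlim s at_top sequentially" "(\<lambda>k. x (- s k)) \<longlonglongrightarrow> z"
  thus "\<exists>s. filterlim s at_bot sequentially \<and> (\<lambda>k. x (s k)) \<longlonglongrightarrow> z"
    by (intro exI[of _ "\<lambda>k. - s k"]) (simp add: filterlim_uminus_at_bot)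
next
  fix z s assume "filterlim s at_bot sequentially" "(\<lambda>k. x (s k)) \<longlonglongrightarrow> z"
  thus "\<exists>s. filterlim s at_top sequentially \<and> (\<lambda>k. x (- s k)) \<longlonglongrightarrow> z"
    by (intro exI[of _ "\<lambda>k. - s k"]) (simp add: filterlim_uminus_at_top)
qed

text \<open>The torus and \<open>D\<close> are kept and the frequencies are negated.\<close>

lemma quasi_periodic_reverse:
  assumes "quasi_periodic y"
  shows "quasi_periodic (\<lambda>t. y (- t))"
proof -
  obtain m D w where D: "homeomorphic_map (torus m) (top_of_set (orbit_closure y)) D"
    and w: "rationally_independent m w"
    and yt: "\<And>t. y t = D (torus_add m (inv_into (topspace (torus m)) D (y 0)) (\<lambda>k. w k * t))"
    using assms unfolding quasi_periodic_def by blast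
  have w': "rationally_independent m (\<lambda>k. - w k)"
    using w unfolding rationally_independent_def by (simp add: sum_negf)
  show ?thesis
    unfolding quasi_periodic_def orbit_closure_reverse
  proof (intro exI conjI allI)
    fix t show "y (- t) = D (torus_add m (inv_into (topspace (torus m)) D (y (- 0))) (\<lambda>k. - w k * t))"
      using yt[of "- t"] by simp
  qed (rule D w')+
qed

lemma fundamental_solution_reverse:
  fixes B :: "real \<Rightarrow> 'n::finite phase_matrix"
  assumes "admissible b B"
  shows "fundamental_solution (\<lambda>t. - B (- t)) = (\<lambda>t. fundamental_solution B (- t))"
proof (rule fundamental_solution_eq)
  let ?g = "fundamental_solution B"
  note p = fundamental_solution_props[OF assms]
  show "solves (\<lambda>t. - B (- t)) (\<lambda>t. ?g (- t))"
    unfolding solves_def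
  proof (intro conjI allI)
    fix t
    have "((\<lambda>t. ?g (- t)) has_vector_derivative - (symp_J ** B (- t) ** ?g (- t))) (at t)"
      by (rule has_vector_derivative_reflect[OF p(3)])
    thus "((\<lambda>t. ?g (- t)) has_vector_derivative symp_J ** - B (- t) ** ?g (- t)) (at t)"
      by (simp add: matrix_mult_minus_left matrix_mult_minus_right)
  qed (simp add: p(1))
  fix t
  have "transpose (- B (- t)) = - transpose (B (- t))" by (simp add: transpose_def vec_eq_iff)
  thus "transpose (- B (- t)) = - B (- t)" using assms by (simp add: admissible_def)
qed

text \<open>Reversing time in the linearised system along \<open>x\<close> gives the linearised
  system of \<open>- H\<close> along the reversed orbit, so the two indices agree. Dividing by
  \<open>- l\<close> instead of \<open>l\<close> changes the sign of the limit.\<close>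

lemma orbit_index_neg_limit:
  fixes H :: "'n::finite phase \<Rightarrow> real"
  assumes H: "C2_function H" and x: "hamiltonian_orbit H x" "bounded (range x)"
    and lim: "mean_index_limit (\<lambda>z. - H z) (\<lambda>t. x (- t)) \<rho>"
  shows "orbit_index_neg H x = {ereal (- \<rho>)}"
proof -
  obtain R where R: "range x \<subseteq> cball 0 R" using x(2) unfolding bounded_iff by (auto simp: subset_eq)
  obtain b where b: "0 < b" "\<forall>z\<in>cball 0 R. norm (hessian H z) \<le> b" using hessian_bound[OF H, of R] by blast
  have adm: "admissible b (\<lambda>t. hessian H (x t))"
    by (rule admissible_hessian[OF H _ b]) (simp add: orbits_def x(1) R)
  let ?g = "\<lambda>t. fundamental_solution (\<lambda>t. hessian H (x t)) (- t)"
  let ?f = "\<lambda>l. ereal (omega_index 1 ?g l / (- l))"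
  have "((\<lambda>l. omega_index 1 ?g l / l) \<longlongrightarrow> \<rho>) at_top"
    using lim unfolding mean_index_limit_def hessian_uminus[OF H] fundamental_solution_reverse[OF adm] .
  from tendsto_ereal[OF tendsto_minus[OF this]] have "(?f \<longlongrightarrow> ereal (- \<rho>)) at_top" by simp
  hence "Limsup at_top ?f = ereal (- \<rho>)" "Liminf at_top ?f = ereal (- \<rho>)"
    by (auto intro!: lim_imp_Limsup lim_imp_Liminf)
  thus ?thesis
    unfolding orbit_index_neg_def mean_index_interval_neg_def mean_index_lower_neg_def mean_index_upper_neg_def by simp
qed

lemma alpha_part:
  fixes H :: "'n::finite phase \<Rightarrow> real"
  assumes H: "C2_function H" and x: "hamiltonian_orbit H x" "bounded (range x)"
    and y: "hamiltonian_orbit H y" "quasi_periodic y" and xy: "alpha_limit_set x = orbit_closure y"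
  shows "orbit_index_neg H x = set_index_neg H (orbit_closure y)"
proof -
  let ?H = "\<lambda>z. - H z" and ?x = "\<lambda>t. x (- t)" and ?y = "\<lambda>t. y (- t)"
  have H': "C2_function ?H" by (rule C2_function_uminus[OF H])
  have "bounded (range ?x)" "omega_limit_set ?x = orbit_closure ?y"
    unfolding range_reverse omega_limit_set_reverse orbit_closure_reverse by (rule x(2) xy)+
  from forward_index[OF H' hamiltonian_orbit_reverse[OF H x(1)] this(1)
      hamiltonian_orbit_reverse[OF H y(1)] quasi_periodic_reverse[OF y(2)] this(2)]
  obtain \<rho> where \<rho>: "mean_index_limit ?H ?x \<rho>" "\<forall>z\<in>orbit_closure y. \<exists>u. hamiltonian_orbit ?H u \<and> u 0 = z \<and>
    bounded (range u) \<and> mean_index_limit ?H u \<rho>"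
    unfolding orbit_closure_reverse by blast
  have "orbit_index_neg H (orbit_from H z) = {ereal (- \<rho>)}" if "z \<in> orbit_closure y" for z
  proof -
    obtain u where u: "hamiltonian_orbit ?H u" "u 0 = z" "bounded (range u)" "mean_index_limit ?H u \<rho>"
      using \<rho>(2) \<open>z \<in> orbit_closure y\<close> by blast
    \<comment> \<open>A second reversal leads back from \<open>- H\<close> to
      \<open>H\<close>.\<close>
    have o: "hamiltonian_orbit H (\<lambda>t. u (- t))" using hamiltonian_orbit_reverse[OF H' u(1)] by simp
    have "orbit_index_neg H (\<lambda>t. u (- t)) = {ereal (- \<rho>)}"
      by (rule orbit_index_neg_limit[OF H o]) (simp_all add: range_reverse u(3,4))
    thus ?thesis using orbit_from_eq[OF H o] u(2) by simp
  qed
  hence "set_index_neg H (orbit_closure y) = (\<Union>z\<in>orbit_closure y. {ereal (- \<rho>)})" unfolding set_index_neg_def by simp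
  thus ?thesis using orbit_index_neg_limit[OF H x \<rho>(1)] orbit_closure_nonempty[of y] by simp
qed

theorem corollary1p4:
  fixes H :: "'n::finite phase \<Rightarrow> real" and x :: "real \<Rightarrow> 'n phase"
  assumes "C2_function H"
    and "hamiltonian_orbit H x"
    and "bounded (range x)"
  shows "(\<forall>y. hamiltonian_orbit H y \<and> quasi_periodic y \<and> omega_limit_set x = orbit_closure y \<longrightarrow>
           orbit_index H x = set_index H (omega_limit_set x) \<and>
           set_index H (omega_limit_set x) = set_index H (orbit_closure y)) \<and>
         (\<forall>y. hamiltonian_orbit H y \<and> quasi_periodic y \<and> alpha_limit_set x = orbit_closure y \<longrightarrow>
           orbit_index_neg H x = set_index_neg H (alpha_limit_set x) \<and>
           set_index_neg H (alpha_limit_set x) = set_index_neg H (orbit_closure y))"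
  using omega_part[OF assms] alpha_part[OF assms] by simp

end
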